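(* Let $k$ be a commutative ring, let $\mathcal{B}$ be a $k$-linear abelian category, and let $\mathcal{C}$ be a small, $k$-linear, locally bounded and Hom-finite category. Let \[ i^*\colon\mathcal{B}^{\mathcal{C}}\to\prod_{c\in\mathcal{C}}\mathcal{B},\quad i^*(F)=(F(c))_{c\in\mathcal{C}}, \] with left adjoint \[ i_!\colon\prod_{c\in\mathcal{C}}\mathcal{B}\to\mathcal{B}^{\mathcal{C}},\quad i_!((B^c)_{c\in\mathcal{C}})=\bigoplus_{c\in\mathcal{C}}\mathcal{C}(c,-)\otimes_kB^c, \] and let $\nu\colon\mathcal{B}^{\mathcal{C}}\to\mathcal{B}^{\mathcal{C}}$ be the functor $\nu(F)=D(\mathcal{C})\otimes_{\mathcal{C}}F$, i.e. $\nu(F)(c)=D(\mathcal{C}(c,-))\otimes_{\mathcal{C}}F$. Then $\nu$ is a Nakayama functor relative to $i_!\dashv i^*$.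
   Context: $\mathcal{C}$ is locally bounded if for each $c\in\mathcal{C}$ one has $\mathcal{C}(c,c')\neq 0$ for only finitely many $c'$ and $\mathcal{C}(c'',c)\neq 0$ for only finitely many $c''$. $\mathcal{C}$ is Hom-finite if each $\mathcal{C}(c,c')$ is a finitely generated projective $k$-module. $\mathcal{B}^{\mathcal{C}}$ is the category of $k$-linear functors $\mathcal{C}\to\mathcal{B}$. $D=\operatorname{Hom}_k(-,k)$. Tensor products: a right $\mathcal{C}$-module is a $k$-linear functor $\mathcal{C}^{\mathrm{op}}\to k\text{-Mod}$; it is finitely presented if it is the cokernel of a morphism $\bigoplus_{i=1}^m\mathcal{C}(-,c_i)\to\bigoplus_{j=1}^n\mathcal{C}(-,d_j)$. Let $\operatorname{mod}\text{-}\mathcal{C}$ be the category of finitely presented right $\mathcal{C}$-modules. The functor $-\otimes_{\mathcal{C}}-\colon(\operatorname{mod}\text{-}\mathcal{C})\otimes\mathcal{B}^{\mathcal{C}}\to\mathcal{B}$ is the (essentially unique) $k$-bilinear functor such that $-\otimes_{\mathcal{C}}F$ is right exact for every $F$ and $\mathcal{C}(-,c)\otimes_{\mathcal{C}}F\cong F(c)$ naturally in $c$ and $F$ (it is the colimit of $F$ weighted by the module). For $\mathcal{C}=k$ this gives $V\otimes_kB\in\mathcal{B}$ for $V$ a finitely presented $k$-module and $B\in\mathcal{B}$. Under the hypotheses on $\mathcal{C}$, the right $\mathcal{C}$-module $D(\mathcal{C}(c,-))$ is finitely presented, and the direct sum defining $i_!$ is finite when evaluated at each object. The right adjoint of $\nu$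 is $\nu^-(F)(c)=\operatorname{Hom}_{\mathcal{C}}(D(\mathcal{C}(-,c)),F)$ (weighted limit). Nakayama functor: for an abelian category $\mathcal{A}$, an additive category $\mathcal{D}$ and a faithful functor $f^*\colon\mathcal{A}\to\mathcal{D}$ with left adjoint $f_!$, a Nakayama functor relative to $f_!\dashv f^*$ is a functor $\nu\colon\mathcal{A}\to\mathcal{A}$ with a right adjoint $\nu^-$ such that (1) $\nu\circ f_!$ is right adjoint to $f^*$; (2) the unit of $\nu\dashv\nu^-$ precomposed with $f_!$ is an isomorphism $f_!\to\nu^-\circ\nu\circ f_!$. *)

theory Defs
  imports "HOL-Algebra.Module" "HOL-Library.FuncSet"
begin

section \<open>Modules over a commutative ring\<close>

definition self_module :: "('k, 'r) ring_scheme \<Rightarrow> ('k, 'k) module" where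
  "self_module R =
    \<lparr>carrier = carrier R, mult = mult R, one = one R, zero = zero R, add = add R, smult = mult R\<rparr>"

text \<open>Linear maps are normalised to be undefined outside the carrier, so that equality of
  linear maps is equality of functions. The ring multiplication and unit fields that the
  library's module record inherits play no role and are left undefined.\<close>

definition linear_maps ::
  "('k, 'r) ring_scheme \<Rightarrow> ('k, 'u) module \<Rightarrow> ('k, 'v) module \<Rightarrow> ('u \<Rightarrow> 'v) set" where
  "linear_maps R M N = {f \<in> carrier M \<rightarrow>\<^sub>E carrier N.
     (\<forall>x\<in>carrier M. \<forall>y\<in>carrier M. f (x \<oplus>\<^bsub>M\<^esub> y) = f x \<oplus>\<^bsub>N\<^esub> f y) \<and>
     (\<forall>a\<in>carrier R. \<forall>x\<in>carrier M. f (a \<odot>\<^bsub>M\<^esub> x) = a \<odot>\<^bsub>N\<^esub> f x)}"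

definition hom_module ::
  "('k, 'r) ring_scheme \<Rightarrow> ('k, 'u) module \<Rightarrow> ('k, 'v) module \<Rightarrow> ('k, 'u \<Rightarrow> 'v) module" where
  "hom_module R M N =
    \<lparr>carrier = linear_maps R M N, mult = (\<lambda>_ _. undefined), one = undefined,
     zero = (\<lambda>x\<in>carrier M. \<zero>\<^bsub>N\<^esub>),
     add = (\<lambda>f g. \<lambda>x\<in>carrier M. f x \<oplus>\<^bsub>N\<^esub> g x),
     smult = (\<lambda>a f. \<lambda>x\<in>carrier M. a \<odot>\<^bsub>N\<^esub> f x)\<rparr>"

definition dual :: "('k, 'r) ring_scheme \<Rightarrow> ('k, 'u) module \<Rightarrow> ('k, 'u \<Rightarrow> 'k) module" where
  "dual R M = hom_module R M (self_module R)"

definition dual_map ::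
  "('k, 'r) ring_scheme \<Rightarrow> ('k, 'u) module \<Rightarrow> ('k, 'v) module \<Rightarrow> ('u \<Rightarrow> 'v)
    \<Rightarrow> ('v \<Rightarrow> 'k) \<Rightarrow> ('u \<Rightarrow> 'k)" where
  "dual_map R M N f = (\<lambda>\<phi>\<in>carrier (dual R N). \<lambda>x\<in>carrier M. \<phi> (f x))"

definition free_module :: "('k, 'r) ring_scheme \<Rightarrow> nat \<Rightarrow> ('k, nat \<Rightarrow> 'k) module" where
  "free_module R n =
    \<lparr>carrier = {..<n} \<rightarrow>\<^sub>E carrier R, mult = (\<lambda>_ _. undefined), one = undefined,
     zero = (\<lambda>i\<in>{..<n}. \<zero>\<^bsub>R\<^esub>),
     add = (\<lambda>x y. \<lambda>i\<in>{..<n}. x i \<oplus>\<^bsub>R\<^esub> y i),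
     smult = (\<lambda>a x. \<lambda>i\<in>{..<n}. a \<otimes>\<^bsub>R\<^esub> x i)\<rparr>"

text \<open>Finitely generated projective: a direct summand of a free module of finite rank.\<close>

definition fg_projective :: "('k, 'r) ring_scheme \<Rightarrow> ('k, 'v) module \<Rightarrow> bool" where
  "fg_projective R P \<longleftrightarrow> module R P \<and>
     (\<exists>n. \<exists>s\<in>linear_maps R P (free_module R n). \<exists>p\<in>linear_maps R (free_module R n) P.
        \<forall>x\<in>carrier P. p (s x) = x)"


section \<open>Linear categories\<close>

text \<open>Hom modules of different pairs of objects need not be disjoint, so composition takes the
  three objects involved: \<open>Comp C a b c g f\<close> is the composite of \<open>f : a \<rightarrow> b\<close> and
  \<open>g : b \<rightarrow> c\<close>.\<close>

record ('o, 'm, 'k) lincat =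
  Obj :: "'o set"
  Hom :: "'o \<Rightarrow> 'o \<Rightarrow> ('k, 'm) module"
  Comp :: "'o \<Rightarrow> 'o \<Rightarrow> 'o \<Rightarrow> 'm \<Rightarrow> 'm \<Rightarrow> 'm"
  Ident :: "'o \<Rightarrow> 'm"

abbreviation arr :: "('o, 'm, 'k) lincat \<Rightarrow> 'o \<Rightarrow> 'o \<Rightarrow> 'm set" where
  "arr C a b \<equiv> carrier (Hom C a b)"

locale linear_category = R?: cring R
  for R :: "('k, 'r) ring_scheme" (structure)
    and C :: "('o, 'm, 'k) lincat" +
  assumes hom_module: "\<lbrakk>a \<in> Obj C; b \<in> Obj C\<rbrakk> \<Longrightarrow> module R (Hom C a b)"
    and ident_arr: "a \<in> Obj C \<Longrightarrow> Ident C a \<in> arr C a a"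
    and comp_arr:
      "\<lbrakk>a \<in> Obj C; b \<in> Obj C; c \<in> Obj C; f \<in> arr C a b; g \<in> arr C b c\<rbrakk>
        \<Longrightarrow> Comp C a b c g f \<in> arr C a c"
    and comp_ident_right:
      "\<lbrakk>a \<in> Obj C; b \<in> Obj C; f \<in> arr C a b\<rbrakk> \<Longrightarrow> Comp C a a b f (Ident C a) = f"
    and comp_ident_left:
      "\<lbrakk>a \<in> Obj C; b \<in> Obj C; f \<in> arr C a b\<rbrakk> \<Longrightarrow> Comp C a b b (Ident C b) f = f"
    and comp_assoc:
      "\<lbrakk>a \<in> Obj C; b \<in> Obj C; c \<in> Obj C; d \<in> Obj C;
        f \<in> arr C a b; g \<in> arr C b c; h \<in> arr C c d\<rbrakk>
        \<Longrightarrow> Comp C a c d h (Comp C a b c g f) = Comp C a b d (Comp C b c d h g) f"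
    and comp_add_left:
      "\<lbrakk>a \<in> Obj C; b \<in> Obj C; c \<in> Obj C; f \<in> arr C a b; g \<in> arr C b c; g' \<in> arr C b c\<rbrakk>
        \<Longrightarrow> Comp C a b c (g \<oplus>\<^bsub>Hom C b c\<^esub> g') f
            = Comp C a b c g f \<oplus>\<^bsub>Hom C a c\<^esub> Comp C a b c g' f"
    and comp_add_right:
      "\<lbrakk>a \<in> Obj C; b \<in> Obj C; c \<in> Obj C; f \<in> arr C a b; f' \<in> arr C a b; g \<in> arr C b c\<rbrakk>
        \<Longrightarrow> Comp C a b c g (f \<oplus>\<^bsub>Hom C a b\<^esub> f')
            = Comp C a b c g f \<oplus>\<^bsub>Hom C a c\<^esub> Comp C a b c g f'"
    and comp_smult_left:
      "\<lbrakk>a \<in> Obj C; b \<in> Obj C; c \<in> Obj C; r \<in> carrier R; f \<in> arr C a b; g \<in> arr C b c\<rbrakk>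
        \<Longrightarrow> Comp C a b c (r \<odot>\<^bsub>Hom C b c\<^esub> g) f = r \<odot>\<^bsub>Hom C a c\<^esub> Comp C a b c g f"
    and comp_smult_right:
      "\<lbrakk>a \<in> Obj C; b \<in> Obj C; c \<in> Obj C; r \<in> carrier R; f \<in> arr C a b; g \<in> arr C b c\<rbrakk>
        \<Longrightarrow> Comp C a b c g (r \<odot>\<^bsub>Hom C a b\<^esub> f) = r \<odot>\<^bsub>Hom C a c\<^esub> Comp C a b c g f"

definition iso :: "('o, 'm, 'k) lincat \<Rightarrow> 'o \<Rightarrow> 'o \<Rightarrow> 'm \<Rightarrow> bool" where
  "iso C a b f \<longleftrightarrow> f \<in> arr C a b \<and>
     (\<exists>g\<in>arr C b a. Comp C a b a g f = Ident C a \<and> Comp C b a b f g = Ident C b)"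

definition mono :: "('o, 'm, 'k) lincat \<Rightarrow> 'o \<Rightarrow> 'o \<Rightarrow> 'm \<Rightarrow> bool" where
  "mono C a b f \<longleftrightarrow> f \<in> arr C a b \<and>
     (\<forall>x\<in>Obj C. \<forall>g\<in>arr C x a. \<forall>h\<in>arr C x a. Comp C x a b f g = Comp C x a b f h \<longrightarrow> g = h)"

definition epi :: "('o, 'm, 'k) lincat \<Rightarrow> 'o \<Rightarrow> 'o \<Rightarrow> 'm \<Rightarrow> bool" where
  "epi C a b f \<longleftrightarrow> f \<in> arr C a b \<and>
     (\<forall>x\<in>Obj C. \<forall>g\<in>arr C b x. \<forall>h\<in>arr C b x. Comp C a b x g f = Comp C a b x h f \<longrightarrow> g = h)"

definition zero_object :: "('o, 'm, 'k) lincat \<Rightarrow> 'o \<Rightarrow> bool" where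
  "zero_object C z \<longleftrightarrow> z \<in> Obj C \<and>
     (\<forall>a\<in>Obj C. (\<exists>!f. f \<in> arr C z a) \<and> (\<exists>!f. f \<in> arr C a z))"

definition is_biproduct ::
  "('o, 'm, 'k) lincat \<Rightarrow> 'o \<Rightarrow> 'o \<Rightarrow> 'o \<Rightarrow> 'm \<Rightarrow> 'm \<Rightarrow> 'm \<Rightarrow> 'm \<Rightarrow> bool" where
  "is_biproduct C a b s i1 i2 p1 p2 \<longleftrightarrow>
     s \<in> Obj C \<and> i1 \<in> arr C a s \<and> i2 \<in> arr C b s \<and> p1 \<in> arr C s a \<and> p2 \<in> arr C s b \<and>
     Comp C a s a p1 i1 = Ident C a \<and> Comp C b s b p2 i2 = Ident C b \<and>
     Comp C b s a p1 i2 = \<zero>\<^bsub>Hom C b a\<^esub> \<and> Comp C a s b p2 i1 = \<zero>\<^bsub>Hom C a b\<^esub> \<and>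
     Comp C s a s i1 p1 \<oplus>\<^bsub>Hom C s s\<^esub> Comp C s b s i2 p2 = Ident C s"

definition is_kernel ::
  "('o, 'm, 'k) lincat \<Rightarrow> 'o \<Rightarrow> 'o \<Rightarrow> 'm \<Rightarrow> 'o \<Rightarrow> 'm \<Rightarrow> bool" where
  "is_kernel C a b f u j \<longleftrightarrow> f \<in> arr C a b \<and> u \<in> Obj C \<and> j \<in> arr C u a \<and>
     Comp C u a b f j = \<zero>\<^bsub>Hom C u b\<^esub> \<and>
     (\<forall>x\<in>Obj C. \<forall>g\<in>arr C x a. Comp C x a b f g = \<zero>\<^bsub>Hom C x b\<^esub>
        \<longrightarrow> (\<exists>!h. h \<in> arr C x u \<and> Comp C x u a j h = g))"

definition is_cokernel ::
  "('o, 'm, 'k) lincat \<Rightarrow> 'o \<Rightarrow> 'o \<Rightarrow> 'm \<Rightarrow> 'o \<Rightarrow> 'm \<Rightarrow> bool" where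
  "is_cokernel C a b f q p \<longleftrightarrow> f \<in> arr C a b \<and> q \<in> Obj C \<and> p \<in> arr C b q \<and>
     Comp C a b q p f = \<zero>\<^bsub>Hom C a q\<^esub> \<and>
     (\<forall>x\<in>Obj C. \<forall>g\<in>arr C b x. Comp C a b x g f = \<zero>\<^bsub>Hom C a x\<^esub>
        \<longrightarrow> (\<exists>!h. h \<in> arr C q x \<and> Comp C b q x h p = g))"

locale additive_category = linear_category +
  assumes ex_zero_object: "\<exists>z. zero_object C z"
    and ex_biproduct: "\<lbrakk>a \<in> Obj C; b \<in> Obj C\<rbrakk> \<Longrightarrow> \<exists>s i1 i2 p1 p2. is_biproduct C a b s i1 i2 p1 p2"

locale abelian_category = additive_category +
  assumes ex_kernel:
      "\<lbrakk>a \<in> Obj C; b \<in> Obj C; f \<in> arr C a b\<rbrakk> \<Longrightarrow> \<exists>u j. is_kernel C a b f u j"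
    and ex_cokernel:
      "\<lbrakk>a \<in> Obj C; b \<in> Obj C; f \<in> arr C a b\<rbrakk> \<Longrightarrow> \<exists>q p. is_cokernel C a b f q p"
    and mono_is_kernel:
      "\<lbrakk>a \<in> Obj C; b \<in> Obj C; mono C a b f\<rbrakk> \<Longrightarrow> \<exists>c\<in>Obj C. \<exists>g. is_kernel C b c g a f"
    and epi_is_cokernel:
      "\<lbrakk>a \<in> Obj C; b \<in> Obj C; epi C a b f\<rbrakk> \<Longrightarrow> \<exists>c\<in>Obj C. \<exists>g. is_cokernel C c a g b f"

definition locally_bounded :: "('o, 'm, 'k) lincat \<Rightarrow> bool" where
  "locally_bounded C \<longleftrightarrow> (\<forall>c\<in>Obj C.
     finite {c' \<in> Obj C. arr C c c' \<noteq> {\<zero>\<^bsub>Hom C c c'\<^esub>}} \<and>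
     finite {c'' \<in> Obj C. arr C c'' c \<noteq> {\<zero>\<^bsub>Hom C c'' c\<^esub>}})"

definition hom_finite :: "('k, 'r) ring_scheme \<Rightarrow> ('o, 'm, 'k) lincat \<Rightarrow> bool" where
  "hom_finite R C \<longleftrightarrow> (\<forall>c\<in>Obj C. \<forall>c'\<in>Obj C. fg_projective R (Hom C c c'))"

definition op_cat :: "('o, 'm, 'k) lincat \<Rightarrow> ('o, 'm, 'k) lincat" where
  "op_cat C = \<lparr>Obj = Obj C, Hom = (\<lambda>a b. Hom C b a),
     Comp = (\<lambda>a b c g f. Comp C c b a f g), Ident = Ident C\<rparr>"

text \<open>The category of all modules whose elements are drawn from the type \<open>'v\<close>.\<close>

definition mod_cat :: "('k, 'r) ring_scheme \<Rightarrow> (('k, 'v) module, 'v \<Rightarrow> 'v, 'k) lincat" where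
  "mod_cat R = \<lparr>Obj = {M. module R M}, Hom = hom_module R,
     Comp = (\<lambda>L M N g f. \<lambda>x\<in>carrier L. g (f x)), Ident = (\<lambda>M. \<lambda>x\<in>carrier M. x)\<rparr>"

text \<open>The ring, regarded as a linear category with one object.\<close>

definition ring_cat :: "('k, 'r) ring_scheme \<Rightarrow> (unit, 'k, 'k) lincat" where
  "ring_cat R = \<lparr>Obj = {()}, Hom = (\<lambda>_ _. self_module R),
     Comp = (\<lambda>_ _ _ g f. g \<otimes>\<^bsub>R\<^esub> f), Ident = (\<lambda>_. \<one>\<^bsub>R\<^esub>)\<rparr>"

text \<open>The power of a category indexed by a set of indices.\<close>

definition power_cat ::
  "'i set \<Rightarrow> ('o, 'm, 'k) lincat \<Rightarrow> ('i \<Rightarrow> 'o, 'i \<Rightarrow> 'm, 'k) lincat" where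
  "power_cat I B = \<lparr>Obj = I \<rightarrow>\<^sub>E Obj B,
     Hom = (\<lambda>X Y.
       \<lparr>carrier = (\<Pi>\<^sub>E i\<in>I. arr B (X i) (Y i)), mult = (\<lambda>_ _. undefined), one = undefined,
        zero = (\<lambda>i\<in>I. \<zero>\<^bsub>Hom B (X i) (Y i)\<^esub>),
        add = (\<lambda>f g. \<lambda>i\<in>I. f i \<oplus>\<^bsub>Hom B (X i) (Y i)\<^esub> g i),
        smult = (\<lambda>r f. \<lambda>i\<in>I. r \<odot>\<^bsub>Hom B (X i) (Y i)\<^esub> f i)\<rparr>),
     Comp = (\<lambda>X Y Z g f. \<lambda>i\<in>I. Comp B (X i) (Y i) (Z i) (g i) (f i)),
     Ident = (\<lambda>X. \<lambda>i\<in>I. Ident B (X i))\<rparr>"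


section \<open>Functors and natural transformations\<close>

record ('o, 'm, 'p, 'n) funct =
  FOb :: "'o \<Rightarrow> 'p"
  FArr :: "'o \<Rightarrow> 'o \<Rightarrow> 'm \<Rightarrow> 'n"

definition is_functor ::
  "('o, 'm, 'k) lincat \<Rightarrow> ('p, 'n, 'l) lincat \<Rightarrow> ('o, 'm, 'p, 'n) funct \<Rightarrow> bool" where
  "is_functor C D F \<longleftrightarrow>
     (\<forall>a\<in>Obj C. FOb F a \<in> Obj D) \<and>
     (\<forall>a\<in>Obj C. \<forall>b\<in>Obj C. \<forall>f\<in>arr C a b. FArr F a b f \<in> arr D (FOb F a) (FOb F b)) \<and>
     (\<forall>a\<in>Obj C. FArr F a a (Ident C a) = Ident D (FOb F a)) \<and>
     (\<forall>a\<in>Obj C. \<forall>b\<in>Obj C. \<forall>c\<in>Obj C. \<forall>f\<in>arr C a b. \<forall>g\<in>arr C b c.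
        FArr F a c (Comp C a b c g f)
          = Comp D (FOb F a) (FOb F b) (FOb F c) (FArr F b c g) (FArr F a b f))"

definition is_linear_functor ::
  "('k, 'r) ring_scheme \<Rightarrow> ('o, 'm, 'k) lincat \<Rightarrow> ('p, 'n, 'k) lincat
    \<Rightarrow> ('o, 'm, 'p, 'n) funct \<Rightarrow> bool" where
  "is_linear_functor R C D F \<longleftrightarrow> is_functor C D F \<and>
     (\<forall>a\<in>Obj C. \<forall>b\<in>Obj C. \<forall>f\<in>arr C a b. \<forall>g\<in>arr C a b.
        FArr F a b (f \<oplus>\<^bsub>Hom C a b\<^esub> g)
          = FArr F a b f \<oplus>\<^bsub>Hom D (FOb F a) (FOb F b)\<^esub> FArr F a b g) \<and>
     (\<forall>a\<in>Obj C. \<forall>b\<in>Obj C. \<forall>r\<in>carrier R. \<forall>f\<in>arr C a b.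
        FArr F a b (r \<odot>\<^bsub>Hom C a b\<^esub> f) = r \<odot>\<^bsub>Hom D (FOb F a) (FOb F b)\<^esub> FArr F a b f)"

definition mk_functor ::
  "('o, 'm, 'k) lincat \<Rightarrow> ('o \<Rightarrow> 'p) \<Rightarrow> ('o \<Rightarrow> 'o \<Rightarrow> 'm \<Rightarrow> 'n) \<Rightarrow> ('o, 'm, 'p, 'n) funct" where
  "mk_functor C fo fa =
    \<lparr>FOb = (\<lambda>a\<in>Obj C. fo a), FArr = (\<lambda>a\<in>Obj C. \<lambda>b\<in>Obj C. \<lambda>f\<in>arr C a b. fa a b f)\<rparr>"

definition comp_functor ::
  "('p, 'n, 'q, 'l) funct \<Rightarrow> ('o, 'm, 'p, 'n) funct \<Rightarrow> ('o, 'm, 'q, 'l) funct" where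
  "comp_functor G F =
    \<lparr>FOb = (\<lambda>a. FOb G (FOb F a)),
     FArr = (\<lambda>a b f. FArr G (FOb F a) (FOb F b) (FArr F a b f))\<rparr>"

definition faithful ::
  "('o, 'm, 'k) lincat \<Rightarrow> ('o, 'm, 'p, 'n) funct \<Rightarrow> bool" where
  "faithful C F \<longleftrightarrow> (\<forall>a\<in>Obj C. \<forall>b\<in>Obj C. inj_on (FArr F a b) (arr C a b))"

definition nat_trans ::
  "('o, 'm, 'k) lincat \<Rightarrow> ('p, 'n, 'k) lincat \<Rightarrow> ('o, 'm, 'p, 'n) funct
    \<Rightarrow> ('o, 'm, 'p, 'n) funct \<Rightarrow> ('o \<Rightarrow> 'n) set" where
  "nat_trans C D F G = {\<alpha> \<in> (\<Pi>\<^sub>E c\<in>Obj C. arr D (FOb F c) (FOb G c)).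
     \<forall>a\<in>Obj C. \<forall>b\<in>Obj C. \<forall>f\<in>arr C a b.
       Comp D (FOb F a) (FOb F b) (FOb G b) (\<alpha> b) (FArr F a b f)
         = Comp D (FOb F a) (FOb G a) (FOb G b) (FArr G a b f) (\<alpha> a)}"

text \<open>The category of linear functors \<open>C \<rightarrow> B\<close>. The equation with \<open>mk_functor\<close> says that a
  functor takes the value \<open>undefined\<close> outside its domain, so that two objects which agree on
  \<open>C\<close> are equal.\<close>

definition functor_cat ::
  "('k, 'r) ring_scheme \<Rightarrow> ('o, 'm, 'k) lincat \<Rightarrow> ('p, 'n, 'k) lincat
    \<Rightarrow> (('o, 'm, 'p, 'n) funct, 'o \<Rightarrow> 'n, 'k) lincat" where
  "functor_cat R C B =
    \<lparr>Obj = {F. is_linear_functor R C B F \<and> F = mk_functor C (FOb F) (FArr F)},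
     Hom = (\<lambda>F G.
       \<lparr>carrier = nat_trans C B F G, mult = (\<lambda>_ _. undefined), one = undefined,
        zero = (\<lambda>c\<in>Obj C. \<zero>\<^bsub>Hom B (FOb F c) (FOb G c)\<^esub>),
        add = (\<lambda>\<alpha> \<beta>. \<lambda>c\<in>Obj C. \<alpha> c \<oplus>\<^bsub>Hom B (FOb F c) (FOb G c)\<^esub> \<beta> c),
        smult = (\<lambda>r \<alpha>. \<lambda>c\<in>Obj C. r \<odot>\<^bsub>Hom B (FOb F c) (FOb G c)\<^esub> \<alpha> c)\<rparr>),
     Comp = (\<lambda>F G H \<beta> \<alpha>. \<lambda>c\<in>Obj C. Comp B (FOb F c) (FOb G c) (FOb H c) (\<beta> c) (\<alpha> c)),
     Ident = (\<lambda>F. \<lambda>c\<in>Obj C. Ident B (FOb F c))\<rparr>"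

text \<open>The covariant functor \<open>C(c,-)\<close> and the contravariant functor \<open>C(-,c)\<close>.\<close>

definition hom_from ::
  "('o, 'm, 'k) lincat \<Rightarrow> 'o \<Rightarrow> ('o, 'm, ('k, 'm) module, 'm \<Rightarrow> 'm) funct" where
  "hom_from C c = mk_functor C (\<lambda>d. Hom C c d) (\<lambda>d d' g. \<lambda>h\<in>arr C c d. Comp C c d d' g h)"

definition hom_to ::
  "('o, 'm, 'k) lincat \<Rightarrow> 'o \<Rightarrow> ('o, 'm, ('k, 'm) module, 'm \<Rightarrow> 'm) funct" where
  "hom_to C c = hom_from (op_cat C) c"

definition dual_functor ::
  "('k, 'r) ring_scheme \<Rightarrow> ('o, 'm, 'k) lincat \<Rightarrow> ('o, 'm, ('k, 'v) module, 'v \<Rightarrow> 'v) funct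
    \<Rightarrow> ('o, 'm, ('k, 'v \<Rightarrow> 'k) module, ('v \<Rightarrow> 'k) \<Rightarrow> ('v \<Rightarrow> 'k)) funct" where
  "dual_functor R C M = mk_functor (op_cat C) (\<lambda>d. dual R (FOb M d))
     (\<lambda>d' d g. dual_map R (FOb M d) (FOb M d') (FArr M d d' g))"


section \<open>Adjunctions\<close>

text \<open>\<open>adjunction D A L G \<eta>\<close>: the functor \<open>L : D \<rightarrow> A\<close> is left adjoint to \<open>G : A \<rightarrow> D\<close>
  with unit \<open>\<eta>\<close>.\<close>

definition adjunction ::
  "('o, 'm, 'k) lincat \<Rightarrow> ('p, 'n, 'l) lincat \<Rightarrow> ('o, 'm, 'p, 'n) funct
    \<Rightarrow> ('p, 'n, 'o, 'm) funct \<Rightarrow> ('o \<Rightarrow> 'm) \<Rightarrow> bool" where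
  "adjunction D A L G \<eta> \<longleftrightarrow> is_functor D A L \<and> is_functor A D G \<and>
     (\<forall>x\<in>Obj D. \<eta> x \<in> arr D x (FOb G (FOb L x))) \<and>
     (\<forall>x\<in>Obj D. \<forall>y\<in>Obj D. \<forall>f\<in>arr D x y.
        Comp D x y (FOb G (FOb L y)) (\<eta> y) f
          = Comp D x (FOb G (FOb L x)) (FOb G (FOb L y))
              (FArr G (FOb L x) (FOb L y) (FArr L x y f)) (\<eta> x)) \<and>
     (\<forall>x\<in>Obj D. \<forall>y\<in>Obj A. \<forall>f\<in>arr D x (FOb G y).
        \<exists>!g. g \<in> arr A (FOb L x) y \<and>
          f = Comp D x (FOb G (FOb L x)) (FOb G y) (FArr G (FOb L x) y g) (\<eta> x))"

definition left_adjoint ::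
  "('o, 'm, 'k) lincat \<Rightarrow> ('p, 'n, 'l) lincat \<Rightarrow> ('o, 'm, 'p, 'n) funct
    \<Rightarrow> ('p, 'n, 'o, 'm) funct \<Rightarrow> bool" where
  "left_adjoint D A L G \<longleftrightarrow> (\<exists>\<eta>. adjunction D A L G \<eta>)"


section \<open>Tensor products over a linear category\<close>

text \<open>Let \<open>W\<close> be a right \<open>C\<close>-module and \<open>F : C \<rightarrow> B\<close> a linear functor. A cocone with vertex \<open>X\<close>
  is a morphism of right modules from \<open>W\<close> to \<open>B(F(-), X)\<close>.\<close>

definition weighted_cocone ::
  "('k, 'r) ring_scheme \<Rightarrow> ('c, 'm, 'k) lincat \<Rightarrow> ('o, 'n, 'k) lincat
    \<Rightarrow> ('c, 'm, ('k, 'v) module, 'v \<Rightarrow> 'v) funct \<Rightarrow> ('c, 'm, 'o, 'n) funct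
    \<Rightarrow> 'o \<Rightarrow> ('c \<Rightarrow> 'v \<Rightarrow> 'n) \<Rightarrow> bool" where
  "weighted_cocone R C B W F X u \<longleftrightarrow> X \<in> Obj B \<and>
     (\<forall>c\<in>Obj C. u c \<in> linear_maps R (FOb W c) (Hom B (FOb F c) X)) \<and>
     (\<forall>c\<in>Obj C. \<forall>c'\<in>Obj C. \<forall>f\<in>arr C c c'. \<forall>w\<in>carrier (FOb W c').
        u c (FArr W c' c f w) = Comp B (FOb F c) (FOb F c') X (u c' w) (FArr F c c' f))"

definition is_weighted_colimit ::
  "('k, 'r) ring_scheme \<Rightarrow> ('c, 'm, 'k) lincat \<Rightarrow> ('o, 'n, 'k) lincat
    \<Rightarrow> ('c, 'm, ('k, 'v) module, 'v \<Rightarrow> 'v) funct \<Rightarrow> ('c, 'm, 'o, 'n) funct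
    \<Rightarrow> 'o \<Rightarrow> ('c \<Rightarrow> 'v \<Rightarrow> 'n) \<Rightarrow> bool" where
  "is_weighted_colimit R C B W F X u \<longleftrightarrow> weighted_cocone R C B W F X u \<and>
     (\<forall>Y v. weighted_cocone R C B W F Y v \<longrightarrow>
        (\<exists>!h. h \<in> arr B X Y \<and>
          (\<forall>c\<in>Obj C. \<forall>w\<in>carrier (FOb W c). v c w = Comp B (FOb F c) X Y h (u c w))))"

text \<open>The tensor product of \<open>W\<close> and \<open>F\<close> is the colimit of \<open>F\<close> weighted by \<open>W\<close>. It is determined
  up to unique isomorphism, and one is chosen together with its universal cocone.\<close>

definition tensor ::
  "('k, 'r) ring_scheme \<Rightarrow> ('c, 'm, 'k) lincat \<Rightarrow> ('o, 'n, 'k) lincat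
    \<Rightarrow> ('c, 'm, ('k, 'v) module, 'v \<Rightarrow> 'v) funct \<Rightarrow> ('c, 'm, 'o, 'n) funct
    \<Rightarrow> 'o \<times> ('c \<Rightarrow> 'v \<Rightarrow> 'n)" where
  "tensor R C B W F = (SOME (X, u). is_weighted_colimit R C B W F X u)"

definition tensor_ob ::
  "('k, 'r) ring_scheme \<Rightarrow> ('c, 'm, 'k) lincat \<Rightarrow> ('o, 'n, 'k) lincat
    \<Rightarrow> ('c, 'm, ('k, 'v) module, 'v \<Rightarrow> 'v) funct \<Rightarrow> ('c, 'm, 'o, 'n) funct \<Rightarrow> 'o" where
  "tensor_ob R C B W F = fst (tensor R C B W F)"

definition tensor_in ::
  "('k, 'r) ring_scheme \<Rightarrow> ('c, 'm, 'k) lincat \<Rightarrow> ('o, 'n, 'k) lincat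
    \<Rightarrow> ('c, 'm, ('k, 'v) module, 'v \<Rightarrow> 'v) funct \<Rightarrow> ('c, 'm, 'o, 'n) funct
    \<Rightarrow> 'c \<Rightarrow> 'v \<Rightarrow> 'n" where
  "tensor_in R C B W F = snd (tensor R C B W F)"

text \<open>The morphism of tensor products induced by \<open>\<tau> : W \<rightarrow> W'\<close> and \<open>\<alpha> : F \<rightarrow> F'\<close>.\<close>

definition tensor_map ::
  "('k, 'r) ring_scheme \<Rightarrow> ('c, 'm, 'k) lincat \<Rightarrow> ('o, 'n, 'k) lincat
    \<Rightarrow> ('c, 'm, ('k, 'v) module, 'v \<Rightarrow> 'v) funct \<Rightarrow> ('c, 'm, ('k, 'v) module, 'v \<Rightarrow> 'v) funct
    \<Rightarrow> ('c \<Rightarrow> 'v \<Rightarrow> 'v) \<Rightarrow> ('c, 'm, 'o, 'n) funct \<Rightarrow> ('c, 'm, 'o, 'n) funct \<Rightarrow> ('c \<Rightarrow> 'n) \<Rightarrow> 'n" where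
  "tensor_map R C B W W' \<tau> F F' \<alpha> =
     (THE h. h \<in> arr B (tensor_ob R C B W F) (tensor_ob R C B W' F') \<and>
        (\<forall>c\<in>Obj C. \<forall>w\<in>carrier (FOb W c).
           Comp B (FOb F c) (tensor_ob R C B W F) (tensor_ob R C B W' F') h
               (tensor_in R C B W F c w)
             = Comp B (FOb F c) (FOb F' c) (tensor_ob R C B W' F')
                 (tensor_in R C B W' F' c (\<tau> c w)) (\<alpha> c)))"

text \<open>With this definition, the tensor product of \<open>C(-,c)\<close> with \<open>F\<close> is \<open>F(c)\<close>, and tensoring with
  \<open>F\<close> is right exact.\<close>

lemma weighted_colimit_hom_to:
  assumes C: "linear_category R C" and B: "linear_category R B"
    and F: "is_linear_functor R C B F" and c: "c \<in> Obj C"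
  shows "is_weighted_colimit R C B (hom_to C c) F (FOb F c) (\<lambda>d. \<lambda>w\<in>arr C d c. FArr F d c w)"
proof -
  interpret C: linear_category R C by (fact C)
  interpret B: linear_category R B by (fact B)
  note Fs = F[unfolded is_linear_functor_def is_functor_def]
  have ob: "FOb (hom_to C c) d = Hom C d c" if "d \<in> Obj C" for d
    using that by (simp add: hom_to_def hom_from_def mk_functor_def op_cat_def)
  have ar: "FArr (hom_to C c) d' d f w = Comp C d d' c w f"
    if "d \<in> Obj C" "d' \<in> Obj C" "f \<in> arr C d d'" "w \<in> arr C d' c" for d d' f w
    using that by (simp add: hom_to_def hom_from_def mk_functor_def op_cat_def)
  have mod: "abelian_group (Hom C d c)" if "d \<in> Obj C" for d
    using C.hom_module[OF that c] by (simp add: module_def)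
  have coc: "weighted_cocone R C B (hom_to C c) F (FOb F c) (\<lambda>d. \<lambda>w\<in>arr C d c. FArr F d c w)"
    unfolding weighted_cocone_def
  proof (intro conjI ballI)
    show "FOb F c \<in> Obj B" using Fs c by blast
  next
    fix d assume d: "d \<in> Obj C"
    show "(\<lambda>w\<in>arr C d c. FArr F d c w)
        \<in> linear_maps R (FOb (hom_to C c) d) (Hom B (FOb F d) (FOb F c))"
      using Fs d c abelian_groupE(1)[OF mod[OF d]] module.smult_closed[OF C.hom_module[OF d c]]
      unfolding linear_maps_def by (auto simp: ob[OF d])
  next
    fix d d' f w
    assume "d \<in> Obj C" "d' \<in> Obj C" "f \<in> arr C d d'" "w \<in> carrier (FOb (hom_to C c) d')"
    then show "(\<lambda>w\<in>arr C d c. FArr F d c w) (FArr (hom_to C c) d' d f w) =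
       Comp B (FOb F d) (FOb F d') (FOb F c) ((\<lambda>w\<in>arr C d' c. FArr F d' c w) w) (FArr F d d' f)"
      using Fs c C.comp_arr by (simp add: ob ar)
  qed
  show ?thesis
    unfolding is_weighted_colimit_def
  proof (intro conjI allI impI coc)
    fix Y v assume v: "weighted_cocone R C B (hom_to C c) F Y v"
    have Y: "Y \<in> Obj B" and
      vl: "\<And>d. d \<in> Obj C \<Longrightarrow> v d \<in> linear_maps R (FOb (hom_to C c) d) (Hom B (FOb F d) Y)" and
      vn: "\<And>d d' f w. \<lbrakk>d \<in> Obj C; d' \<in> Obj C; f \<in> arr C d d'; w \<in> carrier (FOb (hom_to C c) d')\<rbrakk>
        \<Longrightarrow> v d (FArr (hom_to C c) d' d f w) = Comp B (FOb F d) (FOb F d') Y (v d' w) (FArr F d d' f)"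
      using v unfolding weighted_cocone_def by blast+
    have id: "Ident C c \<in> arr C c c" using C.ident_arr c .
    have h: "v c (Ident C c) \<in> arr B (FOb F c) Y"
      using vl[OF c] id unfolding linear_maps_def by (auto simp: ob[OF c])
    show "\<exists>!h. h \<in> arr B (FOb F c) Y \<and> (\<forall>d\<in>Obj C. \<forall>w\<in>carrier (FOb (hom_to C c) d).
        v d w = Comp B (FOb F d) (FOb F c) Y h ((\<lambda>w\<in>arr C d c. FArr F d c w) w))"
    proof (rule ex1I[of _ "v c (Ident C c)"], intro conjI ballI h)
      fix d w assume d: "d \<in> Obj C" and w: "w \<in> carrier (FOb (hom_to C c) d)"
      then have w: "w \<in> arr C d c" by (simp add: ob)
      show "v d w = Comp B (FOb F d) (FOb F c) Y (v c (Ident C c)) ((\<lambda>w\<in>arr C d c. FArr F d c w) w)"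
        using vn[OF d c w, of "Ident C c"] C.comp_ident_left[OF d c w] id w d c by (simp add: ob ar)
    next
      fix h assume h: "h \<in> arr B (FOb F c) Y \<and> (\<forall>d\<in>Obj C. \<forall>w\<in>carrier (FOb (hom_to C c) d).
        v d w = Comp B (FOb F d) (FOb F c) Y h ((\<lambda>w\<in>arr C d c. FArr F d c w) w))"
      then have "v c (Ident C c) = Comp B (FOb F c) (FOb F c) Y h (FArr F c c (Ident C c))"
        using c id by (simp add: ob)
      also have "\<dots> = h" using Fs c h Y B.comp_ident_right by simp
      finally show "h = v c (Ident C c)" by simp
    qed
  qed
qed


lemma weighted_colimit_joint_epi:
  assumes B: "linear_category R B" and F: "is_functor C B F"
    and W: "is_functor (op_cat C) (mod_cat R) W"
    and X: "is_weighted_colimit R C B W F X u" and Y: "Y \<in> Obj B"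
    and h: "h \<in> arr B X Y" "h' \<in> arr B X Y"
    and eq: "\<And>c w. \<lbrakk>c \<in> Obj C; w \<in> carrier (FOb W c)\<rbrakk>
      \<Longrightarrow> Comp B (FOb F c) X Y h (u c w) = Comp B (FOb F c) X Y h' (u c w)"
  shows "h = h'"
proof -
  interpret B: linear_category R B by (fact B)
  define v where "v = (\<lambda>c. \<lambda>w\<in>carrier (FOb W c). Comp B (FOb F c) X Y h (u c w))"
  have FO: "FOb F c \<in> Obj B" if "c \<in> Obj C" for c using F that by (auto simp: is_functor_def)
  have FA: "FArr F c d f \<in> arr B (FOb F c) (FOb F d)"
    if "c \<in> Obj C" "d \<in> Obj C" "f \<in> arr C c d" for c d f
    using F that by (auto simp: is_functor_def)
  have WM: "module R (FOb W c)" if "c \<in> Obj C" for c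
    using W that by (auto simp: is_functor_def op_cat_def mod_cat_def)
  have WA: "FArr W d c f w \<in> carrier (FOb W c)"
    if "c \<in> Obj C" "d \<in> Obj C" "f \<in> arr C c d" "w \<in> carrier (FOb W d)" for c d f w
  proof -
    have "FArr W d c f \<in> linear_maps R (FOb W d) (FOb W c)"
      using W that by (auto simp: is_functor_def op_cat_def mod_cat_def hom_module_def)
    then show ?thesis using that by (auto simp: linear_maps_def)
  qed
  have u: "weighted_cocone R C B W F X u" using X by (simp add: is_weighted_colimit_def)
  have XO: "X \<in> Obj B" using u by (simp add: weighted_cocone_def)
  have ul: "u c \<in> linear_maps R (FOb W c) (Hom B (FOb F c) X)" if "c \<in> Obj C" for c
    using u that by (simp add: weighted_cocone_def)
  have ua: "u c w \<in> arr B (FOb F c) X" if "c \<in> Obj C" "w \<in> carrier (FOb W c)" for c w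
    using ul[OF that(1)] that(2) by (auto simp: linear_maps_def)
  have "weighted_cocone R C B W F Y v"
    unfolding weighted_cocone_def
  proof (intro conjI ballI Y)
    fix c assume c: "c \<in> Obj C"
    interpret W: module R "FOb W c" by (rule WM[OF c])
    have "u c (x \<oplus>\<^bsub>FOb W c\<^esub> y) = u c x \<oplus>\<^bsub>Hom B (FOb F c) X\<^esub> u c y"
      if "x \<in> carrier (FOb W c)" "y \<in> carrier (FOb W c)" for x y
      using ul[OF c] that by (simp add: linear_maps_def)
    moreover have "u c (r \<odot>\<^bsub>FOb W c\<^esub> x) = r \<odot>\<^bsub>Hom B (FOb F c) X\<^esub> u c x"
      if "r \<in> carrier R" "x \<in> carrier (FOb W c)" for r x
      using ul[OF c] that by (simp add: linear_maps_def)
    ultimately show "v c \<in> linear_maps R (FOb W c) (Hom B (FOb F c) Y)"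
      using c XO Y h FO[OF c] ua[OF c]
      by (auto simp: linear_maps_def v_def B.comp_arr B.comp_add_right B.comp_smult_right)
  next
    fix c d f w assume a: "c \<in> Obj C" "d \<in> Obj C" "f \<in> arr C c d" "w \<in> carrier (FOb W d)"
    have "u c (FArr W d c f w) = Comp B (FOb F c) (FOb F d) X (u d w) (FArr F c d f)"
      using u a by (simp add: weighted_cocone_def)
    then show "v c (FArr W d c f w) = Comp B (FOb F c) (FOb F d) Y (v d w) (FArr F c d f)"
      using a WA XO Y h FO FA ua by (simp add: v_def B.comp_assoc)
  qed
  then have "\<exists>!h. h \<in> arr B X Y \<and>
      (\<forall>c\<in>Obj C. \<forall>w\<in>carrier (FOb W c). v c w = Comp B (FOb F c) X Y h (u c w))"
    using X by (simp add: is_weighted_colimit_def)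
  then show ?thesis using h eq by (auto simp: v_def)
qed

lemma weighted_colimit_right_exact:
  assumes B: "linear_category R B" and F: "is_functor C B F"
    and W1: "is_functor (op_cat C) (mod_cat R) W1"
    and W2: "is_functor (op_cat C) (mod_cat R) W2"
    and W3: "is_functor (op_cat C) (mod_cat R) W3"
    and \<sigma>: "\<sigma> \<in> nat_trans (op_cat C) (mod_cat R) W1 W2"
    and \<tau>: "\<tau> \<in> nat_trans (op_cat C) (mod_cat R) W2 W3"
    and surj: "\<And>c. c \<in> Obj C \<Longrightarrow> \<tau> c ` carrier (FOb W2 c) = carrier (FOb W3 c)"
    and exact: "\<And>c. c \<in> Obj C \<Longrightarrow>
      \<sigma> c ` carrier (FOb W1 c) = {w \<in> carrier (FOb W2 c). \<tau> c w = \<zero>\<^bsub>FOb W3 c\<^esub>}"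
    and X1: "is_weighted_colimit R C B W1 F X1 u1"
    and X2: "is_weighted_colimit R C B W2 F X2 u2"
    and X3: "is_weighted_colimit R C B W3 F X3 u3"
    and s: "s \<in> arr B X1 X2"
      "\<And>c w. \<lbrakk>c \<in> Obj C; w \<in> carrier (FOb W1 c)\<rbrakk>
        \<Longrightarrow> Comp B (FOb F c) X1 X2 s (u1 c w) = u2 c (\<sigma> c w)"
    and t: "t \<in> arr B X2 X3"
      "\<And>c w. \<lbrakk>c \<in> Obj C; w \<in> carrier (FOb W2 c)\<rbrakk>
        \<Longrightarrow> Comp B (FOb F c) X2 X3 t (u2 c w) = u3 c (\<tau> c w)"
  shows "is_cokernel B X1 X2 s X3 t"
proof -
  interpret B: linear_category R B by (fact B)
  have FO: "FOb F c \<in> Obj B" if "c \<in> Obj C" for c using F that by (auto simp: is_functor_def)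
  have FA: "FArr F c d f \<in> arr B (FOb F c) (FOb F d)"
    if "c \<in> Obj C" "d \<in> Obj C" "f \<in> arr C c d" for c d f
    using F that by (auto simp: is_functor_def)
  have M: "module R (FOb W1 c)" "module R (FOb W2 c)" "module R (FOb W3 c)" if "c \<in> Obj C" for c
    using W1 W2 W3 that by (auto simp: is_functor_def op_cat_def mod_cat_def)
  have WA: "FArr W2 d c f w \<in> carrier (FOb W2 c)"
    if "c \<in> Obj C" "d \<in> Obj C" "f \<in> arr C c d" "w \<in> carrier (FOb W2 d)" for c d f w
  proof -
    have "FArr W2 d c f \<in> linear_maps R (FOb W2 d) (FOb W2 c)"
      using W2 that by (auto simp: is_functor_def op_cat_def mod_cat_def hom_module_def)
    then show ?thesis using that by (auto simp: linear_maps_def)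
  qed
  have lin: "\<tau> c \<in> linear_maps R (FOb W2 c) (FOb W3 c)" "\<sigma> c \<in> linear_maps R (FOb W1 c) (FOb W2 c)"
    if "c \<in> Obj C" for c
    using \<sigma> \<tau> that by (auto simp: nat_trans_def op_cat_def mod_cat_def hom_module_def PiE_iff)
  have nat: "FArr W3 d c f (\<tau> d w) = \<tau> c (FArr W2 d c f w)"
    if c: "c \<in> Obj C" and d: "d \<in> Obj C" and f: "f \<in> arr C c d" and w: "w \<in> carrier (FOb W2 d)" for c d f w
  proof -
    have "(\<lambda>x\<in>carrier (FOb W2 d). \<tau> c (FArr W2 d c f x)) = (\<lambda>x\<in>carrier (FOb W2 d). FArr W3 d c f (\<tau> d x))"
      using \<tau> c d f by (auto simp: nat_trans_def op_cat_def mod_cat_def)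
    from fun_cong[OF this, of w] w show ?thesis by simp
  qed
  have coc: "weighted_cocone R C B W1 F X1 u1" "weighted_cocone R C B W2 F X2 u2"
    "weighted_cocone R C B W3 F X3 u3"
    using X1 X2 X3 by (auto simp: is_weighted_colimit_def)
  have XO: "X1 \<in> Obj B" "X2 \<in> Obj B" "X3 \<in> Obj B"
    using coc by (auto simp: weighted_cocone_def)
  have ul: "u1 c \<in> linear_maps R (FOb W1 c) (Hom B (FOb F c) X1)"
    "u2 c \<in> linear_maps R (FOb W2 c) (Hom B (FOb F c) X2)"
    "u3 c \<in> linear_maps R (FOb W3 c) (Hom B (FOb F c) X3)" if "c \<in> Obj C" for c
    using coc that by (auto simp: weighted_cocone_def)
  have ua: "w \<in> carrier (FOb W1 c) \<Longrightarrow> u1 c w \<in> arr B (FOb F c) X1"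
    "w \<in> carrier (FOb W2 c) \<Longrightarrow> u2 c w \<in> arr B (FOb F c) X2"
    "w \<in> carrier (FOb W3 c) \<Longrightarrow> u3 c w \<in> arr B (FOb F c) X3" if "c \<in> Obj C" for c w
    using ul[OF that] by (auto simp: linear_maps_def)
  have u2n: "u2 c (FArr W2 d c f w) = Comp B (FOb F c) (FOb F d) X2 (u2 d w) (FArr F c d f)"
    if "c \<in> Obj C" "d \<in> Obj C" "f \<in> arr C c d" "w \<in> carrier (FOb W2 d)" for c d f w
    using coc that by (auto simp: weighted_cocone_def)
  have hm: "abelian_group (Hom B x y)" "module R (Hom B x y)" if "x \<in> Obj B" "y \<in> Obj B" for x y
    using B.hom_module[OF that] by (auto simp: module_def)
  have zl: "Comp B x y z \<zero>\<^bsub>Hom B y z\<^esub> f = \<zero>\<^bsub>Hom B x z\<^esub>"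
    if "x \<in> Obj B" "y \<in> Obj B" "z \<in> Obj B" "f \<in> arr B x y" for x y z f
  proof -
    interpret yz: module R "Hom B y z" using hm that by blast
    interpret xz: module R "Hom B x z" using hm that by blast
    have "Comp B x y z (\<zero>\<^bsub>R\<^esub> \<odot>\<^bsub>Hom B y z\<^esub> \<zero>\<^bsub>Hom B y z\<^esub>) f = \<zero>\<^bsub>R\<^esub> \<odot>\<^bsub>Hom B x z\<^esub> Comp B x y z \<zero>\<^bsub>Hom B y z\<^esub> f"
      using that by (intro B.comp_smult_left) auto
    then show ?thesis using that B.comp_arr[of x y z f "\<zero>\<^bsub>Hom B y z\<^esub>"] by simp
  qed
  have zr: "Comp B x y z g \<zero>\<^bsub>Hom B x y\<^esub> = \<zero>\<^bsub>Hom B x z\<^esub>"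
    if "x \<in> Obj B" "y \<in> Obj B" "z \<in> Obj B" "g \<in> arr B y z" for x y z g
  proof -
    interpret xy: module R "Hom B x y" using hm that by blast
    interpret xz: module R "Hom B x z" using hm that by blast
    have "Comp B x y z g (\<zero>\<^bsub>R\<^esub> \<odot>\<^bsub>Hom B x y\<^esub> \<zero>\<^bsub>Hom B x y\<^esub>) = \<zero>\<^bsub>R\<^esub> \<odot>\<^bsub>Hom B x z\<^esub> Comp B x y z g \<zero>\<^bsub>Hom B x y\<^esub>"
      using that by (intro B.comp_smult_right) auto
    then show ?thesis using that B.comp_arr[of x y z "\<zero>\<^bsub>Hom B x y\<^esub>" g] by simp
  qed
  have z3: "u3 c \<zero>\<^bsub>FOb W3 c\<^esub> = \<zero>\<^bsub>Hom B (FOb F c) X3\<^esub>" if c: "c \<in> Obj C" for c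
  proof -
    interpret W: module R "FOb W3 c" using M c by blast
    interpret H: module R "Hom B (FOb F c) X3" using hm FO XO c by blast
    have "u3 c (\<zero>\<^bsub>R\<^esub> \<odot>\<^bsub>FOb W3 c\<^esub> \<zero>\<^bsub>FOb W3 c\<^esub>) = \<zero>\<^bsub>R\<^esub> \<odot>\<^bsub>Hom B (FOb F c) X3\<^esub> u3 c \<zero>\<^bsub>FOb W3 c\<^esub>"
      using ul(3)[OF c] B.zero_closed W.zero_closed unfolding linear_maps_def by blast
    then show ?thesis using ua(3)[OF c, of "\<zero>\<^bsub>FOb W3 c\<^esub>"] by simp
  qed
  have \<sigma>a: "\<sigma> c w \<in> carrier (FOb W2 c)" "\<tau> c (\<sigma> c w) = \<zero>\<^bsub>FOb W3 c\<^esub>"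
    if "c \<in> Obj C" "w \<in> carrier (FOb W1 c)" for c w
    using exact[OF that(1)] that(2) by auto
  have \<tau>a: "\<tau> c w \<in> carrier (FOb W3 c)" if "c \<in> Obj C" "w \<in> carrier (FOb W2 c)" for c w
    using surj[OF that(1)] that(2) by auto
  have ts: "Comp B X1 X2 X3 t s = \<zero>\<^bsub>Hom B X1 X3\<^esub>"
  proof (rule weighted_colimit_joint_epi[OF B F W1 X1 XO(3)])
    show "Comp B X1 X2 X3 t s \<in> arr B X1 X3" using s t XO B.comp_arr by blast
    show "\<zero>\<^bsub>Hom B X1 X3\<^esub> \<in> arr B X1 X3" using hm XO abelian_groupE(2) by blast
  next
    fix c w assume c: "c \<in> Obj C" and w: "w \<in> carrier (FOb W1 c)"
    have "Comp B (FOb F c) X1 X3 (Comp B X1 X2 X3 t s) (u1 c w)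
        = Comp B (FOb F c) X2 X3 t (Comp B (FOb F c) X1 X2 s (u1 c w))"
      by (rule B.comp_assoc[OF FO[OF c] XO ua(1)[OF c w] s(1) t(1), symmetric])
    also have "\<dots> = \<zero>\<^bsub>Hom B (FOb F c) X3\<^esub>"
      using c w by (simp add: s t \<sigma>a z3)
    finally show "Comp B (FOb F c) X1 X3 (Comp B X1 X2 X3 t s) (u1 c w)
        = Comp B (FOb F c) X1 X3 \<zero>\<^bsub>Hom B X1 X3\<^esub> (u1 c w)"
      using XO FO c ua w by (simp add: zl)
  qed
  have univ: "\<exists>!h. h \<in> arr B X3 Y \<and> Comp B X2 X3 Y h t = g"
    if Y: "Y \<in> Obj B" and g: "g \<in> arr B X2 Y" and gs: "Comp B X1 X2 Y g s = \<zero>\<^bsub>Hom B X1 Y\<^esub>" for Y g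
  proof -
    define p where "p c w = (SOME x. x \<in> carrier (FOb W2 c) \<and> \<tau> c x = w)" for c w
    have p: "p c w \<in> carrier (FOb W2 c)" "\<tau> c (p c w) = w"
      if "c \<in> Obj C" "w \<in> carrier (FOb W3 c)" for c w
    proof -
      have "\<exists>x. x \<in> carrier (FOb W2 c) \<and> \<tau> c x = w" using surj[OF that(1)] that(2) by force
      from someI_ex[OF this] show "p c w \<in> carrier (FOb W2 c)" "\<tau> c (p c w) = w"
        by (auto simp: p_def)
    qed
    define q where "q c x = Comp B (FOb F c) X2 Y g (u2 c x)" for c x
    have qa: "q c x \<in> arr B (FOb F c) Y" if "c \<in> Obj C" "x \<in> carrier (FOb W2 c)" for c x
      using that g Y XO FO ua B.comp_arr by (simp add: q_def)
    have q_add: "q c (x \<oplus>\<^bsub>FOb W2 c\<^esub> y) = q c x \<oplus>\<^bsub>Hom B (FOb F c) Y\<^esub> q c y"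
      if "c \<in> Obj C" "x \<in> carrier (FOb W2 c)" "y \<in> carrier (FOb W2 c)" for c x y
      using ul(2)[OF that(1)] that g Y XO FO ua by (simp add: q_def linear_maps_def B.comp_add_right)
    have q_smult: "q c (r \<odot>\<^bsub>FOb W2 c\<^esub> x) = r \<odot>\<^bsub>Hom B (FOb F c) Y\<^esub> q c x"
      if "c \<in> Obj C" "r \<in> carrier R" "x \<in> carrier (FOb W2 c)" for c r x
      using ul(2)[OF that(1)] that g Y XO FO ua by (simp add: q_def linear_maps_def B.comp_smult_right)
    have q_zero: "q c x = \<zero>\<^bsub>Hom B (FOb F c) Y\<^esub>"
      if c: "c \<in> Obj C" and x: "x \<in> carrier (FOb W2 c)" "\<tau> c x = \<zero>\<^bsub>FOb W3 c\<^esub>" for c x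
    proof -
      obtain w where w: "w \<in> carrier (FOb W1 c)" "x = \<sigma> c w" using exact[OF c] x by blast
      have "q c x = Comp B (FOb F c) X2 Y g (Comp B (FOb F c) X1 X2 s (u1 c w))"
        using s(2)[OF c w(1)] by (simp add: q_def w(2))
      also have "\<dots> = Comp B (FOb F c) X1 Y (Comp B X1 X2 Y g s) (u1 c w)"
        by (rule B.comp_assoc[OF FO[OF c] XO(1,2) Y ua(1)[OF c w(1)] s(1) g])
      also have "\<dots> = \<zero>\<^bsub>Hom B (FOb F c) Y\<^esub>"
        using XO Y FO c ua w by (simp add: gs zl)
      finally show ?thesis .
    qed
    have q_cong: "q c x = q c y"
      if c: "c \<in> Obj C" and x: "x \<in> carrier (FOb W2 c)" and y: "y \<in> carrier (FOb W2 c)"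
        and xy: "\<tau> c x = \<tau> c y" for c x y
    proof -
      interpret W2: module R "FOb W2 c" using M c by blast
      interpret W3: module R "FOb W3 c" using M c by blast
      interpret H: module R "Hom B (FOb F c) Y" using hm FO Y c by blast
      have m: "(\<ominus>\<^bsub>R\<^esub> \<one>\<^bsub>R\<^esub>) \<odot>\<^bsub>FOb W2 c\<^esub> y \<in> carrier (FOb W2 c)" using y by simp
      have l: "\<tau> c (a \<oplus>\<^bsub>FOb W2 c\<^esub> b) = \<tau> c a \<oplus>\<^bsub>FOb W3 c\<^esub> \<tau> c b"
        "r \<in> carrier R \<Longrightarrow> \<tau> c (r \<odot>\<^bsub>FOb W2 c\<^esub> a) = r \<odot>\<^bsub>FOb W3 c\<^esub> \<tau> c a"
        if "a \<in> carrier (FOb W2 c)" "b \<in> carrier (FOb W2 c)" for a b r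
        using lin(1)[OF c] that by (auto simp: linear_maps_def)
      have "\<tau> c (x \<oplus>\<^bsub>FOb W2 c\<^esub> (\<ominus>\<^bsub>R\<^esub> \<one>\<^bsub>R\<^esub>) \<odot>\<^bsub>FOb W2 c\<^esub> y) = \<zero>\<^bsub>FOb W3 c\<^esub>"
        using x y m \<tau>a[OF c y] by (simp add: l xy W3.smult_l_minus W3.r_neg)
      from q_zero[OF c _ this] x m have "q c x \<oplus>\<^bsub>Hom B (FOb F c) Y\<^esub> (\<ominus>\<^bsub>R\<^esub> \<one>\<^bsub>R\<^esub>) \<odot>\<^bsub>Hom B (FOb F c) Y\<^esub> q c y
          = \<zero>\<^bsub>Hom B (FOb F c) Y\<^esub>"
        using y c by (simp add: q_add q_smult)
      then have "q c x \<oplus>\<^bsub>Hom B (FOb F c) Y\<^esub> (\<ominus>\<^bsub>Hom B (FOb F c) Y\<^esub> q c y) = \<zero>\<^bsub>Hom B (FOb F c) Y\<^esub>"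
        using qa[OF c y] by (simp add: H.smult_l_minus)
      from H.minus_equality[OF this H.a_inv_closed[OF qa[OF c y]] qa[OF c x]]
      show ?thesis using qa[OF c y] by simp
    qed
    define v where "v = (\<lambda>c. \<lambda>w\<in>carrier (FOb W3 c). q c (p c w))"
    have vq: "v c (\<tau> c x) = q c x" if "c \<in> Obj C" "x \<in> carrier (FOb W2 c)" for c x
      using q_cong[OF that(1) p(1)[OF that(1) \<tau>a[OF that]] that(2) p(2)[OF that(1) \<tau>a[OF that]]]
        \<tau>a[OF that] by (simp add: v_def)
    have coc3: "weighted_cocone R C B W3 F Y v"
      unfolding weighted_cocone_def
    proof (intro conjI ballI Y)
      fix c assume c: "c \<in> Obj C"
      interpret W2: module R "FOb W2 c" using M c by blast
      interpret W3: module R "FOb W3 c" using M c by blast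
      have "v c (x \<oplus>\<^bsub>FOb W3 c\<^esub> y) = v c x \<oplus>\<^bsub>Hom B (FOb F c) Y\<^esub> v c y"
        if x: "x \<in> carrier (FOb W3 c)" and y: "y \<in> carrier (FOb W3 c)" for x y
      proof -
        have "\<tau> c (p c x \<oplus>\<^bsub>FOb W2 c\<^esub> p c y) = x \<oplus>\<^bsub>FOb W3 c\<^esub> y"
          using lin(1)[OF c] p[OF c] x y by (simp add: linear_maps_def)
        then show ?thesis
          using vq[OF c, of "p c x \<oplus>\<^bsub>FOb W2 c\<^esub> p c y"] p[OF c] x y c by (simp add: q_add v_def)
      qed
      moreover have "v c (r \<odot>\<^bsub>FOb W3 c\<^esub> x) = r \<odot>\<^bsub>Hom B (FOb F c) Y\<^esub> v c x"
        if r: "r \<in> carrier R" and x: "x \<in> carrier (FOb W3 c)" for r x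
      proof -
        have "\<tau> c (r \<odot>\<^bsub>FOb W2 c\<^esub> p c x) = r \<odot>\<^bsub>FOb W3 c\<^esub> x"
          using lin(1)[OF c] p[OF c] x r by (simp add: linear_maps_def)
        then show ?thesis
          using vq[OF c, of "r \<odot>\<^bsub>FOb W2 c\<^esub> p c x"] p[OF c] x r c by (simp add: q_smult v_def)
      qed
      ultimately show "v c \<in> linear_maps R (FOb W3 c) (Hom B (FOb F c) Y)"
        using qa p c by (auto simp: linear_maps_def v_def)
    next
      fix c d f w assume a: "c \<in> Obj C" "d \<in> Obj C" "f \<in> arr C c d" "w \<in> carrier (FOb W3 d)"
      note pw = p[OF a(2,4)]
      have "v c (FArr W3 d c f w) = v c (\<tau> c (FArr W2 d c f (p d w)))"
        using nat[OF a(1-3) pw(1)] pw(2) by simp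
      also have "\<dots> = q c (FArr W2 d c f (p d w))" using a WA pw by (simp add: vq)
      also have "\<dots> = Comp B (FOb F c) (FOb F d) Y (q d (p d w)) (FArr F c d f)"
        using a pw u2n FO FA ua XO g Y by (simp add: q_def B.comp_assoc)
      finally show "v c (FArr W3 d c f w) = Comp B (FOb F c) (FOb F d) Y (v d w) (FArr F c d f)"
        using a by (simp add: v_def)
    qed
    have ex: "\<exists>!h. h \<in> arr B X3 Y \<and>
        (\<forall>c\<in>Obj C. \<forall>w\<in>carrier (FOb W3 c). v c w = Comp B (FOb F c) X3 Y h (u3 c w))"
      using X3 coc3 by (simp add: is_weighted_colimit_def)
    have iff: "(\<forall>c\<in>Obj C. \<forall>w\<in>carrier (FOb W3 c). v c w = Comp B (FOb F c) X3 Y h (u3 c w))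
        \<longleftrightarrow> Comp B X2 X3 Y h t = g" if h: "h \<in> arr B X3 Y" for h
    proof
      assume v: "\<forall>c\<in>Obj C. \<forall>w\<in>carrier (FOb W3 c). v c w = Comp B (FOb F c) X3 Y h (u3 c w)"
      show "Comp B X2 X3 Y h t = g"
      proof (rule weighted_colimit_joint_epi[OF B F W2 X2 Y _ g])
        show "Comp B X2 X3 Y h t \<in> arr B X2 Y" using XO Y h t B.comp_arr by blast
      next
        fix c x assume c: "c \<in> Obj C" and x: "x \<in> carrier (FOb W2 c)"
        have "Comp B (FOb F c) X2 Y (Comp B X2 X3 Y h t) (u2 c x)
            = Comp B (FOb F c) X3 Y h (u3 c (\<tau> c x))"
          using B.comp_assoc[OF FO[OF c] XO(2,3) Y ua(2)[OF c x] t(1) h] t(2)[OF c x] by simp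
        also have "\<dots> = q c x" using v c x \<tau>a vq[OF c x] by metis
        finally show "Comp B (FOb F c) X2 Y (Comp B X2 X3 Y h t) (u2 c x)
            = Comp B (FOb F c) X2 Y g (u2 c x)" by (simp add: q_def)
      qed
    next
      assume ht: "Comp B X2 X3 Y h t = g"
      show "\<forall>c\<in>Obj C. \<forall>w\<in>carrier (FOb W3 c). v c w = Comp B (FOb F c) X3 Y h (u3 c w)"
      proof (intro ballI)
        fix c w assume c: "c \<in> Obj C" and w: "w \<in> carrier (FOb W3 c)"
        have "v c w = Comp B (FOb F c) X2 Y (Comp B X2 X3 Y h t) (u2 c (p c w))"
          using c w by (simp add: v_def q_def ht)
        also have "\<dots> = Comp B (FOb F c) X3 Y h (Comp B (FOb F c) X2 X3 t (u2 c (p c w)))"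
          by (rule B.comp_assoc[OF FO[OF c] XO(2,3) Y ua(2)[OF c p(1)[OF c w]] t(1) h, symmetric])
        also have "\<dots> = Comp B (FOb F c) X3 Y h (u3 c w)"
          using c p[OF c w] by (simp add: t)
        finally show "v c w = Comp B (FOb F c) X3 Y h (u3 c w)" .
      qed
    qed
    have "(h \<in> arr B X3 Y \<and>
        (\<forall>c\<in>Obj C. \<forall>w\<in>carrier (FOb W3 c). v c w = Comp B (FOb F c) X3 Y h (u3 c w)))
        \<longleftrightarrow> (h \<in> arr B X3 Y \<and> Comp B X2 X3 Y h t = g)" for h
      using iff by blast
    with ex show ?thesis by simp
  qed
  show ?thesis unfolding is_cokernel_def using s t XO ts univ by auto
qed

text \<open>A module \<open>V\<close> and an object \<open>X\<close> of \<open>B\<close> are a right module over, respectively a linear functor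
  out of, the one-object category given by the ring: every scalar acts as the corresponding
  multiple of the identity. (As the ring is commutative, the same functor is covariant and
  contravariant.)\<close>

definition scalar_functor ::
  "('k, 'r) ring_scheme \<Rightarrow> ('o, 'n, 'k) lincat \<Rightarrow> 'o \<Rightarrow> (unit, 'k, 'o, 'n) funct" where
  "scalar_functor R B X =
     mk_functor (ring_cat R) (\<lambda>_. X) (\<lambda>_ _ r. r \<odot>\<^bsub>Hom B X X\<^esub> Ident B X)"

definition tensor_k_ob ::
  "('k, 'r) ring_scheme \<Rightarrow> ('o, 'n, 'k) lincat \<Rightarrow> ('k, 'v) module \<Rightarrow> 'o \<Rightarrow> 'o" where
  "tensor_k_ob R B V X =
     tensor_ob R (ring_cat R) B (scalar_functor R (mod_cat R) V) (scalar_functor R B X)"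

definition tensor_k_map ::
  "('k, 'r) ring_scheme \<Rightarrow> ('o, 'n, 'k) lincat \<Rightarrow> ('k, 'v) module \<Rightarrow> ('k, 'v) module
    \<Rightarrow> ('v \<Rightarrow> 'v) \<Rightarrow> 'o \<Rightarrow> 'o \<Rightarrow> 'n \<Rightarrow> 'n" where
  "tensor_k_map R B V V' t X X' g =
     tensor_map R (ring_cat R) B
       (scalar_functor R (mod_cat R) V) (scalar_functor R (mod_cat R) V') (\<lambda>_. t)
       (scalar_functor R B X) (scalar_functor R B X') (\<lambda>_. g)"


section \<open>Direct sums\<close>

definition is_coproduct ::
  "('o, 'n, 'k) lincat \<Rightarrow> 'i set \<Rightarrow> ('i \<Rightarrow> 'o) \<Rightarrow> 'o \<Rightarrow> ('i \<Rightarrow> 'n) \<Rightarrow> bool" where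
  "is_coproduct B I X S j \<longleftrightarrow> S \<in> Obj B \<and> (\<forall>i\<in>I. j i \<in> arr B (X i) S) \<and>
     (\<forall>Y\<in>Obj B. \<forall>f. (\<forall>i\<in>I. f i \<in> arr B (X i) Y) \<longrightarrow>
        (\<exists>!h. h \<in> arr B S Y \<and> (\<forall>i\<in>I. Comp B (X i) S Y h (j i) = f i)))"

definition coproduct ::
  "('o, 'n, 'k) lincat \<Rightarrow> 'i set \<Rightarrow> ('i \<Rightarrow> 'o) \<Rightarrow> 'o \<times> ('i \<Rightarrow> 'n)" where
  "coproduct B I X = (SOME (S, j). is_coproduct B I X S j)"

definition coproduct_ob :: "('o, 'n, 'k) lincat \<Rightarrow> 'i set \<Rightarrow> ('i \<Rightarrow> 'o) \<Rightarrow> 'o" where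
  "coproduct_ob B I X = fst (coproduct B I X)"

definition coproduct_in :: "('o, 'n, 'k) lincat \<Rightarrow> 'i set \<Rightarrow> ('i \<Rightarrow> 'o) \<Rightarrow> 'i \<Rightarrow> 'n" where
  "coproduct_in B I X = snd (coproduct B I X)"

definition coproduct_map ::
  "('o, 'n, 'k) lincat \<Rightarrow> 'i set \<Rightarrow> ('i \<Rightarrow> 'o) \<Rightarrow> ('i \<Rightarrow> 'o) \<Rightarrow> ('i \<Rightarrow> 'n) \<Rightarrow> 'n" where
  "coproduct_map B I X Y f =
     (THE h. h \<in> arr B (coproduct_ob B I X) (coproduct_ob B I Y) \<and>
        (\<forall>i\<in>I. Comp B (X i) (coproduct_ob B I X) (coproduct_ob B I Y) h (coproduct_in B I X i)
           = Comp B (X i) (Y i) (coproduct_ob B I Y) (coproduct_in B I Y i) (f i)))"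


section \<open>The functors on the functor category\<close>

definition i_upper_star ::
  "('k, 'r) ring_scheme \<Rightarrow> ('c, 'm, 'k) lincat \<Rightarrow> ('o, 'n, 'k) lincat
    \<Rightarrow> (('c, 'm, 'o, 'n) funct, 'c \<Rightarrow> 'n, 'c \<Rightarrow> 'o, 'c \<Rightarrow> 'n) funct" where
  "i_upper_star R C B =
     mk_functor (functor_cat R C B) (\<lambda>F. \<lambda>c\<in>Obj C. FOb F c) (\<lambda>F G \<alpha>. \<lambda>c\<in>Obj C. \<alpha> c)"

definition i_lower_shriek_ob ::
  "('k, 'r) ring_scheme \<Rightarrow> ('c, 'm, 'k) lincat \<Rightarrow> ('o, 'n, 'k) lincat
    \<Rightarrow> ('c \<Rightarrow> 'o) \<Rightarrow> ('c, 'm, 'o, 'n) funct" where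
  "i_lower_shriek_ob R C B X = mk_functor C
     (\<lambda>d. coproduct_ob B (Obj C) (\<lambda>c. tensor_k_ob R B (Hom C c d) (X c)))
     (\<lambda>d d' g. coproduct_map B (Obj C)
        (\<lambda>c. tensor_k_ob R B (Hom C c d) (X c)) (\<lambda>c. tensor_k_ob R B (Hom C c d') (X c))
        (\<lambda>c. tensor_k_map R B (Hom C c d) (Hom C c d') (FArr (hom_from C c) d d' g)
               (X c) (X c) (Ident B (X c))))"

definition i_lower_shriek ::
  "('k, 'r) ring_scheme \<Rightarrow> ('c, 'm, 'k) lincat \<Rightarrow> ('o, 'n, 'k) lincat
    \<Rightarrow> ('c \<Rightarrow> 'o, 'c \<Rightarrow> 'n, ('c, 'm, 'o, 'n) funct, 'c \<Rightarrow> 'n) funct" where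
  "i_lower_shriek R C B = mk_functor (power_cat (Obj C) B) (i_lower_shriek_ob R C B)
     (\<lambda>X Y f. \<lambda>d\<in>Obj C. coproduct_map B (Obj C)
        (\<lambda>c. tensor_k_ob R B (Hom C c d) (X c)) (\<lambda>c. tensor_k_ob R B (Hom C c d) (Y c))
        (\<lambda>c. tensor_k_map R B (Hom C c d) (Hom C c d) (\<lambda>h\<in>arr C c d. h) (X c) (Y c) (f c)))"

text \<open>The right module \<open>D(C(c,-))\<close>, covariant in \<open>c\<close>: an arrow \<open>f : c \<rightarrow> c'\<close> induces the dual
  of precomposition with \<open>f\<close>, which maps \<open>C(c',d)\<close> to \<open>C(c,d)\<close>.\<close>

definition dual_weight ::
  "('k, 'r) ring_scheme \<Rightarrow> ('c, 'm, 'k) lincat \<Rightarrow> 'c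
    \<Rightarrow> ('c, 'm, ('k, 'm \<Rightarrow> 'k) module, ('m \<Rightarrow> 'k) \<Rightarrow> ('m \<Rightarrow> 'k)) funct" where
  "dual_weight R C c = dual_functor R C (hom_from C c)"

definition dual_weight_map ::
  "('k, 'r) ring_scheme \<Rightarrow> ('c, 'm, 'k) lincat \<Rightarrow> 'c \<Rightarrow> 'c \<Rightarrow> 'm
    \<Rightarrow> 'c \<Rightarrow> ('m \<Rightarrow> 'k) \<Rightarrow> ('m \<Rightarrow> 'k)" where
  "dual_weight_map R C c c' f =
     (\<lambda>d\<in>Obj C. dual_map R (Hom C c' d) (Hom C c d) (FArr (hom_to C d) c' c f))"

definition nu_ob ::
  "('k, 'r) ring_scheme \<Rightarrow> ('c, 'm, 'k) lincat \<Rightarrow> ('o, 'n, 'k) lincat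
    \<Rightarrow> ('c, 'm, 'o, 'n) funct \<Rightarrow> ('c, 'm, 'o, 'n) funct" where
  "nu_ob R C B F = mk_functor C
     (\<lambda>c. tensor_ob R C B (dual_weight R C c) F)
     (\<lambda>c c' f. tensor_map R C B (dual_weight R C c) (dual_weight R C c') (dual_weight_map R C c c' f)
        F F (\<lambda>d\<in>Obj C. Ident B (FOb F d)))"

definition nu ::
  "('k, 'r) ring_scheme \<Rightarrow> ('c, 'm, 'k) lincat \<Rightarrow> ('o, 'n, 'k) lincat
    \<Rightarrow> (('c, 'm, 'o, 'n) funct, 'c \<Rightarrow> 'n, ('c, 'm, 'o, 'n) funct, 'c \<Rightarrow> 'n) funct" where
  "nu R C B = mk_functor (functor_cat R C B) (nu_ob R C B)
     (\<lambda>F G \<alpha>. \<lambda>c\<in>Obj C. tensor_map R C B (dual_weight R C c) (dual_weight R C c)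
        (\<lambda>d\<in>Obj C. \<lambda>\<phi>\<in>carrier (FOb (dual_weight R C c) d). \<phi>) F G \<alpha>)"


section \<open>Nakayama functors\<close>

text \<open>The functor \<open>fs : A \<rightarrow> D\<close> is the faithful functor \<open>f\<^sup>*\<close>, and \<open>fl : D \<rightarrow> A\<close> is its left adjoint
  \<open>f\<^sub>!\<close>. Whether the unit of the adjunction between \<open>N\<close> and its right adjoint \<open>N'\<close> is invertible on
  the image of \<open>f\<^sub>!\<close> does not depend on the choice of right adjoint.\<close>

definition nakayama_functor ::
  "('k, 'r) ring_scheme \<Rightarrow> ('a, 'm, 'k) lincat \<Rightarrow> ('d, 'n, 'k) lincat
    \<Rightarrow> ('d, 'n, 'a, 'm) funct \<Rightarrow> ('a, 'm, 'd, 'n) funct \<Rightarrow> ('a, 'm, 'a, 'm) funct \<Rightarrow> bool" where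
  "nakayama_functor R A D fl fs N \<longleftrightarrow>
     abelian_category R A \<and> additive_category R D \<and>
     is_functor A D fs \<and> faithful A fs \<and> left_adjoint D A fl fs \<and>
     is_functor A A N \<and>
     (\<exists>N' \<eta>. adjunction A A N N' \<eta> \<and>
        left_adjoint A D fs (comp_functor N fl) \<and>
        (\<forall>x\<in>Obj D. iso A (FOb fl x) (FOb N' (FOb N (FOb fl x))) (\<eta> (FOb fl x))))"

end

theory Submission
  imports Defs
begin

text \<open>
  Write \<open>P = i\<^sub>! X\<close> for the functor freely generated by a family \<open>X\<close>, whose value at \<open>d\<close> is the direct sum
  of the \<open>C(c,d) \<otimes> X c\<close>. The whole argument rests on the self-duality of such sums: if the modules \<open>V i\<close>
  are finitely generated projective and almost all zero, then an object that represents
  \<open>Y \<mapsto> \<Prod>i. Hom(V i, B(X i, Y))\<close> also represents \<open>Y \<mapsto> \<Prod>i. Hom(D(V i), B(Y, X i))\<close>, because dual bases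
  express its identity as a finite sum of maps through the \<open>X i\<close> (\<open>copower_sum_dual\<close>). Here the
  finiteness of the Hom modules and local boundedness enter. They are also what makes the tensor
  products exist: a weight with finite support and finitely generated projective values is finitely
  presented, so that finite coproducts and coequalizers in \<open>B\<close> suffice (\<open>weighted_colimit_exists\<close>).

  By the Yoneda lemma, \<open>P\<close> is free on \<open>X\<close>, which gives the adjunction of \<open>i\<^sub>!\<close> and \<open>i\<^sup>*\<close>, and the value of \<open>\<nu> P\<close>
  at \<open>d\<close> is the direct sum of the \<open>D(C(d,c)) \<otimes> X c\<close>. By self-duality this is the product of the powers of the
  \<open>X c\<close> by the modules \<open>C(d,c)\<close>, that is, \<open>\<nu> P\<close> is the cofree functor on \<open>X\<close> (\<open>nu_free_cofree\<close>). By the Yoneda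
  lemma once more, \<open>\<nu> \<circ> i\<^sub>!\<close> is right adjoint to \<open>i\<^sup>*\<close>.

  The functor \<open>\<nu>\<close> has a right adjoint \<open>\<nu>\<^sup>-\<close>, since transformations \<open>\<nu> F \<rightarrow> G\<close> and \<open>F \<rightarrow> \<nu>\<^sup>- G\<close> are both the
  families of linear maps \<open>D(C(c,d)) \<rightarrow> B(F d, G c)\<close> that are natural in \<open>c\<close> and \<open>d\<close> (\<open>eta_universal\<close>). The
  component at \<open>d\<close> of the unit at \<open>P\<close> is invertible exactly if \<open>P d\<close> is the limit of \<open>\<nu> P\<close> weighted by
  \<open>D(C(-,d))\<close>. As \<open>\<nu> P\<close> is cofree, a cone with vertex \<open>Y\<close> over it amounts to linear maps
  \<open>D(C(c,d)) \<rightarrow> B(Y, X c)\<close> for all \<open>c\<close>; and by self-duality these are the arrows \<open>Y \<rightarrow> P d\<close>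
  (\<open>free_is_weighted_limit\<close>).

  All notions are invariant under passing to opposite categories, and half of the statements are
  obtained in this way: kernels in functor categories from cokernels, \<open>\<nu>\<^sup>-\<close> from \<open>\<nu>\<close>, products of powers
  from sums of copowers, and cofree functors from free ones.
\<close>

section \<open>Modules and dual bases\<close>

lemma linear_mapsI:
  assumes "\<And>x. x \<in> carrier M \<Longrightarrow> f x \<in> carrier N"
    and "\<And>x. x \<notin> carrier M \<Longrightarrow> f x = undefined"
    and "\<And>x y. \<lbrakk>x \<in> carrier M; y \<in> carrier M\<rbrakk> \<Longrightarrow> f (x \<oplus>\<^bsub>M\<^esub> y) = f x \<oplus>\<^bsub>N\<^esub> f y"
    and "\<And>a x. \<lbrakk>a \<in> carrier R; x \<in> carrier M\<rbrakk> \<Longrightarrow> f (a \<odot>\<^bsub>M\<^esub> x) = a \<odot>\<^bsub>N\<^esub> f x"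
  shows "f \<in> linear_maps R M N"
  using assms by (auto simp: linear_maps_def PiE_iff extensional_def)

lemma linear_maps_closed:
  "\<lbrakk>f \<in> linear_maps R M N; x \<in> carrier M\<rbrakk> \<Longrightarrow> f x \<in> carrier N"
  by (auto simp: linear_maps_def)

lemma linear_maps_add:
  "\<lbrakk>f \<in> linear_maps R M N; x \<in> carrier M; y \<in> carrier M\<rbrakk> \<Longrightarrow> f (x \<oplus>\<^bsub>M\<^esub> y) = f x \<oplus>\<^bsub>N\<^esub> f y"
  by (auto simp: linear_maps_def)

lemma linear_maps_smult:
  "\<lbrakk>f \<in> linear_maps R M N; a \<in> carrier R; x \<in> carrier M\<rbrakk> \<Longrightarrow> f (a \<odot>\<^bsub>M\<^esub> x) = a \<odot>\<^bsub>N\<^esub> f x"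
  by (auto simp: linear_maps_def)

lemma linear_maps_eqI:
  assumes "f \<in> linear_maps R M N" "g \<in> linear_maps R M N'"
    and "\<And>x. x \<in> carrier M \<Longrightarrow> f x = g x"
  shows "f = g"
  using assms by (auto simp: linear_maps_def intro: PiE_ext)

lemma restrict_linear_maps_eq:
  "f \<in> linear_maps R M N \<Longrightarrow> restrict f (carrier M) = f"
  by (auto simp: linear_maps_def)

lemma linear_maps_zero:
  assumes "module R M" "module R N" "f \<in> linear_maps R M N"
  shows "f \<zero>\<^bsub>M\<^esub> = \<zero>\<^bsub>N\<^esub>"
proof -
  interpret M: module R M by fact
  interpret N: module R N by fact
  have "f (\<zero>\<^bsub>R\<^esub> \<odot>\<^bsub>M\<^esub> \<zero>\<^bsub>M\<^esub>) = \<zero>\<^bsub>R\<^esub> \<odot>\<^bsub>N\<^esub> f \<zero>\<^bsub>M\<^esub>"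
    by (rule linear_maps_smult[OF assms(3)]) auto
  then show ?thesis using linear_maps_closed[OF assms(3)] by simp
qed

lemma linear_maps_finsum:
  assumes "module R M" "module R N" "f \<in> linear_maps R M N"
    and "finite A" "g \<in> A \<rightarrow> carrier M"
  shows "f (finsum M g A) = finsum N (\<lambda>i. f (g i)) A"
  using assms(4,5)
proof (induction A rule: finite_induct)
  case empty
  interpret M: module R M by fact
  interpret N: module R N by fact
  show ?case using linear_maps_zero[OF assms(1-3)] by simp
next
  case (insert i A)
  interpret M: module R M by fact
  interpret N: module R N by fact
  have "(\<lambda>i. f (g i)) \<in> insert i A \<rightarrow> carrier N"
    using insert.prems linear_maps_closed[OF assms(3)] by auto
  then show ?case
    using insert linear_maps_add[OF assms(3), of "g i" "finsum M g A"] by (simp add: Pi_def)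
qed

lemma linear_maps_compose:
  assumes "f \<in> linear_maps R L M" "g \<in> linear_maps R M N" "module R L"
  shows "(\<lambda>x\<in>carrier L. g (f x)) \<in> linear_maps R L N"
proof -
  interpret L: module R L by fact
  show ?thesis using assms by (auto simp: linear_maps_def PiE_iff)
qed

text \<open>Linear maps, free modules, families of arrows and natural transformations all form modules of
  functions with pointwise operations. Negatives are multiples by \<open>-1\<close>, so closure under sums
  and scalar multiples is enough.\<close>

lemma pointwise_module:
  fixes R :: "('k, 'r) ring_scheme" and K :: "('k, 'i \<Rightarrow> 'v) module"
  assumes R: "cring R"
    and N: "\<And>i. i \<in> I \<Longrightarrow> module R (N i)"
    and sub: "carrier K \<subseteq> (\<Pi>\<^sub>E i\<in>I. carrier (N i))"
    and zero: "\<zero>\<^bsub>K\<^esub> = (\<lambda>i\<in>I. \<zero>\<^bsub>N i\<^esub>)" "\<zero>\<^bsub>K\<^esub> \<in> carrier K"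
    and add: "\<And>f g. \<lbrakk>f \<in> carrier K; g \<in> carrier K\<rbrakk> \<Longrightarrow> f \<oplus>\<^bsub>K\<^esub> g = (\<lambda>i\<in>I. f i \<oplus>\<^bsub>N i\<^esub> g i)"
      "\<And>f g. \<lbrakk>f \<in> carrier K; g \<in> carrier K\<rbrakk> \<Longrightarrow> f \<oplus>\<^bsub>K\<^esub> g \<in> carrier K"
    and smult: "\<And>a f. \<lbrakk>a \<in> carrier R; f \<in> carrier K\<rbrakk> \<Longrightarrow> a \<odot>\<^bsub>K\<^esub> f = (\<lambda>i\<in>I. a \<odot>\<^bsub>N i\<^esub> f i)"
      "\<And>a f. \<lbrakk>a \<in> carrier R; f \<in> carrier K\<rbrakk> \<Longrightarrow> a \<odot>\<^bsub>K\<^esub> f \<in> carrier K"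
  shows "module R K"
proof -
  interpret R: cring R by fact
  have el: "f i \<in> carrier (N i)" if "f \<in> carrier K" "i \<in> I" for f i
    using sub that by auto
  have ext: "f = g" if "f \<in> carrier K" "g \<in> carrier K" "\<And>i. i \<in> I \<Longrightarrow> f i = g i" for f g
    by (rule PiE_ext[of f I "\<lambda>i. carrier (N i)" g]) (use that sub in auto)
  have addi: "(f \<oplus>\<^bsub>K\<^esub> g) i = f i \<oplus>\<^bsub>N i\<^esub> g i" if "f \<in> carrier K" "g \<in> carrier K" "i \<in> I" for f g i
    using that by (simp add: add)
  have smi: "(a \<odot>\<^bsub>K\<^esub> f) i = a \<odot>\<^bsub>N i\<^esub> f i" if "a \<in> carrier R" "f \<in> carrier K" "i \<in> I" for a f i
    using that by (simp add: smult)
  have zi: "\<zero>\<^bsub>K\<^esub> i = \<zero>\<^bsub>N i\<^esub>" if "i \<in> I" for i using that by (simp add: zero)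
  note ptw = addi smi zi add(2) smult(2) zero(2) el
  note grp = abelian_group.axioms(1)[OF module.axioms(2)[OF N]]
  show ?thesis
  proof (rule moduleI[OF R], goal_cases)
    case 1
    show ?case
    proof (rule abelian_groupI, goal_cases)
      case (3 x y z) then show ?case
        by (intro ext) (simp_all add: ptw abelian_monoid.a_assoc[OF grp])
    next
      case (4 x y) then show ?case
        by (intro ext) (simp_all add: ptw abelian_monoid.a_comm[OF grp])
    next
      case (5 x) then show ?case
        by (intro ext) (simp_all add: ptw abelian_monoid.l_zero[OF grp])
    next
      case (6 x)
      have "(\<ominus>\<^bsub>R\<^esub> \<one>\<^bsub>R\<^esub>) \<odot>\<^bsub>K\<^esub> x \<oplus>\<^bsub>K\<^esub> x = \<zero>\<^bsub>K\<^esub>"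
      proof (rule ext)
        fix i assume i: "i \<in> I"
        interpret Ni: module R "N i" by (rule N[OF i])
        show "((\<ominus>\<^bsub>R\<^esub> \<one>\<^bsub>R\<^esub>) \<odot>\<^bsub>K\<^esub> x \<oplus>\<^bsub>K\<^esub> x) i = \<zero>\<^bsub>K\<^esub> i"
          using 6 i el[OF 6 i] by (simp add: ptw Ni.smult_l_minus Ni.l_neg)
      qed (use 6 in \<open>simp_all add: ptw\<close>)
      with 6 show ?case by (intro bexI[of _ "(\<ominus>\<^bsub>R\<^esub> \<one>\<^bsub>R\<^esub>) \<odot>\<^bsub>K\<^esub> x"]) (simp_all add: ptw)
    qed (auto simp: ptw)
  next
    case (3 a b x) then show ?case
      by (intro ext) (simp_all add: ptw module.smult_l_distr[OF N])
  next
    case (4 a x y) then show ?case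
      by (intro ext) (simp_all add: ptw module.smult_r_distr[OF N])
  next
    case (5 a b x) then show ?case
      by (intro ext) (simp_all add: ptw module.smult_assoc1[OF N])
  next
    case (6 x) then show ?case
      by (intro ext) (simp_all add: ptw module.smult_one[OF N])
  qed (auto simp: ptw)
qed

lemma self_module_simps [simp]:
  "carrier (self_module R) = carrier R" "add (self_module R) = add R"
  "zero (self_module R) = zero R" "smult (self_module R) = mult R"
  by (simp_all add: self_module_def)

lemma module_self_module:
  assumes "cring R" shows "module R (self_module R)"
proof -
  interpret R: cring R by fact
  have "abelian_group (self_module R)"
    by (rule abelian_groupI)
      (auto simp: R.a_ac intro!: bexI[of _ "\<ominus>\<^bsub>R\<^esub> _"] R.l_neg)
  then show ?thesis
    by (intro moduleI assms) (auto simp: R.l_distr R.r_distr R.m_assoc)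
qed

lemma hom_module_simps [simp]:
  "carrier (hom_module R M N) = linear_maps R M N"
  "zero (hom_module R M N) = (\<lambda>x\<in>carrier M. \<zero>\<^bsub>N\<^esub>)"
  "add (hom_module R M N) = (\<lambda>f g. \<lambda>x\<in>carrier M. f x \<oplus>\<^bsub>N\<^esub> g x)"
  "smult (hom_module R M N) = (\<lambda>a f. \<lambda>x\<in>carrier M. a \<odot>\<^bsub>N\<^esub> f x)"
  by (simp_all add: hom_module_def)

lemma module_hom_module:
  assumes M: "module R M" and N: "module R N"
  shows "module R (hom_module R M N)"
proof -
  interpret M: module R M by fact
  interpret N: module R N by fact
  show ?thesis
  proof (rule pointwise_module[where I = "carrier M" and N = "\<lambda>_. N"], goal_cases)
    case (5)
    show ?case by (auto intro!: linear_mapsI)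
  next
    case (7 f g)
    then have "f x \<in> carrier N" "g x \<in> carrier N" if "x \<in> carrier M" for x
      using that by (auto dest: linear_maps_closed)
    with 7 show ?case
      by (auto intro!: linear_mapsI simp: linear_maps_add linear_maps_smult N.smult_r_distr
          N.a_assoc N.a_comm N.a_lcomm)
  next
    case (9 a f)
    then have "f x \<in> carrier N" if "x \<in> carrier M" for x
      using that by (auto dest: linear_maps_closed)
    with 9 show ?case
      by (auto intro!: linear_mapsI simp: linear_maps_add linear_maps_smult N.smult_r_distr
          N.smult_assoc1[symmetric] M.R.m_comm)
  next
    case 3 show ?case by (auto simp: linear_maps_def)
  qed (simp_all add: M.is_cring N)
qed

lemma module_dual: "module R M \<Longrightarrow> module R (dual R M)"
  unfolding dual_def
  by (rule module_hom_module[OF _ module_self_module[OF module.axioms(1)]])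

lemma dual_simps [simp]:
  "carrier (dual R M) = linear_maps R M (self_module R)"
  "zero (dual R M) = (\<lambda>x\<in>carrier M. \<zero>\<^bsub>R\<^esub>)"
  "add (dual R M) = (\<lambda>f g. \<lambda>x\<in>carrier M. f x \<oplus>\<^bsub>R\<^esub> g x)"
  "smult (dual R M) = (\<lambda>a f. \<lambda>x\<in>carrier M. a \<otimes>\<^bsub>R\<^esub> f x)"
  by (simp_all add: dual_def)

lemma dual_map_linear:
  assumes M: "module R M" and N: "module R N" and f: "f \<in> linear_maps R M N"
  shows "dual_map R M N f \<in> linear_maps R (dual R N) (dual R M)"
proof -
  interpret M: module R M by fact
  interpret DN: module R "dual R N" by (rule module_dual[OF N])
  note fc = linear_maps_closed[OF f]
  show ?thesis
  proof (rule linear_mapsI, goal_cases)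
    case (1 \<phi>)
    then show ?case
      using linear_maps_compose[OF f, of \<phi> "self_module R"] M by (simp add: dual_map_def)
  next
    case (3 \<phi> \<psi>)
    have "\<phi> \<oplus>\<^bsub>dual R N\<^esub> \<psi> \<in> carrier (dual R N)" using 3 by (rule DN.a_closed)
    then show ?case using fc 3 by (auto simp: dual_map_def intro!: restrict_ext)
  next
    case (4 a \<phi>)
    then have "a \<odot>\<^bsub>dual R N\<^esub> \<phi> \<in> carrier (dual R N)" by (rule DN.smult_closed)
    then show ?case using fc 4 by (auto simp: dual_map_def intro!: restrict_ext)
  qed (auto simp: dual_map_def)
qed


text \<open>A finite family \<open>e\<close> with coordinate functionals \<open>\<epsilon>\<close>; its existence is finitely generated
  projectivity.\<close>

definition dual_basis ::
  "('k, 'r) ring_scheme \<Rightarrow> ('k, 'u) module \<Rightarrow> nat \<Rightarrow> (nat \<Rightarrow> 'u) \<Rightarrow> (nat \<Rightarrow> 'u \<Rightarrow> 'k) \<Rightarrow> bool" where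
  "dual_basis R V n e \<epsilon> \<longleftrightarrow> module R V \<and>
     (\<forall>l<n. e l \<in> carrier V \<and> \<epsilon> l \<in> linear_maps R V (self_module R)) \<and>
     (\<forall>v\<in>carrier V. v = (\<Oplus>\<^bsub>V\<^esub>l\<in>{..<n}. \<epsilon> l v \<odot>\<^bsub>V\<^esub> e l))"

lemma dual_basisD:
  assumes "dual_basis R V n e \<epsilon>"
  shows "module R V" and "l < n \<Longrightarrow> e l \<in> carrier V"
    and "l < n \<Longrightarrow> \<epsilon> l \<in> linear_maps R V (self_module R)"
    and "\<lbrakk>l < n; v \<in> carrier V\<rbrakk> \<Longrightarrow> \<epsilon> l v \<in> carrier R"
    and "v \<in> carrier V \<Longrightarrow> v = (\<Oplus>\<^bsub>V\<^esub>l\<in>{..<n}. \<epsilon> l v \<odot>\<^bsub>V\<^esub> e l)"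
  using assms linear_maps_closed[of "\<epsilon> l" R V "self_module R" v] unfolding dual_basis_def by auto

lemma dual_basis_expand:
  assumes b: "dual_basis R V n e \<epsilon>" and N: "module R N" and g: "g \<in> linear_maps R V N"
    and v: "v \<in> carrier V"
  shows "g v = (\<Oplus>\<^bsub>N\<^esub>l\<in>{..<n}. \<epsilon> l v \<odot>\<^bsub>N\<^esub> g (e l))"
proof -
  note d = dual_basisD[OF b]
  interpret V: module R V by (rule d)
  interpret N: module R N by fact
  have m: "(\<lambda>l. \<epsilon> l v \<odot>\<^bsub>V\<^esub> e l) \<in> {..<n} \<rightarrow> carrier V" using d(2-4) v by auto
  have "g v = g (\<Oplus>\<^bsub>V\<^esub>l\<in>{..<n}. \<epsilon> l v \<odot>\<^bsub>V\<^esub> e l)" using d(5)[OF v] by simp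
  also have "\<dots> = (\<Oplus>\<^bsub>N\<^esub>l\<in>{..<n}. g (\<epsilon> l v \<odot>\<^bsub>V\<^esub> e l))"
    by (rule linear_maps_finsum[OF d(1) N g _ m]) simp
  also have "\<dots> = (\<Oplus>\<^bsub>N\<^esub>l\<in>{..<n}. \<epsilon> l v \<odot>\<^bsub>N\<^esub> g (e l))"
    using d(2-4) v g by (intro N.finsum_cong) (auto simp: linear_maps_smult linear_maps_closed simp_implies_def)
  finally show ?thesis .
qed

lemma dual_basis_ext:
  assumes b: "dual_basis R V n e \<epsilon>" and N: "module R N"
    and g: "g \<in> linear_maps R V N" "h \<in> linear_maps R V N"
    and eq: "\<And>l. l < n \<Longrightarrow> g (e l) = h (e l)" and v: "v \<in> carrier V"
  shows "g v = h v"
proof -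
  note d = dual_basisD[OF b]
  interpret N: module R N by fact
  have "(\<Oplus>\<^bsub>N\<^esub>l\<in>{..<n}. \<epsilon> l v \<odot>\<^bsub>N\<^esub> g (e l)) = (\<Oplus>\<^bsub>N\<^esub>l\<in>{..<n}. \<epsilon> l v \<odot>\<^bsub>N\<^esub> h (e l))"
    using d(2-4) v g(2) eq by (intro N.finsum_cong') (auto simp: linear_maps_closed)
  then show ?thesis
    by (simp add: dual_basis_expand[OF b N g(1) v] dual_basis_expand[OF b N g(2) v])
qed

text \<open>The elements \<open>e l\<close> may satisfy relations, so this map takes \<open>e l\<close> to \<open>x l\<close> only if the \<open>x l\<close>
  satisfy the same relations.\<close>

lemma dual_basis_extend:
  assumes b: "dual_basis R V n e \<epsilon>" and N: "module R N"
    and x: "\<And>l. l < n \<Longrightarrow> x l \<in> carrier N"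
  shows "(\<lambda>v\<in>carrier V. \<Oplus>\<^bsub>N\<^esub>l\<in>{..<n}. \<epsilon> l v \<odot>\<^bsub>N\<^esub> x l) \<in> linear_maps R V N"
proof -
  note d = dual_basisD[OF b]
  interpret V: module R V by (rule d)
  interpret N: module R N by fact
  have m: "(\<lambda>l. \<epsilon> l v \<odot>\<^bsub>N\<^esub> x l) \<in> {..<n} \<rightarrow> carrier N" if "v \<in> carrier V" for v
    using d(2-4) x that by auto
  show ?thesis
  proof (rule linear_mapsI, goal_cases)
    case (1 v) then show ?case using m by (simp add: N.finsum_closed)
  next
    case (3 v w)
    have "(\<Oplus>\<^bsub>N\<^esub>l\<in>{..<n}. \<epsilon> l (v \<oplus>\<^bsub>V\<^esub> w) \<odot>\<^bsub>N\<^esub> x l)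
        = (\<Oplus>\<^bsub>N\<^esub>l\<in>{..<n}. (\<epsilon> l v \<odot>\<^bsub>N\<^esub> x l) \<oplus>\<^bsub>N\<^esub> (\<epsilon> l w \<odot>\<^bsub>N\<^esub> x l))"
      using 3 d(2-4) x by (intro N.finsum_cong') (auto simp: linear_maps_add[OF d(3)] N.smult_l_distr)
    also have "\<dots> = (\<Oplus>\<^bsub>N\<^esub>l\<in>{..<n}. \<epsilon> l v \<odot>\<^bsub>N\<^esub> x l) \<oplus>\<^bsub>N\<^esub> (\<Oplus>\<^bsub>N\<^esub>l\<in>{..<n}. \<epsilon> l w \<odot>\<^bsub>N\<^esub> x l)"
      by (rule N.finsum_addf[OF m[OF 3(1)] m[OF 3(2)]])
    finally show ?case using 3 by simp
  next
    case (4 a v)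
    have "(\<Oplus>\<^bsub>N\<^esub>l\<in>{..<n}. \<epsilon> l (a \<odot>\<^bsub>V\<^esub> v) \<odot>\<^bsub>N\<^esub> x l)
        = (\<Oplus>\<^bsub>N\<^esub>l\<in>{..<n}. a \<odot>\<^bsub>N\<^esub> (\<epsilon> l v \<odot>\<^bsub>N\<^esub> x l))"
      using 4 d(2-4) x by (intro N.finsum_cong') (auto simp: linear_maps_smult[OF d(3)] N.smult_assoc1)
    also have "\<dots> = a \<odot>\<^bsub>N\<^esub> (\<Oplus>\<^bsub>N\<^esub>l\<in>{..<n}. \<epsilon> l v \<odot>\<^bsub>N\<^esub> x l)"
      by (rule N.finsum_smult_ldistr[OF _ 4(1) m[OF 4(2)], symmetric]) simp
    finally show ?case using 4 by simp
  qed auto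
qed

lemma dual_basis_zero:
  assumes "module R V" "carrier V = {\<zero>\<^bsub>V\<^esub>}"
  shows "dual_basis R V 0 e \<epsilon>"
proof -
  interpret V: module R V by fact
  show ?thesis using assms by (auto simp: dual_basis_def)
qed

lemma linear_maps_restrict_app:
  assumes "module R M" "x \<in> carrier M"
  shows "(\<lambda>\<phi>\<in>carrier (dual R M). \<phi> x) \<in> linear_maps R (dual R M) (self_module R)"
proof -
  interpret D: module R "dual R M" by (rule module_dual[OF assms(1)])
  show ?thesis
  proof (rule linear_mapsI, goal_cases)
    case (3 \<phi> \<psi>)
    have "\<phi> \<oplus>\<^bsub>dual R M\<^esub> \<psi> \<in> carrier (dual R M)" using 3 by (rule D.a_closed)
    then show ?case using 3 assms by simp
  next
    case (4 a \<phi>)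
    then have "a \<odot>\<^bsub>dual R M\<^esub> \<phi> \<in> carrier (dual R M)" by (rule D.smult_closed)
    then show ?case using 4 assms by simp
  next
    case (1 \<phi>)
    then show ?case using linear_maps_closed[of \<phi> R M "self_module R" x] assms(2) by simp
  qed simp
qed

lemma finsum_dual:
  assumes M: "module R M" and "finite A" "\<And>i. i \<in> A \<Longrightarrow> g i \<in> carrier (dual R M)" "x \<in> carrier M"
  shows "finsum (dual R M) g A x = (\<Oplus>\<^bsub>R\<^esub>i\<in>A. g i x)"
proof -
  interpret M: module R M by fact
  interpret D: module R "dual R M" by (rule module_dual[OF M])
  have c: "finsum (dual R M) g A \<in> carrier (dual R M)" using assms(3) by (intro D.finsum_closed) auto
  have "(\<lambda>\<phi>\<in>carrier (dual R M). \<phi> x) (finsum (dual R M) g A)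
      = (\<Oplus>\<^bsub>self_module R\<^esub>i\<in>A. (\<lambda>\<phi>\<in>carrier (dual R M). \<phi> x) (g i))"
    using assms by (intro linear_maps_finsum[OF D.module_axioms module_self_module linear_maps_restrict_app])
      (auto simp: M.is_cring)
  also have "\<dots> = (\<Oplus>\<^bsub>self_module R\<^esub>i\<in>A. g i x)"
  proof -
    interpret S: module R "self_module R" by (rule module_self_module[OF M.is_cring])
    show ?thesis using assms(3,4) linear_maps_closed[of _ R M "self_module R" x]
      by (intro S.finsum_cong') auto
  qed
  also have "\<dots> = (\<Oplus>\<^bsub>R\<^esub>i\<in>A. g i x)"
    by (simp add: finsum_def finprod_def self_module_def)
  finally show ?thesis using c by simp
qed

text \<open>Expanding \<open>v\<close> in the argument of \<open>\<phi> v\<close> gives \<open>\<phi> v = \<Sum> \<epsilon> l v * \<phi> (e l)\<close>, which expands \<open>\<phi>\<close> in the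
  functionals \<open>\<epsilon> l\<close>. Hence finitely generated projective modules are reflexive.\<close>

lemma dual_basis_dual:
  assumes b: "dual_basis R V n e \<epsilon>"
  shows "dual_basis R (dual R V) n \<epsilon> (\<lambda>l. \<lambda>\<phi>\<in>carrier (dual R V). \<phi> (e l))"
proof -
  note d = dual_basisD[OF b]
  interpret V: module R V by (rule d)
  interpret D: module R "dual R V" by (rule module_dual[OF d(1)])
  interpret S: module R "self_module R" by (rule module_self_module[OF V.is_cring])
  have "\<phi> = (\<Oplus>\<^bsub>dual R V\<^esub>l\<in>{..<n}. (\<lambda>\<phi>\<in>carrier (dual R V). \<phi> (e l)) \<phi> \<odot>\<^bsub>dual R V\<^esub> \<epsilon> l)" (is "\<phi> = ?s")
    if \<phi>: "\<phi> \<in> carrier (dual R V)" for \<phi>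
  proof (rule linear_maps_eqI)
    have ec: "\<phi> (e l) \<in> carrier R" if "l < n" for l
      using linear_maps_closed[of \<phi> R V "self_module R" "e l"] \<phi> d(2)[OF that] by simp
    have m: "(\<lambda>\<phi>\<in>carrier (dual R V). \<phi> (e l)) \<phi> \<odot>\<^bsub>dual R V\<^esub> \<epsilon> l \<in> carrier (dual R V)"
      if "l \<in> {..<n}" for l
      using that ec d(3) \<phi> by (intro D.smult_closed) auto
    then show "?s \<in> linear_maps R V (self_module R)"
      using D.finsum_closed[of _ "{..<n}"] by (simp add: Pi_def del: dual_simps(4))
    fix v assume v: "v \<in> carrier V"
    have "?s v = (\<Oplus>\<^bsub>R\<^esub>l\<in>{..<n}. ((\<lambda>\<phi>\<in>carrier (dual R V). \<phi> (e l)) \<phi> \<odot>\<^bsub>dual R V\<^esub> \<epsilon> l) v)"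
      by (rule finsum_dual[OF d(1) _ m v]) auto
    also have "\<dots> = (\<Oplus>\<^bsub>R\<^esub>l\<in>{..<n}. \<epsilon> l v \<otimes>\<^bsub>R\<^esub> \<phi> (e l))"
      using v \<phi> ec d(4) by (intro V.R.finsum_cong') (auto simp: V.R.m_comm)
    also have "\<dots> = (\<Oplus>\<^bsub>self_module R\<^esub>l\<in>{..<n}. \<epsilon> l v \<odot>\<^bsub>self_module R\<^esub> \<phi> (e l))"
      by (simp add: finsum_def finprod_def self_module_def)
    also have "\<dots> = \<phi> v"
      by (rule dual_basis_expand[OF b S.module_axioms _ v, symmetric]) (use \<phi> in simp)
    finally show "\<phi> v = ?s v" by simp
  qed (use \<phi> in simp)
  then show ?thesis
    using D.module_axioms d linear_maps_restrict_app[OF d(1)] by (simp add: dual_basis_def)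
qed

text \<open>The images of the standard basis vectors under the projection from the free module, with the
  coordinates of the section as functionals.\<close>

lemma fg_projective_dual_basis:
  assumes "fg_projective R P"
  shows "\<exists>n e \<epsilon>. dual_basis R P n e \<epsilon>"
proof -
  obtain n s p where P: "module R P" and s: "s \<in> linear_maps R P (free_module R n)"
    and p: "p \<in> linear_maps R (free_module R n) P" and ps: "\<And>x. x \<in> carrier P \<Longrightarrow> p (s x) = x"
    using assms by (auto simp: fg_projective_def)
  interpret P: module R P by fact
  let ?F = "free_module R n"
  have simps: "carrier ?F = {..<n} \<rightarrow>\<^sub>E carrier R" "\<zero>\<^bsub>?F\<^esub> = (\<lambda>i\<in>{..<n}. \<zero>\<^bsub>R\<^esub>)"
    "add ?F = (\<lambda>x y. \<lambda>i\<in>{..<n}. x i \<oplus>\<^bsub>R\<^esub> y i)" "smult ?F = (\<lambda>a x. \<lambda>i\<in>{..<n}. a \<otimes>\<^bsub>R\<^esub> x i)"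
    by (simp_all add: free_module_def)
  interpret F: module R ?F
    by (rule pointwise_module[where I = "{..<n}" and N = "\<lambda>_. self_module R"])
      (auto simp: P.is_cring module_self_module simps PiE_iff)
  define \<delta> where "\<delta> l = (\<lambda>i\<in>{..<n}. if i = l then \<one>\<^bsub>R\<^esub> else \<zero>\<^bsub>R\<^esub>)" for l
  have \<delta>: "\<delta> l \<in> carrier ?F" for l by (auto simp: simps \<delta>_def)
  have sc: "s x l \<in> carrier R" if "x \<in> carrier P" "l < n" for x l
    using linear_maps_closed[OF s that(1)] that(2) by (auto simp: simps)
  define \<epsilon> where "\<epsilon> l = (\<lambda>x\<in>carrier P. s x l)" for l
  have \<epsilon>: "\<epsilon> l \<in> linear_maps R P (self_module R)" if "l < n" for l
    using that sc linear_maps_add[OF s] linear_maps_smult[OF s]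
    by (intro linear_mapsI) (auto simp: \<epsilon>_def simps)
  have eval: "finsum ?F g A i = (\<Oplus>\<^bsub>R\<^esub>l\<in>A. g l i)"
    if "finite A" "g \<in> A \<rightarrow> carrier ?F" "i < n" for g i and A :: "nat set"
    using that(1,2)
  proof (induction A rule: finite_induct)
    case (insert l A)
    have "(\<lambda>l. g l i) \<in> insert l A \<rightarrow> carrier R" using insert.prems that(3) by (auto simp: simps)
    then show ?case using insert that(3) by (simp add: Pi_def simps(3))
  qed (use that(3) in \<open>simp add: simps\<close>)
  have dec: "x = (\<Oplus>\<^bsub>?F\<^esub>l\<in>{..<n}. x l \<odot>\<^bsub>?F\<^esub> \<delta> l)" if x: "x \<in> carrier ?F" for x
  proof -
    have xl: "x l \<in> carrier R" if "l < n" for l using x that by (auto simp: simps)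
    have m: "(\<lambda>l. x l \<odot>\<^bsub>?F\<^esub> \<delta> l) \<in> {..<n} \<rightarrow> carrier ?F" using xl \<delta> by auto
    show ?thesis
    proof (rule PiE_ext)
      show "x \<in> {..<n} \<rightarrow>\<^sub>E carrier R" using x by (simp add: simps)
      show "(\<Oplus>\<^bsub>?F\<^esub>l\<in>{..<n}. x l \<odot>\<^bsub>?F\<^esub> \<delta> l) \<in> {..<n} \<rightarrow>\<^sub>E carrier R"
        using F.finsum_closed[OF m] by (simp add: simps)
      fix i assume i: "i \<in> {..<n}"
      have "(\<Oplus>\<^bsub>?F\<^esub>l\<in>{..<n}. x l \<odot>\<^bsub>?F\<^esub> \<delta> l) i = (\<Oplus>\<^bsub>R\<^esub>l\<in>{..<n}. (x l \<odot>\<^bsub>?F\<^esub> \<delta> l) i)"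
        using i m by (intro eval) auto
      also have "\<dots> = (\<Oplus>\<^bsub>R\<^esub>l\<in>{..<n}. if i = l then x l else \<zero>\<^bsub>R\<^esub>)"
        using i xl by (intro P.R.finsum_cong') (auto simp: simps \<delta>_def)
      also have "\<dots> = x i" using i xl by (intro P.R.finsum_singleton) auto
      finally show "x i = (\<Oplus>\<^bsub>?F\<^esub>l\<in>{..<n}. x l \<odot>\<^bsub>?F\<^esub> \<delta> l) i" by simp
    qed
  qed
  have "x = (\<Oplus>\<^bsub>P\<^esub>l\<in>{..<n}. \<epsilon> l x \<odot>\<^bsub>P\<^esub> p (\<delta> l))" if x: "x \<in> carrier P" for x
  proof -
    have m: "(\<lambda>l. s x l \<odot>\<^bsub>?F\<^esub> \<delta> l) \<in> {..<n} \<rightarrow> carrier ?F" using sc[OF x] \<delta> by auto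
    have "x = p (\<Oplus>\<^bsub>?F\<^esub>l\<in>{..<n}. s x l \<odot>\<^bsub>?F\<^esub> \<delta> l)"
      using dec[OF linear_maps_closed[OF s x]] ps[OF x] by simp
    also have "\<dots> = (\<Oplus>\<^bsub>P\<^esub>l\<in>{..<n}. p (s x l \<odot>\<^bsub>?F\<^esub> \<delta> l))"
      by (rule linear_maps_finsum[OF F.module_axioms P p _ m]) simp
    also have "\<dots> = (\<Oplus>\<^bsub>P\<^esub>l\<in>{..<n}. \<epsilon> l x \<odot>\<^bsub>P\<^esub> p (\<delta> l))"
      using x sc \<delta> linear_maps_closed[OF p]
      by (intro P.finsum_cong') (auto simp: \<epsilon>_def linear_maps_smult[OF p])
    finally show ?thesis .
  qed
  then have "dual_basis R P n (\<lambda>l. p (\<delta> l)) \<epsilon>"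
    using P \<epsilon> linear_maps_closed[OF p \<delta>] by (auto simp: dual_basis_def)
  then show ?thesis by blast
qed

text \<open>A perfect pairing of finitely generated projective modules. Stating duality through
  pairings makes the roles of a module and its dual interchangeable.\<close>

definition dual_pair ::
  "('k, 'r) ring_scheme \<Rightarrow> ('k, 'u) module \<Rightarrow> ('k, 'v) module \<Rightarrow> ('u \<Rightarrow> 'v \<Rightarrow> 'k) \<Rightarrow> bool" where
  "dual_pair R V V' \<beta> \<longleftrightarrow>
     (\<forall>v\<in>carrier V. (\<lambda>w\<in>carrier V'. \<beta> v w) \<in> linear_maps R V' (self_module R)) \<and>
     (\<forall>w\<in>carrier V'. (\<lambda>v\<in>carrier V. \<beta> v w) \<in> linear_maps R V (self_module R)) \<and>
     (\<exists>n e e'. dual_basis R V n e (\<lambda>l. \<lambda>v\<in>carrier V. \<beta> v (e' l)) \<and>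
               dual_basis R V' n e' (\<lambda>l. \<lambda>w\<in>carrier V'. \<beta> (e l) w))"

lemma dual_pair_flip: "dual_pair R V V' \<beta> \<Longrightarrow> dual_pair R V' V (\<lambda>w v. \<beta> v w)"
  unfolding dual_pair_def by blast

lemma dual_pair_dual:
  assumes "fg_projective R V"
  shows "dual_pair R V (dual R V) (\<lambda>v \<phi>. \<phi> v)"
proof -
  obtain n e \<epsilon> where b: "dual_basis R V n e \<epsilon>" using fg_projective_dual_basis[OF assms] by blast
  have "restrict (\<epsilon> l) (carrier V) = \<epsilon> l" if "l < n" for l
    using dual_basisD(3)[OF b that] by (rule restrict_linear_maps_eq)
  then have b': "dual_basis R V n e (\<lambda>l. \<lambda>v\<in>carrier V. \<epsilon> l v)"
    using b unfolding dual_basis_def by auto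
  show ?thesis
    unfolding dual_pair_def using b' dual_basis_dual[OF b] linear_maps_restrict_app[OF dual_basisD(1)[OF b]]
    by (auto simp: restrict_linear_maps_eq)
qed

lemma dual_pairD:
  assumes "dual_pair R V V' \<beta>"
  shows "module R V" "module R V'"
    and "\<lbrakk>v \<in> carrier V; w \<in> carrier V'\<rbrakk> \<Longrightarrow> \<beta> v w \<in> carrier R"
    and "\<lbrakk>v \<in> carrier V; w \<in> carrier V'; w' \<in> carrier V'\<rbrakk>
      \<Longrightarrow> \<beta> v (w \<oplus>\<^bsub>V'\<^esub> w') = \<beta> v w \<oplus>\<^bsub>R\<^esub> \<beta> v w'"
    and "\<lbrakk>v \<in> carrier V; v' \<in> carrier V; w \<in> carrier V'\<rbrakk>
      \<Longrightarrow> \<beta> (v \<oplus>\<^bsub>V\<^esub> v') w = \<beta> v w \<oplus>\<^bsub>R\<^esub> \<beta> v' w"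
    and "\<lbrakk>a \<in> carrier R; v \<in> carrier V; w \<in> carrier V'\<rbrakk> \<Longrightarrow> \<beta> v (a \<odot>\<^bsub>V'\<^esub> w) = a \<otimes>\<^bsub>R\<^esub> \<beta> v w"
    and "\<lbrakk>a \<in> carrier R; v \<in> carrier V; w \<in> carrier V'\<rbrakk> \<Longrightarrow> \<beta> (a \<odot>\<^bsub>V\<^esub> v) w = a \<otimes>\<^bsub>R\<^esub> \<beta> v w"
proof -
  show m: "module R V" "module R V'" using assms by (auto simp: dual_pair_def dual_basis_def)
  interpret V: module R V by fact
  interpret V': module R V' by fact
  have l: "(\<lambda>w\<in>carrier V'. \<beta> v w) \<in> linear_maps R V' (self_module R)" if "v \<in> carrier V" for v
    using assms that by (auto simp: dual_pair_def)
  have r: "(\<lambda>v\<in>carrier V. \<beta> v w) \<in> linear_maps R V (self_module R)" if "w \<in> carrier V'" for w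
    using assms that by (auto simp: dual_pair_def)
  show "\<lbrakk>v \<in> carrier V; w \<in> carrier V'\<rbrakk> \<Longrightarrow> \<beta> v w \<in> carrier R"
    using linear_maps_closed[OF l, of v w] by simp
  show "\<lbrakk>v \<in> carrier V; w \<in> carrier V'; w' \<in> carrier V'\<rbrakk>
      \<Longrightarrow> \<beta> v (w \<oplus>\<^bsub>V'\<^esub> w') = \<beta> v w \<oplus>\<^bsub>R\<^esub> \<beta> v w'"
    using linear_maps_add[OF l, of v w w'] by simp
  show "\<lbrakk>v \<in> carrier V; v' \<in> carrier V; w \<in> carrier V'\<rbrakk>
      \<Longrightarrow> \<beta> (v \<oplus>\<^bsub>V\<^esub> v') w = \<beta> v w \<oplus>\<^bsub>R\<^esub> \<beta> v' w"
    using linear_maps_add[OF r, of w v v'] by simp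
  show "\<lbrakk>a \<in> carrier R; v \<in> carrier V; w \<in> carrier V'\<rbrakk> \<Longrightarrow> \<beta> v (a \<odot>\<^bsub>V'\<^esub> w) = a \<otimes>\<^bsub>R\<^esub> \<beta> v w"
    using linear_maps_smult[OF l, of v a w] by simp
  show "\<lbrakk>a \<in> carrier R; v \<in> carrier V; w \<in> carrier V'\<rbrakk> \<Longrightarrow> \<beta> (a \<odot>\<^bsub>V\<^esub> v) w = a \<otimes>\<^bsub>R\<^esub> \<beta> v w"
    using linear_maps_smult[OF r, of w a v] by simp
qed


section \<open>Linear categories and duality\<close>

context linear_category
begin

lemma comp_linear_post:
  assumes o: "a \<in> Obj C" "b \<in> Obj C" "c \<in> Obj C" and h: "h \<in> arr C b c"
    and u: "u \<in> linear_maps R V (Hom C a b)" and V: "module R V"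
  shows "(\<lambda>w\<in>carrier V. Comp C a b c h (u w)) \<in> linear_maps R V (Hom C a c)"
proof -
  interpret V: module R V by fact
  show ?thesis
    using linear_maps_closed[OF u]
    by (intro linear_mapsI)
      (auto simp: linear_maps_add[OF u] linear_maps_smult[OF u] comp_arr[OF o _ h]
        comp_add_right[OF o _ _ h] comp_smult_right[OF o _ _ h])
qed

lemma comp_linear_pre:
  assumes o: "a \<in> Obj C" "b \<in> Obj C" "c \<in> Obj C" and h: "h \<in> arr C a b"
    and u: "u \<in> linear_maps R V (Hom C b c)" and V: "module R V"
  shows "(\<lambda>w\<in>carrier V. Comp C a b c (u w) h) \<in> linear_maps R V (Hom C a c)"
proof -
  interpret V: module R V by fact
  show ?thesis
    using linear_maps_closed[OF u]
    by (intro linear_mapsI)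
      (auto simp: linear_maps_add[OF u] linear_maps_smult[OF u] comp_arr[OF o h]
        comp_add_left[OF o h] comp_smult_left[OF o _ h])
qed

lemma identity_linear:
  assumes "module R V" shows "(\<lambda>w\<in>carrier V. w) \<in> linear_maps R V V"
proof -
  interpret V: module R V by fact
  show ?thesis by (rule linear_mapsI) auto
qed

lemma post_linear:
  assumes o: "a \<in> Obj C" "b \<in> Obj C" "c \<in> Obj C" and h: "h \<in> arr C b c"
  shows "(\<lambda>w\<in>arr C a b. Comp C a b c h w) \<in> linear_maps R (Hom C a b) (Hom C a c)"
  using comp_linear_post[OF o h identity_linear[OF hom_module[OF o(1,2)]] hom_module[OF o(1,2)]]
  by (simp cong: restrict_cong)

lemma pre_linear:
  assumes o: "a \<in> Obj C" "b \<in> Obj C" "c \<in> Obj C" and h: "h \<in> arr C a b"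
  shows "(\<lambda>w\<in>arr C b c. Comp C a b c w h) \<in> linear_maps R (Hom C b c) (Hom C a c)"
  using comp_linear_pre[OF o h identity_linear[OF hom_module[OF o(2,3)]] hom_module[OF o(2,3)]]
  by (simp cong: restrict_cong)

lemma zero_arr [simp]: "\<lbrakk>a \<in> Obj C; b \<in> Obj C\<rbrakk> \<Longrightarrow> \<zero>\<^bsub>Hom C a b\<^esub> \<in> arr C a b"
  using abelian_monoid.zero_closed[OF abelian_group.axioms(1)[OF module.axioms(2)[OF hom_module]]] .

lemma add_arr:
  "\<lbrakk>a \<in> Obj C; b \<in> Obj C; f \<in> arr C a b; g \<in> arr C a b\<rbrakk> \<Longrightarrow> f \<oplus>\<^bsub>Hom C a b\<^esub> g \<in> arr C a b"
  using abelian_monoid.a_closed[OF abelian_group.axioms(1)[OF module.axioms(2)[OF hom_module]]] .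

lemma smult_arr:
  "\<lbrakk>a \<in> Obj C; b \<in> Obj C; r \<in> carrier R; f \<in> arr C a b\<rbrakk> \<Longrightarrow> r \<odot>\<^bsub>Hom C a b\<^esub> f \<in> arr C a b"
  using module.smult_closed[OF hom_module] .

lemma comp_zero_right:
  assumes o: "a \<in> Obj C" "b \<in> Obj C" "c \<in> Obj C" and h: "h \<in> arr C b c"
  shows "Comp C a b c h \<zero>\<^bsub>Hom C a b\<^esub> = \<zero>\<^bsub>Hom C a c\<^esub>"
  using linear_maps_zero[OF hom_module[OF o(1,2)] hom_module[OF o(1,3)] post_linear[OF o h]] o
  by simp

lemma comp_zero_left:
  assumes o: "a \<in> Obj C" "b \<in> Obj C" "c \<in> Obj C" and h: "h \<in> arr C a b"
  shows "Comp C a b c \<zero>\<^bsub>Hom C b c\<^esub> h = \<zero>\<^bsub>Hom C a c\<^esub>"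
  using linear_maps_zero[OF hom_module[OF o(2,3)] hom_module[OF o(1,3)] pre_linear[OF o h]] o
  by simp

lemma comp_finsum_right:
  assumes o: "a \<in> Obj C" "b \<in> Obj C" "c \<in> Obj C" and h: "h \<in> arr C b c"
    and A: "finite A" "\<And>i. i \<in> A \<Longrightarrow> f i \<in> arr C a b"
  shows "Comp C a b c h (finsum (Hom C a b) f A) = (\<Oplus>\<^bsub>Hom C a c\<^esub>i\<in>A. Comp C a b c h (f i))"
proof -
  interpret ab: module R "Hom C a b" by (rule hom_module[OF o(1,2)])
  interpret ac: module R "Hom C a c" by (rule hom_module[OF o(1,3)])
  have m: "f \<in> A \<rightarrow> arr C a b" using A by auto
  have "(\<Oplus>\<^bsub>Hom C a c\<^esub>i\<in>A. (\<lambda>w\<in>arr C a b. Comp C a b c h w) (f i))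
      = (\<Oplus>\<^bsub>Hom C a c\<^esub>i\<in>A. Comp C a b c h (f i))"
    using A o h by (intro ac.finsum_cong') (auto simp: comp_arr)
  then show ?thesis
    using linear_maps_finsum[OF ab.module_axioms ac.module_axioms post_linear[OF o h] A(1) m]
      ab.finsum_closed[OF m] by simp
qed

lemma comp_finsum_left:
  assumes o: "a \<in> Obj C" "b \<in> Obj C" "c \<in> Obj C" and h: "h \<in> arr C a b"
    and A: "finite A" "\<And>i. i \<in> A \<Longrightarrow> f i \<in> arr C b c"
  shows "Comp C a b c (finsum (Hom C b c) f A) h = (\<Oplus>\<^bsub>Hom C a c\<^esub>i\<in>A. Comp C a b c (f i) h)"
proof -
  interpret bc: module R "Hom C b c" by (rule hom_module[OF o(2,3)])
  interpret ac: module R "Hom C a c" by (rule hom_module[OF o(1,3)])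
  have m: "f \<in> A \<rightarrow> arr C b c" using A by auto
  have "(\<Oplus>\<^bsub>Hom C a c\<^esub>i\<in>A. (\<lambda>w\<in>arr C b c. Comp C a b c w h) (f i))
      = (\<Oplus>\<^bsub>Hom C a c\<^esub>i\<in>A. Comp C a b c (f i) h)"
    using A o h by (intro ac.finsum_cong') (auto simp: comp_arr)
  then show ?thesis
    using linear_maps_finsum[OF bc.module_axioms ac.module_axioms pre_linear[OF o h] A(1) m]
      bc.finsum_closed[OF m] by simp
qed

end

lemma op_cat_simps [simp]:
  "Obj (op_cat C) = Obj C" "Hom (op_cat C) a b = Hom C b a"
  "Comp (op_cat C) a b c g f = Comp C c b a f g" "Ident (op_cat C) a = Ident C a"
  by (simp_all add: op_cat_def)

lemma op_cat_op_cat [simp]: "op_cat (op_cat C) = C"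
  by (cases C) (simp add: op_cat_def)

lemma (in linear_category) linear_category_op_cat: "linear_category R (op_cat C)"
  by (intro linear_category.intro linear_category_axioms.intro is_cring;
      simp add: hom_module ident_arr comp_arr comp_ident_left comp_ident_right comp_assoc
        comp_add_left comp_add_right comp_smult_left comp_smult_right)

text \<open>The opposite of a functor category is a functor category only up to renaming objects, so
  duality arguments are run along anti-isomorphisms.\<close>

definition anti_iso ::
  "('o, 'm, 'k) lincat \<Rightarrow> ('p, 'm, 'k) lincat \<Rightarrow> ('o \<Rightarrow> 'p) \<Rightarrow> bool" where
  "anti_iso A A' \<sigma> \<longleftrightarrow> Obj A' = \<sigma> ` Obj A \<and>
     (\<forall>X\<in>Obj A. \<forall>Y\<in>Obj A. Hom A' (\<sigma> X) (\<sigma> Y) = Hom A Y X) \<and>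
     (\<forall>X\<in>Obj A. \<forall>Y\<in>Obj A. \<forall>Z\<in>Obj A. \<forall>g f.
        Comp A' (\<sigma> X) (\<sigma> Y) (\<sigma> Z) g f = Comp A Z Y X f g) \<and>
     (\<forall>X\<in>Obj A. Ident A' (\<sigma> X) = Ident A X)"

lemma anti_iso_op_cat: "anti_iso A (op_cat A) id"
  by (simp add: anti_iso_def)

lemma anti_iso_ObjE:
  assumes "anti_iso A A' \<sigma>" "X \<in> Obj A'"
  obtains Y where "Y \<in> Obj A" "X = \<sigma> Y"
  using assms by (auto simp: anti_iso_def)

lemma anti_iso_kernel:
  assumes "anti_iso A A' \<sigma>" "a \<in> Obj A" "b \<in> Obj A" "u \<in> Obj A"
  shows "is_kernel A' (\<sigma> a) (\<sigma> b) f (\<sigma> u) j \<longleftrightarrow> is_cokernel A b a f u j"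
  using assms unfolding is_kernel_def is_cokernel_def anti_iso_def by auto

lemma anti_iso_cokernel:
  assumes "anti_iso A A' \<sigma>" "a \<in> Obj A" "b \<in> Obj A" "u \<in> Obj A"
  shows "is_cokernel A' (\<sigma> a) (\<sigma> b) f (\<sigma> u) j \<longleftrightarrow> is_kernel A b a f u j"
  using assms unfolding is_kernel_def is_cokernel_def anti_iso_def by auto

lemma anti_iso_mono:
  assumes "anti_iso A A' \<sigma>" "a \<in> Obj A" "b \<in> Obj A"
  shows "mono A' (\<sigma> a) (\<sigma> b) f \<longleftrightarrow> epi A b a f"
  using assms unfolding mono_def epi_def anti_iso_def by auto

lemma anti_iso_epi:
  assumes "anti_iso A A' \<sigma>" "a \<in> Obj A" "b \<in> Obj A"
  shows "epi A' (\<sigma> a) (\<sigma> b) f \<longleftrightarrow> mono A b a f"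
  using assms unfolding mono_def epi_def anti_iso_def by auto

lemma (in abelian_category) abelian_category_op_cat: "abelian_category R (op_cat C)"
proof -
  note ai = anti_iso_op_cat[of C]
  note tr = anti_iso_kernel[OF ai, unfolded id_apply] anti_iso_cokernel[OF ai, unfolded id_apply]
    anti_iso_mono[OF ai, unfolded id_apply] anti_iso_epi[OF ai, unfolded id_apply]
  show ?thesis
  proof (intro abelian_category.intro additive_category.intro linear_category_op_cat
      additive_category_axioms.intro abelian_category_axioms.intro, goal_cases)
    case 1
    obtain z where "zero_object C z" using ex_zero_object by (elim exE)
    then have "zero_object (op_cat C) z" by (simp add: zero_object_def)
    then show ?case by (rule exI)
  next
    case (2 a b)
    then obtain s i1 i2 p1 p2 where "is_biproduct C a b s i1 i2 p1 p2" using ex_biproduct[of a b] by auto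
    then have "is_biproduct (op_cat C) a b s p1 p2 i1 i2" by (simp add: is_biproduct_def)
    then show ?case by blast
  next
    case (3 a b f)
    then obtain u j where "is_cokernel C b a f u j" using ex_cokernel[of b a f] by auto
    with 3 show ?case using tr(1)[of a b u] by (auto simp: is_cokernel_def)
  next
    case (4 a b f)
    then obtain u j where "is_kernel C b a f u j" using ex_kernel[of b a f] by auto
    with 4 show ?case using tr(2)[of a b u] by (auto simp: is_kernel_def)
  next
    case (5 a b f)
    then have "epi C b a f" using tr(3)[of a b f] by simp
    from epi_is_cokernel[OF _ _ this] 5 obtain c g where "c \<in> Obj C" "is_cokernel C c b g a f" by auto
    with 5 show ?case using tr(1)[of b c a g f] by auto
  next
    case (6 a b f)
    then have "mono C b a f" using tr(4)[of a b f] by simp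
    from mono_is_kernel[OF _ _ this] 6 obtain c g where "c \<in> Obj C" "is_kernel C a c g b f" by auto
    with 6 show ?case using tr(2)[of c a b g f] by auto
  qed
qed

text \<open>If \<open>f\<close> is the kernel of \<open>g\<close>, then \<open>g\<close> factors through the cokernel \<open>p\<close> of \<open>f\<close>, so whatever \<open>p\<close>
  annihilates is annihilated by \<open>g\<close> and factors through \<open>f\<close>.\<close>

lemma (in abelian_category) mono_kernel_of_cokernel:
  assumes o: "a \<in> Obj C" "b \<in> Obj C" and f: "mono C a b f" and p: "is_cokernel C a b f q p"
  shows "is_kernel C b q p a f"
proof -
  obtain c g where c: "c \<in> Obj C" and g: "is_kernel C b c g a f"
    using mono_is_kernel[OF o f] by blast
  have q: "q \<in> Obj C" "p \<in> arr C b q" "Comp C a b q p f = \<zero>\<^bsub>Hom C a q\<^esub>"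
    using p by (auto simp: is_cokernel_def)
  have ga: "g \<in> arr C b c" "f \<in> arr C a b" "Comp C a b c g f = \<zero>\<^bsub>Hom C a c\<^esub>"
    using g by (auto simp: is_kernel_def)
  obtain h where h: "h \<in> arr C q c" "Comp C b q c h p = g"
    using p ga c unfolding is_cokernel_def by blast
  have "\<exists>!k. k \<in> arr C x a \<and> Comp C x a b f k = y"
    if x: "x \<in> Obj C" "y \<in> arr C x b" "Comp C x b q p y = \<zero>\<^bsub>Hom C x q\<^esub>" for x y
  proof -
    have "Comp C x b c g y = Comp C x q c h (Comp C x b q p y)"
      using h(2) comp_assoc[OF x(1) o(2) q(1) c x(2) q(2) h(1)] by simp
    also have "\<dots> = \<zero>\<^bsub>Hom C x c\<^esub>" using x q c h comp_zero_right by simp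
    finally show ?thesis using g x unfolding is_kernel_def by blast
  qed
  then show ?thesis using o q ga unfolding is_kernel_def by blast
qed


section \<open>Finite coproducts and coequalizers\<close>

lemma ex1_unique: "\<exists>!x. P x \<Longrightarrow> P a \<Longrightarrow> P b \<Longrightarrow> a = b"
  by blast

lemma ex1_conj_cong:
  assumes "\<exists>!h. A h \<and> Q h" "\<And>h. A h \<Longrightarrow> P h \<longleftrightarrow> Q h"
  shows "\<exists>!h. A h \<and> P h"
proof -
  have "(\<lambda>h. A h \<and> P h) = (\<lambda>h. A h \<and> Q h)" using assms(2) by blast
  then show ?thesis using assms(1) by simp
qed

lemma is_coproductD:
  assumes "is_coproduct B I X S j"
  shows "S \<in> Obj B" "i \<in> I \<Longrightarrow> j i \<in> arr B (X i) S"
    and "\<lbrakk>Y \<in> Obj B; \<And>i. i \<in> I \<Longrightarrow> f i \<in> arr B (X i) Y\<rbrakk>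
      \<Longrightarrow> \<exists>!h. h \<in> arr B S Y \<and> (\<forall>i\<in>I. Comp B (X i) S Y h (j i) = f i)"
  using assms unfolding is_coproduct_def by blast+

lemma (in additive_category) biproduct_coproduct:
  assumes bp: "is_biproduct C a b s i1 i2 p1 p2" and o: "a \<in> Obj C" "b \<in> Obj C" "Y \<in> Obj C"
    and f: "f \<in> arr C a Y" and g: "g \<in> arr C b Y"
  shows "\<exists>!h. h \<in> arr C s Y \<and> Comp C a s Y h i1 = f \<and> Comp C b s Y h i2 = g"
proof -
  have s: "s \<in> Obj C" and ar: "i1 \<in> arr C a s" "i2 \<in> arr C b s" "p1 \<in> arr C s a" "p2 \<in> arr C s b"
    and eq: "Comp C a s a p1 i1 = Ident C a" "Comp C b s b p2 i2 = Ident C b"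
      "Comp C b s a p1 i2 = \<zero>\<^bsub>Hom C b a\<^esub>" "Comp C a s b p2 i1 = \<zero>\<^bsub>Hom C a b\<^esub>"
      "Comp C s a s i1 p1 \<oplus>\<^bsub>Hom C s s\<^esub> Comp C s b s i2 p2 = Ident C s"
    using bp by (simp_all add: is_biproduct_def)
  interpret aY: module R "Hom C a Y" by (rule hom_module[OF o(1,3)])
  interpret bY: module R "Hom C b Y" by (rule hom_module[OF o(2,3)])
  let ?h = "Comp C s a Y f p1 \<oplus>\<^bsub>Hom C s Y\<^esub> Comp C s b Y g p2"
  have m: "Comp C s a Y f p1 \<in> arr C s Y" "Comp C s b Y g p2 \<in> arr C s Y"
    using o s ar f g comp_arr by auto
  show ?thesis
  proof (rule ex1I[of _ ?h], intro conjI)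
    show "?h \<in> arr C s Y" using m s o add_arr by simp
    show "Comp C a s Y ?h i1 = f"
      using o s ar f g m eq comp_assoc[OF o(1) s o(1,3) ar(1,3) f, symmetric]
        comp_assoc[OF o(1) s o(2,3) ar(1,4) g, symmetric]
      by (simp add: comp_add_left comp_ident_right comp_zero_right)
    show "Comp C b s Y ?h i2 = g"
      using o s ar f g m eq comp_assoc[OF o(2) s o(1,3) ar(2,3) f, symmetric]
        comp_assoc[OF o(2) s o(2,3) ar(2,4) g, symmetric]
      by (simp add: comp_add_left comp_ident_right comp_zero_right)
  next
    fix h assume h: "h \<in> arr C s Y \<and> Comp C a s Y h i1 = f \<and> Comp C b s Y h i2 = g"
    then have "h = Comp C s s Y h (Comp C s a s i1 p1 \<oplus>\<^bsub>Hom C s s\<^esub> Comp C s b s i2 p2)"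
      using s o eq comp_ident_right by simp
    also have "\<dots> = ?h"
      using h s o ar comp_assoc[OF s o(1) s o(3) ar(3,1)] comp_assoc[OF s o(2) s o(3) ar(4,2)]
      by (simp add: comp_add_right comp_arr)
    finally show "h = ?h" .
  qed
qed

lemma (in additive_category) finite_coproduct:
  assumes "finite I" "\<And>i. i \<in> I \<Longrightarrow> X i \<in> Obj C"
  shows "\<exists>S j. is_coproduct C I X S j"
  using assms
proof (induction I rule: finite_induct)
  case empty
  obtain z where "zero_object C z" using ex_zero_object by blast
  then have "is_coproduct C {} X z j" for j by (auto simp: zero_object_def is_coproduct_def)
  then show ?case by blast
next
  case (insert k I)
  then obtain S j where S: "is_coproduct C I X S j" by auto
  note Sd = is_coproductD[OF S]
  have k: "X k \<in> Obj C" and X: "\<And>i. i \<in> I \<Longrightarrow> X i \<in> Obj C" using insert.prems by auto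
  obtain s i1 i2 p1 p2 where bp: "is_biproduct C S (X k) s i1 i2 p1 p2"
    using ex_biproduct[OF Sd(1) k] by blast
  then have s: "s \<in> Obj C" "i1 \<in> arr C S s" "i2 \<in> arr C (X k) s" by (auto simp: is_biproduct_def)
  let ?j = "\<lambda>i. if i = k then i2 else Comp C (X i) S s i1 (j i)"
  have ja: "?j i \<in> arr C (X i) s" if "i \<in> insert k I" for i
    using that s Sd(1,2) X comp_arr by auto
  have "\<exists>!h. h \<in> arr C s Y \<and> (\<forall>i\<in>insert k I. Comp C (X i) s Y h (?j i) = f i)"
    if Y: "Y \<in> Obj C" and f: "\<forall>i\<in>insert k I. f i \<in> arr C (X i) Y" for Y f
  proof -
    obtain g where g: "g \<in> arr C S Y" "\<And>i. i \<in> I \<Longrightarrow> Comp C (X i) S Y g (j i) = f i"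
      and gu: "\<And>g'. g' \<in> arr C S Y \<Longrightarrow> (\<forall>i\<in>I. Comp C (X i) S Y g' (j i) = f i) \<Longrightarrow> g' = g"
      using Sd(3)[OF Y, of f] f by (metis insertCI)
    have fk: "f k \<in> arr C (X k) Y" using f by simp
    have "(\<forall>i\<in>insert k I. Comp C (X i) s Y h (?j i) = f i)
        \<longleftrightarrow> Comp C S s Y h i1 = g \<and> Comp C (X k) s Y h i2 = f k" if h: "h \<in> arr C s Y" for h
    proof -
      have "Comp C (X i) s Y h (?j i) = Comp C (X i) S Y (Comp C S s Y h i1) (j i)" if "i \<in> I" for i
        using comp_assoc[OF X[OF that] Sd(1) s(1) Y Sd(2)[OF that] s(2) h] that insert.hyps by auto
      then show ?thesis
        using g gu[of "Comp C S s Y h i1"] comp_arr[OF Sd(1) s(1) Y s(2) h] by auto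
    qed
    from ex1_conj_cong[OF biproduct_coproduct[OF bp Sd(1) k Y g(1) fk] this] show ?thesis .
  qed
  then have "is_coproduct C (insert k I) X s ?j" using s ja by (auto simp: is_coproduct_def)
  then show ?case by blast
qed

text \<open>Almost all summands may be initial; this covers the direct sums over all objects of a locally
  bounded category.\<close>

lemma (in additive_category) almost_finite_coproduct:
  assumes J: "finite J" "J \<subseteq> I" and X: "\<And>i. i \<in> I \<Longrightarrow> X i \<in> Obj C"
    and init: "\<And>i Y. \<lbrakk>i \<in> I - J; Y \<in> Obj C\<rbrakk> \<Longrightarrow> \<exists>!f. f \<in> arr C (X i) Y"
  shows "\<exists>S j. is_coproduct C I X S j"
proof -
  obtain S j where S: "is_coproduct C J X S j" using finite_coproduct[OF J(1)] X J(2) by blast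
  note Sd = is_coproductD[OF S]
  define j' where "j' i = (if i \<in> J then j i else (THE f. f \<in> arr C (X i) S))" for i
  have j': "j' i \<in> arr C (X i) S" if "i \<in> I" for i
    using that Sd theI'[OF init, of i S] by (auto simp: j'_def)
  have "\<exists>!h. h \<in> arr C S Y \<and> (\<forall>i\<in>I. Comp C (X i) S Y h (j' i) = f i)"
    if Y: "Y \<in> Obj C" and f: "\<forall>i\<in>I. f i \<in> arr C (X i) Y" for Y f
  proof -
    have iff: "(\<forall>i\<in>I. Comp C (X i) S Y h (j' i) = f i) \<longleftrightarrow> (\<forall>i\<in>J. Comp C (X i) S Y h (j i) = f i)"
      if h: "h \<in> arr C S Y" for h
    proof -
      have "Comp C (X i) S Y h (j' i) = f i" if "i \<in> I - J" for i
        using init[OF that Y] comp_arr[OF X[of i] Sd(1) Y j'[of i] h] f that by auto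
      moreover have "j' i = j i" if "i \<in> J" for i using that by (simp add: j'_def)
      ultimately show ?thesis using J(2) by (metis DiffI subsetD)
    qed
    have "\<exists>!h. h \<in> arr C S Y \<and> (\<forall>i\<in>J. Comp C (X i) S Y h (j i) = f i)"
      using f J(2) by (intro Sd(3)[OF Y]) auto
    from ex1_conj_cong[OF this iff] show ?thesis .
  qed
  then have "is_coproduct C I X S j'" using Sd j' by (auto simp: is_coproduct_def)
  then show ?thesis by blast
qed

lemma (in module) add_minus_eq_zero_iff:
  assumes "x \<in> carrier M" "y \<in> carrier M"
  shows "x \<oplus>\<^bsub>M\<^esub> (\<ominus>\<^bsub>R\<^esub> \<one>\<^bsub>R\<^esub>) \<odot>\<^bsub>M\<^esub> y = \<zero>\<^bsub>M\<^esub> \<longleftrightarrow> x = y"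
proof -
  have "(\<ominus>\<^bsub>R\<^esub> \<one>\<^bsub>R\<^esub>) \<odot>\<^bsub>M\<^esub> y = \<ominus>\<^bsub>M\<^esub> y" using assms by (simp add: smult_l_minus)
  then show ?thesis
    using assms by (metis M.a_inv_closed M.minus_equality M.minus_minus M.r_neg)
qed

definition is_joint_coequalizer ::
  "('o, 'n, 'k) lincat \<Rightarrow> 'i set \<Rightarrow> ('i \<Rightarrow> 'o) \<Rightarrow> ('i \<Rightarrow> 'n) \<Rightarrow> ('i \<Rightarrow> 'n) \<Rightarrow> 'o \<Rightarrow> 'o \<Rightarrow> 'n \<Rightarrow> bool" where
  "is_joint_coequalizer C K a f g b q p \<longleftrightarrow> q \<in> Obj C \<and> p \<in> arr C b q \<and>
    (\<forall>k\<in>K. Comp C (a k) b q p (f k) = Comp C (a k) b q p (g k)) \<and>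
    (\<forall>Y\<in>Obj C. \<forall>y\<in>arr C b Y. (\<forall>k\<in>K. Comp C (a k) b Y y (f k) = Comp C (a k) b Y y (g k))
       \<longrightarrow> (\<exists>!h. h \<in> arr C q Y \<and> Comp C b q Y h p = y))"

lemma is_joint_coequalizerD:
  assumes "is_joint_coequalizer C K a f g b q p"
  shows "q \<in> Obj C" "p \<in> arr C b q"
    and "k \<in> K \<Longrightarrow> Comp C (a k) b q p (f k) = Comp C (a k) b q p (g k)"
    and "\<lbrakk>Y \<in> Obj C; y \<in> arr C b Y;
        \<And>k. k \<in> K \<Longrightarrow> Comp C (a k) b Y y (f k) = Comp C (a k) b Y y (g k)\<rbrakk>
       \<Longrightarrow> \<exists>!h. h \<in> arr C q Y \<and> Comp C b q Y h p = y"
  using assms unfolding is_joint_coequalizer_def by simp_all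

text \<open>The cokernel of the difference of the two arrows.\<close>

lemma (in abelian_category) coequalizer:
  assumes o: "a \<in> Obj C" "b \<in> Obj C" and f: "f \<in> arr C a b" and g: "g \<in> arr C a b"
  shows "\<exists>q p. is_joint_coequalizer C {()} (\<lambda>_. a) (\<lambda>_. f) (\<lambda>_. g) b q p"
proof -
  let ?d = "f \<oplus>\<^bsub>Hom C a b\<^esub> (\<ominus>\<^bsub>R\<^esub> \<one>\<^bsub>R\<^esub>) \<odot>\<^bsub>Hom C a b\<^esub> g"
  have gm: "(\<ominus>\<^bsub>R\<^esub> \<one>\<^bsub>R\<^esub>) \<odot>\<^bsub>Hom C a b\<^esub> g \<in> arr C a b" using o g by (simp add: smult_arr)
  have d: "?d \<in> arr C a b" using o f gm by (simp add: add_arr)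
  have iff: "Comp C a b Y y ?d = \<zero>\<^bsub>Hom C a Y\<^esub> \<longleftrightarrow> Comp C a b Y y f = Comp C a b Y y g"
    if Y: "Y \<in> Obj C" "y \<in> arr C b Y" for Y y
  proof -
    interpret aY: module R "Hom C a Y" by (rule hom_module[OF o(1) Y(1)])
    show ?thesis
      using o Y f g gm aY.add_minus_eq_zero_iff[of "Comp C a b Y y f" "Comp C a b Y y g"]
      by (simp add: comp_add_right comp_smult_right comp_arr)
  qed
  obtain q p where p: "is_cokernel C a b ?d q p" using ex_cokernel[OF o d] by (elim exE)
  have q: "q \<in> Obj C" "p \<in> arr C b q" "Comp C a b q p ?d = \<zero>\<^bsub>Hom C a q\<^esub>"
    using p by (simp_all add: is_cokernel_def)
  have "is_joint_coequalizer C {()} (\<lambda>_. a) (\<lambda>_. f) (\<lambda>_. g) b q p"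
    unfolding is_joint_coequalizer_def
  proof (intro conjI ballI impI q)
    show "Comp C a b q p f = Comp C a b q p g" using q iff by simp
  next
    fix Y y assume Y: "Y \<in> Obj C" "y \<in> arr C b Y"
      and "\<forall>k\<in>{()}. Comp C a b Y y f = Comp C a b Y y g"
    then have "Comp C a b Y y ?d = \<zero>\<^bsub>Hom C a Y\<^esub>" using iff[OF Y] by simp
    then show "\<exists>!h. h \<in> arr C q Y \<and> Comp C b q Y h p = y" using p Y by (simp add: is_cokernel_def)
  qed
  then show ?thesis by (intro exI)
qed

text \<open>A further pair of arrows is coequalized after composition with the coequalizer of the pairs
  before it.\<close>

lemma (in abelian_category) joint_coequalizer:
  assumes "finite K" "b \<in> Obj C"
    and "\<And>k. k \<in> K \<Longrightarrow> a k \<in> Obj C" "\<And>k. k \<in> K \<Longrightarrow> f k \<in> arr C (a k) b"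
    and "\<And>k. k \<in> K \<Longrightarrow> g k \<in> arr C (a k) b"
  shows "\<exists>q p. is_joint_coequalizer C K a f g b q p"
  using assms
proof (induction K rule: finite_induct)
  case empty
  have "\<exists>!h. h \<in> arr C b Y \<and> Comp C b b Y h (Ident C b) = y" if "Y \<in> Obj C" "y \<in> arr C b Y" for Y y
    using that comp_ident_right[OF empty.prems(1)] by (intro ex1I[of _ y]) auto
  then have "is_joint_coequalizer C {} a f g b b (Ident C b)"
    using ident_arr[OF empty.prems(1)] empty.prems(1) by (simp add: is_joint_coequalizer_def)
  then show ?case by (intro exI)
next
  case (insert k K)
  note b = insert.prems(1)
  have k: "a k \<in> Obj C" "f k \<in> arr C (a k) b" "g k \<in> arr C (a k) b" using insert.prems by simp_all
  have "\<exists>q p. is_joint_coequalizer C K a f g b q p"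
    by (rule insert.IH[OF b]) (use insert.prems in simp_all)
  then obtain q p where qp: "is_joint_coequalizer C K a f g b q p" by (elim exE)
  note qd = is_joint_coequalizerD[OF qp]
  note q = qd(1) and p = qd(2)
  note pk = comp_arr[OF k(1) b q k(2) p] comp_arr[OF k(1) b q k(3) p]
  obtain r s where rs: "is_joint_coequalizer C {()} (\<lambda>_. a k) (\<lambda>_. Comp C (a k) b q p (f k))
      (\<lambda>_. Comp C (a k) b q p (g k)) q r s"
    using coequalizer[OF k(1) q pk] by (elim exE)
  note rd = is_joint_coequalizerD[OF rs]
  note r = rd(1) and s = rd(2)
  let ?p = "Comp C b q r s p"
  have sp: "?p \<in> arr C b r" by (rule comp_arr[OF b q r p s])
  have "is_joint_coequalizer C (insert k K) a f g b r ?p"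
    unfolding is_joint_coequalizer_def
  proof (intro conjI ballI impI r sp)
    fix i assume "i \<in> insert k K"
    then have i: "a i \<in> Obj C" "f i \<in> arr C (a i) b" "g i \<in> arr C (a i) b" and
      "Comp C (a i) q r s (Comp C (a i) b q p (f i)) = Comp C (a i) q r s (Comp C (a i) b q p (g i))"
      using insert.prems rd(3) qd(3) by auto
    then show "Comp C (a i) b r ?p (f i) = Comp C (a i) b r ?p (g i)"
      by (simp add: comp_assoc[OF i(1) b q r i(2) p s, symmetric]
          comp_assoc[OF i(1) b q r i(3) p s, symmetric])
  next
    fix Y y assume Y: "Y \<in> Obj C" and y: "y \<in> arr C b Y"
      and e: "\<forall>i\<in>insert k K. Comp C (a i) b Y y (f i) = Comp C (a i) b Y y (g i)"
    have y_ex1: "\<exists>!h. h \<in> arr C q Y \<and> Comp C b q Y h p = y"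
      by (rule qd(4)[OF Y y]) (use e in simp)
    then obtain h where h: "h \<in> arr C q Y" "Comp C b q Y h p = y" by (elim ex1E conjE)
    have "Comp C (a k) q Y h (Comp C (a k) b q p (f k)) = Comp C (a k) q Y h (Comp C (a k) b q p (g k))"
      using e h(2) comp_assoc[OF k(1) b q Y k(2) p h(1)] comp_assoc[OF k(1) b q Y k(3) p h(1)] by simp
    then have h_ex1: "\<exists>!t. t \<in> arr C r Y \<and> Comp C q r Y t s = h" by (rule rd(4)[OF Y h(1)])
    have "Comp C b r Y t ?p = y \<longleftrightarrow> Comp C q r Y t s = h" if t: "t \<in> arr C r Y" for t
    proof -
      have "Comp C b r Y t ?p = Comp C b q Y (Comp C q r Y t s) p"
        by (rule comp_assoc[OF b q r Y p s t])
      moreover have "Comp C q r Y t s \<in> arr C q Y" by (rule comp_arr[OF q r Y s t])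
      ultimately show ?thesis using y_ex1 h by metis
    qed
    from ex1_conj_cong[OF h_ex1 this] show "\<exists>!h. h \<in> arr C r Y \<and> Comp C b r Y h ?p = y" .
  qed
  then show ?case by (intro exI)
qed


section \<open>Weighted colimits\<close>

lemma linear_functorD:
  assumes "is_linear_functor R C D F"
  shows "a \<in> Obj C \<Longrightarrow> FOb F a \<in> Obj D"
    and "\<lbrakk>a \<in> Obj C; b \<in> Obj C; f \<in> arr C a b\<rbrakk> \<Longrightarrow> FArr F a b f \<in> arr D (FOb F a) (FOb F b)"
    and "a \<in> Obj C \<Longrightarrow> FArr F a a (Ident C a) = Ident D (FOb F a)"
    and "\<lbrakk>a \<in> Obj C; b \<in> Obj C; c \<in> Obj C; f \<in> arr C a b; g \<in> arr C b c\<rbrakk>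
      \<Longrightarrow> FArr F a c (Comp C a b c g f)
        = Comp D (FOb F a) (FOb F b) (FOb F c) (FArr F b c g) (FArr F a b f)"
    and "\<lbrakk>a \<in> Obj C; b \<in> Obj C; f \<in> arr C a b; g \<in> arr C a b\<rbrakk>
      \<Longrightarrow> FArr F a b (f \<oplus>\<^bsub>Hom C a b\<^esub> g)
        = FArr F a b f \<oplus>\<^bsub>Hom D (FOb F a) (FOb F b)\<^esub> FArr F a b g"
    and "\<lbrakk>a \<in> Obj C; b \<in> Obj C; r \<in> carrier R; f \<in> arr C a b\<rbrakk>
      \<Longrightarrow> FArr F a b (r \<odot>\<^bsub>Hom C a b\<^esub> f) = r \<odot>\<^bsub>Hom D (FOb F a) (FOb F b)\<^esub> FArr F a b f"
  using assms unfolding is_linear_functor_def is_functor_def by blast+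

lemma nat_transD:
  assumes "\<alpha> \<in> nat_trans C D F G"
  shows "a \<in> Obj C \<Longrightarrow> \<alpha> a \<in> arr D (FOb F a) (FOb G a)"
    and "\<lbrakk>a \<in> Obj C; b \<in> Obj C; f \<in> arr C a b\<rbrakk>
      \<Longrightarrow> Comp D (FOb F a) (FOb F b) (FOb G b) (\<alpha> b) (FArr F a b f)
         = Comp D (FOb F a) (FOb G a) (FOb G b) (FArr G a b f) (\<alpha> a)"
  using assms unfolding nat_trans_def by auto

lemma weighted_coconeD:
  assumes "weighted_cocone R C B W F X u"
  shows "X \<in> Obj B" "c \<in> Obj C \<Longrightarrow> u c \<in> linear_maps R (FOb W c) (Hom B (FOb F c) X)"
    and "\<lbrakk>c \<in> Obj C; w \<in> carrier (FOb W c)\<rbrakk> \<Longrightarrow> u c w \<in> arr B (FOb F c) X"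
    and "\<lbrakk>c \<in> Obj C; d \<in> Obj C; f \<in> arr C c d; w \<in> carrier (FOb W d)\<rbrakk>
      \<Longrightarrow> u c (FArr W d c f w) = Comp B (FOb F c) (FOb F d) X (u d w) (FArr F c d f)"
  using assms linear_maps_closed[of "u c" R "FOb W c" "Hom B (FOb F c) X" w]
  unfolding weighted_cocone_def by auto

lemma is_weighted_colimitD:
  assumes "is_weighted_colimit R C B W F X u"
  shows "weighted_cocone R C B W F X u"
    and "weighted_cocone R C B W F Y v \<Longrightarrow> \<exists>!h. h \<in> arr B X Y \<and>
          (\<forall>c\<in>Obj C. \<forall>w\<in>carrier (FOb W c). v c w = Comp B (FOb F c) X Y h (u c w))"
  using assms by (simp_all add: is_weighted_colimit_def)

lemma tensor_is_weighted_colimit: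
  assumes "\<exists>X u. is_weighted_colimit R C B W F X u"
  shows "is_weighted_colimit R C B W F (tensor_ob R C B W F) (tensor_in R C B W F)"
proof -
  obtain X u where "is_weighted_colimit R C B W F X u" using assms by (elim exE)
  then have "case (X, u) of (X, u) \<Rightarrow> is_weighted_colimit R C B W F X u" by simp
  then have "case tensor R C B W F of (X, u) \<Rightarrow> is_weighted_colimit R C B W F X u"
    unfolding tensor_def by (rule someI)
  then show ?thesis by (simp add: tensor_ob_def tensor_in_def split_beta)
qed

text \<open>Right modules are described elementwise here, because as functors into \<open>mod_cat\<close> they would
  require equations between functions restricted to carriers.\<close>

locale right_module = C: linear_category R C
  for R :: "('k, 'r) ring_scheme" (structure) and C :: "('c, 'm, 'k) lincat" +
  fixes W :: "('c, 'm, ('k, 'v) module, 'v \<Rightarrow> 'v) funct"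
  assumes weight_module: "c \<in> Obj C \<Longrightarrow> module R (FOb W c)"
    and weight_linear: "\<lbrakk>c \<in> Obj C; d \<in> Obj C; f \<in> arr C c d\<rbrakk>
      \<Longrightarrow> FArr W d c f \<in> linear_maps R (FOb W d) (FOb W c)"
    and weight_ident: "\<lbrakk>c \<in> Obj C; w \<in> carrier (FOb W c)\<rbrakk> \<Longrightarrow> FArr W c c (Ident C c) w = w"
    and weight_add: "\<lbrakk>c \<in> Obj C; d \<in> Obj C; f \<in> arr C c d; g \<in> arr C c d; w \<in> carrier (FOb W d)\<rbrakk>
      \<Longrightarrow> FArr W d c (f \<oplus>\<^bsub>Hom C c d\<^esub> g) w = FArr W d c f w \<oplus>\<^bsub>FOb W c\<^esub> FArr W d c g w"
    and weight_smult: "\<lbrakk>c \<in> Obj C; d \<in> Obj C; r \<in> carrier R; f \<in> arr C c d; w \<in> carrier (FOb W d)\<rbrakk>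
      \<Longrightarrow> FArr W d c (r \<odot>\<^bsub>Hom C c d\<^esub> f) w = r \<odot>\<^bsub>FOb W c\<^esub> FArr W d c f w"
begin

lemma weight_closed:
  "\<lbrakk>c \<in> Obj C; d \<in> Obj C; f \<in> arr C c d; w \<in> carrier (FOb W d)\<rbrakk>
    \<Longrightarrow> FArr W d c f w \<in> carrier (FOb W c)"
  using linear_maps_closed[OF weight_linear] .

lemma weight_orbit_linear:
  assumes "c \<in> Obj C" "d \<in> Obj C" "w \<in> carrier (FOb W d)"
  shows "(\<lambda>f\<in>arr C c d. FArr W d c f w) \<in> linear_maps R (Hom C c d) (FOb W c)"
proof -
  interpret cd: module R "Hom C c d" by (rule C.hom_module[OF assms(1,2)])
  show ?thesis by (rule linear_mapsI) (simp_all add: assms weight_closed weight_add weight_smult)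
qed

end

locale weighted_diagram = right_module R C W + B: linear_category R B
  for R :: "('k, 'r) ring_scheme" (structure) and C :: "('c, 'm, 'k) lincat"
    and B :: "('o, 'n, 'k) lincat" and W :: "('c, 'm, ('k, 'v) module, 'v \<Rightarrow> 'v) funct" +
  fixes F :: "('c, 'm, 'o, 'n) funct"
  assumes linear_functor: "is_linear_functor R C B F"
begin

lemmas F_ob = linear_functorD(1)[OF linear_functor]
lemmas F_arr = linear_functorD(2)[OF linear_functor]
lemmas F_ident = linear_functorD(3)[OF linear_functor]

lemma functor_linear:
  assumes "c \<in> Obj C" "d \<in> Obj C"
  shows "(\<lambda>f\<in>arr C c d. FArr F c d f) \<in> linear_maps R (Hom C c d) (Hom B (FOb F c) (FOb F d))"
proof -
  interpret cd: module R "Hom C c d" by (rule C.hom_module[OF assms])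
  show ?thesis
    by (rule linear_mapsI) (simp_all add: assms F_arr linear_functorD(5,6)[OF linear_functor])
qed

lemma weighted_cocone_post:
  assumes u: "weighted_cocone R C B W F X u" and Y: "Y \<in> Obj B" and h: "h \<in> arr B X Y"
  shows "weighted_cocone R C B W F Y (\<lambda>c. \<lambda>w\<in>carrier (FOb W c). Comp B (FOb F c) X Y h (u c w))"
  unfolding weighted_cocone_def
proof (intro conjI ballI Y)
  note ud = weighted_coconeD[OF u]
  fix c assume c: "c \<in> Obj C"
  show "(\<lambda>w\<in>carrier (FOb W c). Comp B (FOb F c) X Y h (u c w)) \<in> linear_maps R (FOb W c) (Hom B (FOb F c) Y)"
    by (rule B.comp_linear_post[OF F_ob[OF c] ud(1) Y h ud(2)[OF c] weight_module[OF c]])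
next
  note ud = weighted_coconeD[OF u]
  fix c d f w assume a: "c \<in> Obj C" "d \<in> Obj C" "f \<in> arr C c d" "w \<in> carrier (FOb W d)"
  have "Comp B (FOb F c) X Y h (Comp B (FOb F c) (FOb F d) X (u d w) (FArr F c d f))
      = Comp B (FOb F c) (FOb F d) Y (Comp B (FOb F d) X Y h (u d w)) (FArr F c d f)"
    by (rule B.comp_assoc[OF F_ob[OF a(1)] F_ob[OF a(2)] ud(1) Y F_arr[OF a(1-3)] ud(3)[OF a(2,4)] h])
  then show "(\<lambda>w\<in>carrier (FOb W c). Comp B (FOb F c) X Y h (u c w)) (FArr W d c f w)
      = Comp B (FOb F c) (FOb F d) Y
          ((\<lambda>w\<in>carrier (FOb W d). Comp B (FOb F d) X Y h (u d w)) w) (FArr F c d f)"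
    using a by (simp add: weight_closed ud(4))
qed

lemma weighted_colimit_cancel:
  assumes X: "is_weighted_colimit R C B W F X u" and Y: "Y \<in> Obj B"
    and h: "h \<in> arr B X Y" "h' \<in> arr B X Y"
    and eq: "\<And>c w. \<lbrakk>c \<in> Obj C; w \<in> carrier (FOb W c)\<rbrakk>
      \<Longrightarrow> Comp B (FOb F c) X Y h (u c w) = Comp B (FOb F c) X Y h' (u c w)"
  shows "h = h'"
proof -
  note Xd = is_weighted_colimitD[OF X]
  show ?thesis
    by (rule ex1_unique[OF Xd(2)[OF weighted_cocone_post[OF Xd(1) Y h(1)]]]) (simp_all add: h eq)
qed

lemma weighted_colimit_iso:
  assumes X: "is_weighted_colimit R C B W F X u" and Y: "is_weighted_colimit R C B W F Y v"
    and h: "h \<in> arr B X Y"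
    and hu: "\<And>c w. \<lbrakk>c \<in> Obj C; w \<in> carrier (FOb W c)\<rbrakk> \<Longrightarrow> Comp B (FOb F c) X Y h (u c w) = v c w"
  shows "iso B X Y h"
proof -
  note Xd = is_weighted_colimitD[OF X] note Yd = is_weighted_colimitD[OF Y]
  note uc = weighted_coconeD[OF Xd(1)] note vc = weighted_coconeD[OF Yd(1)]
  obtain k where k: "k \<in> arr B Y X"
    and kv: "\<forall>c\<in>Obj C. \<forall>w\<in>carrier (FOb W c). u c w = Comp B (FOb F c) Y X k (v c w)"
    using Yd(2)[OF Xd(1)] by (elim ex1E conjE)
  have 1: "Comp B (FOb F c) X X (Comp B X Y X k h) (u c w) = Comp B (FOb F c) X X (Ident B X) (u c w)"
    if c: "c \<in> Obj C" and w: "w \<in> carrier (FOb W c)" for c w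
    using hu[OF c w] kv c w B.comp_assoc[OF F_ob[OF c] uc(1) vc(1) uc(1) uc(3)[OF c w] h k]
      B.comp_ident_left[OF F_ob[OF c] uc(1) uc(3)[OF c w]] by simp
  have 2: "Comp B (FOb F c) Y Y (Comp B Y X Y h k) (v c w) = Comp B (FOb F c) Y Y (Ident B Y) (v c w)"
    if c: "c \<in> Obj C" and w: "w \<in> carrier (FOb W c)" for c w
    using hu[OF c w] kv c w B.comp_assoc[OF F_ob[OF c] vc(1) uc(1) vc(1) vc(3)[OF c w] k h]
      B.comp_ident_left[OF F_ob[OF c] vc(1) vc(3)[OF c w]] by simp
  have "Comp B X Y X k h = Ident B X"
    by (rule weighted_colimit_cancel[OF X uc(1) _ _ 1])
      (simp_all add: B.comp_arr[OF uc(1) vc(1) uc(1) h k] B.ident_arr uc(1))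
  moreover have "Comp B Y X Y h k = Ident B Y"
    by (rule weighted_colimit_cancel[OF Y vc(1) _ _ 2])
      (simp_all add: B.comp_arr[OF vc(1) uc(1) vc(1) k h] B.ident_arr vc(1))
  ultimately show ?thesis using h k by (auto simp: iso_def)
qed

text \<open>The colimit is the quotient of the finite sum of copies of \<open>F(c)\<close>, one for each element of a
  dual basis of \<open>W(c)\<close>, by the finitely many relations that express how generators of the
  Hom modules act on these bases. Local boundedness makes the relations finite in number.\<close>

theorem weighted_colimit_exists:
  assumes ab: "abelian_category R B"
    and lb: "locally_bounded C"
    and support: "finite {c \<in> Obj C. carrier (FOb W c) \<noteq> {\<zero>\<^bsub>FOb W c\<^esub>}}"
    and basisW: "\<And>c. c \<in> Obj C \<Longrightarrow> \<exists>n e \<epsilon>. dual_basis R (FOb W c) n e \<epsilon>"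
    and basisC: "\<And>c d. \<lbrakk>c \<in> Obj C; d \<in> Obj C\<rbrakk> \<Longrightarrow> \<exists>n e \<epsilon>. dual_basis R (Hom C c d) n e \<epsilon>"
  shows "\<exists>X u. is_weighted_colimit R C B W F X u"
proof -
  interpret AB: abelian_category R B by (rule ab)
  have "\<forall>c\<in>Obj C. \<exists>t. dual_basis R (FOb W c) (fst t) (fst (snd t)) (snd (snd t)) \<and>
      (carrier (FOb W c) = {\<zero>\<^bsub>FOb W c\<^esub>} \<longrightarrow> fst t = 0)"
  proof
    fix c assume c: "c \<in> Obj C"
    obtain n e \<epsilon> where b: "dual_basis R (FOb W c) n e \<epsilon>" using basisW[OF c] by blast
    show "\<exists>t. dual_basis R (FOb W c) (fst t) (fst (snd t)) (snd (snd t)) \<and>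
      (carrier (FOb W c) = {\<zero>\<^bsub>FOb W c\<^esub>} \<longrightarrow> fst t = 0)"
    proof (cases "carrier (FOb W c) = {\<zero>\<^bsub>FOb W c\<^esub>}")
      case True
      then show ?thesis
        using dual_basis_zero[OF weight_module[OF c], of e \<epsilon>] by (intro exI[of _ "(0, e, \<epsilon>)"]) simp
    qed (use b in \<open>auto intro!: exI[of _ "(n, e, \<epsilon>)"]\<close>)
  qed
  from bchoice[OF this] obtain t where t: "\<And>c. c \<in> Obj C \<Longrightarrow>
      dual_basis R (FOb W c) (fst (t c)) (fst (snd (t c))) (snd (snd (t c))) \<and>
      (carrier (FOb W c) = {\<zero>\<^bsub>FOb W c\<^esub>} \<longrightarrow> fst (t c) = 0)" by blast
  define n e \<epsilon> where "n c = fst (t c)" and "e c = fst (snd (t c))" and "\<epsilon> c = snd (snd (t c))" for c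
  have bW: "dual_basis R (FOb W c) (n c) (e c) (\<epsilon> c)" if "c \<in> Obj C" for c
    using t[OF that] by (simp add: n_def e_def \<epsilon>_def)
  have nW: "carrier (FOb W c) \<noteq> {\<zero>\<^bsub>FOb W c\<^esub>}" if "c \<in> Obj C" "i < n c" for c i
    using t[OF that(1)] that(2) by (auto simp: n_def)
  have "\<forall>z\<in>Obj C \<times> Obj C. \<exists>t. dual_basis R (Hom C (fst z) (snd z)) (fst t) (fst (snd t)) (snd (snd t)) \<and>
      (arr C (fst z) (snd z) = {\<zero>\<^bsub>Hom C (fst z) (snd z)\<^esub>} \<longrightarrow> fst t = 0)"
  proof
    fix z assume "z \<in> Obj C \<times> Obj C"
    then obtain c d where z: "z = (c, d)" and cd: "c \<in> Obj C" "d \<in> Obj C" by auto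
    obtain n e \<epsilon> where b: "dual_basis R (Hom C c d) n e \<epsilon>" using basisC[OF cd] by blast
    show "\<exists>t. dual_basis R (Hom C (fst z) (snd z)) (fst t) (fst (snd t)) (snd (snd t)) \<and>
      (arr C (fst z) (snd z) = {\<zero>\<^bsub>Hom C (fst z) (snd z)\<^esub>} \<longrightarrow> fst t = 0)"
    proof (cases "arr C c d = {\<zero>\<^bsub>Hom C c d\<^esub>}")
      case True
      then show ?thesis
        using dual_basis_zero[OF C.hom_module[OF cd], of e \<epsilon>] z
        by (intro exI[of _ "(0, e, \<epsilon>)"]) simp
    qed (use b z in \<open>auto intro!: exI[of _ "(n, e, \<epsilon>)"]\<close>)
  qed
  from bchoice[OF this] obtain t' where t'_all: "\<forall>z\<in>Obj C \<times> Obj C.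
      dual_basis R (Hom C (fst z) (snd z)) (fst (t' z)) (fst (snd (t' z))) (snd (snd (t' z))) \<and>
      (arr C (fst z) (snd z) = {\<zero>\<^bsub>Hom C (fst z) (snd z)\<^esub>} \<longrightarrow> fst (t' z) = 0)"
    by (elim exE)
  have t': "dual_basis R (Hom C c d) (fst (t' (c, d))) (fst (snd (t' (c, d)))) (snd (snd (t' (c, d)))) \<and>
      (arr C c d = {\<zero>\<^bsub>Hom C c d\<^esub>} \<longrightarrow> fst (t' (c, d)) = 0)"
    if "c \<in> Obj C" "d \<in> Obj C" for c d
    using bspec[OF t'_all, of "(c, d)"] that by simp
  define m g \<gamma> where "m c d = fst (t' (c, d))" and "g c d = fst (snd (t' (c, d)))"
    and "\<gamma> c d = snd (snd (t' (c, d)))" for c d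
  have bC: "dual_basis R (Hom C c d) (m c d) (g c d) (\<gamma> c d)" if "c \<in> Obj C" "d \<in> Obj C" for c d
    using t'[OF that] by (simp add: m_def g_def \<gamma>_def)
  have mC: "arr C c d \<noteq> {\<zero>\<^bsub>Hom C c d\<^esub>}" if "c \<in> Obj C" "d \<in> Obj C" "j < m c d" for c d j
    using t'[OF that(1,2)] that(3) by (auto simp: m_def)
  note Wm = weight_module
  have el: "e c i \<in> carrier (FOb W c)" if "c \<in> Obj C" "i < n c" for c i
    using dual_basisD(2)[OF bW] that by blast
  have gl: "g c d j \<in> arr C c d" if "c \<in> Obj C" "d \<in> Obj C" "j < m c d" for c d j
    using dual_basisD(2)[OF bC] that by blast

  \<comment> \<open>\<open>G\<close> indexes the generators and \<open>K\<close> the relations. Both are finite because the chosen dual bases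
    of zero modules are empty.\<close>
  define G where "G = {(c, i). c \<in> Obj C \<and> i < n c}"
  have "G \<subseteq> Sigma {c \<in> Obj C. carrier (FOb W c) \<noteq> {\<zero>\<^bsub>FOb W c\<^esub>}} (\<lambda>c. {..<n c})"
    using nW by (auto simp: G_def)
  then have "finite G" using support finite_subset[OF _ finite_SigmaI] by blast
  then have "\<exists>E \<iota>. is_coproduct B G (\<lambda>z. FOb F (fst z)) E \<iota>"
    by (rule AB.finite_coproduct) (auto simp: G_def F_ob)
  then obtain E \<iota> where E: "is_coproduct B G (\<lambda>z. FOb F (fst z)) E \<iota>" by (elim exE)
  note Ed = is_coproductD[OF E]
  have il: "\<iota> (c, i) \<in> arr B (FOb F c) E" if "c \<in> Obj C" "i < n c" for c i
    using Ed(2)[of "(c, i)"] that by (simp add: G_def)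
  define gen where "gen c = (\<lambda>w\<in>carrier (FOb W c).
      \<Oplus>\<^bsub>Hom B (FOb F c) E\<^esub>l\<in>{..<n c}. \<epsilon> c l w \<odot>\<^bsub>Hom B (FOb F c) E\<^esub> \<iota> (c, l))" for c
  have genl: "gen c \<in> linear_maps R (FOb W c) (Hom B (FOb F c) E)" if c: "c \<in> Obj C" for c
    unfolding gen_def by (rule dual_basis_extend[OF bW[OF c] B.hom_module[OF F_ob[OF c] Ed(1)] il[OF c]])
  note gena = linear_maps_closed[OF genl]
  define K where "K = {(c, d, i, j). c \<in> Obj C \<and> d \<in> Obj C \<and> i < n d \<and> j < m c d}"
  have "K \<subseteq> (\<Union>d\<in>{c \<in> Obj C. carrier (FOb W c) \<noteq> {\<zero>\<^bsub>FOb W c\<^esub>}}.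
      \<Union>c\<in>{c \<in> Obj C. arr C c d \<noteq> {\<zero>\<^bsub>Hom C c d\<^esub>}}. {c} \<times> {d} \<times> {..<n d} \<times> {..<m c d})"
  proof
    fix z assume "z \<in> K"
    then obtain c d i j where z: "z = (c, d, i, j)" and o: "c \<in> Obj C" "d \<in> Obj C" "i < n d" "j < m c d"
      by (auto simp: K_def)
    have d: "d \<in> {c \<in> Obj C. carrier (FOb W c) \<noteq> {\<zero>\<^bsub>FOb W c\<^esub>}}" using nW[OF o(2,3)] o by simp
    have c: "c \<in> {c \<in> Obj C. arr C c d \<noteq> {\<zero>\<^bsub>Hom C c d\<^esub>}}" using mC[OF o(1,2,4)] o by simp
    show "z \<in> (\<Union>d\<in>{c \<in> Obj C. carrier (FOb W c) \<noteq> {\<zero>\<^bsub>FOb W c\<^esub>}}.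
      \<Union>c\<in>{c \<in> Obj C. arr C c d \<noteq> {\<zero>\<^bsub>Hom C c d\<^esub>}}. {c} \<times> {d} \<times> {..<n d} \<times> {..<m c d})"
      by (rule UN_I[OF d], rule UN_I[OF c]) (use o in \<open>simp add: z\<close>)
  qed
  moreover have "finite (\<Union>d\<in>{c \<in> Obj C. carrier (FOb W c) \<noteq> {\<zero>\<^bsub>FOb W c\<^esub>}}.
      \<Union>c\<in>{c \<in> Obj C. arr C c d \<noteq> {\<zero>\<^bsub>Hom C c d\<^esub>}}. {c} \<times> {d} \<times> {..<n d} \<times> {..<m c d})"
    using support lb by (intro finite_UN_I) (auto simp: locally_bounded_def)
  ultimately have finK: "finite K" by (rule finite_subset)
  define l where "l = (\<lambda>(c, d, i, j). Comp B (FOb F c) (FOb F d) E (\<iota> (d, i)) (FArr F c d (g c d j)))"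
  define r where "r = (\<lambda>(c, d, i, j). gen c (FArr W d c (g c d j) (e d i)))"
  have "\<exists>Q p. is_joint_coequalizer B K (\<lambda>z. FOb F (fst z)) l r E Q p"
    by (rule AB.joint_coequalizer[OF finK Ed(1)])
      (auto simp: K_def l_def r_def F_ob intro!: B.comp_arr Ed(1) F_arr gl il gena weight_closed el)
  then obtain Q p where Qp: "is_joint_coequalizer B K (\<lambda>z. FOb F (fst z)) l r E Q p" by (elim exE)
  note Qd = is_joint_coequalizerD[OF Qp]
  note Q = Qd(1) note p = Qd(2)
  define u where "u c = (\<lambda>w\<in>carrier (FOb W c). Comp B (FOb F c) E Q p (gen c w))" for c
  have ul: "u c \<in> linear_maps R (FOb W c) (Hom B (FOb F c) Q)" if c: "c \<in> Obj C" for c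
    unfolding u_def by (rule B.comp_linear_post[OF F_ob[OF c] Ed(1) Q p genl[OF c] Wm[OF c]])
  have pil: "Comp B (FOb F c) E Q p (\<iota> (c, i)) \<in> arr B (FOb F c) Q" if "c \<in> Obj C" "i < n c" for c i
    by (rule B.comp_arr[OF F_ob[OF that(1)] Ed(1) Q il[OF that] p])
  \<comment> \<open>The relations were imposed for the generators \<open>g c d j\<close> of the Hom modules only; as both sides
    are linear in \<open>f\<close>, they hold for all arrows \<open>f\<close>.\<close>
  have rel: "Comp B (FOb F c) (FOb F d) Q (Comp B (FOb F d) E Q p (\<iota> (d, i))) (FArr F c d f)
      = u c (FArr W d c f (e d i))"
    if c: "c \<in> Obj C" and d: "d \<in> Obj C" and i: "i < n d" and f: "f \<in> arr C c d" for c d i f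
  proof -
    note cd = c d
    have lin1: "(\<lambda>f\<in>arr C c d. Comp B (FOb F c) (FOb F d) Q (Comp B (FOb F d) E Q p (\<iota> (d, i)))
        ((\<lambda>f\<in>arr C c d. FArr F c d f) f)) \<in> linear_maps R (Hom C c d) (Hom B (FOb F c) Q)"
      by (rule B.comp_linear_post[OF F_ob[OF c] F_ob[OF d] Q pil[OF d i] functor_linear[OF cd] C.hom_module[OF cd]])
    have lin2: "(\<lambda>f\<in>arr C c d. u c ((\<lambda>f\<in>arr C c d. FArr W d c f (e d i)) f))
        \<in> linear_maps R (Hom C c d) (Hom B (FOb F c) Q)"
      by (rule linear_maps_compose[OF weight_orbit_linear[OF cd el[OF d i]] ul[OF c] C.hom_module[OF cd]])
    have "Comp B (FOb F c) (FOb F d) Q (Comp B (FOb F d) E Q p (\<iota> (d, i))) (FArr F c d (g c d j))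
        = u c (FArr W d c (g c d j) (e d i))" if j: "j < m c d" for j
    proof -
      note gj = gl[OF cd j]
      have "Comp B (FOb F c) E Q p (l (c, d, i, j)) = Comp B (FOb F c) E Q p (r (c, d, i, j))"
        using Qd(3)[of "(c, d, i, j)"] cd i j by (simp add: K_def)
      then show ?thesis
        using B.comp_assoc[OF F_ob[OF c] F_ob[OF d] Ed(1) Q F_arr[OF cd gj] il[OF d i] p]
          weight_closed[OF cd gj el[OF d i]] by (simp add: l_def r_def u_def)
    qed
    then show ?thesis
      using dual_basis_ext[OF bC[OF cd] B.hom_module[OF F_ob[OF c] Q] lin1 lin2 _ f] f gl[OF cd] by simp
  qed
  \<comment> \<open>The case of an identity arrow says that the linear extension \<open>u\<close> takes the expected values
    on the elements \<open>e d i\<close>, which need not be linearly independent.\<close>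
  have ue: "u d (e d i) = Comp B (FOb F d) E Q p (\<iota> (d, i))" if d: "d \<in> Obj C" and i: "i < n d" for d i
    using rel[OF d d i C.ident_arr[OF d]] B.comp_ident_right[OF F_ob[OF d] Q pil[OF d i]]
    by (simp add: F_ident[OF d] weight_ident[OF d el[OF d i]])
  have coc: "weighted_cocone R C B W F Q u"
    unfolding weighted_cocone_def
  proof (intro conjI ballI Q ul)
    fix c d f w assume cd: "c \<in> Obj C" "d \<in> Obj C" and f: "f \<in> arr C c d" and w: "w \<in> carrier (FOb W d)"
    have lin1: "(\<lambda>w\<in>carrier (FOb W d). u c (FArr W d c f w)) \<in> linear_maps R (FOb W d) (Hom B (FOb F c) Q)"
      by (rule linear_maps_compose[OF weight_linear[OF cd f] ul[OF cd(1)] Wm[OF cd(2)]])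
    have lin2: "(\<lambda>w\<in>carrier (FOb W d). Comp B (FOb F c) (FOb F d) Q (u d w) (FArr F c d f))
        \<in> linear_maps R (FOb W d) (Hom B (FOb F c) Q)"
      by (rule B.comp_linear_pre[OF F_ob[OF cd(1)] F_ob[OF cd(2)] Q F_arr[OF cd f] ul[OF cd(2)] Wm[OF cd(2)]])
    show "u c (FArr W d c f w) = Comp B (FOb F c) (FOb F d) Q (u d w) (FArr F c d f)"
      using dual_basis_ext[OF bW[OF cd(2)] B.hom_module[OF F_ob[OF cd(1)] Q] lin1 lin2 _ w] w
        rel[OF cd _ f] ue[OF cd(2)] el[OF cd(2)] by simp
  qed
  have "\<exists>!h. h \<in> arr B Q Y \<and>
      (\<forall>c\<in>Obj C. \<forall>w\<in>carrier (FOb W c). v c w = Comp B (FOb F c) Q Y h (u c w))"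
    if v: "weighted_cocone R C B W F Y v" for Y v
  proof -
    note vd = weighted_coconeD[OF v]
    note Y = vd(1)
    have "\<exists>!h. h \<in> arr B E Y \<and> (\<forall>z\<in>G. Comp B (FOb F (fst z)) E Y h (\<iota> z) = v (fst z) (e (fst z) (snd z)))"
      by (rule Ed(3)[OF Y]) (auto simp: G_def vd(3) el)
    then obtain y where y: "y \<in> arr B E Y"
      and yi: "\<forall>z\<in>G. Comp B (FOb F (fst z)) E Y y (\<iota> z) = v (fst z) (e (fst z) (snd z))"
      and yu: "\<And>y'. y' \<in> arr B E Y \<and>
        (\<forall>z\<in>G. Comp B (FOb F (fst z)) E Y y' (\<iota> z) = v (fst z) (e (fst z) (snd z))) \<Longrightarrow> y' = y"
      by (elim ex1E conjE) blast
    have ygen: "Comp B (FOb F c) E Y y (gen c w) = v c w" if c: "c \<in> Obj C" and w: "w \<in> carrier (FOb W c)" for c w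
    proof -
      have m: "\<epsilon> c l w \<odot>\<^bsub>Hom B (FOb F c) E\<^esub> \<iota> (c, l) \<in> arr B (FOb F c) E" if "l \<in> {..<n c}" for l
        using that B.smult_arr[OF F_ob[OF c] Ed(1) dual_basisD(4)[OF bW[OF c] _ w] il[OF c]] by simp
      interpret cY: module R "Hom B (FOb F c) Y" by (rule B.hom_module[OF F_ob[OF c] Y])
      have "Comp B (FOb F c) E Y y (gen c w)
          = (\<Oplus>\<^bsub>Hom B (FOb F c) Y\<^esub>l\<in>{..<n c}. Comp B (FOb F c) E Y y (\<epsilon> c l w \<odot>\<^bsub>Hom B (FOb F c) E\<^esub> \<iota> (c, l)))"
        using B.comp_finsum_right[OF F_ob[OF c] Ed(1) Y y finite_lessThan m] w by (simp add: gen_def)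
      also have "\<dots> = (\<Oplus>\<^bsub>Hom B (FOb F c) Y\<^esub>l\<in>{..<n c}. \<epsilon> c l w \<odot>\<^bsub>Hom B (FOb F c) Y\<^esub> v c (e c l))"
        using yi c w dual_basisD(4)[OF bW[OF c] _ w] vd(3)[OF c el[OF c]]
        by (intro cY.finsum_cong')
          (auto simp: G_def B.comp_smult_right[OF F_ob[OF c] Ed(1) Y _ il[OF c] y])
      also have "\<dots> = v c w"
        by (rule dual_basis_expand[OF bW[OF c] cY.module_axioms vd(2)[OF c] w, symmetric])
      finally show ?thesis .
    qed
    have "Comp B (FOb F (fst z)) E Y y (l z) = Comp B (FOb F (fst z)) E Y y (r z)" if z: "z \<in> K" for z
    proof -
      obtain c d i j where z: "z = (c, d, i, j)" and cd: "c \<in> Obj C" "d \<in> Obj C" and ij: "i < n d" "j < m c d"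
        using z by (auto simp: K_def)
      note gj = gl[OF cd ij(2)]
      have "Comp B (FOb F c) E Y y (l z) = Comp B (FOb F c) (FOb F d) Y (v d (e d i)) (FArr F c d (g c d j))"
        using B.comp_assoc[OF F_ob[OF cd(1)] F_ob[OF cd(2)] Ed(1) Y F_arr[OF cd gj] il[OF cd(2) ij(1)] y]
          bspec[OF yi, of "(d, i)"] cd ij by (simp add: l_def z G_def)
      also have "\<dots> = v c (FArr W d c (g c d j) (e d i))"
        by (rule vd(4)[OF cd gj el[OF cd(2) ij(1)], symmetric])
      also have "\<dots> = Comp B (FOb F c) E Y y (r z)"
        using ygen[OF cd(1) weight_closed[OF cd gj el[OF cd(2) ij(1)]]] by (simp add: r_def z)
      finally show ?thesis by (simp add: z)
    qed
    from Qd(4)[OF Y y this] have ex: "\<exists>!h. h \<in> arr B Q Y \<and> Comp B E Q Y h p = y" .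
    have "(\<forall>c\<in>Obj C. \<forall>w\<in>carrier (FOb W c). v c w = Comp B (FOb F c) Q Y h (u c w)) \<longleftrightarrow> Comp B E Q Y h p = y"
      (is "?L \<longleftrightarrow> ?R") if h: "h \<in> arr B Q Y" for h
    proof
      assume L: ?L
      have "Comp B (FOb F c) E Y (Comp B E Q Y h p) (\<iota> (c, i)) = v c (e c i)" if c: "c \<in> Obj C" "i < n c" for c i
        using B.comp_assoc[OF F_ob[OF c(1)] Ed(1) Q Y il[OF c] p h] L ue[OF c] el[OF c] c by simp
      then show ?R using yu[of "Comp B E Q Y h p"] B.comp_arr[OF Ed(1) Q Y p h] by (auto simp: G_def)
    next
      assume R: ?R
      have "v c w = Comp B (FOb F c) Q Y h (u c w)" if c: "c \<in> Obj C" "w \<in> carrier (FOb W c)" for c w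
        using B.comp_assoc[OF F_ob[OF c(1)] Ed(1) Q Y gena[OF c] p h] R ygen[OF c] c by (simp add: u_def)
      then show ?L by blast
    qed
    from ex1_conj_cong[OF ex this] show ?thesis .
  qed
  then have "is_weighted_colimit R C B W F Q u" using coc by (simp add: is_weighted_colimit_def)
  then show ?thesis by (intro exI)
qed

end

text \<open>Functoriality of weighted colimits in the weight and in the diagram.\<close>

definition weight_map ::
  "('k, 'r) ring_scheme \<Rightarrow> ('c, 'm, 'k) lincat \<Rightarrow> ('c, 'm, ('k, 'v) module, 'v \<Rightarrow> 'v) funct
    \<Rightarrow> ('c, 'm, ('k, 'v) module, 'v \<Rightarrow> 'v) funct \<Rightarrow> ('c \<Rightarrow> 'v \<Rightarrow> 'v) \<Rightarrow> bool" where
  "weight_map R C W W' \<tau> \<longleftrightarrow> (\<forall>c\<in>Obj C. \<tau> c \<in> linear_maps R (FOb W c) (FOb W' c)) \<and>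
     (\<forall>c\<in>Obj C. \<forall>d\<in>Obj C. \<forall>f\<in>arr C c d. \<forall>w\<in>carrier (FOb W d).
        \<tau> c (FArr W d c f w) = FArr W' d c f (\<tau> d w))"

lemma (in weighted_diagram) tensor_map_universal:
  assumes F': "is_linear_functor R C B F'"
    and \<tau>: "weight_map R C W W' \<tau>" and \<alpha>: "\<alpha> \<in> nat_trans C B F F'"
    and ex: "\<exists>X u. is_weighted_colimit R C B W F X u" "\<exists>X u. is_weighted_colimit R C B W' F' X u"
  shows "tensor_map R C B W W' \<tau> F F' \<alpha> \<in> arr B (tensor_ob R C B W F) (tensor_ob R C B W' F')"
    and "\<lbrakk>c \<in> Obj C; w \<in> carrier (FOb W c)\<rbrakk> \<Longrightarrow>
      Comp B (FOb F c) (tensor_ob R C B W F) (tensor_ob R C B W' F')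
        (tensor_map R C B W W' \<tau> F F' \<alpha>) (tensor_in R C B W F c w)
      = Comp B (FOb F c) (FOb F' c) (tensor_ob R C B W' F') (tensor_in R C B W' F' c (\<tau> c w)) (\<alpha> c)"
proof -
  let ?X = "tensor_ob R C B W F" and ?u = "tensor_in R C B W F"
  let ?Y = "tensor_ob R C B W' F'" and ?v = "tensor_in R C B W' F'"
  note Xd = is_weighted_colimitD[OF tensor_is_weighted_colimit[OF ex(1)]]
  note Yd = is_weighted_colimitD[OF tensor_is_weighted_colimit[OF ex(2)]]
  note vd = weighted_coconeD[OF Yd(1)]
  note F'd = linear_functorD[OF F']
  note \<alpha>d = nat_transD[OF \<alpha>]
  have tl: "\<tau> c \<in> linear_maps R (FOb W c) (FOb W' c)" if "c \<in> Obj C" for c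
    using \<tau> that by (simp add: weight_map_def)
  note ta = linear_maps_closed[OF tl]
  have tn: "\<tau> c (FArr W d c f w) = FArr W' d c f (\<tau> d w)"
    if "c \<in> Obj C" "d \<in> Obj C" "f \<in> arr C c d" "w \<in> carrier (FOb W d)" for c d f w
    using \<tau> that by (simp add: weight_map_def)
  have va: "?v c (\<tau> c w) \<in> arr B (FOb F' c) ?Y" if "c \<in> Obj C" "w \<in> carrier (FOb W c)" for c w
    using vd(3)[OF that(1) ta[OF that]] .
  let ?w = "\<lambda>c. \<lambda>w\<in>carrier (FOb W c). Comp B (FOb F c) (FOb F' c) ?Y (?v c (\<tau> c w)) (\<alpha> c)"
  have "weighted_cocone R C B W F ?Y ?w"
    unfolding weighted_cocone_def
  proof (intro conjI ballI vd(1))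
    fix c assume c: "c \<in> Obj C"
    have "(\<lambda>w\<in>carrier (FOb W c). Comp B (FOb F c) (FOb F' c) ?Y
        ((\<lambda>w\<in>carrier (FOb W c). ?v c (\<tau> c w)) w) (\<alpha> c)) \<in> linear_maps R (FOb W c) (Hom B (FOb F c) ?Y)"
      by (rule B.comp_linear_pre[OF F_ob[OF c] F'd(1)[OF c] vd(1) \<alpha>d(1)[OF c]
            linear_maps_compose[OF tl[OF c] vd(2)[OF c] weight_module[OF c]] weight_module[OF c]])
    then show "?w c \<in> linear_maps R (FOb W c) (Hom B (FOb F c) ?Y)" by (simp cong: restrict_cong)
  next
    fix c d f w assume cd: "c \<in> Obj C" "d \<in> Obj C" and f: "f \<in> arr C c d" and w: "w \<in> carrier (FOb W d)"
    note vw = va[OF cd(2) w]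
    have "Comp B (FOb F c) (FOb F' c) ?Y (?v c (\<tau> c (FArr W d c f w))) (\<alpha> c)
        = Comp B (FOb F c) (FOb F' c) ?Y
            (Comp B (FOb F' c) (FOb F' d) ?Y (?v d (\<tau> d w)) (FArr F' c d f)) (\<alpha> c)"
      using tn[OF cd f w] vd(4)[OF cd f ta[OF cd(2) w]] by simp
    also have "\<dots> = Comp B (FOb F c) (FOb F' d) ?Y (?v d (\<tau> d w))
        (Comp B (FOb F c) (FOb F' c) (FOb F' d) (FArr F' c d f) (\<alpha> c))"
      by (rule B.comp_assoc[OF F_ob[OF cd(1)] F'd(1)[OF cd(1)] F'd(1)[OF cd(2)] vd(1)
            \<alpha>d(1)[OF cd(1)] F'd(2)[OF cd f] vw, symmetric])
    also have "\<dots> = Comp B (FOb F c) (FOb F' d) ?Y (?v d (\<tau> d w))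
        (Comp B (FOb F c) (FOb F d) (FOb F' d) (\<alpha> d) (FArr F c d f))"
      using \<alpha>d(2)[OF cd f] by simp
    also have "\<dots> = Comp B (FOb F c) (FOb F d) ?Y
        (Comp B (FOb F d) (FOb F' d) ?Y (?v d (\<tau> d w)) (\<alpha> d)) (FArr F c d f)"
      by (rule B.comp_assoc[OF F_ob[OF cd(1)] F_ob[OF cd(2)] F'd(1)[OF cd(2)] vd(1)
            F_arr[OF cd f] \<alpha>d(1)[OF cd(2)] vw])
    finally show "?w c (FArr W d c f w) = Comp B (FOb F c) (FOb F d) ?Y (?w d w) (FArr F c d f)"
      using w weight_closed[OF cd f w] by simp
  qed
  from Xd(2)[OF this]
  have "\<exists>!h. h \<in> arr B ?X ?Y \<and> (\<forall>c\<in>Obj C. \<forall>w\<in>carrier (FOb W c).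
      Comp B (FOb F c) ?X ?Y h (?u c w) = Comp B (FOb F c) (FOb F' c) ?Y (?v c (\<tau> c w)) (\<alpha> c))"
    by (rule ex1_conj_cong) (simp add: eq_commute)
  from theI'[OF this] show "tensor_map R C B W W' \<tau> F F' \<alpha> \<in> arr B ?X ?Y"
    and "\<lbrakk>c \<in> Obj C; w \<in> carrier (FOb W c)\<rbrakk> \<Longrightarrow>
      Comp B (FOb F c) ?X ?Y (tensor_map R C B W W' \<tau> F F' \<alpha>) (?u c w)
      = Comp B (FOb F c) (FOb F' c) ?Y (?v c (\<tau> c w)) (\<alpha> c)"
    by (simp_all add: tensor_map_def)
qed


section \<open>Categories with pointwise structure\<close>

lemma is_cokernelD:
  assumes "is_cokernel C a b f q p"
  shows "f \<in> arr C a b" "q \<in> Obj C" "p \<in> arr C b q" "Comp C a b q p f = \<zero>\<^bsub>Hom C a q\<^esub>"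
    and "\<lbrakk>x \<in> Obj C; g \<in> arr C b x; Comp C a b x g f = \<zero>\<^bsub>Hom C a x\<^esub>\<rbrakk>
      \<Longrightarrow> \<exists>!h. h \<in> arr C q x \<and> Comp C b q x h p = g"
  using assms by (simp_all add: is_cokernel_def)

text \<open>Functor categories and powers both have families of arrows of \<open>B\<close> as arrows, with all structure
  computed pointwise. They share this derivation of linearity and of biproducts.\<close>

locale pointwise_category = B: linear_category R B
  for R :: "('k, 'r) ring_scheme" (structure) and B :: "('o, 'n, 'k) lincat" +
  fixes A :: "('a, 'i \<Rightarrow> 'n, 'k) lincat" and I :: "'i set" and ob :: "'a \<Rightarrow> 'i \<Rightarrow> 'o"
  assumes pt_ob: "\<lbrakk>X \<in> Obj A; i \<in> I\<rbrakk> \<Longrightarrow> ob X i \<in> Obj B"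
    and pt_arr: "\<lbrakk>X \<in> Obj A; Y \<in> Obj A\<rbrakk> \<Longrightarrow> arr A X Y \<subseteq> (\<Pi>\<^sub>E i\<in>I. arr B (ob X i) (ob Y i))"
    and pt_zero: "\<lbrakk>X \<in> Obj A; Y \<in> Obj A\<rbrakk> \<Longrightarrow> \<zero>\<^bsub>Hom A X Y\<^esub> = (\<lambda>i\<in>I. \<zero>\<^bsub>Hom B (ob X i) (ob Y i)\<^esub>)"
      "\<lbrakk>X \<in> Obj A; Y \<in> Obj A\<rbrakk> \<Longrightarrow> \<zero>\<^bsub>Hom A X Y\<^esub> \<in> arr A X Y"
    and pt_add: "\<lbrakk>X \<in> Obj A; Y \<in> Obj A; f \<in> arr A X Y; g \<in> arr A X Y\<rbrakk>
        \<Longrightarrow> f \<oplus>\<^bsub>Hom A X Y\<^esub> g = (\<lambda>i\<in>I. f i \<oplus>\<^bsub>Hom B (ob X i) (ob Y i)\<^esub> g i)"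
      "\<lbrakk>X \<in> Obj A; Y \<in> Obj A; f \<in> arr A X Y; g \<in> arr A X Y\<rbrakk> \<Longrightarrow> f \<oplus>\<^bsub>Hom A X Y\<^esub> g \<in> arr A X Y"
    and pt_smult: "\<lbrakk>X \<in> Obj A; Y \<in> Obj A; r \<in> carrier R; f \<in> arr A X Y\<rbrakk>
        \<Longrightarrow> r \<odot>\<^bsub>Hom A X Y\<^esub> f = (\<lambda>i\<in>I. r \<odot>\<^bsub>Hom B (ob X i) (ob Y i)\<^esub> f i)"
      "\<lbrakk>X \<in> Obj A; Y \<in> Obj A; r \<in> carrier R; f \<in> arr A X Y\<rbrakk> \<Longrightarrow> r \<odot>\<^bsub>Hom A X Y\<^esub> f \<in> arr A X Y"
    and pt_ident: "X \<in> Obj A \<Longrightarrow> Ident A X = (\<lambda>i\<in>I. Ident B (ob X i))"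
      "X \<in> Obj A \<Longrightarrow> Ident A X \<in> arr A X X"
    and pt_comp: "\<lbrakk>X \<in> Obj A; Y \<in> Obj A; Z \<in> Obj A; f \<in> arr A X Y; g \<in> arr A Y Z\<rbrakk>
        \<Longrightarrow> Comp A X Y Z g f = (\<lambda>i\<in>I. Comp B (ob X i) (ob Y i) (ob Z i) (g i) (f i))"
      "\<lbrakk>X \<in> Obj A; Y \<in> Obj A; Z \<in> Obj A; f \<in> arr A X Y; g \<in> arr A Y Z\<rbrakk>
        \<Longrightarrow> Comp A X Y Z g f \<in> arr A X Z"
begin

lemma pt_app: "\<lbrakk>X \<in> Obj A; Y \<in> Obj A; f \<in> arr A X Y; i \<in> I\<rbrakk> \<Longrightarrow> f i \<in> arr B (ob X i) (ob Y i)"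
  using pt_arr by blast

lemma pt_apps:
  "\<lbrakk>X \<in> Obj A; Y \<in> Obj A; i \<in> I\<rbrakk> \<Longrightarrow> \<zero>\<^bsub>Hom A X Y\<^esub> i = \<zero>\<^bsub>Hom B (ob X i) (ob Y i)\<^esub>"
  "\<lbrakk>X \<in> Obj A; Y \<in> Obj A; f \<in> arr A X Y; g \<in> arr A X Y; i \<in> I\<rbrakk>
    \<Longrightarrow> (f \<oplus>\<^bsub>Hom A X Y\<^esub> g) i = f i \<oplus>\<^bsub>Hom B (ob X i) (ob Y i)\<^esub> g i"
  "\<lbrakk>X \<in> Obj A; Y \<in> Obj A; r \<in> carrier R; f \<in> arr A X Y; i \<in> I\<rbrakk>
    \<Longrightarrow> (r \<odot>\<^bsub>Hom A X Y\<^esub> f) i = r \<odot>\<^bsub>Hom B (ob X i) (ob Y i)\<^esub> f i"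
  "\<lbrakk>X \<in> Obj A; i \<in> I\<rbrakk> \<Longrightarrow> Ident A X i = Ident B (ob X i)"
  "\<lbrakk>X \<in> Obj A; Y \<in> Obj A; Z \<in> Obj A; f \<in> arr A X Y; g \<in> arr A Y Z; i \<in> I\<rbrakk>
    \<Longrightarrow> Comp A X Y Z g f i = Comp B (ob X i) (ob Y i) (ob Z i) (g i) (f i)"
  by (simp_all add: pt_zero(1) pt_add(1) pt_smult(1) pt_ident(1) pt_comp(1))

lemmas pt_closed = pt_zero(2) pt_add(2) pt_smult(2) pt_ident(2) pt_comp(2)

lemma pt_eqI:
  assumes "X \<in> Obj A" "Y \<in> Obj A" "f \<in> arr A X Y" "g \<in> arr A X Y" "\<And>i. i \<in> I \<Longrightarrow> f i = g i"
  shows "f = g"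
  using assms pt_arr[OF assms(1,2)] by (intro PiE_ext[of f I "\<lambda>i. arr B (ob X i) (ob Y i)" g]) auto

lemma pointwise_linear_category: "linear_category R A"
proof (intro linear_category.intro linear_category_axioms.intro B.is_cring, goal_cases)
  case (1 X Y)
  show ?case
    by (rule pointwise_module[OF B.is_cring B.hom_module[OF pt_ob[OF 1(1)] pt_ob[OF 1(2)]]
          pt_arr[OF 1] pt_zero[OF 1] pt_add[OF 1] pt_smult[OF 1]])
next
  case (4 X Y f) then show ?case
    by (intro pt_eqI[of X Y]) (simp_all add: pt_apps pt_closed pt_ob pt_app B.comp_ident_right)
next
  case (5 X Y f) then show ?case
    by (intro pt_eqI[of X Y]) (simp_all add: pt_apps pt_closed pt_ob pt_app B.comp_ident_left)
next
  case (6 X Y Z V f g h) 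
  then have "(Comp A X Z V h (Comp A X Y Z g f)) i = (Comp A X Y V (Comp A Y Z V h g) f) i" if "i \<in> I" for i
    using B.comp_assoc[OF pt_ob[OF 6(1) that] pt_ob[OF 6(2) that] pt_ob[OF 6(3) that] pt_ob[OF 6(4) that]
        pt_app[OF 6(1,2,5) that] pt_app[OF 6(2,3,6) that] pt_app[OF 6(3,4,7) that]] that
    by (simp add: pt_apps pt_closed 6)
  with 6 show ?case by (intro pt_eqI[of X V]) (simp_all add: pt_closed)
next
  case (7 X Y Z f g g') then show ?case
    by (intro pt_eqI[of X Z]) (simp_all add: pt_apps pt_closed pt_ob pt_app B.comp_add_left)
next
  case (8 X Y Z f f' g) then show ?case
    by (intro pt_eqI[of X Z]) (simp_all add: pt_apps pt_closed pt_ob pt_app B.comp_add_right)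
next
  case (9 X Y Z r f g) then show ?case
    by (intro pt_eqI[of X Z]) (simp_all add: pt_apps pt_closed pt_ob pt_app B.comp_smult_left)
next
  case (10 X Y Z r f g) then show ?case
    by (intro pt_eqI[of X Z]) (simp_all add: pt_apps pt_closed pt_ob pt_app B.comp_smult_right)
qed (simp_all add: pt_closed)

lemma pointwise_biproduct:
  assumes o: "X \<in> Obj A" "Y \<in> Obj A" "S \<in> Obj A"
    and ar: "i1 \<in> arr A X S" "i2 \<in> arr A Y S" "p1 \<in> arr A S X" "p2 \<in> arr A S Y"
    and bp: "\<And>i. i \<in> I \<Longrightarrow> is_biproduct B (ob X i) (ob Y i) (ob S i) (i1 i) (i2 i) (p1 i) (p2 i)"
  shows "is_biproduct A X Y S i1 i2 p1 p2"
proof -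
  interpret A: linear_category R A by (rule pointwise_linear_category)
  note c = A.comp_arr A.ident_arr A.zero_arr
  have "Comp A X S X p1 i1 = Ident A X"
    by (rule pt_eqI[OF o(1,1)])
      (use bp o ar in \<open>simp_all add: c is_biproduct_def pt_apps\<close>)
  moreover have "Comp A Y S Y p2 i2 = Ident A Y"
    by (rule pt_eqI[OF o(2,2)])
      (use bp o ar in \<open>simp_all add: c is_biproduct_def pt_apps\<close>)
  moreover have "Comp A Y S X p1 i2 = \<zero>\<^bsub>Hom A Y X\<^esub>"
    by (rule pt_eqI[OF o(2,1)])
      (use bp o ar in \<open>simp_all add: c is_biproduct_def pt_apps\<close>)
  moreover have "Comp A X S Y p2 i1 = \<zero>\<^bsub>Hom A X Y\<^esub>"
    by (rule pt_eqI[OF o(1,2)])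
      (use bp o ar in \<open>simp_all add: c is_biproduct_def pt_apps\<close>)
  moreover have "Comp A S X S i1 p1 \<oplus>\<^bsub>Hom A S S\<^esub> Comp A S Y S i2 p2 = Ident A S"
    by (rule pt_eqI[OF o(3,3)])
      (use bp o ar in \<open>simp_all add: c A.add_arr is_biproduct_def pt_apps\<close>)
  ultimately show ?thesis using o ar by (simp add: is_biproduct_def)
qed

end

context linear_category
begin

text \<open>An object is zero as soon as its identity vanishes; this equation can be checked pointwise.\<close>

lemma zero_objectI:
  assumes z: "z \<in> Obj C" and id: "Ident C z = \<zero>\<^bsub>Hom C z z\<^esub>"
  shows "zero_object C z"
proof -
  have "f = \<zero>\<^bsub>Hom C z a\<^esub>" if a: "a \<in> Obj C" and f: "f \<in> arr C z a" for a f
    using comp_ident_right[OF z a f] comp_zero_right[OF z z a f] id by simp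
  moreover have "f = \<zero>\<^bsub>Hom C a z\<^esub>" if a: "a \<in> Obj C" and f: "f \<in> arr C a z" for a f
    using comp_ident_left[OF a z f] comp_zero_left[OF a z z f] id by simp
  ultimately have "\<exists>!f. f \<in> arr C z a" "\<exists>!f. f \<in> arr C a z" if a: "a \<in> Obj C" for a
    using z a zero_arr[OF z a] zero_arr[OF a z] by blast+
  then show ?thesis using z unfolding zero_object_def by simp
qed

lemma zero_object_ident:
  assumes "zero_object C z"
  shows "Ident C z = \<zero>\<^bsub>Hom C z z\<^esub>"
proof -
  have z: "z \<in> Obj C" "\<exists>!f. f \<in> arr C z z" using assms by (simp_all add: zero_object_def)
  then show ?thesis by (intro ex1_unique[OF z(2)]) (simp_all add: ident_arr)
qed

end

lemma power_cat_simps [simp]: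
  "Obj (power_cat I B) = I \<rightarrow>\<^sub>E Obj B"
  "arr (power_cat I B) X Y = (\<Pi>\<^sub>E i\<in>I. arr B (X i) (Y i))"
  "zero (Hom (power_cat I B) X Y) = (\<lambda>i\<in>I. \<zero>\<^bsub>Hom B (X i) (Y i)\<^esub>)"
  "add (Hom (power_cat I B) X Y) f g = (\<lambda>i\<in>I. f i \<oplus>\<^bsub>Hom B (X i) (Y i)\<^esub> g i)"
  "smult (Hom (power_cat I B) X Y) r f = (\<lambda>i\<in>I. r \<odot>\<^bsub>Hom B (X i) (Y i)\<^esub> f i)"
  "Comp (power_cat I B) X Y Z g f = (\<lambda>i\<in>I. Comp B (X i) (Y i) (Z i) (g i) (f i))"
  "Ident (power_cat I B) X = (\<lambda>i\<in>I. Ident B (X i))"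
  by (simp_all add: power_cat_def)

lemma (in linear_category) power_pointwise: "pointwise_category R C (power_cat I C) I (\<lambda>X i. X i)"
  by (intro pointwise_category.intro pointwise_category_axioms.intro linear_category_axioms)
    (auto simp: add_arr smult_arr ident_arr comp_arr PiE_iff)

lemma (in additive_category) biproduct_choice:
  assumes "\<And>i. i \<in> I \<Longrightarrow> X i \<in> Obj C" "\<And>i. i \<in> I \<Longrightarrow> Y i \<in> Obj C"
  shows "\<exists>s i1 i2 p1 p2. \<forall>i\<in>I. is_biproduct C (X i) (Y i) (s i) (i1 i) (i2 i) (p1 i) (p2 i)"
proof -
  have "\<forall>i\<in>I. \<exists>s i1 i2 p1 p2. is_biproduct C (X i) (Y i) s i1 i2 p1 p2"
    using ex_biproduct assms by simp
  then show ?thesis by (simp only: bchoice_iff)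
qed

lemma (in additive_category) additive_power_cat: "additive_category R (power_cat I C)"
proof -
  interpret P: pointwise_category R C "power_cat I C" I "\<lambda>X i. X i" by (rule power_pointwise)
  interpret PL: linear_category R "power_cat I C" by (rule P.pointwise_linear_category)
  show ?thesis
  proof (intro additive_category.intro additive_category_axioms.intro PL.linear_category_axioms)
    obtain z where z: "zero_object C z" using ex_zero_object by (elim exE)
    have "zero_object (power_cat I C) (\<lambda>i\<in>I. z)"
      using z zero_object_ident[OF z]
      by (intro PL.zero_objectI) (auto simp: zero_object_def intro!: restrict_ext)
    then show "\<exists>z. zero_object (power_cat I C) z" by (intro exI)
  next
    fix X Y assume X: "X \<in> Obj (power_cat I C)" and Y: "Y \<in> Obj (power_cat I C)"
    obtain s i1 i2 p1 p2 where t: "\<forall>i\<in>I. is_biproduct C (X i) (Y i) (s i) (i1 i) (i2 i) (p1 i) (p2 i)"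
      using biproduct_choice[of I X Y] X Y by (auto simp: PiE_iff)
    have "is_biproduct (power_cat I C) X Y (\<lambda>i\<in>I. s i) (\<lambda>i\<in>I. i1 i) (\<lambda>i\<in>I. i2 i) (\<lambda>i\<in>I. p1 i) (\<lambda>i\<in>I. p2 i)"
      by (rule P.pointwise_biproduct[OF X Y]) (use t in \<open>simp_all add: is_biproduct_def\<close>)
    then show "\<exists>s i1 i2 p1 p2. is_biproduct (power_cat I C) X Y s i1 i2 p1 p2" by (intro exI)
  qed
qed


section \<open>Functor categories\<close>

lemma functor_catD:
  assumes "F \<in> Obj (functor_cat R C B)"
  shows "is_linear_functor R C B F" "mk_functor C (FOb F) (FArr F) = F"
  using assms by (auto simp: functor_cat_def)

lemma functor_catI:
  "\<lbrakk>is_linear_functor R C B F; mk_functor C (FOb F) (FArr F) = F\<rbrakk> \<Longrightarrow> F \<in> Obj (functor_cat R C B)"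
  by (simp add: functor_cat_def)

lemma functor_cat_simps [simp]:
  "arr (functor_cat R C B) F G = nat_trans C B F G"
  "zero (Hom (functor_cat R C B) F G) = (\<lambda>c\<in>Obj C. \<zero>\<^bsub>Hom B (FOb F c) (FOb G c)\<^esub>)"
  "add (Hom (functor_cat R C B) F G) \<alpha> \<beta> = (\<lambda>c\<in>Obj C. \<alpha> c \<oplus>\<^bsub>Hom B (FOb F c) (FOb G c)\<^esub> \<beta> c)"
  "smult (Hom (functor_cat R C B) F G) r \<alpha> = (\<lambda>c\<in>Obj C. r \<odot>\<^bsub>Hom B (FOb F c) (FOb G c)\<^esub> \<alpha> c)"
  "Comp (functor_cat R C B) F G H \<beta> \<alpha>
    = (\<lambda>c\<in>Obj C. Comp B (FOb F c) (FOb G c) (FOb H c) (\<beta> c) (\<alpha> c))"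
  "Ident (functor_cat R C B) F = (\<lambda>c\<in>Obj C. Ident B (FOb F c))"
  by (simp_all add: functor_cat_def)

lemma mk_functor_simps [simp]:
  "c \<in> Obj C \<Longrightarrow> FOb (mk_functor C T fa) c = T c"
  "\<lbrakk>c \<in> Obj C; d \<in> Obj C; f \<in> arr C c d\<rbrakk> \<Longrightarrow> FArr (mk_functor C T fa) c d f = fa c d f"
  by (simp_all add: mk_functor_def)

lemma mk_functor_idem: "mk_functor C (FOb (mk_functor C T fa)) (FArr (mk_functor C T fa)) = mk_functor C T fa"
  by (auto simp: mk_functor_def fun_eq_iff restrict_def)

lemma functor_cat_Obj_eqI:
  assumes "F \<in> Obj (functor_cat R C B)" "G \<in> Obj (functor_cat R C B)"
    and "\<And>c. c \<in> Obj C \<Longrightarrow> FOb F c = FOb G c"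
    and "\<And>c d f. \<lbrakk>c \<in> Obj C; d \<in> Obj C; f \<in> arr C c d\<rbrakk> \<Longrightarrow> FArr F c d f = FArr G c d f"
  shows "F = G"
proof -
  have "mk_functor C (FOb F) (FArr F) = mk_functor C (FOb G) (FArr G)"
    unfolding mk_functor_def using assms(3,4) by (auto intro!: restrict_ext)
  then show ?thesis using functor_catD(2)[OF assms(1)] functor_catD(2)[OF assms(2)] by simp
qed

lemma nat_transI:
  assumes "\<And>c. c \<in> Obj C \<Longrightarrow> \<alpha> c \<in> arr D (FOb F c) (FOb G c)"
    and "\<And>c. c \<notin> Obj C \<Longrightarrow> \<alpha> c = undefined"
    and "\<And>a b f. \<lbrakk>a \<in> Obj C; b \<in> Obj C; f \<in> arr C a b\<rbrakk>
      \<Longrightarrow> Comp D (FOb F a) (FOb F b) (FOb G b) (\<alpha> b) (FArr F a b f)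
         = Comp D (FOb F a) (FOb G a) (FOb G b) (FArr G a b f) (\<alpha> a)"
  shows "\<alpha> \<in> nat_trans C D F G"
  using assms by (auto simp: nat_trans_def PiE_iff extensional_def)

lemma nat_trans_eqI:
  assumes "\<alpha> \<in> nat_trans C D F G" "\<beta> \<in> nat_trans C D F' G'" "\<And>c. c \<in> Obj C \<Longrightarrow> \<alpha> c = \<beta> c"
  shows "\<alpha> = \<beta>"
  using assms by (intro extensionalityI[of _ "Obj C"]) (auto simp: nat_trans_def PiE_iff)

text \<open>Exchanging the arguments of \<open>FArr\<close> moves the arguments at which the value is \<open>undefined\<close>.
  Normalising again makes \<open>op_functor\<close> an involution on the objects of functor categories.\<close>

definition op_functor ::
  "('c, 'm, 'k) lincat \<Rightarrow> ('c, 'm, 'o, 'n) funct \<Rightarrow> ('c, 'm, 'o, 'n) funct" where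
  "op_functor C F = mk_functor (op_cat C) (FOb F) (\<lambda>a b. FArr F b a)"

lemma op_functor_simps [simp]:
  "c \<in> Obj C \<Longrightarrow> FOb (op_functor C F) c = FOb F c"
  "\<lbrakk>c \<in> Obj C; d \<in> Obj C; f \<in> arr C d c\<rbrakk> \<Longrightarrow> FArr (op_functor C F) c d f = FArr F d c f"
  by (simp_all add: op_functor_def)

text \<open>A linear functor is determined by, and its axioms can be checked on, jointly epic families
  \<open>t\<close> of arrows into its values.\<close>

lemma mk_functor_by_generators:
  assumes B: "linear_category R B" and C: "linear_category R C"
    and T: "\<And>c. c \<in> Obj C \<Longrightarrow> T c \<in> Obj B"
    and s: "\<And>c j. \<lbrakk>c \<in> Obj C; j \<in> J c\<rbrakk> \<Longrightarrow> s c j \<in> Obj B"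
    and t: "\<And>c j. \<lbrakk>c \<in> Obj C; j \<in> J c\<rbrakk> \<Longrightarrow> t c j \<in> arr B (s c j) (T c)"
    and cancel: "\<And>c Y h h'. \<lbrakk>c \<in> Obj C; Y \<in> Obj B; h \<in> arr B (T c) Y; h' \<in> arr B (T c) Y;
        \<And>j. j \<in> J c \<Longrightarrow> Comp B (s c j) (T c) Y h (t c j) = Comp B (s c j) (T c) Y h' (t c j)\<rbrakk> \<Longrightarrow> h = h'"
    and fa: "\<And>c d f. \<lbrakk>c \<in> Obj C; d \<in> Obj C; f \<in> arr C c d\<rbrakk> \<Longrightarrow> fa c d f \<in> arr B (T c) (T d)"
    and fat: "\<And>c d f j. \<lbrakk>c \<in> Obj C; d \<in> Obj C; f \<in> arr C c d; j \<in> J c\<rbrakk>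
        \<Longrightarrow> Comp B (s c j) (T c) (T d) (fa c d f) (t c j) = r c d f j"
    and ident: "\<And>c j. \<lbrakk>c \<in> Obj C; j \<in> J c\<rbrakk> \<Longrightarrow> r c c (Ident C c) j = t c j"
    and comp: "\<And>c d e f g j. \<lbrakk>c \<in> Obj C; d \<in> Obj C; e \<in> Obj C; f \<in> arr C c d; g \<in> arr C d e; j \<in> J c\<rbrakk>
        \<Longrightarrow> r c e (Comp C c d e g f) j = Comp B (s c j) (T d) (T e) (fa d e g) (r c d f j)"
    and add: "\<And>c d f g j. \<lbrakk>c \<in> Obj C; d \<in> Obj C; f \<in> arr C c d; g \<in> arr C c d; j \<in> J c\<rbrakk>
        \<Longrightarrow> r c d (f \<oplus>\<^bsub>Hom C c d\<^esub> g) j = r c d f j \<oplus>\<^bsub>Hom B (s c j) (T d)\<^esub> r c d g j"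
    and smult: "\<And>c d a f j. \<lbrakk>c \<in> Obj C; d \<in> Obj C; a \<in> carrier R; f \<in> arr C c d; j \<in> J c\<rbrakk>
        \<Longrightarrow> r c d (a \<odot>\<^bsub>Hom C c d\<^esub> f) j = a \<odot>\<^bsub>Hom B (s c j) (T d)\<^esub> r c d f j"
  shows "mk_functor C T fa \<in> Obj (functor_cat R C B)"
proof -
  interpret B: linear_category R B by (rule B)
  interpret C: linear_category R C by (rule C)
  have "fa c c (Ident C c) = Ident B (T c)" if c: "c \<in> Obj C" for c
    by (rule cancel[OF c T[OF c]])
      (simp_all add: c T s t fa fat ident C.ident_arr B.ident_arr B.comp_ident_left)
  moreover have "fa c e (Comp C c d e g f) = Comp B (T c) (T d) (T e) (fa d e g) (fa c d f)"
    if o: "c \<in> Obj C" "d \<in> Obj C" "e \<in> Obj C" and f: "f \<in> arr C c d" and g: "g \<in> arr C d e" for c d e f g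
  proof (rule cancel[OF o(1) T[OF o(3)]])
    note gf = C.comp_arr[OF o f g]
    show "fa c e (Comp C c d e g f) \<in> arr B (T c) (T e)" using fa[OF o(1,3) gf] .
    show "Comp B (T c) (T d) (T e) (fa d e g) (fa c d f) \<in> arr B (T c) (T e)"
      using o f g by (simp add: B.comp_arr T fa)
    fix j assume j: "j \<in> J c"
    show "Comp B (s c j) (T c) (T e) (fa c e (Comp C c d e g f)) (t c j)
        = Comp B (s c j) (T c) (T e) (Comp B (T c) (T d) (T e) (fa d e g) (fa c d f)) (t c j)"
      using B.comp_assoc[OF s[OF o(1) j] T[OF o(1)] T[OF o(2)] T[OF o(3)] t[OF o(1) j] fa[OF o(1,2) f] fa[OF o(2,3) g]]
      by (simp add: fat[OF o(1,3) gf j] fat[OF o(1,2) f j] comp[OF o f g j])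
  qed
  moreover have "fa c d (f \<oplus>\<^bsub>Hom C c d\<^esub> g) = fa c d f \<oplus>\<^bsub>Hom B (T c) (T d)\<^esub> fa c d g"
    if o: "c \<in> Obj C" "d \<in> Obj C" and fg: "f \<in> arr C c d" "g \<in> arr C c d" for c d f g
  proof (rule cancel[OF o(1) T[OF o(2)]])
    note sum = C.add_arr[OF o fg]
    show "fa c d (f \<oplus>\<^bsub>Hom C c d\<^esub> g) \<in> arr B (T c) (T d)" using fa[OF o sum] .
    show "fa c d f \<oplus>\<^bsub>Hom B (T c) (T d)\<^esub> fa c d g \<in> arr B (T c) (T d)"
      using o fg by (simp add: B.add_arr T fa)
    fix j assume j: "j \<in> J c"
    show "Comp B (s c j) (T c) (T d) (fa c d (f \<oplus>\<^bsub>Hom C c d\<^esub> g)) (t c j)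
      = Comp B (s c j) (T c) (T d) (fa c d f \<oplus>\<^bsub>Hom B (T c) (T d)\<^esub> fa c d g) (t c j)"
      using B.comp_add_left[OF s[OF o(1) j] T[OF o(1)] T[OF o(2)] t[OF o(1) j] fa[OF o fg(1)] fa[OF o fg(2)]]
      by (simp add: fat[OF o sum j] fat[OF o fg(1) j] fat[OF o fg(2) j] add[OF o fg j])
  qed
  moreover have "fa c d (a \<odot>\<^bsub>Hom C c d\<^esub> f) = a \<odot>\<^bsub>Hom B (T c) (T d)\<^esub> fa c d f"
    if o: "c \<in> Obj C" "d \<in> Obj C" and a: "a \<in> carrier R" and f: "f \<in> arr C c d" for c d a f
  proof (rule cancel[OF o(1) T[OF o(2)]])
    note af = C.smult_arr[OF o a f]
    show "fa c d (a \<odot>\<^bsub>Hom C c d\<^esub> f) \<in> arr B (T c) (T d)" using fa[OF o af] .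
    show "a \<odot>\<^bsub>Hom B (T c) (T d)\<^esub> fa c d f \<in> arr B (T c) (T d)"
      using o a f by (simp add: B.smult_arr T fa)
    fix j assume j: "j \<in> J c"
    show "Comp B (s c j) (T c) (T d) (fa c d (a \<odot>\<^bsub>Hom C c d\<^esub> f)) (t c j)
      = Comp B (s c j) (T c) (T d) (a \<odot>\<^bsub>Hom B (T c) (T d)\<^esub> fa c d f) (t c j)"
      using B.comp_smult_left[OF s[OF o(1) j] T[OF o(1)] T[OF o(2)] a t[OF o(1) j] fa[OF o f]]
      by (simp add: fat[OF o af j] fat[OF o f j] smult[OF o a f j])
  qed
  ultimately show ?thesis
    by (intro functor_catI mk_functor_idem)
      (simp add: is_linear_functor_def is_functor_def T fa C.ident_arr C.comp_arr C.add_arr C.smult_arr)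
qed

locale functor_setting = B: abelian_category R B + C: linear_category R C
  for R :: "('k, 'r) ring_scheme" (structure)
    and B :: "('o, 'n, 'k) lincat" and C :: "('c, 'm, 'k) lincat"
begin

abbreviation "FC \<equiv> functor_cat R C B"

lemma functor_setting_op: "functor_setting R (op_cat B) (op_cat C)"
  by (intro functor_setting.intro B.abelian_category_op_cat C.linear_category_op_cat)

lemma objD:
  assumes "F \<in> Obj FC"
  shows "a \<in> Obj C \<Longrightarrow> FOb F a \<in> Obj B"
    and "\<lbrakk>a \<in> Obj C; b \<in> Obj C; f \<in> arr C a b\<rbrakk> \<Longrightarrow> FArr F a b f \<in> arr B (FOb F a) (FOb F b)"
    and "a \<in> Obj C \<Longrightarrow> FArr F a a (Ident C a) = Ident B (FOb F a)"
    and "\<lbrakk>a \<in> Obj C; b \<in> Obj C; c \<in> Obj C; f \<in> arr C a b; g \<in> arr C b c\<rbrakk>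
      \<Longrightarrow> FArr F a c (Comp C a b c g f)
        = Comp B (FOb F a) (FOb F b) (FOb F c) (FArr F b c g) (FArr F a b f)"
    and "\<lbrakk>a \<in> Obj C; b \<in> Obj C; f \<in> arr C a b; g \<in> arr C a b\<rbrakk>
      \<Longrightarrow> FArr F a b (f \<oplus>\<^bsub>Hom C a b\<^esub> g)
        = FArr F a b f \<oplus>\<^bsub>Hom B (FOb F a) (FOb F b)\<^esub> FArr F a b g"
    and "\<lbrakk>a \<in> Obj C; b \<in> Obj C; r \<in> carrier R; f \<in> arr C a b\<rbrakk>
      \<Longrightarrow> FArr F a b (r \<odot>\<^bsub>Hom C a b\<^esub> f) = r \<odot>\<^bsub>Hom B (FOb F a) (FOb F b)\<^esub> FArr F a b f"
  using linear_functorD[OF functor_catD(1)[OF assms]] by blast+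

lemma functor_pointwise: "pointwise_category R B FC (Obj C) FOb"
proof (intro pointwise_category.intro pointwise_category_axioms.intro B.linear_category_axioms, goal_cases)
  case (1 X i) then show ?case using objD(1) by blast
next
  case (2 X Y) then show ?case by (auto simp: nat_trans_def)
next
  case (4 X Y)
  note X = objD[OF 4(1)] and Y = objD[OF 4(2)]
  show ?case unfolding functor_cat_simps
    by (rule nat_transI) (simp_all add: X Y B.comp_zero_left B.comp_zero_right)
next
  case (6 X Y f g)
  note X = objD[OF 6(1)] and Y = objD[OF 6(2)]
  note f = nat_transD[OF 6(3)[unfolded functor_cat_simps]] and g = nat_transD[OF 6(4)[unfolded functor_cat_simps]]
  show ?case unfolding functor_cat_simps
    by (rule nat_transI) (simp_all add: X(1,2) Y(1,2) f g B.comp_add_left B.comp_add_right B.add_arr)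
next
  case (8 X Y r f)
  note X = objD[OF 8(1)] and Y = objD[OF 8(2)]
  note f = nat_transD[OF 8(4)[unfolded functor_cat_simps]]
  show ?case unfolding functor_cat_simps
    by (rule nat_transI)
      (simp_all add: X(1,2) Y(1,2) f 8(3) B.comp_smult_left B.comp_smult_right B.smult_arr)
next
  case (10 X)
  note X = objD[OF 10]
  show ?case unfolding functor_cat_simps
    by (rule nat_transI) (simp_all add: X(1,2) B.ident_arr B.comp_ident_left B.comp_ident_right)
next
  case (12 X Y Z f g)
  note X = objD[OF 12(1)] and Y = objD[OF 12(2)] and Z = objD[OF 12(3)]
  note f = nat_transD[OF 12(4)[unfolded functor_cat_simps]] and g = nat_transD[OF 12(5)[unfolded functor_cat_simps]]
  show ?case unfolding functor_cat_simps
  proof (rule nat_transI)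
    fix a b h assume o: "a \<in> Obj C" "b \<in> Obj C" and h: "h \<in> arr C a b"
    note ob = X(1)[OF o(1)] X(1)[OF o(2)] Y(1)[OF o(1)] Y(1)[OF o(2)] Z(1)[OF o(1)] Z(1)[OF o(2)]
    show "Comp B (FOb X a) (FOb X b) (FOb Z b)
          ((\<lambda>c\<in>Obj C. Comp B (FOb X c) (FOb Y c) (FOb Z c) (g c) (f c)) b) (FArr X a b h)
        = Comp B (FOb X a) (FOb Z a) (FOb Z b) (FArr Z a b h)
          ((\<lambda>c\<in>Obj C. Comp B (FOb X c) (FOb Y c) (FOb Z c) (g c) (f c)) a)"
      using B.comp_assoc[OF ob(1,2,4,6) X(2)[OF o h] f(1)[OF o(2)] g(1)[OF o(2)]]
        B.comp_assoc[OF ob(1,3,4,6) f(1)[OF o(1)] Y(2)[OF o h] g(1)[OF o(2)]]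
        B.comp_assoc[OF ob(1,3,5,6) f(1)[OF o(1)] g(1)[OF o(1)] Z(2)[OF o h]]
        f(2)[OF o h] g(2)[OF o h] o by simp
  qed (simp_all add: X(1) Y(1) Z(1) f(1) g(1) B.comp_arr)
qed simp_all

sublocale A: pointwise_category R B "FC" "Obj C" FOb
  by (rule functor_pointwise)

lemma linear_functor_cat: "linear_category R FC"
  by (rule A.pointwise_linear_category)

lemma op_functor_obj:
  assumes "F \<in> Obj FC"
  shows "op_functor C F \<in> Obj (functor_cat R (op_cat C) (op_cat B))"
proof (rule functor_catI)
  show "is_linear_functor R (op_cat C) (op_cat B) (op_functor C F)"
    by (simp add: is_linear_functor_def is_functor_def C.ident_arr C.comp_arr C.add_arr C.smult_arr
        objD[OF assms])
qed (simp add: op_functor_def mk_functor_idem)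

end

context functor_setting
begin

lemma op_functor_op_functor:
  assumes "F \<in> Obj FC"
  shows "op_functor (op_cat C) (op_functor C F) = F"
  using functor_setting.op_functor_obj[OF functor_setting_op op_functor_obj[OF assms]] assms
  by (intro functor_cat_Obj_eqI[of _ R C B]) simp_all

lemma op_nat_trans:
  "nat_trans (op_cat C) (op_cat B) (op_functor C F) (op_functor C G) = nat_trans C B G F"
  by (auto simp: nat_trans_def PiE_iff)

lemma anti_iso_functor_cat:
  "anti_iso FC (functor_cat R (op_cat C) (op_cat B)) (op_functor C)"
  unfolding anti_iso_def
proof (intro conjI ballI allI)
  show "Obj (functor_cat R (op_cat C) (op_cat B)) = op_functor C ` Obj FC"
  proof
    show "op_functor C ` Obj FC \<subseteq> Obj (functor_cat R (op_cat C) (op_cat B))"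
      using op_functor_obj by blast
    show "Obj (functor_cat R (op_cat C) (op_cat B)) \<subseteq> op_functor C ` Obj FC"
    proof
      fix F assume F: "F \<in> Obj (functor_cat R (op_cat C) (op_cat B))"
      have "op_functor (op_cat C) F \<in> Obj FC"
        using functor_setting.op_functor_obj[OF functor_setting_op F] by (simp only: op_cat_op_cat)
      moreover have "op_functor C (op_functor (op_cat C) F) = F"
        using functor_setting.op_functor_op_functor[OF functor_setting_op F] by (simp only: op_cat_op_cat)
      ultimately show "F \<in> op_functor C ` Obj FC" by (metis image_eqI)
    qed
  qed
next
  fix F G assume "F \<in> Obj FC" "G \<in> Obj FC"
  show "Hom (functor_cat R (op_cat C) (op_cat B)) (op_functor C F) (op_functor C G)
      = Hom FC G F"
    unfolding functor_cat_def by (simp add: op_nat_trans cong: restrict_cong)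
next
  fix F G H \<beta> \<alpha>
  show "Comp (functor_cat R (op_cat C) (op_cat B)) (op_functor C F) (op_functor C G) (op_functor C H) \<beta> \<alpha>
      = Comp FC H G F \<alpha> \<beta>"
    by (simp cong: restrict_cong)
next
  fix F
  show "Ident (functor_cat R (op_cat C) (op_cat B)) (op_functor C F) = Ident FC F"
    by (simp cong: restrict_cong)
qed

text \<open>The pointwise factorisations are natural because the components of \<open>p\<close> are epimorphisms.\<close>

lemma pointwise_cokernel:
  assumes o: "F \<in> Obj FC" "G \<in> Obj FC" "Q \<in> Obj FC"
    and \<alpha>: "\<alpha> \<in> nat_trans C B F G" and p: "p \<in> nat_trans C B G Q"
    and coker: "\<And>c. c \<in> Obj C \<Longrightarrow> is_cokernel B (FOb F c) (FOb G c) (\<alpha> c) (FOb Q c) (p c)"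
  shows "is_cokernel FC F G \<alpha> Q p"
proof -
  let ?A = "FC"
  note F = objD[OF o(1)] and G = objD[OF o(2)] and Q = objD[OF o(3)]
  note pd = nat_transD[OF p]
  have ck: "Comp B (FOb F c) (FOb G c) (FOb Q c) (p c) (\<alpha> c) = \<zero>\<^bsub>Hom B (FOb F c) (FOb Q c)\<^esub>"
    "\<And>Y g. \<lbrakk>Y \<in> Obj B; g \<in> arr B (FOb G c) Y;
        Comp B (FOb F c) (FOb G c) Y g (\<alpha> c) = \<zero>\<^bsub>Hom B (FOb F c) Y\<^esub>\<rbrakk>
      \<Longrightarrow> \<exists>!h. h \<in> arr B (FOb Q c) Y \<and> Comp B (FOb G c) (FOb Q c) Y h (p c) = g"
    if "c \<in> Obj C" for c
    using coker[OF that] by (simp_all add: is_cokernel_def)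
  have univ: "\<exists>!h. h \<in> arr ?A Q Y \<and> Comp ?A G Q Y h p = g"
    if Y: "Y \<in> Obj ?A" and g: "g \<in> arr ?A G Y" and g0: "Comp ?A F G Y g \<alpha> = \<zero>\<^bsub>Hom ?A F Y\<^esub>" for Y g
  proof -
    note Yd = objD[OF Y]
    note gd = nat_transD[OF g[unfolded functor_cat_simps]]
    have "Comp B (FOb F c) (FOb G c) (FOb Y c) (g c) (\<alpha> c) = \<zero>\<^bsub>Hom B (FOb F c) (FOb Y c)\<^esub>"
      if "c \<in> Obj C" for c
      using fun_cong[OF g0, of c] that by simp
    note ex = ck(2)[OF _ Yd(1) gd(1) this]
    define h where "h = (\<lambda>c\<in>Obj C. THE h. h \<in> arr B (FOb Q c) (FOb Y c) \<and>
        Comp B (FOb G c) (FOb Q c) (FOb Y c) h (p c) = g c)"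
    have h: "h c \<in> arr B (FOb Q c) (FOb Y c)" "Comp B (FOb G c) (FOb Q c) (FOb Y c) (h c) (p c) = g c"
      if c: "c \<in> Obj C" for c
      using theI'[OF ex[OF c c c c]] c by (simp_all add: h_def)
    have hN: "h \<in> nat_trans C B Q Y"
    proof (rule nat_transI)
      fix a b f assume ab: "a \<in> Obj C" "b \<in> Obj C" and f: "f \<in> arr C a b"
      let ?l = "Comp B (FOb Q a) (FOb Q b) (FOb Y b) (h b) (FArr Q a b f)"
      let ?r = "Comp B (FOb Q a) (FOb Y a) (FOb Y b) (FArr Y a b f) (h a)"
      have arr: "?l \<in> arr B (FOb Q a) (FOb Y b)" "?r \<in> arr B (FOb Q a) (FOb Y b)"
        using ab f h by (simp_all add: B.comp_arr Q Yd)
      have l: "Comp B (FOb G a) (FOb Q a) (FOb Y b) ?l (p a)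
          = Comp B (FOb G a) (FOb G b) (FOb Y b) (g b) (FArr G a b f)"
        using B.comp_assoc[OF G(1)[OF ab(1)] Q(1)[OF ab(1)] Q(1)[OF ab(2)] Yd(1)[OF ab(2)]
            pd(1)[OF ab(1)] Q(2)[OF ab f] h(1)[OF ab(2)]]
          B.comp_assoc[OF G(1)[OF ab(1)] G(1)[OF ab(2)] Q(1)[OF ab(2)] Yd(1)[OF ab(2)]
            G(2)[OF ab f] pd(1)[OF ab(2)] h(1)[OF ab(2)]]
          pd(2)[OF ab f] h(2)[OF ab(2)] by simp
      have r: "Comp B (FOb G a) (FOb Q a) (FOb Y b) ?r (p a)
          = Comp B (FOb G a) (FOb Y a) (FOb Y b) (FArr Y a b f) (g a)"
        using B.comp_assoc[OF G(1)[OF ab(1)] Q(1)[OF ab(1)] Yd(1)[OF ab(1)] Yd(1)[OF ab(2)]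
            pd(1)[OF ab(1)] h(1)[OF ab(1)] Yd(2)[OF ab f]] h(2)[OF ab(1)] by simp
      let ?m = "Comp B (FOb G a) (FOb Y a) (FOb Y b) (FArr Y a b f) (g a)"
      have "?m \<in> arr B (FOb G a) (FOb Y b)" using ab f by (simp add: B.comp_arr G Yd gd)
      moreover have "Comp B (FOb F a) (FOb G a) (FOb Y b) ?m (\<alpha> a) = \<zero>\<^bsub>Hom B (FOb F a) (FOb Y b)\<^esub>"
      proof -
        have "Comp B (FOb F a) (FOb G a) (FOb Y b) (Comp B (FOb G a) (FOb Q a) (FOb Y b) ?r (p a)) (\<alpha> a)
            = Comp B (FOb F a) (FOb Q a) (FOb Y b) ?r (Comp B (FOb F a) (FOb G a) (FOb Q a) (p a) (\<alpha> a))"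
          by (rule B.comp_assoc[OF F(1)[OF ab(1)] G(1)[OF ab(1)] Q(1)[OF ab(1)] Yd(1)[OF ab(2)]
            nat_transD(1)[OF \<alpha> ab(1)] pd(1)[OF ab(1)] arr(2), symmetric])
        then show ?thesis
          using r ck(1)[OF ab(1)] arr(2) B.comp_zero_right[OF F(1)[OF ab(1)] Q(1)[OF ab(1)] Yd(1)[OF ab(2)] arr(2)]
          by simp
      qed
      ultimately have "\<exists>!k. k \<in> arr B (FOb Q a) (FOb Y b) \<and> Comp B (FOb G a) (FOb Q a) (FOb Y b) k (p a) = ?m"
        by (rule ck(2)[OF ab(1) Yd(1)[OF ab(2)]])
      then show "?l = ?r"
        by (rule ex1_unique) (simp_all add: arr l r gd(2)[OF ab f])
    qed (simp_all add: h(1), simp add: h_def)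
    have hp: "Comp ?A G Q Y h p = g"
      by (rule extensionalityI[of _ "Obj C"]) (use g h in \<open>auto simp: nat_trans_def PiE_iff\<close>)
    have hu: "h' = h" if h': "h' \<in> nat_trans C B Q Y" "Comp ?A G Q Y h' p = g" for h'
    proof (rule nat_trans_eqI[OF h'(1) hN])
      fix c assume c: "c \<in> Obj C"
      have "Comp B (FOb G c) (FOb Q c) (FOb Y c) (h' c) (p c) = g c"
        using fun_cong[OF h'(2), of c] c by simp
      then show "h' c = h c"
        by (intro ex1_unique[OF ex[OF c c c c]]) (simp_all add: h[OF c] nat_transD(1)[OF h'(1) c])
    qed
    show ?thesis
    proof (rule ex1I[of _ h])
      show "h \<in> arr ?A Q Y \<and> Comp ?A G Q Y h p = g" using hN hp by (simp only: functor_cat_simps(1))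
    next
      fix h' assume "h' \<in> arr ?A Q Y \<and> Comp ?A G Q Y h' p = g"
      then show "h' = h" by (intro hu) (simp_all only: functor_cat_simps(1))
    qed
  qed
  have zero: "Comp ?A F G Q p \<alpha> = \<zero>\<^bsub>Hom ?A F Q\<^esub>" using ck(1) by (auto intro!: restrict_ext)
  show ?thesis unfolding is_cokernel_def
    using \<alpha> p by (intro conjI ballI impI univ zero o) (simp_all only: functor_cat_simps(1))
qed

lemma pointwise_cokernel_exists:
  assumes o: "F \<in> Obj FC" "G \<in> Obj FC"
    and \<alpha>: "\<alpha> \<in> nat_trans C B F G"
  shows "\<exists>Q p. Q \<in> Obj FC \<and> p \<in> nat_trans C B G Q \<and>
    (\<forall>c\<in>Obj C. is_cokernel B (FOb F c) (FOb G c) (\<alpha> c) (FOb Q c) (p c))"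
proof -
  note F = objD[OF o(1)] and G = objD[OF o(2)]
  note ad = nat_transD[OF \<alpha>]
  have "\<forall>c\<in>Obj C. \<exists>t. is_cokernel B (FOb F c) (FOb G c) (\<alpha> c) (fst t) (snd t)"
    using B.ex_cokernel[OF F(1) G(1) ad(1)] by simp
  from bchoice[OF this] obtain t where
    t: "\<And>c. c \<in> Obj C \<Longrightarrow> is_cokernel B (FOb F c) (FOb G c) (\<alpha> c) (fst (t c)) (snd (t c))"
    by blast
  define q p where "q c = fst (t c)" and "p = (\<lambda>c\<in>Obj C. snd (t c))" for c
  have ck: "is_cokernel B (FOb F c) (FOb G c) (\<alpha> c) (q c) (p c)" if "c \<in> Obj C" for c
    using t that by (simp add: q_def p_def)
  then have q: "q c \<in> Obj B" and p: "p c \<in> arr B (FOb G c) (q c)"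
    and pa: "Comp B (FOb F c) (FOb G c) (q c) (p c) (\<alpha> c) = \<zero>\<^bsub>Hom B (FOb F c) (q c)\<^esub>"
    and univ: "\<And>Y g. \<lbrakk>Y \<in> Obj B; g \<in> arr B (FOb G c) Y;
        Comp B (FOb F c) (FOb G c) Y g (\<alpha> c) = \<zero>\<^bsub>Hom B (FOb F c) Y\<^esub>\<rbrakk>
      \<Longrightarrow> \<exists>!h. h \<in> arr B (q c) Y \<and> Comp B (FOb G c) (q c) Y h (p c) = g"
    if "c \<in> Obj C" for c
    using that by (simp_all add: is_cokernel_def)
  have cancel: "h = h'" if c: "c \<in> Obj C" and Y: "Y \<in> Obj B" and h: "h \<in> arr B (q c) Y" "h' \<in> arr B (q c) Y"
    and e: "Comp B (FOb G c) (q c) Y h (p c) = Comp B (FOb G c) (q c) Y h' (p c)" for c Y h h'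
  proof -
    let ?g = "Comp B (FOb G c) (q c) Y h (p c)"
    have z0: "Comp B (FOb F c) (FOb G c) Y ?g (\<alpha> c) = \<zero>\<^bsub>Hom B (FOb F c) Y\<^esub>"
      using B.comp_assoc[OF F(1)[OF c] G(1)[OF c] q[OF c] Y ad(1)[OF c] p[OF c] h(1)] pa[OF c]
        B.comp_zero_right[OF F(1)[OF c] q[OF c] Y h(1)] by simp
    show ?thesis
      by (rule ex1_unique[OF univ[OF c Y B.comp_arr[OF G(1)[OF c] q[OF c] Y p[OF c] h(1)] z0]])
        (simp_all add: h e)
  qed
  define r where "r c d f = Comp B (FOb G c) (FOb G d) (q d) (p d) (FArr G c d f)" for c d f
  have ra: "r c d f \<in> arr B (FOb G c) (q d)" if "c \<in> Obj C" "d \<in> Obj C" "f \<in> arr C c d" for c d f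
    using that by (simp add: r_def B.comp_arr G q p)
  have ex: "\<exists>!h. h \<in> arr B (q c) (q d) \<and> Comp B (FOb G c) (q c) (q d) h (p c) = r c d f"
    if cd: "c \<in> Obj C" "d \<in> Obj C" and f: "f \<in> arr C c d" for c d f
  proof (rule univ[OF cd(1) q[OF cd(2)] ra[OF cd f]])
    show "Comp B (FOb F c) (FOb G c) (q d) (r c d f) (\<alpha> c) = \<zero>\<^bsub>Hom B (FOb F c) (q d)\<^esub>"
      using B.comp_assoc[OF F(1)[OF cd(1)] G(1)[OF cd(1)] G(1)[OF cd(2)] q[OF cd(2)]
          ad(1)[OF cd(1)] G(2)[OF cd f] p[OF cd(2)]]
        B.comp_assoc[OF F(1)[OF cd(1)] F(1)[OF cd(2)] G(1)[OF cd(2)] q[OF cd(2)]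
          F(2)[OF cd f] ad(1)[OF cd(2)] p[OF cd(2)]]
        ad(2)[OF cd f] pa[OF cd(2)] B.comp_zero_left[OF F(1)[OF cd(1)] F(1)[OF cd(2)] q[OF cd(2)] F(2)[OF cd f]]
      by (simp add: r_def)
  qed
  define fa where "fa c d f = (THE h. h \<in> arr B (q c) (q d) \<and> Comp B (FOb G c) (q c) (q d) h (p c) = r c d f)" for c d f
  have fa: "fa c d f \<in> arr B (q c) (q d)" "Comp B (FOb G c) (q c) (q d) (fa c d f) (p c) = r c d f"
    if "c \<in> Obj C" "d \<in> Obj C" "f \<in> arr C c d" for c d f
    using theI'[OF ex[OF that]] by (simp_all add: fa_def)
  have Q: "mk_functor C q fa \<in> Obj FC"
  proof (rule mk_functor_by_generators[OF B.linear_category_axioms C.linear_category_axioms,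
      where J = "\<lambda>_. {()}" and s = "\<lambda>c _. FOb G c" and t = "\<lambda>c _. p c" and r = "\<lambda>c d f _. r c d f"], goal_cases)
    case (4 c Y h h') then show ?case using cancel[of c Y h h'] by simp
  next
    case (7 c j) then show ?case
      by (simp add: r_def G(3) B.comp_ident_right[OF G(1) q p])
  next
    case (8 c d e f g j)
    note o = 8(1-3)
    have "Comp B (FOb G c) (q d) (q e) (fa d e g) (r c d f)
        = Comp B (FOb G c) (FOb G d) (q e) (r d e g) (FArr G c d f)"
      using B.comp_assoc[OF G(1)[OF o(1)] G(1)[OF o(2)] q[OF o(2)] q[OF o(3)] G(2)[OF o(1,2) 8(4)] p[OF o(2)] fa(1)[OF o(2,3) 8(5)]]
        fa(2)[OF o(2,3) 8(5)] by (simp add: r_def)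
    also have "\<dots> = r c e (Comp C c d e g f)"
      using B.comp_assoc[OF G(1)[OF o(1)] G(1)[OF o(2)] G(1)[OF o(3)] q[OF o(3)] G(2)[OF o(1,2) 8(4)] G(2)[OF o(2,3) 8(5)] p[OF o(3)]]
      by (simp add: r_def G(4)[OF o 8(4,5)])
    finally show ?case by simp
  next
    case (9 c d f g j) then show ?case
      by (simp add: r_def G(5) B.comp_add_right[OF G(1) G(1) q] G(2) p)
  next
    case (10 c d a f j) then show ?case
      by (simp add: r_def G(6) B.comp_smult_right[OF G(1) G(1) q] G(2) p)
  qed (simp_all add: q G p fa)
  have "p \<in> nat_trans C B G (mk_functor C q fa)"
    by (rule nat_transI) (simp_all add: p fa r_def, simp add: p_def)
  with Q show ?thesis using ck by (intro exI[of _ "mk_functor C q fa"] exI[of _ p]) simp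
qed

end

context functor_setting
begin

text \<open>Cokernels in the functor category of the opposite categories.\<close>

lemma pointwise_kernel_exists:
  assumes o: "F \<in> Obj FC" "G \<in> Obj FC"
    and \<alpha>: "\<alpha> \<in> nat_trans C B F G"
  shows "\<exists>U j. U \<in> Obj FC \<and> j \<in> nat_trans C B U F \<and>
    (\<forall>c\<in>Obj C. is_kernel B (FOb F c) (FOb G c) (\<alpha> c) (FOb U c) (j c))"
proof -
  note ai = anti_iso_functor_cat
  have "\<alpha> \<in> nat_trans (op_cat C) (op_cat B) (op_functor C G) (op_functor C F)"
    using \<alpha> by (simp add: op_nat_trans)
  from functor_setting.pointwise_cokernel_exists[OF functor_setting_op op_functor_obj[OF o(2)] op_functor_obj[OF o(1)] this]
  obtain Q j where Q: "Q \<in> Obj (functor_cat R (op_cat C) (op_cat B))"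
    and j: "j \<in> nat_trans (op_cat C) (op_cat B) (op_functor C F) Q"
    and ck: "\<And>c. c \<in> Obj C \<Longrightarrow> is_cokernel (op_cat B) (FOb G c) (FOb F c) (\<alpha> c) (FOb Q c) (j c)"
    by auto
  obtain U where U: "U \<in> Obj FC" and QU: "Q = op_functor C U"
    by (rule anti_iso_ObjE[OF ai Q])
  have "is_kernel B (FOb F c) (FOb G c) (\<alpha> c) (FOb U c) (j c)" if c: "c \<in> Obj C" for c
    using ck[OF c] anti_iso_cokernel[OF anti_iso_op_cat[of B] objD(1)[OF o(2) c] objD(1)[OF o(1) c] objD(1)[OF U c], unfolded id_apply] c
    by (simp add: QU)
  moreover have "j \<in> nat_trans C B U F" using j by (simp add: QU op_nat_trans)
  ultimately show ?thesis using U by (intro exI[of _ U] exI[of _ j]) simp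
qed

text \<open>The cokernel of an epimorphism vanishes, and the cokernel is computed pointwise; an arrow of
  \<open>B\<close> whose cokernel vanishes is an epimorphism.\<close>

lemma epi_pointwise:
  assumes o: "F \<in> Obj FC" "G \<in> Obj FC"
    and e: "epi FC F G \<alpha>" and c: "c \<in> Obj C"
  shows "epi B (FOb F c) (FOb G c) (\<alpha> c)"
proof -
  let ?A = "FC"
  interpret A': linear_category R ?A by (rule linear_functor_cat)
  have \<alpha>: "\<alpha> \<in> nat_trans C B F G" using e by (simp add: epi_def)
  obtain Q p where Q: "Q \<in> Obj ?A" and p: "p \<in> nat_trans C B G Q"
    and ck: "\<forall>c\<in>Obj C. is_cokernel B (FOb F c) (FOb G c) (\<alpha> c) (FOb Q c) (p c)"
    using pointwise_cokernel_exists[OF o \<alpha>] by (elim exE conjE)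
  have "Comp ?A F G Q p \<alpha> = Comp ?A F G Q \<zero>\<^bsub>Hom ?A G Q\<^esub> \<alpha>"
    using pointwise_cokernel[OF o Q \<alpha> p] ck A'.comp_zero_left[OF o Q, of \<alpha>] \<alpha>
    unfolding is_cokernel_def by simp
  moreover have "p \<in> arr ?A G Q" "\<zero>\<^bsub>Hom ?A G Q\<^esub> \<in> arr ?A G Q" using p A'.zero_arr[OF o(2) Q] by simp_all
  ultimately have "p = \<zero>\<^bsub>Hom ?A G Q\<^esub>" using e Q unfolding epi_def by blast
  then have p0: "p c = \<zero>\<^bsub>Hom B (FOb G c) (FOb Q c)\<^esub>" using c by simp
  note ob = objD(1)[OF o(1) c] objD(1)[OF o(2) c] objD(1)[OF Q c]
  note ac = nat_transD(1)[OF \<alpha> c]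
  have cancel: "g = h" if Y: "Y \<in> Obj B" and gh: "g \<in> arr B (FOb G c) Y" "h \<in> arr B (FOb G c) Y"
    and eq: "Comp B (FOb F c) (FOb G c) Y g (\<alpha> c) = Comp B (FOb F c) (FOb G c) Y h (\<alpha> c)" for Y g h
  proof -
    interpret GY: module R "Hom B (FOb G c) Y" by (rule B.hom_module[OF ob(2) Y])
    interpret FY: module R "Hom B (FOb F c) Y" by (rule B.hom_module[OF ob(1) Y])
    let ?d = "g \<oplus>\<^bsub>Hom B (FOb G c) Y\<^esub> (\<ominus>\<^bsub>R\<^esub> \<one>\<^bsub>R\<^esub>) \<odot>\<^bsub>Hom B (FOb G c) Y\<^esub> h"
    have m: "(\<ominus>\<^bsub>R\<^esub> \<one>\<^bsub>R\<^esub>) \<odot>\<^bsub>Hom B (FOb G c) Y\<^esub> h \<in> arr B (FOb G c) Y" using gh by simp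
    have "Comp B (FOb F c) (FOb G c) Y ?d (\<alpha> c) = \<zero>\<^bsub>Hom B (FOb F c) Y\<^esub>"
      using FY.add_minus_eq_zero_iff[of "Comp B (FOb F c) (FOb G c) Y g (\<alpha> c)" "Comp B (FOb F c) (FOb G c) Y h (\<alpha> c)"] eq
        B.comp_arr[OF ob(1,2) Y ac]
      by (simp add: B.comp_add_left[OF ob(1,2) Y ac gh(1) m] B.comp_smult_left[OF ob(1,2) Y _ ac gh(2)] gh)
    moreover have "?d \<in> arr B (FOb G c) Y" using gh m by simp
    ultimately have "\<exists>!k. k \<in> arr B (FOb Q c) Y \<and> Comp B (FOb G c) (FOb Q c) Y k (p c) = ?d"
      using is_cokernelD(5)[OF bspec[OF ck c] Y] by simp
    then obtain k where "k \<in> arr B (FOb Q c) Y" "Comp B (FOb G c) (FOb Q c) Y k (p c) = ?d" by (elim ex1E conjE)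
    then have "?d = \<zero>\<^bsub>Hom B (FOb G c) Y\<^esub>" using p0 B.comp_zero_right[OF ob(2,3) Y] by simp
    then show ?thesis using GY.add_minus_eq_zero_iff gh by simp
  qed
  show ?thesis unfolding epi_def by (intro conjI ballI impI ac) (rule cancel)
qed

text \<open>Pointwise, an epimorphism is the cokernel of its kernel.\<close>

lemma epi_functor_is_cokernel:
  assumes o: "F \<in> Obj FC" "G \<in> Obj FC"
    and e: "epi FC F G \<alpha>"
  shows "\<exists>U\<in>Obj FC. \<exists>j. is_cokernel FC U F j G \<alpha>"
proof -
  have \<alpha>: "\<alpha> \<in> nat_trans C B F G" using e by (simp add: epi_def)
  obtain U j where U: "U \<in> Obj FC" and j: "j \<in> nat_trans C B U F"
    and k: "\<forall>c\<in>Obj C. is_kernel B (FOb F c) (FOb G c) (\<alpha> c) (FOb U c) (j c)"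
    using pointwise_kernel_exists[OF o \<alpha>] by (elim exE conjE)
  note ai = anti_iso_op_cat[of B]
  have "is_cokernel B (FOb U c) (FOb F c) (j c) (FOb G c) (\<alpha> c)" if c: "c \<in> Obj C" for c
  proof -
    note ob = objD(1)[OF o(1) c] objD(1)[OF o(2) c] objD(1)[OF U c]
    have "mono (op_cat B) (FOb G c) (FOb F c) (\<alpha> c)"
      using epi_pointwise[OF o e c] anti_iso_mono[OF ai ob(2,1), unfolded id_apply] by simp
    moreover have "is_cokernel (op_cat B) (FOb G c) (FOb F c) (\<alpha> c) (FOb U c) (j c)"
      using k c anti_iso_cokernel[OF ai ob(2,1,3), unfolded id_apply] by simp
    ultimately have "is_kernel (op_cat B) (FOb F c) (FOb U c) (j c) (FOb G c) (\<alpha> c)"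
      using ob by (intro abelian_category.mono_kernel_of_cokernel[OF B.abelian_category_op_cat]) simp_all
    then show ?thesis using anti_iso_kernel[OF ai ob(1,3,2), unfolded id_apply] by simp
  qed
  then have "is_cokernel FC U F j G \<alpha>" by (rule pointwise_cokernel[OF U o j \<alpha>])
  then show ?thesis using U by blast
qed

lemma biproduct_functor_exists:
  assumes o: "F \<in> Obj FC" "G \<in> Obj FC"
  shows "\<exists>S i1 i2 p1 p2. is_biproduct FC F G S i1 i2 p1 p2"
proof -
  note F = objD[OF o(1)] and G = objD[OF o(2)]
  obtain s i1' i2' p1' p2' where
    bp': "\<forall>c\<in>Obj C. is_biproduct B (FOb F c) (FOb G c) (s c) (i1' c) (i2' c) (p1' c) (p2' c)"
    using B.biproduct_choice[of "Obj C" "FOb F" "FOb G"] F(1) G(1) by auto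
  define i1 i2 p1 p2 where "i1 = restrict i1' (Obj C)" and "i2 = restrict i2' (Obj C)"
    and "p1 = restrict p1' (Obj C)" and "p2 = restrict p2' (Obj C)"
  have bp: "is_biproduct B (FOb F c) (FOb G c) (s c) (i1 c) (i2 c) (p1 c) (p2 c)" if "c \<in> Obj C" for c
    using bp' that by (simp add: i1_def i2_def p1_def p2_def)
  then have s: "s c \<in> Obj B" and i: "i1 c \<in> arr B (FOb F c) (s c)" "i2 c \<in> arr B (FOb G c) (s c)"
    and p: "p1 c \<in> arr B (s c) (FOb F c)" "p2 c \<in> arr B (s c) (FOb G c)"
    and eq: "Comp B (FOb F c) (s c) (FOb F c) (p1 c) (i1 c) = Ident B (FOb F c)"
      "Comp B (FOb G c) (s c) (FOb G c) (p2 c) (i2 c) = Ident B (FOb G c)"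
      "Comp B (FOb G c) (s c) (FOb F c) (p1 c) (i2 c) = \<zero>\<^bsub>Hom B (FOb G c) (FOb F c)\<^esub>"
      "Comp B (FOb F c) (s c) (FOb G c) (p2 c) (i1 c) = \<zero>\<^bsub>Hom B (FOb F c) (FOb G c)\<^esub>"
    if "c \<in> Obj C" for c
    using that by (simp_all add: is_biproduct_def)
  have univ: "\<exists>!h. h \<in> arr B (s c) Y \<and> Comp B (FOb F c) (s c) Y h (i1 c) = f \<and> Comp B (FOb G c) (s c) Y h (i2 c) = g"
    if "c \<in> Obj C" "Y \<in> Obj B" "f \<in> arr B (FOb F c) Y" "g \<in> arr B (FOb G c) Y" for c Y f g
    by (rule B.biproduct_coproduct[OF bp[OF that(1)] F(1)[OF that(1)] G(1)[OF that(1)] that(2-4)])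
  have cancel: "h = h'" if c: "c \<in> Obj C" "Y \<in> Obj B" and h: "h \<in> arr B (s c) Y" "h' \<in> arr B (s c) Y"
    and e: "Comp B (FOb F c) (s c) Y h (i1 c) = Comp B (FOb F c) (s c) Y h' (i1 c)"
      "Comp B (FOb G c) (s c) Y h (i2 c) = Comp B (FOb G c) (s c) Y h' (i2 c)" for c Y h h'
    by (rule ex1_unique[OF univ[OF c B.comp_arr[OF F(1)[OF c(1)] s[OF c(1)] c(2) i(1)[OF c(1)] h(1)]
          B.comp_arr[OF G(1)[OF c(1)] s[OF c(1)] c(2) i(2)[OF c(1)] h(1)]]]) (simp_all add: h e)
  define fa where "fa c d f = (THE h. h \<in> arr B (s c) (s d) \<and>
      Comp B (FOb F c) (s c) (s d) h (i1 c) = Comp B (FOb F c) (FOb F d) (s d) (i1 d) (FArr F c d f) \<and>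
      Comp B (FOb G c) (s c) (s d) h (i2 c) = Comp B (FOb G c) (FOb G d) (s d) (i2 d) (FArr G c d f))" for c d f
  have fa: "fa c d f \<in> arr B (s c) (s d)"
      "Comp B (FOb F c) (s c) (s d) (fa c d f) (i1 c) = Comp B (FOb F c) (FOb F d) (s d) (i1 d) (FArr F c d f)"
      "Comp B (FOb G c) (s c) (s d) (fa c d f) (i2 c) = Comp B (FOb G c) (FOb G d) (s d) (i2 d) (FArr G c d f)"
    if cd: "c \<in> Obj C" "d \<in> Obj C" and f: "f \<in> arr C c d" for c d f
    using theI'[OF univ[OF cd(1) s[OF cd(2)] B.comp_arr[OF F(1)[OF cd(1)] F(1)[OF cd(2)] s[OF cd(2)] F(2)[OF cd f] i(1)[OF cd(2)]]
          B.comp_arr[OF G(1)[OF cd(1)] G(1)[OF cd(2)] s[OF cd(2)] G(2)[OF cd f] i(2)[OF cd(2)]]]]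
    by (simp_all add: fa_def)
  let ?s = "\<lambda>c j. if j then FOb F c else FOb G c"
  let ?t = "\<lambda>c j. if j then i1 c else i2 c"
  let ?r = "\<lambda>c d f j. if j then Comp B (FOb F c) (FOb F d) (s d) (i1 d) (FArr F c d f)
      else Comp B (FOb G c) (FOb G d) (s d) (i2 d) (FArr G c d f)"
  have S: "mk_functor C s fa \<in> Obj FC"
  proof (rule mk_functor_by_generators[OF B.linear_category_axioms C.linear_category_axioms,
      where J = "\<lambda>_. UNIV :: bool set" and s = ?s and t = ?t and r = ?r], goal_cases)
    case (4 c Y h h') then show ?case using cancel[of c Y h h'] 4(5)[of True] 4(5)[of False] by simp
  next
    case (7 c j) then show ?case
      by (simp add: F(3) G(3) B.comp_ident_right[OF F(1) s i(1)] B.comp_ident_right[OF G(1) s i(2)])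
  next
    case (8 c d e f g j)
    note o = 8(1-3) and f = 8(4) and g = 8(5)
    show ?case
      using B.comp_assoc[OF F(1)[OF o(1)] F(1)[OF o(2)] s[OF o(2)] s[OF o(3)] F(2)[OF o(1,2) f] i(1)[OF o(2)] fa(1)[OF o(2,3) g]]
        B.comp_assoc[OF F(1)[OF o(1)] F(1)[OF o(2)] F(1)[OF o(3)] s[OF o(3)] F(2)[OF o(1,2) f] F(2)[OF o(2,3) g] i(1)[OF o(3)]]
        B.comp_assoc[OF G(1)[OF o(1)] G(1)[OF o(2)] s[OF o(2)] s[OF o(3)] G(2)[OF o(1,2) f] i(2)[OF o(2)] fa(1)[OF o(2,3) g]]
        B.comp_assoc[OF G(1)[OF o(1)] G(1)[OF o(2)] G(1)[OF o(3)] s[OF o(3)] G(2)[OF o(1,2) f] G(2)[OF o(2,3) g] i(2)[OF o(3)]]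
        fa(2,3)[OF o(2,3) g] F(4)[OF o f g] G(4)[OF o f g] by simp
  next
    case (9 c d f g j) then show ?case
      by (simp add: F(5) G(5) B.comp_add_right[OF F(1) F(1) s] B.comp_add_right[OF G(1) G(1) s] F(2) G(2) i)
  next
    case (10 c d a f j) then show ?case
      by (simp add: F(6) G(6) B.comp_smult_right[OF F(1) F(1) s] B.comp_smult_right[OF G(1) G(1) s] F(2) G(2) i)
  qed (simp_all add: s F(1) G(1) i fa)
  let ?S = "mk_functor C s fa"
  have inj1: "i1 \<in> nat_trans C B F ?S"
    by (rule nat_transI) (simp_all add: i fa, simp add: i1_def)
  have inj2: "i2 \<in> nat_trans C B G ?S"
    by (rule nat_transI) (simp_all add: i fa, simp add: i2_def)
  \<comment> \<open>A family of arrows out of the sums is natural if its restrictions to both summands are.\<close>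
  have pr: "Comp B (s a) (s b) (FOb H b) (p b) (fa a b f) = Comp B (s a) (FOb H a) (FOb H b) (FArr H a b f) (p a)"
    if H: "H \<in> Obj FC" and p: "\<And>c. c \<in> Obj C \<Longrightarrow> p c \<in> arr B (s c) (FOb H c)"
      and x: "x \<in> arr FC F H" "\<And>c. c \<in> Obj C \<Longrightarrow> Comp B (FOb F c) (s c) (FOb H c) (p c) (i1 c) = x c"
      and y: "y \<in> arr FC G H" "\<And>c. c \<in> Obj C \<Longrightarrow> Comp B (FOb G c) (s c) (FOb H c) (p c) (i2 c) = y c"
      and o: "a \<in> Obj C" "b \<in> Obj C" and f: "f \<in> arr C a b" for H p x y a b f
  proof (rule cancel[OF o(1)])
    note H = objD[OF H]
    note xd = nat_transD[OF x(1)[unfolded functor_cat_simps]] and yd = nat_transD[OF y(1)[unfolded functor_cat_simps]]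
    show "FOb H b \<in> Obj B" by (rule H(1)[OF o(2)])
    show "Comp B (FOb F a) (s a) (FOb H b) (Comp B (s a) (s b) (FOb H b) (p b) (fa a b f)) (i1 a)
      = Comp B (FOb F a) (s a) (FOb H b) (Comp B (s a) (FOb H a) (FOb H b) (FArr H a b f) (p a)) (i1 a)"
      using B.comp_assoc[OF F(1)[OF o(1)] s[OF o(1)] s[OF o(2)] H(1)[OF o(2)] i(1)[OF o(1)] fa(1)[OF o f] p[OF o(2)]]
        B.comp_assoc[OF F(1)[OF o(1)] F(1)[OF o(2)] s[OF o(2)] H(1)[OF o(2)] F(2)[OF o f] i(1)[OF o(2)] p[OF o(2)]]
        B.comp_assoc[OF F(1)[OF o(1)] s[OF o(1)] H(1)[OF o(1)] H(1)[OF o(2)] i(1)[OF o(1)] p[OF o(1)] H(2)[OF o f]]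
        fa(2)[OF o f] x(2)[OF o(1)] x(2)[OF o(2)] xd(2)[OF o f] by simp
    show "Comp B (FOb G a) (s a) (FOb H b) (Comp B (s a) (s b) (FOb H b) (p b) (fa a b f)) (i2 a)
      = Comp B (FOb G a) (s a) (FOb H b) (Comp B (s a) (FOb H a) (FOb H b) (FArr H a b f) (p a)) (i2 a)"
      using B.comp_assoc[OF G(1)[OF o(1)] s[OF o(1)] s[OF o(2)] H(1)[OF o(2)] i(2)[OF o(1)] fa(1)[OF o f] p[OF o(2)]]
        B.comp_assoc[OF G(1)[OF o(1)] G(1)[OF o(2)] s[OF o(2)] H(1)[OF o(2)] G(2)[OF o f] i(2)[OF o(2)] p[OF o(2)]]
        B.comp_assoc[OF G(1)[OF o(1)] s[OF o(1)] H(1)[OF o(1)] H(1)[OF o(2)] i(2)[OF o(1)] p[OF o(1)] H(2)[OF o f]]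
        fa(3)[OF o f] y(2)[OF o(1)] y(2)[OF o(2)] yd(2)[OF o f] by simp
  qed (use o f H p in \<open>simp_all add: B.comp_arr[OF s s objD(1)[OF H] fa(1) p] B.comp_arr[OF s objD(1)[OF H] objD(1)[OF H] p objD(2)[OF H]]\<close>)
  interpret FL: linear_category R "FC" by (rule linear_functor_cat)
  have pr1: "Comp B (s a) (s b) (FOb F b) (p1 b) (fa a b f) = Comp B (s a) (FOb F a) (FOb F b) (FArr F a b f) (p1 a)"
    if "a \<in> Obj C" "b \<in> Obj C" "f \<in> arr C a b" for a b f
    by (rule pr[OF o(1) p(1) FL.ident_arr[OF o(1)] _ FL.zero_arr[OF o(2,1)] _ that]) (simp_all add: eq)
  have pr2: "Comp B (s a) (s b) (FOb G b) (p2 b) (fa a b f) = Comp B (s a) (FOb G a) (FOb G b) (FArr G a b f) (p2 a)"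
    if "a \<in> Obj C" "b \<in> Obj C" "f \<in> arr C a b" for a b f
    by (rule pr[OF o(2) p(2) FL.zero_arr[OF o(1,2)] _ FL.ident_arr[OF o(2)] _ that]) (simp_all add: eq)
  have proj1: "p1 \<in> nat_trans C B ?S F"
    by (rule nat_transI) (simp_all add: p pr1, simp add: p1_def)
  have proj2: "p2 \<in> nat_trans C B ?S G"
    by (rule nat_transI) (simp_all add: p pr2, simp add: p2_def)
  have "is_biproduct FC F G ?S i1 i2 p1 p2"
    by (rule A.pointwise_biproduct[OF o S])
      (use inj1 inj2 proj1 proj2 bp in \<open>simp_all only: functor_cat_simps mk_functor_simps\<close>)
  then show ?thesis by (intro exI)
qed

lemma zero_functor_exists: "\<exists>Z. zero_object FC Z"
proof -
  interpret A': linear_category R "FC" by (rule linear_functor_cat)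
  obtain z where z: "zero_object B z" using B.ex_zero_object by (elim exE)
  have zo: "z \<in> Obj B" using z by (simp add: zero_object_def)
  note id = B.zero_object_ident[OF z]
  interpret zz: module R "Hom B z z" by (rule B.hom_module[OF zo zo])
  let ?Z = "mk_functor C (\<lambda>_. z) (\<lambda>_ _ _. Ident B z)"
  have "?Z \<in> Obj FC"
    by (intro functor_catI mk_functor_idem)
      (simp add: is_linear_functor_def is_functor_def zo C.ident_arr C.comp_arr
        C.add_arr C.smult_arr B.ident_arr B.comp_ident_left, simp add: id)
  moreover from this have "zero_object FC ?Z"
    by (rule A'.zero_objectI) (simp add: id cong: restrict_cong)
  ultimately show ?thesis by blast
qed

end

context functor_setting
begin

text \<open>The statements about kernels and monomorphisms are those about cokernels and epimorphisms for
  the opposite categories.\<close>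

theorem abelian_functor_cat: "abelian_category R FC"
proof (intro abelian_category.intro additive_category.intro additive_category_axioms.intro
    abelian_category_axioms.intro linear_functor_cat zero_functor_exists)
  note ai = anti_iso_functor_cat
  let ?A = "FC" and ?A' = "functor_cat R (op_cat C) (op_cat B)"
  fix F G assume o: "F \<in> Obj ?A" "G \<in> Obj ?A"
  then show "\<exists>S i1 i2 p1 p2. is_biproduct ?A F G S i1 i2 p1 p2" by (rule biproduct_functor_exists)
  {
    fix f assume f: "f \<in> arr ?A F G"
    obtain Q p where "Q \<in> Obj ?A" "p \<in> nat_trans C B G Q"
      "\<forall>c\<in>Obj C. is_cokernel B (FOb F c) (FOb G c) (f c) (FOb Q c) (p c)"
      using pointwise_cokernel_exists[OF o f[unfolded functor_cat_simps]] by (elim exE conjE)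
    then have "is_cokernel ?A F G f Q p" using pointwise_cokernel[OF o, of Q f p] f by simp
    then show "\<exists>q p. is_cokernel ?A F G f q p" by (intro exI)
    obtain U j where U: "U \<in> Obj ?A" and j: "j \<in> nat_trans C B U F"
      and k: "\<forall>c\<in>Obj C. is_kernel B (FOb F c) (FOb G c) (f c) (FOb U c) (j c)"
      using pointwise_kernel_exists[OF o f[unfolded functor_cat_simps]] by (elim exE conjE)
    have "is_cokernel ?A' (op_functor C G) (op_functor C F) f (op_functor C U) j"
    proof (rule functor_setting.pointwise_cokernel[OF functor_setting_op op_functor_obj[OF o(2)]
          op_functor_obj[OF o(1)] op_functor_obj[OF U]])
      show "f \<in> nat_trans (op_cat C) (op_cat B) (op_functor C G) (op_functor C F)"
        using f by (simp add: op_nat_trans)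
      show "j \<in> nat_trans (op_cat C) (op_cat B) (op_functor C F) (op_functor C U)"
        using j by (simp add: op_nat_trans)
      fix c assume "c \<in> Obj (op_cat C)"
      then have c: "c \<in> Obj C" by simp
      have "is_cokernel (op_cat B) (FOb G c) (FOb F c) (f c) (FOb U c) (j c)"
        using k c anti_iso_cokernel[OF anti_iso_op_cat[of B] objD(1)[OF o(2) c] objD(1)[OF o(1) c] objD(1)[OF U c],
            unfolded id_apply] by simp
      then show "is_cokernel (op_cat B) (FOb (op_functor C G) c) (FOb (op_functor C F) c) (f c)
          (FOb (op_functor C U) c) (j c)" using c by simp
    qed
    then have "is_kernel ?A F G f U j" using anti_iso_cokernel[OF ai o(2,1) U] by simp
    then show "\<exists>u j. is_kernel ?A F G f u j" by (intro exI)
  }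
  fix f
  show "\<exists>c\<in>Obj ?A. \<exists>g. is_cokernel ?A c F g G f" if "epi ?A F G f"
    by (rule epi_functor_is_cokernel[OF o that])
  show "\<exists>c\<in>Obj ?A. \<exists>g. is_kernel ?A G c g F f" if m: "mono ?A F G f"
  proof -
    have "epi ?A' (op_functor C G) (op_functor C F) f" using anti_iso_epi[OF ai o(2,1)] m by simp
    from functor_setting.epi_functor_is_cokernel[OF functor_setting_op op_functor_obj[OF o(2)]
        op_functor_obj[OF o(1)] this]
    obtain U j where U: "U \<in> Obj ?A'" and j: "is_cokernel ?A' U (op_functor C G) j (op_functor C F) f"
      by (elim bexE exE)
    obtain V where V: "V \<in> Obj ?A" "U = op_functor C V" by (rule anti_iso_ObjE[OF ai U])
    have "is_kernel ?A G V j F f" using j anti_iso_cokernel[OF ai V(1) o(2,1)] V(2) by simp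
    then show ?thesis using V(1) by (intro bexI exI)
  qed
qed

end


section \<open>Sums of copowers and their self-duality\<close>

text \<open>The object \<open>T\<close> is the direct sum of the tensor products \<open>V i \<otimes> X i\<close>, described by the functor
  that it represents. The values of a free functor are such sums; the arrows of \<open>C\<close> that
  relate them act separately, in \<open>is_free\<close>. As a predicate on the category it can be read in
  the opposite category, where it says that \<open>T\<close> represents the product of the functors
  \<open>Y \<mapsto> Hom(V i, B(Y, X i))\<close>.\<close>

definition is_copower_sum ::
  "('k, 'r) ring_scheme \<Rightarrow> ('o, 'n, 'k) lincat \<Rightarrow> 'i set \<Rightarrow> ('i \<Rightarrow> ('k, 'v) module) \<Rightarrow> ('i \<Rightarrow> 'o)
    \<Rightarrow> 'o \<Rightarrow> ('i \<Rightarrow> 'v \<Rightarrow> 'n) \<Rightarrow> bool" where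
  "is_copower_sum R B I V X T u \<longleftrightarrow> T \<in> Obj B \<and>
     (\<forall>i\<in>I. u i \<in> linear_maps R (V i) (Hom B (X i) T)) \<and>
     (\<forall>Y\<in>Obj B. \<forall>v. (\<forall>i\<in>I. v i \<in> linear_maps R (V i) (Hom B (X i) Y)) \<longrightarrow>
       (\<exists>!h. h \<in> arr B T Y \<and> (\<forall>i\<in>I. \<forall>w\<in>carrier (V i). Comp B (X i) T Y h (u i w) = v i w)))"

lemma is_copower_sumD:
  assumes "is_copower_sum R B I V X T u"
  shows "T \<in> Obj B" "i \<in> I \<Longrightarrow> u i \<in> linear_maps R (V i) (Hom B (X i) T)"
    and "\<lbrakk>i \<in> I; w \<in> carrier (V i)\<rbrakk> \<Longrightarrow> u i w \<in> arr B (X i) T"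
    and "\<lbrakk>Y \<in> Obj B; \<And>i. i \<in> I \<Longrightarrow> v i \<in> linear_maps R (V i) (Hom B (X i) Y)\<rbrakk>
      \<Longrightarrow> \<exists>!h. h \<in> arr B T Y \<and> (\<forall>i\<in>I. \<forall>w\<in>carrier (V i). Comp B (X i) T Y h (u i w) = v i w)"
  using assms linear_maps_closed[of "u i" R "V i" "Hom B (X i) T" w]
  unfolding is_copower_sum_def by auto

context linear_category
begin

lemma copower_sum_cancel:
  assumes cs: "is_copower_sum R C I V X T u" and X: "\<And>i. i \<in> I \<Longrightarrow> X i \<in> Obj C"
    and V: "\<And>i. i \<in> I \<Longrightarrow> module R (V i)"
    and Y: "Y \<in> Obj C" and h: "h \<in> arr C T Y" "h' \<in> arr C T Y"
    and eq: "\<And>i w. \<lbrakk>i \<in> I; w \<in> carrier (V i)\<rbrakk> \<Longrightarrow> Comp C (X i) T Y h (u i w) = Comp C (X i) T Y h' (u i w)"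
  shows "h = h'"
proof -
  note d = is_copower_sumD[OF cs]
  have "(\<lambda>w\<in>carrier (V i). Comp C (X i) T Y h (u i w)) \<in> linear_maps R (V i) (Hom C (X i) Y)" if "i \<in> I" for i
    by (rule comp_linear_post[OF X[OF that] d(1) Y h(1) d(2)[OF that] V[OF that]])
  from d(4)[OF Y, of "\<lambda>i. \<lambda>w\<in>carrier (V i). Comp C (X i) T Y h (u i w)", OF this]
  show ?thesis by (rule ex1_unique) (simp_all add: h eq)
qed

text \<open>Finite direct sums are also products; this is the analogue with coefficients in finitely
  generated projective modules. The universal property of \<open>T\<close> provides arrows \<open>p j w : T \<rightarrow> X j\<close>
  with \<open>p j w \<circ> u i v\<close> equal to the multiple \<open>\<beta> i v w\<close> of the identity if \<open>i = j\<close> and zero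
  otherwise. With dual bases \<open>e\<close> and \<open>e'\<close>, the sum of all \<open>u i (e i l) \<circ> p i (e' i l)\<close> is the
  identity of \<open>T\<close>, because it fixes each \<open>u j v\<close>. Therefore an arrow into \<open>T\<close> amounts to its
  coordinates under the \<open>p j w\<close>.\<close>

theorem copower_sum_dual:
  fixes V :: "'i \<Rightarrow> (_, 'v) module" and V' :: "'i \<Rightarrow> (_, 'w) module"
  assumes cs: "is_copower_sum R C I V X T u" and X: "\<And>i. i \<in> I \<Longrightarrow> X i \<in> Obj C"
    and dp: "\<And>i. i \<in> I \<Longrightarrow> dual_pair R (V i) (V' i) (\<beta> i)"
    and fin: "finite {i \<in> I. carrier (V i) \<noteq> {\<zero>\<^bsub>V i\<^esub>}}"
      "\<And>i. \<lbrakk>i \<in> I; carrier (V i) = {\<zero>\<^bsub>V i\<^esub>}\<rbrakk> \<Longrightarrow> carrier (V' i) = {\<zero>\<^bsub>V' i\<^esub>}"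
  shows "\<exists>p. is_copower_sum R (op_cat C) I V' X T p \<and>
    (\<forall>i\<in>I. \<forall>j\<in>I. \<forall>v\<in>carrier (V i). \<forall>w\<in>carrier (V' j).
       Comp C (X i) T (X j) (p j w) (u i v)
         = (if i = j then \<beta> i v w \<odot>\<^bsub>Hom C (X i) (X j)\<^esub> Ident C (X i) else \<zero>\<^bsub>Hom C (X i) (X j)\<^esub>))"
proof -
  note d = is_copower_sumD[OF cs]
  note T = d(1)
  note pr = dual_pairD[OF dp]
  note V = pr(1) note V' = pr(2)
  define S where "S = {i \<in> I. carrier (V i) \<noteq> {\<zero>\<^bsub>V i\<^esub>}}"
  have S: "finite S" "S \<subseteq> I" using fin by (auto simp: S_def)
  define \<delta> where "\<delta> j w i = (\<lambda>v\<in>carrier (V i). if i = j then \<beta> i v w \<odot>\<^bsub>Hom C (X i) (X j)\<^esub> Ident C (X i)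
      else \<zero>\<^bsub>Hom C (X i) (X j)\<^esub>)" for j w i
  have \<delta>: "\<delta> j w i \<in> linear_maps R (V i) (Hom C (X i) (X j))"
    if ij: "i \<in> I" "j \<in> I" and w: "w \<in> carrier (V' j)" for i j w
  proof -
    interpret V: module R "V i" by (rule V[OF ij(1)])
    interpret H: module R "Hom C (X i) (X j)" by (rule hom_module[OF X[OF ij(1)] X[OF ij(2)]])
    interpret J: module R "Hom C (X j) (X j)" by (rule hom_module[OF X[OF ij(2)] X[OF ij(2)]])
    show ?thesis unfolding \<delta>_def
      by (rule linear_mapsI)
        (use ij w in \<open>auto simp: pr(3,5,7) ident_arr[OF X] J.smult_l_distr J.smult_assoc1\<close>)
  qed
  have ex: "\<exists>!h. h \<in> arr C T (X j) \<and> (\<forall>i\<in>I. \<forall>v\<in>carrier (V i). Comp C (X i) T (X j) h (u i v) = \<delta> j w i v)"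
    if "j \<in> I" "w \<in> carrier (V' j)" for j w
    by (rule d(4)[OF X[OF that(1)]]) (rule \<delta>[OF _ that])
  define p where "p j = (\<lambda>w\<in>carrier (V' j). THE h. h \<in> arr C T (X j) \<and>
      (\<forall>i\<in>I. \<forall>v\<in>carrier (V i). Comp C (X i) T (X j) h (u i v) = \<delta> j w i v))" for j
  have pa: "p j w \<in> arr C T (X j)" if "j \<in> I" "w \<in> carrier (V' j)" for j w
    using theI'[OF ex[OF that]] that by (simp add: p_def)
  have pu: "Comp C (X i) T (X j) (p j w) (u i v) = \<delta> j w i v"
    if "j \<in> I" "w \<in> carrier (V' j)" "i \<in> I" "v \<in> carrier (V i)" for i j v w
    using theI'[OF ex[OF that(1,2)]] that by (simp add: p_def)
  have pl: "p j \<in> linear_maps R (V' j) (Hom C T (X j))" if j: "j \<in> I" for j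
  proof -
    interpret V': module R "V' j" by (rule V'[OF j])
    note cc = copower_sum_cancel[OF cs X V X[OF j]]
    show ?thesis
    proof (rule linear_mapsI, goal_cases)
      case (3 w w')
      have s: "w \<oplus>\<^bsub>V' j\<^esub> w' \<in> carrier (V' j)" using 3 by simp
      show ?case
      proof (rule cc)
        fix i v assume iv: "i \<in> I" "v \<in> carrier (V i)"
        interpret H: module R "Hom C (X i) (X j)" by (rule hom_module[OF X[OF iv(1)] X[OF j]])
        interpret J: module R "Hom C (X j) (X j)" by (rule hom_module[OF X[OF j] X[OF j]])
        have "\<delta> j (w \<oplus>\<^bsub>V' j\<^esub> w') i v = \<delta> j w i v \<oplus>\<^bsub>Hom C (X i) (X j)\<^esub> \<delta> j w' i v"
          using iv 3 j by (cases "i = j") (simp_all add: \<delta>_def pr(3,4) J.smult_l_distr ident_arr[OF X])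
        then show "Comp C (X i) T (X j) (p j (w \<oplus>\<^bsub>V' j\<^esub> w')) (u i v)
          = Comp C (X i) T (X j) (p j w \<oplus>\<^bsub>Hom C T (X j)\<^esub> p j w') (u i v)"
          using comp_add_left[OF X[OF iv(1)] T X[OF j] d(3)[OF iv] pa[OF j 3(1)] pa[OF j 3(2)]]
          by (simp add: pu[OF j s iv] pu[OF j 3(1) iv] pu[OF j 3(2) iv])
      qed (use s 3 j in \<open>simp_all add: pa add_arr[OF T X]\<close>)
    next
      case (4 a w)
      have s: "a \<odot>\<^bsub>V' j\<^esub> w \<in> carrier (V' j)" using 4 by simp
      show ?case
      proof (rule cc)
        fix i v assume iv: "i \<in> I" "v \<in> carrier (V i)"
        interpret H: module R "Hom C (X i) (X j)" by (rule hom_module[OF X[OF iv(1)] X[OF j]])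
        interpret J: module R "Hom C (X j) (X j)" by (rule hom_module[OF X[OF j] X[OF j]])
        have "\<delta> j (a \<odot>\<^bsub>V' j\<^esub> w) i v = a \<odot>\<^bsub>Hom C (X i) (X j)\<^esub> \<delta> j w i v"
          using iv 4 j by (cases "i = j") (simp_all add: \<delta>_def pr(3,6) J.smult_assoc1 ident_arr[OF X])
        then show "Comp C (X i) T (X j) (p j (a \<odot>\<^bsub>V' j\<^esub> w)) (u i v)
          = Comp C (X i) T (X j) (a \<odot>\<^bsub>Hom C T (X j)\<^esub> p j w) (u i v)"
          using comp_smult_left[OF X[OF iv(1)] T X[OF j] 4(1) d(3)[OF iv] pa[OF j 4(2)]]
          by (simp add: pu[OF j s iv] pu[OF j 4(2) iv])
      qed (use s 4 j in \<open>simp_all add: pa smult_arr[OF T X]\<close>)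
    qed (use j pa in \<open>simp_all, simp add: p_def\<close>)
  qed
  have "\<forall>i\<in>I. \<exists>t. dual_basis R (V i) (fst t) (fst (snd t)) (\<lambda>l. \<lambda>v\<in>carrier (V i). \<beta> i v (snd (snd t) l)) \<and>
               dual_basis R (V' i) (fst t) (snd (snd t)) (\<lambda>l. \<lambda>w\<in>carrier (V' i). \<beta> i (fst (snd t) l) w)"
  proof
    fix i assume "i \<in> I"
    from dp[OF this] obtain n e e' where
      "dual_basis R (V i) n e (\<lambda>l. \<lambda>v\<in>carrier (V i). \<beta> i v (e' l))"
      "dual_basis R (V' i) n e' (\<lambda>l. \<lambda>w\<in>carrier (V' i). \<beta> i (e l) w)"
      unfolding dual_pair_def by (elim conjE exE)
    then show "\<exists>t. dual_basis R (V i) (fst t) (fst (snd t)) (\<lambda>l. \<lambda>v\<in>carrier (V i). \<beta> i v (snd (snd t) l)) \<and>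
               dual_basis R (V' i) (fst t) (snd (snd t)) (\<lambda>l. \<lambda>w\<in>carrier (V' i). \<beta> i (fst (snd t) l) w)"
      by (intro exI[of _ "(n, e, e')"]) simp
  qed
  from bchoice[OF this] obtain t where
    t: "\<forall>i\<in>I. dual_basis R (V i) (fst (t i)) (fst (snd (t i))) (\<lambda>l. \<lambda>v\<in>carrier (V i). \<beta> i v (snd (snd (t i)) l)) \<and>
      dual_basis R (V' i) (fst (t i)) (snd (snd (t i))) (\<lambda>l. \<lambda>w\<in>carrier (V' i). \<beta> i (fst (snd (t i)) l) w)"
    by (elim exE)
  define n e e' where "n i = fst (t i)" and "e i = fst (snd (t i))" and "e' i = snd (snd (t i))" for i
  have b: "dual_basis R (V i) (n i) (e i) (\<lambda>l. \<lambda>v\<in>carrier (V i). \<beta> i v (e' i l))"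
    and b': "dual_basis R (V' i) (n i) (e' i) (\<lambda>l. \<lambda>w\<in>carrier (V' i). \<beta> i (e i l) w)" if "i \<in> I" for i
    using t that by (simp_all add: n_def e_def e'_def)
  have el: "e i l \<in> carrier (V i)" and el': "e' i l \<in> carrier (V' i)" if "i \<in> I" "l < n i" for i l
    using dual_basisD(2)[OF b[OF that(1)] that(2)] dual_basisD(2)[OF b'[OF that(1)] that(2)] by simp_all
  \<comment> \<open>\<open>mat Y b\<close> is the arrow into \<open>T\<close> with prescribed coordinates \<open>b i w : Y \<rightarrow> X i\<close>.\<close>
  define row where "row Y b i = (\<Oplus>\<^bsub>Hom C Y T\<^esub>l\<in>{..<n i}. Comp C Y (X i) T (u i (e i l)) (b i (e' i l)))"
    for Y and b :: "'i \<Rightarrow> 'w \<Rightarrow> _" and i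
  define mat where "mat Y b = (\<Oplus>\<^bsub>Hom C Y T\<^esub>i\<in>S. row Y b i)" for Y and b :: "'i \<Rightarrow> 'w \<Rightarrow> _"
  have cell: "Comp C Y (X i) T (u i (e i l)) (b i (e' i l)) \<in> arr C Y T"
    if "Y \<in> Obj C" "i \<in> I" "\<And>w. w \<in> carrier (V' i) \<Longrightarrow> b i w \<in> arr C Y (X i)" "l < n i"
    for Y and b :: "'i \<Rightarrow> 'w \<Rightarrow> _" and i l
    by (rule comp_arr[OF that(1) X[OF that(2)] T that(3)[OF el'[OF that(2,4)]] d(3)[OF that(2) el[OF that(2,4)]]])
  have row: "row Y b i \<in> arr C Y T"
    if "Y \<in> Obj C" "i \<in> I" "\<And>w. w \<in> carrier (V' i) \<Longrightarrow> b i w \<in> arr C Y (X i)"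
    for Y and b :: "'i \<Rightarrow> 'w \<Rightarrow> _" and i
  proof -
    interpret YT: module R "Hom C Y T" by (rule hom_module[OF that(1) T])
    show ?thesis unfolding row_def by (rule YT.finsum_closed) (use cell[of Y i b, OF that(1,2)] that(3) in auto)
  qed
  have mat: "mat Y b \<in> arr C Y T"
    if "Y \<in> Obj C" "\<And>i w. \<lbrakk>i \<in> I; w \<in> carrier (V' i)\<rbrakk> \<Longrightarrow> b i w \<in> arr C Y (X i)"
    for Y and b :: "'i \<Rightarrow> 'w \<Rightarrow> _"
  proof -
    interpret YT: module R "Hom C Y T" by (rule hom_module[OF that(1) T])
    show ?thesis unfolding mat_def by (rule YT.finsum_closed) (use row[OF that(1), of _ b] that(2) S(2) in auto)
  qed
  have mat_comp: "Comp C Z Y T (mat Y b) z = mat Z (\<lambda>i w. Comp C Z Y (X i) (b i w) z)"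
    if Y: "Y \<in> Obj C" and ba: "\<And>i w. \<lbrakk>i \<in> I; w \<in> carrier (V' i)\<rbrakk> \<Longrightarrow> b i w \<in> arr C Y (X i)"
      and Z: "Z \<in> Obj C" and z: "z \<in> arr C Z Y"
    for Y Z z and b :: "'i \<Rightarrow> 'w \<Rightarrow> _"
  proof -
    interpret ZT: module R "Hom C Z T" by (rule hom_module[OF Z T])
    have bz: "Comp C Z Y (X i) (b i w) z \<in> arr C Z (X i)" if "i \<in> I" "w \<in> carrier (V' i)" for i w
      by (rule comp_arr[OF Z Y X[OF that(1)] z ba[OF that]])
    have "Comp C Z Y T (row Y b i) z = row Z (\<lambda>i w. Comp C Z Y (X i) (b i w) z) i" if i: "i \<in> I" for i
    proof -
      have "Comp C Z Y T (row Y b i) z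
          = (\<Oplus>\<^bsub>Hom C Z T\<^esub>l\<in>{..<n i}. Comp C Z Y T (Comp C Y (X i) T (u i (e i l)) (b i (e' i l))) z)"
        unfolding row_def by (rule comp_finsum_left[OF Z Y T z]) (use cell[OF Y i, of b] ba[OF i] in simp_all)
      also have "\<dots> = row Z (\<lambda>i w. Comp C Z Y (X i) (b i w) z) i"
        unfolding row_def
        by (rule ZT.finsum_cong')
          (use cell[OF Z i, of "\<lambda>i w. Comp C Z Y (X i) (b i w) z"] bz[OF i] el' el i ba d(3) in
            \<open>simp_all add: comp_assoc[OF Z Y X[OF i] T z]\<close>)
      finally show ?thesis .
    qed
    moreover have "Comp C Z Y T (mat Y b) z = (\<Oplus>\<^bsub>Hom C Z T\<^esub>i\<in>S. Comp C Z Y T (row Y b i) z)"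
      unfolding mat_def by (rule comp_finsum_left[OF Z Y T z S(1)]) (use row[OF Y, of _ b] ba S(2) in auto)
    ultimately show ?thesis
      unfolding mat_def using S(2) row[OF Z, of _ "\<lambda>i w. Comp C Z Y (X i) (b i w) z"] bz
      by (simp, intro ZT.finsum_cong') auto
  qed
  \<comment> \<open>Only one summand contributes to a coordinate.\<close>
  have single: "(\<Oplus>\<^bsub>Hom C Y Z\<^esub>i\<in>S. g i) = g j"
    if YZ: "Y \<in> Obj C" "Z \<in> Obj C" and j: "j \<in> I" and g: "g j \<in> arr C Y Z"
      "\<And>i. \<lbrakk>i \<in> I; i \<noteq> j\<rbrakk> \<Longrightarrow> g i = \<zero>\<^bsub>Hom C Y Z\<^esub>" "j \<notin> S \<Longrightarrow> g j = \<zero>\<^bsub>Hom C Y Z\<^esub>"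
    for Y Z g j
  proof -
    interpret H: module R "Hom C Y Z" by (rule hom_module[OF YZ])
    have "(\<Oplus>\<^bsub>Hom C Y Z\<^esub>i\<in>S. g i) = (\<Oplus>\<^bsub>Hom C Y Z\<^esub>i\<in>S. if j = i then g j else \<zero>\<^bsub>Hom C Y Z\<^esub>)"
      by (rule H.finsum_cong') (use g S(2) in auto)
    also have "\<dots> = g j"
    proof (cases "j \<in> S")
      case True
      then show ?thesis using H.finsum_singleton[OF True S(1), of "\<lambda>_. g j"] g(1) by simp
    next
      case False
      then have "(\<Oplus>\<^bsub>Hom C Y Z\<^esub>i\<in>S. if j = i then g j else \<zero>\<^bsub>Hom C Y Z\<^esub>)
          = (\<Oplus>\<^bsub>Hom C Y Z\<^esub>i\<in>S. \<zero>\<^bsub>Hom C Y Z\<^esub>)"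
        by (intro H.finsum_cong') auto
      then show ?thesis using g(3)[OF False] by simp
    qed
    finally show ?thesis .
  qed
  have outside: "carrier (V j) = {\<zero>\<^bsub>V j\<^esub>}" "carrier (V' j) = {\<zero>\<^bsub>V' j\<^esub>}" if "j \<in> I" "j \<notin> S" for j
    using that fin(2) by (auto simp: S_def)
  have coord: "Comp C Y T (X j) (p j w) (mat Y b) = b j w"
    if Y: "Y \<in> Obj C" and b: "\<And>i. i \<in> I \<Longrightarrow> b i \<in> linear_maps R (V' i) (Hom C Y (X i))"
      and j: "j \<in> I" and w: "w \<in> carrier (V' j)" for Y b j w
  proof -
    note ba = linear_maps_closed[OF b]
    interpret H: module R "Hom C Y (X j)" by (rule hom_module[OF Y X[OF j]])
    have rowi: "Comp C Y T (X j) (p j w) (row Y b i)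
        = (\<Oplus>\<^bsub>Hom C Y (X j)\<^esub>l\<in>{..<n i}. Comp C Y (X i) (X j) (\<delta> j w i (e i l)) (b i (e' i l)))"
      if i: "i \<in> I" for i
    proof -
      have "Comp C Y T (X j) (p j w) (row Y b i)
          = (\<Oplus>\<^bsub>Hom C Y (X j)\<^esub>l\<in>{..<n i}. Comp C Y T (X j) (p j w) (Comp C Y (X i) T (u i (e i l)) (b i (e' i l))))"
        unfolding row_def
        by (rule comp_finsum_right[OF Y T X[OF j] pa[OF j w]]) (use cell[OF Y i, of b] ba[OF i] in simp_all)
      also have "\<dots> = (\<Oplus>\<^bsub>Hom C Y (X j)\<^esub>l\<in>{..<n i}. Comp C Y (X i) (X j) (\<delta> j w i (e i l)) (b i (e' i l)))"
      proof (rule H.finsum_cong')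
        show "(\<lambda>l. Comp C Y (X i) (X j) (\<delta> j w i (e i l)) (b i (e' i l))) \<in> {..<n i} \<rightarrow> arr C Y (X j)"
          using comp_arr[OF Y X[OF i] X[OF j] ba[OF i el'[OF i]] linear_maps_closed[OF \<delta>[OF i j w] el[OF i]]] by auto
        fix l assume "l \<in> {..<n i}"
        then have l: "l < n i" by simp
        show "Comp C Y T (X j) (p j w) (Comp C Y (X i) T (u i (e i l)) (b i (e' i l)))
            = Comp C Y (X i) (X j) (\<delta> j w i (e i l)) (b i (e' i l))"
          using comp_assoc[OF Y X[OF i] T X[OF j] ba[OF i el'[OF i l]] d(3)[OF i el[OF i l]] pa[OF j w]]
          by (simp add: pu[OF j w i el[OF i l]])
      qed simp
      finally show ?thesis .
    qed
    have other: "Comp C Y T (X j) (p j w) (row Y b i) = \<zero>\<^bsub>Hom C Y (X j)\<^esub>" if i: "i \<in> I" and ne: "i \<noteq> j" for i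
    proof -
      have "Comp C Y T (X j) (p j w) (row Y b i) = (\<Oplus>\<^bsub>Hom C Y (X j)\<^esub>l\<in>{..<n i}. \<zero>\<^bsub>Hom C Y (X j)\<^esub>)"
        unfolding rowi[OF i]
        by (rule H.finsum_cong')
          (use ne el[OF i] comp_zero_left[OF Y X[OF i] X[OF j] ba[OF i el'[OF i]]] in \<open>auto simp: \<delta>_def\<close>)
      then show ?thesis by simp
    qed
    have own: "Comp C Y T (X j) (p j w) (row Y b j) = b j w"
    proof -
      have "Comp C Y T (X j) (p j w) (row Y b j)
          = (\<Oplus>\<^bsub>Hom C Y (X j)\<^esub>l\<in>{..<n j}. (\<lambda>w\<in>carrier (V' j). \<beta> j (e j l) w) w \<odot>\<^bsub>Hom C Y (X j)\<^esub> b j (e' j l))"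
        unfolding rowi[OF j]
      proof (rule H.finsum_cong')
        fix l assume "l \<in> {..<n j}"
        then have l: "l < n j" by simp
        note bl = ba[OF j el'[OF j l]]
        show "Comp C Y (X j) (X j) (\<delta> j w j (e j l)) (b j (e' j l))
            = (\<lambda>w\<in>carrier (V' j). \<beta> j (e j l) w) w \<odot>\<^bsub>Hom C Y (X j)\<^esub> b j (e' j l)"
          using comp_smult_left[OF Y X[OF j] X[OF j] pr(3)[OF j el[OF j l] w] bl ident_arr[OF X[OF j]]]
            comp_ident_left[OF Y X[OF j] bl] el[OF j l] w by (simp add: \<delta>_def)
      qed (use ba[OF j] el' el pr(3) j w in auto)
      also have "\<dots> = b j w" by (rule dual_basis_expand[OF b'[OF j] H.module_axioms b[OF j] w, symmetric])
      finally show ?thesis .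
    qed
    have "Comp C Y T (X j) (p j w) (mat Y b) = (\<Oplus>\<^bsub>Hom C Y (X j)\<^esub>i\<in>S. Comp C Y T (X j) (p j w) (row Y b i))"
      unfolding mat_def
      by (rule comp_finsum_right[OF Y T X[OF j] pa[OF j w] S(1)]) (use row[OF Y, of _ b] ba S(2) in auto)
    also have "\<dots> = Comp C Y T (X j) (p j w) (row Y b j)"
    proof (rule single[OF Y X[OF j] j])
      assume "j \<notin> S"
      then have "w = \<zero>\<^bsub>V' j\<^esub>" using outside(2)[OF j] w by simp
      then show "Comp C Y T (X j) (p j w) (row Y b j) = \<zero>\<^bsub>Hom C Y (X j)\<^esub>"
        using own linear_maps_zero[OF V'[OF j] H.module_axioms b[OF j]] by simp
    qed (use own ba[OF j w] other in simp_all)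
    finally show ?thesis using own by simp
  qed
  have resolution: "mat T p = Ident C T"
  proof (rule copower_sum_cancel[OF cs X V T])
    show "mat T p \<in> arr C T T" by (rule mat[of T p, OF T pa])
    show "Ident C T \<in> arr C T T" by (rule ident_arr[OF T])
    fix j v assume j: "j \<in> I" and v: "v \<in> carrier (V j)"
    interpret H: module R "Hom C (X j) T" by (rule hom_module[OF X[OF j] T])
    let ?b = "\<lambda>i w. Comp C (X j) T (X i) (p i w) (u j v)"
    have ba: "?b i w \<in> arr C (X j) (X i)" if "i \<in> I" "w \<in> carrier (V' i)" for i w
      by (rule comp_arr[OF X[OF j] T X[OF that(1)] d(3)[OF j v] pa[OF that]])
    have other: "row (X j) ?b i = \<zero>\<^bsub>Hom C (X j) T\<^esub>" if i: "i \<in> I" and ne: "i \<noteq> j" for i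
    proof -
      have "row (X j) ?b i = (\<Oplus>\<^bsub>Hom C (X j) T\<^esub>l\<in>{..<n i}. \<zero>\<^bsub>Hom C (X j) T\<^esub>)"
        unfolding row_def
        by (rule H.finsum_cong')
          (use ne v pu[OF i el'[OF i] j v] comp_zero_right[OF X[OF j] X[OF i] T d(3)[OF i el[OF i]]] in
            \<open>auto simp: \<delta>_def\<close>)
      then show ?thesis by simp
    qed
    have own: "row (X j) ?b j = u j v"
    proof -
      have "row (X j) ?b j = (\<Oplus>\<^bsub>Hom C (X j) T\<^esub>l\<in>{..<n j}. (\<lambda>v\<in>carrier (V j). \<beta> j v (e' j l)) v \<odot>\<^bsub>Hom C (X j) T\<^esub> u j (e j l))"
        unfolding row_def
      proof (rule H.finsum_cong')
        fix l assume "l \<in> {..<n j}"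
        then have l: "l < n j" by simp
        note ul = d(3)[OF j el[OF j l]]
        show "Comp C (X j) (X j) T (u j (e j l)) (Comp C (X j) T (X j) (p j (e' j l)) (u j v))
            = (\<lambda>v\<in>carrier (V j). \<beta> j v (e' j l)) v \<odot>\<^bsub>Hom C (X j) T\<^esub> u j (e j l)"
          using comp_smult_right[OF X[OF j] X[OF j] T pr(3)[OF j v el'[OF j l]] ident_arr[OF X[OF j]] ul]
            comp_ident_right[OF X[OF j] T ul] pu[OF j el'[OF j l] j v] v by (simp add: \<delta>_def)
      qed (use d(3)[OF j] el' el pr(3) j v in auto)
      also have "\<dots> = u j v" by (rule dual_basis_expand[OF b[OF j] H.module_axioms d(2)[OF j] v, symmetric])
      finally show ?thesis .
    qed
    have "Comp C (X j) T T (mat T p) (u j v) = mat (X j) ?b"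
      by (rule mat_comp[of T p, OF T pa X[OF j] d(3)[OF j v]])
    also have "\<dots> = row (X j) ?b j"
      unfolding mat_def
    proof (rule single[OF X[OF j] T j])
      assume "j \<notin> S"
      then have "v = \<zero>\<^bsub>V j\<^esub>" using outside(1)[OF j] v by simp
      then show "row (X j) ?b j = \<zero>\<^bsub>Hom C (X j) T\<^esub>"
        using own linear_maps_zero[OF V[OF j] H.module_axioms d(2)[OF j]] by simp
    qed (use own d(3)[OF j v] other in simp_all)
    also have "\<dots> = Comp C (X j) T T (Ident C T) (u j v)"
      using own comp_ident_left[OF X[OF j] T d(3)[OF j v]] by simp
    finally show "Comp C (X j) T T (mat T p) (u j v) = Comp C (X j) T T (Ident C T) (u j v)" .
  qed
  have "\<exists>!h. h \<in> arr (op_cat C) T Y \<and>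
      (\<forall>i\<in>I. \<forall>w\<in>carrier (V' i). Comp (op_cat C) (X i) T Y h (p i w) = b i w)"
    if Y: "Y \<in> Obj C" and b: "\<forall>i\<in>I. b i \<in> linear_maps R (V' i) (Hom (op_cat C) (X i) Y)" for Y b
  proof -
    have b: "b i \<in> linear_maps R (V' i) (Hom C Y (X i))" if "i \<in> I" for i using b that by simp
    show ?thesis
    proof (rule ex1I[of _ "mat Y b"])
      show "mat Y b \<in> arr (op_cat C) T Y \<and>
        (\<forall>i\<in>I. \<forall>w\<in>carrier (V' i). Comp (op_cat C) (X i) T Y (mat Y b) (p i w) = b i w)"
        using mat[OF Y, of b] linear_maps_closed[OF b] coord[of Y b, OF Y b] by simp
      fix h assume "h \<in> arr (op_cat C) T Y \<and>
        (\<forall>i\<in>I. \<forall>w\<in>carrier (V' i). Comp (op_cat C) (X i) T Y h (p i w) = b i w)"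
      then have h: "h \<in> arr C Y T" "\<And>i w. \<lbrakk>i \<in> I; w \<in> carrier (V' i)\<rbrakk> \<Longrightarrow> Comp C Y T (X i) (p i w) h = b i w"
        by simp_all
      have "h = Comp C Y T T (mat T p) h" using comp_ident_left[OF Y T h(1)] resolution by simp
      also have "\<dots> = mat Y (\<lambda>i w. Comp C Y T (X i) (p i w) h)" by (rule mat_comp[of T p, OF T pa Y h(1)])
      also have "\<dots> = mat Y b"
      proof -
        interpret H: module R "Hom C Y T" by (rule hom_module[OF Y T])
        have eq: "row Y (\<lambda>i w. Comp C Y T (X i) (p i w) h) i = row Y b i" if i: "i \<in> I" for i
          unfolding row_def
          by (rule H.finsum_cong') (use cell[OF Y i, of b] linear_maps_closed[OF b[OF i]] h(2)[OF i el'[OF i]] in auto)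
        show ?thesis unfolding mat_def
          by (rule H.finsum_cong') (use eq row[OF Y, of _ b] linear_maps_closed[OF b] S(2) in auto)
      qed
      finally show "h = mat Y b" .
    qed
  qed
  then have "is_copower_sum R (op_cat C) I V' X T p"
    using T pl unfolding is_copower_sum_def by simp
  moreover have "Comp C (X i) T (X j) (p j w) (u i v)
         = (if i = j then \<beta> i v w \<odot>\<^bsub>Hom C (X i) (X j)\<^esub> Ident C (X i) else \<zero>\<^bsub>Hom C (X i) (X j)\<^esub>)"
    if "i \<in> I" "j \<in> I" "v \<in> carrier (V i)" "w \<in> carrier (V' j)" for i j v w
    using pu[OF that(2,4,1,3)] that by (simp add: \<delta>_def)
  ultimately show ?thesis by blast
qed

end


section \<open>Tensor products with modules and their direct sums\<close>

lemma ring_cat_simps [simp]: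
  "Obj (ring_cat R) = {()}" "Hom (ring_cat R) a b = self_module R"
  "Comp (ring_cat R) a b c g f = g \<otimes>\<^bsub>R\<^esub> f" "Ident (ring_cat R) a = \<one>\<^bsub>R\<^esub>"
  by (simp_all add: ring_cat_def)

lemma linear_category_ring_cat:
  assumes "cring R" shows "linear_category R (ring_cat R)"
proof -
  interpret R: cring R by fact
  show ?thesis
    by (intro linear_category.intro linear_category_axioms.intro assms)
      (auto simp: module_self_module assms R.m_assoc R.l_distr R.r_distr R.m_lcomm)
qed

lemma dual_basis_self_module:
  assumes "cring R"
  shows "dual_basis R (self_module R) (Suc 0) (\<lambda>_. \<one>\<^bsub>R\<^esub>) (\<lambda>_. \<lambda>x\<in>carrier R. x)"
proof -
  interpret R: cring R by fact
  interpret S: module R "self_module R" by (rule module_self_module[OF assms])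
  have "(\<lambda>x\<in>carrier R. x) \<in> linear_maps R (self_module R) (self_module R)"
    by (rule linear_mapsI) auto
  moreover have "(\<Oplus>\<^bsub>self_module R\<^esub>l\<in>{..<Suc 0}. f l) = f 0" if "f 0 \<in> carrier R" for f
  proof -
    have "{..<Suc 0} = insert 0 {}" by auto
    then show ?thesis using that by (simp add: S.finsum_insert)
  qed
  ultimately show ?thesis by (simp add: dual_basis_def S.module_axioms)
qed

lemma scalar_functor_simps [simp]:
  "FOb (scalar_functor R B X) () = X"
  "r \<in> carrier R \<Longrightarrow> FArr (scalar_functor R B X) () () r = r \<odot>\<^bsub>Hom B X X\<^esub> Ident B X"
  by (simp_all add: scalar_functor_def mk_functor_def)

lemma scalar_weight_simps:
  "r \<in> carrier R \<Longrightarrow> FArr (scalar_functor R (mod_cat R) V) () () r = (\<lambda>x\<in>carrier V. r \<odot>\<^bsub>V\<^esub> x)"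
  by (simp add: mod_cat_def cong: restrict_cong)

lemma right_module_scalar:
  assumes "module R V"
  shows "right_module R (ring_cat R) (scalar_functor R (mod_cat R) V)"
proof -
  interpret V: module R V by fact
  have lin: "(\<lambda>x\<in>carrier V. r \<odot>\<^bsub>V\<^esub> x) \<in> linear_maps R V V" if "r \<in> carrier R" for r
    by (rule linear_mapsI)
      (use that in \<open>auto simp: V.smult_r_distr V.smult_assoc1[symmetric] V.R.m_comm\<close>)
  show ?thesis
    by (intro right_module.intro right_module_axioms.intro linear_category_ring_cat V.is_cring)
      (simp_all add: scalar_weight_simps lin assms V.smult_l_distr V.smult_assoc1 del: scalar_functor_simps(2))
qed

context linear_category
begin

lemma scalar_functor_linear:
  assumes X: "X \<in> Obj C"
  shows "is_linear_functor R (ring_cat R) C (scalar_functor R C X)"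
proof -
  interpret H: module R "Hom C X X" by (rule hom_module[OF X X])
  note id = ident_arr[OF X]
  have "Comp C X X X (r \<odot>\<^bsub>Hom C X X\<^esub> Ident C X) (s \<odot>\<^bsub>Hom C X X\<^esub> Ident C X)
      = r \<odot>\<^bsub>Hom C X X\<^esub> (s \<odot>\<^bsub>Hom C X X\<^esub> Ident C X)" if "r \<in> carrier R" "s \<in> carrier R" for r s
    using comp_smult_left[OF X X X that(1) smult_arr[OF X X that(2) id] id]
      comp_ident_left[OF X X smult_arr[OF X X that(2) id]] by simp
  then show ?thesis
    using id by (simp add: is_linear_functor_def is_functor_def X H.smult_l_distr H.smult_assoc1)
qed

lemma scalar_diagram:
  assumes "module R V" "X \<in> Obj C"
  shows "weighted_diagram R (ring_cat R) C (scalar_functor R (mod_cat R) V) (scalar_functor R C X)"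
  by (intro weighted_diagram.intro weighted_diagram_axioms.intro right_module_scalar assms
      linear_category_axioms scalar_functor_linear)

text \<open>Naturality with respect to the scalars is part of linearity.\<close>

lemma scalar_cocone_iff:
  assumes V: "module R V" and X: "X \<in> Obj C"
  shows "weighted_cocone R (ring_cat R) C (scalar_functor R (mod_cat R) V) (scalar_functor R C X) Y v
    \<longleftrightarrow> Y \<in> Obj C \<and> v () \<in> linear_maps R V (Hom C X Y)"
proof -
  interpret V: module R V by fact
  have "v () (FArr (scalar_functor R (mod_cat R) V) () () r w)
      = Comp C X X Y (v () w) (FArr (scalar_functor R C X) () () r)"
    if Y: "Y \<in> Obj C" and v: "v () \<in> linear_maps R V (Hom C X Y)" and r: "r \<in> carrier R" and w: "w \<in> carrier V" for r w
    using linear_maps_closed[OF v w] linear_maps_smult[OF v r w] r w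
      comp_smult_right[OF X X Y r ident_arr[OF X] linear_maps_closed[OF v w]]
      comp_ident_right[OF X Y linear_maps_closed[OF v w]]
    by (simp add: scalar_weight_simps del: scalar_functor_simps(2)) (simp add: r)
  then show ?thesis by (auto simp: weighted_cocone_def)
qed

end

definition tensor_k_in ::
  "('k, 'r) ring_scheme \<Rightarrow> ('o, 'n, 'k) lincat \<Rightarrow> ('k, 'v) module \<Rightarrow> 'o \<Rightarrow> 'v \<Rightarrow> 'n" where
  "tensor_k_in R B V X =
     tensor_in R (ring_cat R) B (scalar_functor R (mod_cat R) V) (scalar_functor R B X) ()"

text \<open>The structure map of the \<open>i\<close>-th summand of the direct sum of the copowers \<open>V i \<otimes> X i\<close>.\<close>

definition copower_sum_in ::
  "('k, 'r) ring_scheme \<Rightarrow> ('o, 'n, 'k) lincat \<Rightarrow> 'i set \<Rightarrow> ('i \<Rightarrow> ('k, 'v) module) \<Rightarrow> ('i \<Rightarrow> 'o)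
    \<Rightarrow> 'i \<Rightarrow> 'v \<Rightarrow> 'n" where
  "copower_sum_in R B I V X i w =
     Comp B (X i) (tensor_k_ob R B (V i) (X i)) (coproduct_ob B I (\<lambda>i. tensor_k_ob R B (V i) (X i)))
       (coproduct_in B I (\<lambda>i. tensor_k_ob R B (V i) (X i)) i) (tensor_k_in R B (V i) (X i) w)"

lemma coproduct_is_coproduct:
  assumes "\<exists>S j. is_coproduct B I X S j"
  shows "is_coproduct B I X (coproduct_ob B I X) (coproduct_in B I X)"
proof -
  obtain S j where "is_coproduct B I X S j" using assms by (elim exE)
  then have "case (S, j) of (S, j) \<Rightarrow> is_coproduct B I X S j" by simp
  then have "case coproduct B I X of (S, j) \<Rightarrow> is_coproduct B I X S j"
    unfolding coproduct_def by (rule someI)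
  then show ?thesis by (simp add: coproduct_ob_def coproduct_in_def split_beta)
qed

context abelian_category
begin

lemma scalar_colimit_exists:
  assumes V: "fg_projective R V" and X: "X \<in> Obj C"
  shows "\<exists>T u. is_weighted_colimit R (ring_cat R) C (scalar_functor R (mod_cat R) V) (scalar_functor R C X) T u"
proof -
  obtain n e \<epsilon> where b: "dual_basis R V n e \<epsilon>" using fg_projective_dual_basis[OF V] by (elim exE)
  show ?thesis
  proof (rule weighted_diagram.weighted_colimit_exists[OF scalar_diagram[OF dual_basisD(1)[OF b] X]])
    show "abelian_category R C" by (rule abelian_category_axioms)
    show "locally_bounded (ring_cat R)" by (simp add: locally_bounded_def)
    show "\<exists>n e \<epsilon>. dual_basis R (FOb (scalar_functor R (mod_cat R) V) c) n e \<epsilon>" for c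
      using b by (cases c) (auto intro!: exI)
    show "\<exists>n e \<epsilon>. dual_basis R (Hom (ring_cat R) c d) n e \<epsilon>" for c d
      using dual_basis_self_module[OF is_cring] by (auto intro!: exI)
  qed simp
qed

lemma tensor_k_colimit:
  assumes "fg_projective R V" "X \<in> Obj C"
  shows "is_weighted_colimit R (ring_cat R) C (scalar_functor R (mod_cat R) V) (scalar_functor R C X)
    (tensor_k_ob R C V X) (tensor_in R (ring_cat R) C (scalar_functor R (mod_cat R) V) (scalar_functor R C X))"
  unfolding tensor_k_ob_def
  by (rule tensor_is_weighted_colimit[OF scalar_colimit_exists[OF assms]])

lemma tensor_k_universal:
  assumes V: "fg_projective R V" and X: "X \<in> Obj C"
  shows "tensor_k_ob R C V X \<in> Obj C"
    and "tensor_k_in R C V X \<in> linear_maps R V (Hom C X (tensor_k_ob R C V X))"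
    and "\<lbrakk>Y \<in> Obj C; v \<in> linear_maps R V (Hom C X Y)\<rbrakk> \<Longrightarrow>
      \<exists>!h. h \<in> arr C (tensor_k_ob R C V X) Y \<and>
        (\<forall>w\<in>carrier V. Comp C X (tensor_k_ob R C V X) Y h (tensor_k_in R C V X w) = v w)"
proof -
  have Vm: "module R V" using V by (simp add: fg_projective_def)
  note cd = is_weighted_colimitD[OF tensor_k_colimit[OF V X]]
  note iff = scalar_cocone_iff[OF Vm X]
  show "tensor_k_ob R C V X \<in> Obj C" 
    "tensor_k_in R C V X \<in> linear_maps R V (Hom C X (tensor_k_ob R C V X))"
    using cd(1)[unfolded iff] by (simp_all add: tensor_k_in_def)
  assume "Y \<in> Obj C" "v \<in> linear_maps R V (Hom C X Y)"
  then have "weighted_cocone R (ring_cat R) C (scalar_functor R (mod_cat R) V) (scalar_functor R C X) Y (\<lambda>_. v)"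
    by (simp add: iff)
  from cd(2)[OF this] show "\<exists>!h. h \<in> arr C (tensor_k_ob R C V X) Y \<and>
        (\<forall>w\<in>carrier V. Comp C X (tensor_k_ob R C V X) Y h (tensor_k_in R C V X w) = v w)"
    by (rule ex1_conj_cong) (simp add: tensor_k_in_def eq_commute)
qed

lemma tensor_k_map:
  assumes V: "fg_projective R V" and V': "fg_projective R V'" and X: "X \<in> Obj C" "X' \<in> Obj C"
    and \<tau>: "\<tau> \<in> linear_maps R V V'" and g: "g \<in> arr C X X'"
  shows "tensor_k_map R C V V' \<tau> X X' g \<in> arr C (tensor_k_ob R C V X) (tensor_k_ob R C V' X')"
    and "w \<in> carrier V \<Longrightarrow>
      Comp C X (tensor_k_ob R C V X) (tensor_k_ob R C V' X') (tensor_k_map R C V V' \<tau> X X' g) (tensor_k_in R C V X w)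
      = Comp C X X' (tensor_k_ob R C V' X') (tensor_k_in R C V' X' (\<tau> w)) g"
proof -
  have m: "module R V" "module R V'" using V V' by (simp_all add: fg_projective_def)
  have w: "weight_map R (ring_cat R) (scalar_functor R (mod_cat R) V) (scalar_functor R (mod_cat R) V') (\<lambda>_. \<tau>)"
    using \<tau> module.smult_closed[OF m(1)] linear_maps_smult[OF \<tau>] linear_maps_closed[OF \<tau>]
    by (auto simp: weight_map_def scalar_weight_simps simp del: scalar_functor_simps(2))
  have nt: "(\<lambda>_. g) \<in> nat_trans (ring_cat R) C (scalar_functor R C X) (scalar_functor R C X')"
    by (rule nat_transI)
      (use g in \<open>simp_all add: comp_smult_right[OF X(1,1,2)] comp_smult_left[OF X(1,2,2)]
        comp_ident_left[OF X] comp_ident_right[OF X] ident_arr X\<close>)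
  note u = weighted_diagram.tensor_map_universal[OF scalar_diagram[OF m(1) X(1)] scalar_functor_linear[OF X(2)] w nt
      scalar_colimit_exists[OF V X(1)] scalar_colimit_exists[OF V' X(2)]]
  show "tensor_k_map R C V V' \<tau> X X' g \<in> arr C (tensor_k_ob R C V X) (tensor_k_ob R C V' X')"
    using u(1) by (simp add: tensor_k_map_def tensor_k_ob_def)
  show "Comp C X (tensor_k_ob R C V X) (tensor_k_ob R C V' X') (tensor_k_map R C V V' \<tau> X X' g) (tensor_k_in R C V X w)
      = Comp C X X' (tensor_k_ob R C V' X') (tensor_k_in R C V' X' (\<tau> w)) g" if "w \<in> carrier V"
    using u(2)[of "()" w] that by (simp add: tensor_k_map_def tensor_k_ob_def tensor_k_in_def)
qed

text \<open>The tensor product with a zero module is initial, so almost all summands are.\<close>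

lemma copower_coproduct_exists:
  assumes V: "\<And>i. i \<in> I \<Longrightarrow> fg_projective R (V i)" and X: "\<And>i. i \<in> I \<Longrightarrow> X i \<in> Obj C"
    and fin: "finite {i \<in> I. carrier (V i) \<noteq> {\<zero>\<^bsub>V i\<^esub>}}"
  shows "\<exists>S j. is_coproduct C I (\<lambda>i. tensor_k_ob R C (V i) (X i)) S j"
proof (rule almost_finite_coproduct[OF fin])
  note tu = tensor_k_universal[OF V X]
  fix i Y assume i: "i \<in> I - {i \<in> I. carrier (V i) \<noteq> {\<zero>\<^bsub>V i\<^esub>}}" and Y: "Y \<in> Obj C"
  then have iI: "i \<in> I" and z: "carrier (V i) = {\<zero>\<^bsub>V i\<^esub>}" by auto
  have Vm: "module R (V i)" using V[OF iI] by (simp add: fg_projective_def)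
  interpret V: module R "V i" by (rule Vm)
  interpret H: module R "Hom C (X i) Y" by (rule hom_module[OF X[OF iI] Y])
  let ?v = "\<lambda>w\<in>carrier (V i). \<zero>\<^bsub>Hom C (X i) Y\<^esub>"
  have "?v \<in> linear_maps R (V i) (Hom C (X i) Y)" by (rule linear_mapsI) auto
  note ex = tu(3)[OF iI iI Y this]
  have "\<exists>!f. f \<in> arr C (tensor_k_ob R C (V i) (X i)) Y \<and> True"
  proof (rule ex1_conj_cong[OF ex])
    fix h assume h: "h \<in> arr C (tensor_k_ob R C (V i) (X i)) Y"
    have "Comp C (X i) (tensor_k_ob R C (V i) (X i)) Y h (tensor_k_in R C (V i) (X i) \<zero>\<^bsub>V i\<^esub>) = \<zero>\<^bsub>Hom C (X i) Y\<^esub>"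
      using linear_maps_zero[OF Vm hom_module[OF X[OF iI] tu(1)[OF iI iI]] tu(2)[OF iI iI]]
        comp_zero_right[OF X[OF iI] tu(1)[OF iI iI] Y h] by simp
    then show "True \<longleftrightarrow> (\<forall>w\<in>carrier (V i).
        Comp C (X i) (tensor_k_ob R C (V i) (X i)) Y h (tensor_k_in R C (V i) (X i) w) = ?v w)"
      using z by simp
  qed
  then show "\<exists>!f. f \<in> arr C (tensor_k_ob R C (V i) (X i)) Y" by simp
qed (use tensor_k_universal(1)[OF V X] in auto)

lemma copower_sum_in_universal:
  assumes V: "\<And>i. i \<in> I \<Longrightarrow> fg_projective R (V i)" and X: "\<And>i. i \<in> I \<Longrightarrow> X i \<in> Obj C"
    and fin: "finite {i \<in> I. carrier (V i) \<noteq> {\<zero>\<^bsub>V i\<^esub>}}"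
  shows "is_copower_sum R C I V X (coproduct_ob C I (\<lambda>i. tensor_k_ob R C (V i) (X i)))
    (\<lambda>i. \<lambda>w\<in>carrier (V i). copower_sum_in R C I V X i w)"
proof -
  note tu = tensor_k_universal[OF V X]
  let ?T = "\<lambda>i. tensor_k_ob R C (V i) (X i)"
  let ?S = "coproduct_ob C I ?T" and ?j = "coproduct_in C I ?T"
  have Sc: "is_coproduct C I ?T ?S ?j"
    by (rule coproduct_is_coproduct, rule copower_coproduct_exists) (simp_all add: V X fin)
  note Sd = is_coproductD[OF Sc]
  have Vm: "module R (V i)" if "i \<in> I" for i using V[OF that] by (simp add: fg_projective_def)
  note ta = linear_maps_closed[OF tu(2)]
  have "\<exists>!h. h \<in> arr C ?S Y \<and> (\<forall>i\<in>I. \<forall>w\<in>carrier (V i).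
      Comp C (X i) ?S Y h ((\<lambda>w\<in>carrier (V i). copower_sum_in R C I V X i w) w) = v i w)"
    if Y: "Y \<in> Obj C" and v: "\<forall>i\<in>I. v i \<in> linear_maps R (V i) (Hom C (X i) Y)" for Y v
  proof -
    let ?P = "\<lambda>i h. h \<in> arr C (?T i) Y \<and> (\<forall>w\<in>carrier (V i). Comp C (X i) (?T i) Y h (tensor_k_in R C (V i) (X i) w) = v i w)"
    have ex: "\<exists>!h. ?P i h" if "i \<in> I" for i
      using tu(3)[OF that that Y] v that by simp
    define f where "f i = (THE h. ?P i h)" for i
    have f: "?P i (f i)" if "i \<in> I" for i
      using theI'[OF ex[OF that]] unfolding f_def .
    have fa: "f i \<in> arr C (?T i) Y" if "i \<in> I" for i using f[OF that] by simp
    have eq: "Comp C (X i) ?S Y h (copower_sum_in R C I V X i w)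
        = Comp C (X i) (?T i) Y (Comp C (?T i) ?S Y h (?j i)) (tensor_k_in R C (V i) (X i) w)"
      if "h \<in> arr C ?S Y" "i \<in> I" "w \<in> carrier (V i)" for h i w
      unfolding copower_sum_in_def
      by (rule comp_assoc[OF X[OF that(2)] tu(1)[OF that(2,2)] Sd(1) Y ta[OF that(2,2,3)] Sd(2)[OF that(2)] that(1)])
    have iff: "(\<forall>i\<in>I. \<forall>w\<in>carrier (V i).
        Comp C (X i) ?S Y h ((\<lambda>w\<in>carrier (V i). copower_sum_in R C I V X i w) w) = v i w)
      \<longleftrightarrow> (\<forall>i\<in>I. Comp C (?T i) ?S Y h (?j i) = f i)" if h: "h \<in> arr C ?S Y" for h
    proof -
      have "(\<forall>w\<in>carrier (V i). Comp C (X i) ?S Y h ((\<lambda>w\<in>carrier (V i). copower_sum_in R C I V X i w) w) = v i w)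
        \<longleftrightarrow> Comp C (?T i) ?S Y h (?j i) = f i" if i: "i \<in> I" for i
      proof -
        note hj = comp_arr[OF tu(1)[OF i i] Sd(1) Y Sd(2)[OF i] h]
        show ?thesis
        proof
          assume "\<forall>w\<in>carrier (V i). Comp C (X i) ?S Y h ((\<lambda>w\<in>carrier (V i). copower_sum_in R C I V X i w) w) = v i w"
          then have "?P i (Comp C (?T i) ?S Y h (?j i))" using hj by (simp add: eq[OF h i])
          from ex1_unique[OF ex[OF i] this f[OF i]] show "Comp C (?T i) ?S Y h (?j i) = f i" .
        next
          assume "Comp C (?T i) ?S Y h (?j i) = f i"
          then show "\<forall>w\<in>carrier (V i). Comp C (X i) ?S Y h ((\<lambda>w\<in>carrier (V i). copower_sum_in R C I V X i w) w) = v i w"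
            using f[OF i] by (simp add: eq[OF h i])
        qed
      qed
      then show ?thesis by simp
    qed
    from ex1_conj_cong[OF Sd(3)[OF Y, of f, OF fa] iff] show ?thesis .
  qed
  moreover have "(\<lambda>w\<in>carrier (V i). copower_sum_in R C I V X i w) \<in> linear_maps R (V i) (Hom C (X i) ?S)"
    if i: "i \<in> I" for i
    unfolding copower_sum_in_def
    by (rule comp_linear_post[OF X[OF i] tu(1)[OF i i] Sd(1) Sd(2)[OF i] tu(2)[OF i i] Vm[OF i]])
  ultimately show ?thesis using Sd(1) unfolding is_copower_sum_def by simp
qed

lemma copower_sum_map:
  assumes V: "\<And>i. i \<in> I \<Longrightarrow> fg_projective R (V i)" and X: "\<And>i. i \<in> I \<Longrightarrow> X i \<in> Obj C"
    and fin: "finite {i \<in> I. carrier (V i) \<noteq> {\<zero>\<^bsub>V i\<^esub>}}"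
    and V': "\<And>i. i \<in> I \<Longrightarrow> fg_projective R (V' i)" and X': "\<And>i. i \<in> I \<Longrightarrow> X' i \<in> Obj C"
    and fin': "finite {i \<in> I. carrier (V' i) \<noteq> {\<zero>\<^bsub>V' i\<^esub>}}"
    and \<tau>: "\<And>i. i \<in> I \<Longrightarrow> \<tau> i \<in> linear_maps R (V i) (V' i)" and g: "\<And>i. i \<in> I \<Longrightarrow> g i \<in> arr C (X i) (X' i)"
  defines "S \<equiv> coproduct_ob C I (\<lambda>i. tensor_k_ob R C (V i) (X i))"
    and "S' \<equiv> coproduct_ob C I (\<lambda>i. tensor_k_ob R C (V' i) (X' i))"
    and "m \<equiv> coproduct_map C I (\<lambda>i. tensor_k_ob R C (V i) (X i)) (\<lambda>i. tensor_k_ob R C (V' i) (X' i))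
      (\<lambda>i. tensor_k_map R C (V i) (V' i) (\<tau> i) (X i) (X' i) (g i))"
  shows "m \<in> arr C S S'"
    and "\<lbrakk>i \<in> I; w \<in> carrier (V i)\<rbrakk> \<Longrightarrow> Comp C (X i) S S' m (copower_sum_in R C I V X i w)
      = Comp C (X i) (X' i) S' (copower_sum_in R C I V' X' i (\<tau> i w)) (g i)"
proof -
  note tu = tensor_k_universal[OF V X] and tu' = tensor_k_universal[OF V' X']
  let ?T = "\<lambda>i. tensor_k_ob R C (V i) (X i)" and ?T' = "\<lambda>i. tensor_k_ob R C (V' i) (X' i)"
  let ?j = "coproduct_in C I ?T" and ?j' = "coproduct_in C I ?T'"
  let ?f = "\<lambda>i. tensor_k_map R C (V i) (V' i) (\<tau> i) (X i) (X' i) (g i)"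
  have Sc: "is_coproduct C I ?T S ?j"
    unfolding S_def by (rule coproduct_is_coproduct, rule copower_coproduct_exists) (simp_all add: V X fin)
  have Sc': "is_coproduct C I ?T' S' ?j'"
    unfolding S'_def by (rule coproduct_is_coproduct, rule copower_coproduct_exists) (simp_all add: V' X' fin')
  note Sd = is_coproductD[OF Sc] note Sd' = is_coproductD[OF Sc']
  note f = tensor_k_map[OF V V' X X' \<tau> g]
  note ta = linear_maps_closed[OF tu(2)] and ta' = linear_maps_closed[OF tu'(2)]
  have "\<exists>!h. h \<in> arr C S S' \<and> (\<forall>i\<in>I. Comp C (?T i) S S' h (?j i) = Comp C (?T i) (?T' i) S' (?j' i) (?f i))"
    by (rule Sd(3)[OF Sd'(1)], rule comp_arr[OF tu(1) tu'(1) Sd'(1) f(1) Sd'(2)])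
  from theI'[OF this] have m: "m \<in> arr C S S'"
    "\<And>i. i \<in> I \<Longrightarrow> Comp C (?T i) S S' m (?j i) = Comp C (?T i) (?T' i) S' (?j' i) (?f i)"
    by (simp_all add: m_def coproduct_map_def S_def S'_def)
  show "m \<in> arr C S S'" by (rule m)
  show "Comp C (X i) S S' m (copower_sum_in R C I V X i w)
      = Comp C (X i) (X' i) S' (copower_sum_in R C I V' X' i (\<tau> i w)) (g i)"
    if i: "i \<in> I" and w: "w \<in> carrier (V i)"
  proof -
    note ii = i i
    note tw = linear_maps_closed[OF \<tau>[OF i] w]
    note o = X[OF i] X'[OF i] tu(1)[OF ii] tu'(1)[OF ii] Sd(1) Sd'(1)
    have fi: "?f i \<in> arr C (?T i) (?T' i)" by (rule f(1)) (rule i)+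
    show ?thesis
      using comp_assoc[OF o(1,3,5,6) ta[OF ii w] Sd(2)[OF i] m(1)]
        comp_assoc[OF o(1,3,4,6) ta[OF ii w] fi Sd'(2)[OF i]]
        comp_assoc[OF o(1,2,4,6) g[OF i] ta'[OF ii tw] Sd'(2)[OF i]]
        m(2)[OF i] tensor_k_map(2)[OF V[OF i] V'[OF i] X[OF i] X'[OF i] \<tau>[OF i] g[OF i] w]
      by (simp add: copower_sum_in_def S_def S'_def)
  qed
qed

end


section \<open>The left adjoint of evaluation\<close>

locale nakayama_setting = functor_setting R B C
  for R :: "('k, 'r) ring_scheme" (structure)
    and B :: "('o, 'n, 'k) lincat" and C :: "('c, 'm, 'k) lincat" +
  assumes locally_bounded: "locally_bounded C" and hom_finite: "hom_finite R C"
begin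

lemma op_setting: "nakayama_setting R (op_cat B) (op_cat C)"
  using locally_bounded hom_finite
  by (intro nakayama_setting.intro nakayama_setting_axioms.intro functor_setting_op)
    (auto simp: locally_bounded_def hom_finite_def)

lemma fg_hom: "\<lbrakk>c \<in> Obj C; d \<in> Obj C\<rbrakk> \<Longrightarrow> fg_projective R (Hom C c d)"
  using hom_finite by (simp add: hom_finite_def)

lemma finite_into: "d \<in> Obj C \<Longrightarrow> finite {c \<in> Obj C. arr C c d \<noteq> {\<zero>\<^bsub>Hom C c d\<^esub>}}"
  using locally_bounded by (simp add: locally_bounded_def)

lemma finite_from: "c \<in> Obj C \<Longrightarrow> finite {d \<in> Obj C. arr C c d \<noteq> {\<zero>\<^bsub>Hom C c d\<^esub>}}"
  using locally_bounded by (simp add: locally_bounded_def)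

end

text \<open>The functor \<open>P\<close> is freely generated by objects \<open>X c\<close> placed at \<open>c\<close>: its value at \<open>d\<close> is the
  direct sum of the \<open>C(c,d) \<otimes> X c\<close>, with arrows of \<open>C\<close> acting by composition. In the opposite
  categories, \<open>is_free\<close> describes cofree functors.\<close>

definition is_free ::
  "('k, 'r) ring_scheme \<Rightarrow> ('o, 'n, 'k) lincat \<Rightarrow> ('c, 'm, 'k) lincat \<Rightarrow> ('c \<Rightarrow> 'o)
    \<Rightarrow> ('c, 'm, 'o, 'n) funct \<Rightarrow> ('c \<Rightarrow> 'c \<Rightarrow> 'm \<Rightarrow> 'n) \<Rightarrow> bool" where
  "is_free R B C X P u \<longleftrightarrow> P \<in> Obj (functor_cat R C B) \<and> (\<forall>c\<in>Obj C. X c \<in> Obj B) \<and>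
     (\<forall>d\<in>Obj C. is_copower_sum R B (Obj C) (\<lambda>c. Hom C c d) X (FOb P d) (u d)) \<and>
     (\<forall>c\<in>Obj C. \<forall>d\<in>Obj C. \<forall>e\<in>Obj C. \<forall>m\<in>arr C c d. \<forall>g\<in>arr C d e.
        Comp B (X c) (FOb P d) (FOb P e) (FArr P d e g) (u d c m) = u e c (Comp C c d e g m))"

lemma is_freeD:
  assumes "is_free R B C X P u"
  shows "P \<in> Obj (functor_cat R C B)" "c \<in> Obj C \<Longrightarrow> X c \<in> Obj B"
    and "d \<in> Obj C \<Longrightarrow> is_copower_sum R B (Obj C) (\<lambda>c. Hom C c d) X (FOb P d) (u d)"
    and "\<lbrakk>c \<in> Obj C; d \<in> Obj C; e \<in> Obj C; m \<in> arr C c d; g \<in> arr C d e\<rbrakk> \<Longrightarrow>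
        Comp B (X c) (FOb P d) (FOb P e) (FArr P d e g) (u d c m) = u e c (Comp C c d e g m)"
    and "\<lbrakk>c \<in> Obj C; d \<in> Obj C; m \<in> arr C c d\<rbrakk> \<Longrightarrow> u d c m \<in> arr B (X c) (FOb P d)"
proof -
  show *: "P \<in> Obj (functor_cat R C B)" "c \<in> Obj C \<Longrightarrow> X c \<in> Obj B"
    "d \<in> Obj C \<Longrightarrow> is_copower_sum R B (Obj C) (\<lambda>c. Hom C c d) X (FOb P d) (u d)"
    "\<lbrakk>c \<in> Obj C; d \<in> Obj C; e \<in> Obj C; m \<in> arr C c d; g \<in> arr C d e\<rbrakk> \<Longrightarrow>
        Comp B (X c) (FOb P d) (FOb P e) (FArr P d e g) (u d c m) = u e c (Comp C c d e g m)"
    using assms unfolding is_free_def by blast+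
  show "\<lbrakk>c \<in> Obj C; d \<in> Obj C; m \<in> arr C c d\<rbrakk> \<Longrightarrow> u d c m \<in> arr B (X c) (FOb P d)"
    using is_copower_sumD(3)[OF *(3)] by simp
qed

context functor_setting
begin

lemma free_cancel:
  assumes "is_free R B C X P u" and d: "d \<in> Obj C" and "Y \<in> Obj B"
    and "h \<in> arr B (FOb P d) Y" "h' \<in> arr B (FOb P d) Y"
    and "\<And>c m. \<lbrakk>c \<in> Obj C; m \<in> arr C c d\<rbrakk>
      \<Longrightarrow> Comp B (X c) (FOb P d) Y h (u d c m) = Comp B (X c) (FOb P d) Y h' (u d c m)"
  shows "h = h'"
  by (rule B.copower_sum_cancel[OF is_freeD(3)[OF assms(1,2)]])
    (use assms is_freeD(2)[OF assms(1)] C.hom_module[OF _ d] in simp_all)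

text \<open>Every structure map \<open>u d c m\<close> is the image of the one for the identity of \<open>c\<close> under \<open>P m\<close>.\<close>

lemma free_nat_trans:
  assumes P: "is_free R B C X P u" and G: "G \<in> Obj FC"
    and \<alpha>: "\<alpha> \<in> nat_trans C B P G" and cd: "c \<in> Obj C" "d \<in> Obj C" and m: "m \<in> arr C c d"
  shows "Comp B (X c) (FOb P d) (FOb G d) (\<alpha> d) (u d c m)
    = Comp B (X c) (FOb G c) (FOb G d) (FArr G c d m)
        (Comp B (X c) (FOb P c) (FOb G c) (\<alpha> c) (u c c (Ident C c)))"
proof -
  note Pd = is_freeD[OF P] note Po = objD[OF Pd(1)] note Go = objD[OF G] note \<alpha>d = nat_transD[OF \<alpha>]
  note i = C.ident_arr[OF cd(1)]
  note ui = Pd(5)[OF cd(1,1) i]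
  have "u d c m = Comp B (X c) (FOb P c) (FOb P d) (FArr P c d m) (u c c (Ident C c))"
    using Pd(4)[OF cd(1,1,2) i m] C.comp_ident_right[OF cd m] by simp
  then show ?thesis
    using B.comp_assoc[OF Pd(2)[OF cd(1)] Po(1)[OF cd(1)] Po(1)[OF cd(2)] Go(1)[OF cd(2)] ui Po(2)[OF cd m] \<alpha>d(1)[OF cd(2)]]
      B.comp_assoc[OF Pd(2)[OF cd(1)] Po(1)[OF cd(1)] Go(1)[OF cd(1)] Go(1)[OF cd(2)] ui \<alpha>d(1)[OF cd(1)] Go(2)[OF cd m]]
      \<alpha>d(2)[OF cd m] by simp
qed

text \<open>Yoneda: a natural transformation out of a free functor can be prescribed on generators.\<close>

lemma free_extension:
  assumes P: "is_free R B C X P u" and G: "G \<in> Obj FC"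
    and f: "\<And>c. c \<in> Obj C \<Longrightarrow> f c \<in> arr B (X c) (FOb G c)"
  shows "\<exists>\<alpha>\<in>nat_trans C B P G. \<forall>c\<in>Obj C. \<forall>d\<in>Obj C. \<forall>m\<in>arr C c d.
    Comp B (X c) (FOb P d) (FOb G d) (\<alpha> d) (u d c m)
      = Comp B (X c) (FOb G c) (FOb G d) (FArr G c d m) (f c)"
proof -
  note Pd = is_freeD[OF P] note Po = objD[OF Pd(1)] note Go = objD[OF G]
  let ?v = "\<lambda>d c. \<lambda>m\<in>arr C c d. Comp B (X c) (FOb G c) (FOb G d) (FArr G c d m) (f c)"
  let ?P = "\<lambda>d h. h \<in> arr B (FOb P d) (FOb G d) \<and>
      (\<forall>c\<in>Obj C. \<forall>m\<in>arr C c d. Comp B (X c) (FOb P d) (FOb G d) h (u d c m) = ?v d c m)"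
  have ex: "\<exists>!h. ?P d h" if d: "d \<in> Obj C" for d
  proof (rule is_copower_sumD(4)[OF Pd(3)[OF d] Go(1)[OF d]])
    fix c assume c: "c \<in> Obj C"
    interpret cd: module R "Hom C c d" by (rule C.hom_module[OF c d])
    have "(\<lambda>m\<in>arr C c d. FArr G c d m) \<in> linear_maps R (Hom C c d) (Hom B (FOb G c) (FOb G d))"
      by (rule linear_mapsI) (use c d in \<open>simp_all add: Go\<close>)
    from B.comp_linear_pre[OF Pd(2)[OF c] Go(1)[OF c] Go(1)[OF d] f[OF c] this cd.module_axioms]
    show "?v d c \<in> linear_maps R (Hom C c d) (Hom B (X c) (FOb G d))" by (simp cong: restrict_cong)
  qed
  define \<alpha> where "\<alpha> = (\<lambda>d\<in>Obj C. THE h. ?P d h)"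
  have "?P d (\<alpha> d)" if "d \<in> Obj C" for d
    using theI'[OF ex[OF that]] unfolding \<alpha>_def using that by simp
  then have \<alpha>: "\<alpha> d \<in> arr B (FOb P d) (FOb G d)"
      "\<lbrakk>c \<in> Obj C; m \<in> arr C c d\<rbrakk> \<Longrightarrow> Comp B (X c) (FOb P d) (FOb G d) (\<alpha> d) (u d c m)
      = Comp B (X c) (FOb G c) (FOb G d) (FArr G c d m) (f c)"
    if "d \<in> Obj C" for c d m
    using that by simp_all
  have "\<alpha> \<in> nat_trans C B P G"
  proof (rule nat_transI)
    fix a b g assume ab: "a \<in> Obj C" "b \<in> Obj C" and g: "g \<in> arr C a b"
    note o = Po(1)[OF ab(1)] Po(1)[OF ab(2)] Go(1)[OF ab(1)] Go(1)[OF ab(2)]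
    show "Comp B (FOb P a) (FOb P b) (FOb G b) (\<alpha> b) (FArr P a b g)
        = Comp B (FOb P a) (FOb G a) (FOb G b) (FArr G a b g) (\<alpha> a)"
    proof (rule free_cancel[OF P ab(1) o(4)])
      show "Comp B (FOb P a) (FOb P b) (FOb G b) (\<alpha> b) (FArr P a b g) \<in> arr B (FOb P a) (FOb G b)"
        by (rule B.comp_arr[OF o(1,2,4) Po(2)[OF ab g] \<alpha>(1)[OF ab(2)]])
      show "Comp B (FOb P a) (FOb G a) (FOb G b) (FArr G a b g) (\<alpha> a) \<in> arr B (FOb P a) (FOb G b)"
        by (rule B.comp_arr[OF o(1,3,4) \<alpha>(1)[OF ab(1)] Go(2)[OF ab g]])
      fix c m assume c: "c \<in> Obj C" and m: "m \<in> arr C c a"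
      note ua = Pd(5)[OF c ab(1) m]
      show "Comp B (X c) (FOb P a) (FOb G b) (Comp B (FOb P a) (FOb P b) (FOb G b) (\<alpha> b) (FArr P a b g)) (u a c m)
        = Comp B (X c) (FOb P a) (FOb G b) (Comp B (FOb P a) (FOb G a) (FOb G b) (FArr G a b g) (\<alpha> a)) (u a c m)"
        using B.comp_assoc[OF Pd(2)[OF c] o(1,2,4) ua Po(2)[OF ab g] \<alpha>(1)[OF ab(2)]]
          B.comp_assoc[OF Pd(2)[OF c] o(1,3,4) ua \<alpha>(1)[OF ab(1)] Go(2)[OF ab g]]
          B.comp_assoc[OF Pd(2)[OF c] Go(1)[OF c] o(3,4) f[OF c] Go(2)[OF c ab(1) m] Go(2)[OF ab g]]
          Pd(4)[OF c ab m g] \<alpha>(2)[OF ab(1) c m] \<alpha>(2)[OF ab(2) c C.comp_arr[OF c ab m g]] Go(4)[OF c ab m g]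
        by simp
    qed
  qed (simp_all add: \<alpha>(1), simp add: \<alpha>_def)
  then show ?thesis using \<alpha>(2) by (intro bexI[of _ \<alpha>]) simp_all
qed

text \<open>The form of \<open>mk_functor_by_generators\<close> for a functor that is already given as a record.\<close>

lemma functor_by_generators:
  assumes norm: "mk_functor C (FOb F) (FArr F) = F"
    and T: "\<And>c. c \<in> Obj C \<Longrightarrow> FOb F c \<in> Obj B"
    and s: "\<And>c j. \<lbrakk>c \<in> Obj C; j \<in> J c\<rbrakk> \<Longrightarrow> s c j \<in> Obj B"
    and t: "\<And>c j. \<lbrakk>c \<in> Obj C; j \<in> J c\<rbrakk> \<Longrightarrow> t c j \<in> arr B (s c j) (FOb F c)"
    and cancel: "\<And>c Y h h'. \<lbrakk>c \<in> Obj C; Y \<in> Obj B; h \<in> arr B (FOb F c) Y; h' \<in> arr B (FOb F c) Y;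
        \<And>j. j \<in> J c \<Longrightarrow> Comp B (s c j) (FOb F c) Y h (t c j) = Comp B (s c j) (FOb F c) Y h' (t c j)\<rbrakk> \<Longrightarrow> h = h'"
    and fa: "\<And>c d f. \<lbrakk>c \<in> Obj C; d \<in> Obj C; f \<in> arr C c d\<rbrakk> \<Longrightarrow> FArr F c d f \<in> arr B (FOb F c) (FOb F d)"
    and fat: "\<And>c d f j. \<lbrakk>c \<in> Obj C; d \<in> Obj C; f \<in> arr C c d; j \<in> J c\<rbrakk>
        \<Longrightarrow> Comp B (s c j) (FOb F c) (FOb F d) (FArr F c d f) (t c j) = r c d f j"
    and ident: "\<And>c j. \<lbrakk>c \<in> Obj C; j \<in> J c\<rbrakk> \<Longrightarrow> r c c (Ident C c) j = t c j"
    and comp: "\<And>c d e f g j. \<lbrakk>c \<in> Obj C; d \<in> Obj C; e \<in> Obj C; f \<in> arr C c d; g \<in> arr C d e; j \<in> J c\<rbrakk>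
        \<Longrightarrow> r c e (Comp C c d e g f) j = Comp B (s c j) (FOb F d) (FOb F e) (FArr F d e g) (r c d f j)"
    and add: "\<And>c d f g j. \<lbrakk>c \<in> Obj C; d \<in> Obj C; f \<in> arr C c d; g \<in> arr C c d; j \<in> J c\<rbrakk>
        \<Longrightarrow> r c d (f \<oplus>\<^bsub>Hom C c d\<^esub> g) j = r c d f j \<oplus>\<^bsub>Hom B (s c j) (FOb F d)\<^esub> r c d g j"
    and smult: "\<And>c d a f j. \<lbrakk>c \<in> Obj C; d \<in> Obj C; a \<in> carrier R; f \<in> arr C c d; j \<in> J c\<rbrakk>
        \<Longrightarrow> r c d (a \<odot>\<^bsub>Hom C c d\<^esub> f) j = a \<odot>\<^bsub>Hom B (s c j) (FOb F d)\<^esub> r c d f j"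
  shows "F \<in> Obj FC"
proof -
  have "mk_functor C (FOb F) (FArr F) \<in> Obj FC"
    using assms(2-) by (rule mk_functor_by_generators[OF B.linear_category_axioms C.linear_category_axioms, where s = s and t = t and J = J and r = r])
  then show ?thesis by (simp only: norm)
qed

end

definition shriek_in ::
  "('k, 'r) ring_scheme \<Rightarrow> ('c, 'm, 'k) lincat \<Rightarrow> ('o, 'n, 'k) lincat \<Rightarrow> ('c \<Rightarrow> 'o)
    \<Rightarrow> 'c \<Rightarrow> 'c \<Rightarrow> 'm \<Rightarrow> 'n" where
  "shriek_in R C B X d c = (\<lambda>m\<in>arr C c d. copower_sum_in R B (Obj C) (\<lambda>c. Hom C c d) X c m)"

context nakayama_setting
begin

abbreviation "PC \<equiv> power_cat (Obj C) B"
abbreviation "shriek \<equiv> i_lower_shriek_ob R C B"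
abbreviation "gen \<equiv> shriek_in R C B"

lemma shriek_FOb: "d \<in> Obj C \<Longrightarrow>
    FOb (shriek X) d = coproduct_ob B (Obj C) (\<lambda>c. tensor_k_ob R B (Hom C c d) (X c))"
  by (simp add: i_lower_shriek_ob_def)

lemma hom_from_FArr:
  "\<lbrakk>d \<in> Obj C; e \<in> Obj C; g \<in> arr C d e\<rbrakk>
    \<Longrightarrow> FArr (hom_from C c) d e g = (\<lambda>h\<in>arr C c d. Comp C c d e g h)"
  by (simp add: hom_from_def)

lemma shriek_copower:
  assumes X: "X \<in> Obj PC" and d: "d \<in> Obj C"
  shows "is_copower_sum R B (Obj C) (\<lambda>c. Hom C c d) X (FOb (shriek X) d) (gen X d)"
proof -
  have "is_copower_sum R B (Obj C) (\<lambda>c. Hom C c d) X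
      (coproduct_ob B (Obj C) (\<lambda>c. tensor_k_ob R B (Hom C c d) (X c)))
      (\<lambda>c. \<lambda>w\<in>carrier (Hom C c d). copower_sum_in R B (Obj C) (\<lambda>c. Hom C c d) X c w)"
    by (rule B.copower_sum_in_universal) (use X fg_hom d finite_into[OF d] in auto)
  then show ?thesis using d by (simp add: shriek_FOb shriek_in_def[abs_def])
qed

lemma shriek_arr:
  assumes X: "X \<in> Obj PC" and o: "d \<in> Obj C" "e \<in> Obj C" and g: "g \<in> arr C d e"
  shows "FArr (shriek X) d e g \<in> arr B (FOb (shriek X) d) (FOb (shriek X) e)"
    and "\<lbrakk>c \<in> Obj C; m \<in> arr C c d\<rbrakk> \<Longrightarrow>
      Comp B (X c) (FOb (shriek X) d) (FOb (shriek X) e) (FArr (shriek X) d e g) (gen X d c m)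
        = gen X e c (Comp C c d e g m)"
proof -
  have Xo: "X c \<in> Obj B" if "c \<in> Obj C" for c using X that by auto
  have lin: "FArr (hom_from C c) d e g \<in> linear_maps R (Hom C c d) (Hom C c e)" if c: "c \<in> Obj C" for c
    using C.post_linear[OF c o g] by (simp add: hom_from_FArr[OF o g])
  note m = B.copower_sum_map[where I = "Obj C" and V = "\<lambda>c. Hom C c d" and X = X and V' = "\<lambda>c. Hom C c e"
      and X' = X and \<tau> = "\<lambda>c. FArr (hom_from C c) d e g" and g = "\<lambda>c. Ident B (X c)",
      OF fg_hom[OF _ o(1)] Xo finite_into[OF o(1)] fg_hom[OF _ o(2)] Xo finite_into[OF o(2)] lin B.ident_arr[OF Xo]]
  have FA: "FArr (shriek X) d e g = coproduct_map B (Obj C) (\<lambda>c. tensor_k_ob R B (Hom C c d) (X c))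
      (\<lambda>c. tensor_k_ob R B (Hom C c e) (X c))
      (\<lambda>c. tensor_k_map R B (Hom C c d) (Hom C c e) (FArr (hom_from C c) d e g) (X c) (X c) (Ident B (X c)))"
    using o g by (simp add: i_lower_shriek_ob_def)
  show "FArr (shriek X) d e g \<in> arr B (FOb (shriek X) d) (FOb (shriek X) e)"
    using m(1) by (simp add: FA shriek_FOb o)
  assume c: "c \<in> Obj C" and cm: "m \<in> arr C c d"
  note gm = C.comp_arr[OF c o cm g]
  have ge: "gen X e c (Comp C c d e g m) \<in> arr B (X c) (FOb (shriek X) e)"
    using is_copower_sumD(3)[OF shriek_copower[OF X o(2)] c gm] .
  show "Comp B (X c) (FOb (shriek X) d) (FOb (shriek X) e) (FArr (shriek X) d e g) (gen X d c m)
        = gen X e c (Comp C c d e g m)"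
    using m(2)[of c m] c cm gm B.comp_ident_right[OF Xo[OF c] is_copower_sumD(1)[OF shriek_copower[OF X o(2)]] ge]
    by (simp add: FA shriek_FOb o shriek_in_def hom_from_FArr[OF o g])
qed

lemma shriek_obj:
  assumes X: "X \<in> Obj PC"
  shows "shriek X \<in> Obj FC"
proof -
  have Xo: "X c \<in> Obj B" if "c \<in> Obj C" for c using X that by auto
  note cd = is_copower_sumD[OF shriek_copower[OF X]]
  note sa = shriek_arr[OF X]
  show ?thesis
  proof (rule functor_by_generators[where J = "\<lambda>d. Sigma (Obj C) (\<lambda>c. arr C c d)" and s = "\<lambda>d z. X (fst z)"
        and t = "\<lambda>d z. gen X d (fst z) (snd z)" and r = "\<lambda>d e g z. gen X e (fst z) (Comp C (fst z) d e g (snd z))"],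
      goal_cases)
    case 1 show ?case by (simp add: i_lower_shriek_ob_def mk_functor_idem)
  next
    case (5 d Y h h')
    show ?case
      by (rule B.copower_sum_cancel[OF shriek_copower[OF X 5(1)] Xo C.hom_module[OF _ 5(1)] 5(2-4)])
        (use 5(5)[of "(_, _)"] in simp_all)
  next
    case (8 d z) then show ?case by (auto simp: C.comp_ident_left)
  next
    case (9 d e f g h z)
    then obtain c m where z: "z = (c, m)" and c: "c \<in> Obj C" and m: "m \<in> arr C c d" by auto
    show ?case
      using sa(2)[OF 9(2,3,5) c C.comp_arr[OF c 9(1,2) m 9(4)]] C.comp_assoc[OF c 9(1,2,3) m 9(4,5)]
      by (simp add: z)
  next
    case (10 d e f g z)
    then obtain c m where z: "z = (c, m)" and c: "c \<in> Obj C" and m: "m \<in> arr C c d" by auto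
    show ?case
      using linear_maps_add[OF cd(2)[OF 10(2) c] C.comp_arr[OF c 10(1,2) m 10(3)] C.comp_arr[OF c 10(1,2) m 10(4)]]
      by (simp add: z C.comp_add_left[OF c 10(1,2) m 10(3,4)])
  next
    case (11 d e a f z)
    then obtain c m where z: "z = (c, m)" and c: "c \<in> Obj C" and m: "m \<in> arr C c d" by auto
    show ?case
      using linear_maps_smult[OF cd(2)[OF 11(2) c] 11(3) C.comp_arr[OF c 11(1,2) m 11(4)]]
      by (simp add: z C.comp_smult_left[OF c 11(1,2,3) m 11(4)])
  qed (use cd sa Xo in auto)
qed

lemma shriek_free:
  assumes X: "X \<in> Obj PC"
  shows "is_free R B C X (shriek X) (gen X)"
  unfolding is_free_def using shriek_obj[OF X] shriek_copower[OF X] shriek_arr(2)[OF X] X by auto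

lemma shriek_map:
  assumes X: "X \<in> Obj PC" and Y: "Y \<in> Obj PC" and f: "f \<in> arr PC X Y"
  shows "FArr (i_lower_shriek R C B) X Y f \<in> nat_trans C B (shriek X) (shriek Y)"
    and "\<lbrakk>d \<in> Obj C; c \<in> Obj C; m \<in> arr C c d\<rbrakk> \<Longrightarrow>
      Comp B (X c) (FOb (shriek X) d) (FOb (shriek Y) d) (FArr (i_lower_shriek R C B) X Y f d) (gen X d c m)
        = Comp B (X c) (Y c) (FOb (shriek Y) d) (gen Y d c m) (f c)"
proof -
  have Xo: "X c \<in> Obj B" if "c \<in> Obj C" for c using X that by auto
  have Yo: "Y c \<in> Obj B" if "c \<in> Obj C" for c using Y that by auto
  have fa: "f c \<in> arr B (X c) (Y c)" if "c \<in> Obj C" for c using f that by auto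
  let ?\<alpha> = "FArr (i_lower_shriek R C B) X Y f"
  have FA: "?\<alpha> d = coproduct_map B (Obj C) (\<lambda>c. tensor_k_ob R B (Hom C c d) (X c))
      (\<lambda>c. tensor_k_ob R B (Hom C c d) (Y c))
      (\<lambda>c. tensor_k_map R B (Hom C c d) (Hom C c d) (\<lambda>h\<in>arr C c d. h) (X c) (Y c) (f c))"
    if "d \<in> Obj C" for d
    unfolding i_lower_shriek_def mk_functor_simps(2)[OF X Y f] using that by simp
  have both: "?\<alpha> d \<in> arr B (FOb (shriek X) d) (FOb (shriek Y) d)"
    "\<lbrakk>c \<in> Obj C; m \<in> arr C c d\<rbrakk> \<Longrightarrow>
      Comp B (X c) (FOb (shriek X) d) (FOb (shriek Y) d) (?\<alpha> d) (gen X d c m)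
        = Comp B (X c) (Y c) (FOb (shriek Y) d) (gen Y d c m) (f c)" if d: "d \<in> Obj C" for c d m
  proof -
    note m = B.copower_sum_map[where I = "Obj C" and V = "\<lambda>c. Hom C c d" and X = X and V' = "\<lambda>c. Hom C c d"
      and X' = Y and \<tau> = "\<lambda>c. \<lambda>h\<in>arr C c d. h" and g = f,
      OF fg_hom[OF _ d] Xo finite_into[OF d] fg_hom[OF _ d] Yo finite_into[OF d]
        C.identity_linear[OF C.hom_module[OF _ d]] fa]
    show "?\<alpha> d \<in> arr B (FOb (shriek X) d) (FOb (shriek Y) d)"
      using m(1) by (simp add: FA shriek_FOb d)
    show "\<lbrakk>c \<in> Obj C; m \<in> arr C c d\<rbrakk> \<Longrightarrow>
      Comp B (X c) (FOb (shriek X) d) (FOb (shriek Y) d) (?\<alpha> d) (gen X d c m)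
        = Comp B (X c) (Y c) (FOb (shriek Y) d) (gen Y d c m) (f c)"
      using m(2)[of c m] by (simp add: FA shriek_FOb d shriek_in_def)
  qed
  note fX = shriek_free[OF X] and fY = shriek_free[OF Y]
  note Xd = is_freeD[OF fX] and Yd = is_freeD[OF fY]
  note PX = objD[OF Xd(1)] and PY = objD[OF Yd(1)]
  show "?\<alpha> \<in> nat_trans C B (shriek X) (shriek Y)"
  proof (rule nat_transI)
    fix a b g assume ab: "a \<in> Obj C" "b \<in> Obj C" and g: "g \<in> arr C a b"
    note o = PX(1)[OF ab(1)] PX(1)[OF ab(2)] PY(1)[OF ab(1)] PY(1)[OF ab(2)]
    show "Comp B (FOb (shriek X) a) (FOb (shriek X) b) (FOb (shriek Y) b) (?\<alpha> b) (FArr (shriek X) a b g)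
        = Comp B (FOb (shriek X) a) (FOb (shriek Y) a) (FOb (shriek Y) b) (FArr (shriek Y) a b g) (?\<alpha> a)"
    proof (rule free_cancel[OF fX ab(1) o(4)])
      fix c m assume c: "c \<in> Obj C" and m: "m \<in> arr C c a"
      note gm = C.comp_arr[OF c ab m g]
      show "Comp B (X c) (FOb (shriek X) a) (FOb (shriek Y) b)
          (Comp B (FOb (shriek X) a) (FOb (shriek X) b) (FOb (shriek Y) b) (?\<alpha> b) (FArr (shriek X) a b g)) (gen X a c m)
        = Comp B (X c) (FOb (shriek X) a) (FOb (shriek Y) b)
          (Comp B (FOb (shriek X) a) (FOb (shriek Y) a) (FOb (shriek Y) b) (FArr (shriek Y) a b g) (?\<alpha> a)) (gen X a c m)"
        using B.comp_assoc[OF Xo[OF c] o(1,2,4) Xd(5)[OF c ab(1) m] PX(2)[OF ab g] both(1)[OF ab(2)]]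
          B.comp_assoc[OF Xo[OF c] o(1,3,4) Xd(5)[OF c ab(1) m] both(1)[OF ab(1)] PY(2)[OF ab g]]
          B.comp_assoc[OF Xo[OF c] Yo[OF c] o(3,4) fa[OF c] Yd(5)[OF c ab(1) m] PY(2)[OF ab g]]
          Xd(4)[OF c ab m g] Yd(4)[OF c ab m g] both(2)[OF ab(1) c m] both(2)[OF ab(2) c gm] by simp
    qed (use B.comp_arr[OF o(1,2,4) PX(2)[OF ab g] both(1)[OF ab(2)]]
        B.comp_arr[OF o(1,3,4) both(1)[OF ab(1)] PY(2)[OF ab g]] in simp_all)
  next
    fix c assume "c \<notin> Obj C"
    then show "?\<alpha> c = undefined"
      unfolding i_lower_shriek_def mk_functor_simps(2)[OF X Y f] by simp
  qed (rule both(1))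
  show "\<lbrakk>d \<in> Obj C; c \<in> Obj C; m \<in> arr C c d\<rbrakk> \<Longrightarrow>
      Comp B (X c) (FOb (shriek X) d) (FOb (shriek Y) d) (?\<alpha> d) (gen X d c m)
        = Comp B (X c) (Y c) (FOb (shriek Y) d) (gen Y d c m) (f c)"
    by (rule both(2))
qed

lemma shriek_functor_FOb [simp]: "X \<in> Obj PC \<Longrightarrow> FOb (i_lower_shriek R C B) X = shriek X"
  by (simp add: i_lower_shriek_def del: power_cat_simps)

lemma shriek_functor: "is_functor PC FC (i_lower_shriek R C B)"
  unfolding is_functor_def
proof (intro conjI ballI)
  let ?L = "i_lower_shriek R C B"
  interpret PL: linear_category R PC
    by (rule pointwise_category.pointwise_linear_category[OF B.power_pointwise])
  interpret FL: linear_category R FC by (rule linear_functor_cat)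
  fix X assume X: "X \<in> Obj PC"
  show "FOb ?L X \<in> Obj FC" using shriek_obj[OF X] X by (simp del: power_cat_simps)
  note fX = shriek_free[OF X]
  note Xd = is_freeD[OF fX]
  have XF: "FOb ?L X = shriek X" by (rule shriek_functor_FOb[OF X])
  {
    fix Y f assume Y: "Y \<in> Obj PC" and f: "f \<in> arr PC X Y"
    show "FArr ?L X Y f \<in> arr FC (FOb ?L X) (FOb ?L Y)"
      using shriek_map(1)[OF X Y f] X Y by (simp del: power_cat_simps)
  }
  show "FArr ?L X X (Ident PC X) = Ident FC (FOb ?L X)"
  proof (rule nat_trans_eqI[OF shriek_map(1)[OF X X PL.ident_arr[OF X]]])
    show "Ident FC (FOb ?L X) \<in> nat_trans C B (shriek X) (shriek X)"
      using FL.ident_arr[OF Xd(1)] by (simp only: functor_cat_simps(1) XF)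
    fix d assume d: "d \<in> Obj C"
    note P = objD(1)[OF Xd(1) d]
    show "FArr ?L X X (Ident PC X) d = Ident FC (FOb ?L X) d"
    proof (rule free_cancel[OF fX d P])
      show "FArr ?L X X (Ident PC X) d \<in> arr B (FOb (shriek X) d) (FOb (shriek X) d)"
        by (rule nat_transD(1)[OF shriek_map(1)[OF X X PL.ident_arr[OF X]] d])
      show "Ident FC (FOb ?L X) d \<in> arr B (FOb (shriek X) d) (FOb (shriek X) d)"
        using d B.ident_arr[OF P] by (simp add: XF)
      fix c m assume c: "c \<in> Obj C" and m: "m \<in> arr C c d"
      note u = Xd(5)[OF c d m]
      show "Comp B (X c) (FOb (shriek X) d) (FOb (shriek X) d) (FArr ?L X X (Ident PC X) d) (gen X d c m)
          = Comp B (X c) (FOb (shriek X) d) (FOb (shriek X) d) (Ident FC (FOb ?L X) d) (gen X d c m)"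
        using shriek_map(2)[OF X X PL.ident_arr[OF X] d c m] c d B.comp_ident_right[OF Xd(2)[OF c] P u]
          B.comp_ident_left[OF Xd(2)[OF c] P u] by (simp add: XF)
    qed
  qed
  fix Y Z f g assume Y: "Y \<in> Obj PC" and Z: "Z \<in> Obj PC" and f: "f \<in> arr PC X Y" and g: "g \<in> arr PC Y Z"
  note Yd = is_freeD[OF shriek_free[OF Y]] and Zd = is_freeD[OF shriek_free[OF Z]]
  have YF: "FOb ?L Y = shriek Y" and ZF: "FOb ?L Z = shriek Z"
    by (rule shriek_functor_FOb[OF Y], rule shriek_functor_FOb[OF Z])
  note gf = PL.comp_arr[OF X Y Z f g]
  note nf = shriek_map(1)[OF X Y f] and ng = shriek_map(1)[OF Y Z g] and ngf = shriek_map(1)[OF X Z gf]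
  show "FArr ?L X Z (Comp PC X Y Z g f)
      = Comp FC (FOb ?L X) (FOb ?L Y) (FOb ?L Z) (FArr ?L Y Z g) (FArr ?L X Y f)"
  proof (rule nat_trans_eqI[OF ngf])
    show "Comp FC (FOb ?L X) (FOb ?L Y) (FOb ?L Z) (FArr ?L Y Z g) (FArr ?L X Y f) \<in> nat_trans C B (shriek X) (shriek Z)"
      using FL.comp_arr[OF Xd(1) Yd(1) Zd(1), unfolded functor_cat_simps(1), OF nf ng] by (simp only: XF YF ZF)
    fix d assume d: "d \<in> Obj C"
    note P = objD(1)[OF Xd(1) d] objD(1)[OF Yd(1) d] objD(1)[OF Zd(1) d]
    note fd = nat_transD(1)[OF nf d] and gd = nat_transD(1)[OF ng d] and gfd = nat_transD(1)[OF ngf d]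
    show "FArr ?L X Z (Comp PC X Y Z g f) d
      = Comp FC (FOb ?L X) (FOb ?L Y) (FOb ?L Z) (FArr ?L Y Z g) (FArr ?L X Y f) d"
    proof (rule free_cancel[OF fX d P(3) gfd])
      show "Comp FC (FOb ?L X) (FOb ?L Y) (FOb ?L Z) (FArr ?L Y Z g) (FArr ?L X Y f) d
          \<in> arr B (FOb (shriek X) d) (FOb (shriek Z) d)"
        using B.comp_arr[OF P fd gd] d by (simp add: XF YF ZF)
      fix c m assume c: "c \<in> Obj C" and m: "m \<in> arr C c d"
      note u = Xd(5)[OF c d m] Yd(5)[OF c d m] Zd(5)[OF c d m]
      have fc: "f c \<in> arr B (X c) (Y c)" "g c \<in> arr B (Y c) (Z c)" using f g c by auto
      show "Comp B (X c) (FOb (shriek X) d) (FOb (shriek Z) d) (FArr ?L X Z (Comp PC X Y Z g f) d) (gen X d c m)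
        = Comp B (X c) (FOb (shriek X) d) (FOb (shriek Z) d)
          (Comp FC (FOb ?L X) (FOb ?L Y) (FOb ?L Z) (FArr ?L Y Z g) (FArr ?L X Y f) d) (gen X d c m)"
        using shriek_map(2)[OF X Y f d c m] shriek_map(2)[OF Y Z g d c m] shriek_map(2)[OF X Z gf d c m]
          B.comp_assoc[OF Xd(2)[OF c] P u(1) fd gd]
          B.comp_assoc[OF Xd(2)[OF c] Yd(2)[OF c] P(2,3) fc(1) u(2) gd]
          B.comp_assoc[OF Xd(2)[OF c] Yd(2)[OF c] Zd(2)[OF c] P(3) fc u(3)] c d
        by (simp add: XF YF ZF)
    qed
  qed
qed

lemma upper_star_simps:
  "F \<in> Obj FC \<Longrightarrow> FOb (i_upper_star R C B) F = (\<lambda>c\<in>Obj C. FOb F c)"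
  "\<lbrakk>F \<in> Obj FC; G \<in> Obj FC; \<alpha> \<in> nat_trans C B F G\<rbrakk> \<Longrightarrow> FArr (i_upper_star R C B) F G \<alpha> = (\<lambda>c\<in>Obj C. \<alpha> c)"
  by (simp_all add: i_upper_star_def)

lemma upper_star_functor: "is_functor FC PC (i_upper_star R C B)"
proof -
  interpret FL: linear_category R FC by (rule linear_functor_cat)
  have id: "Ident FC F \<in> nat_trans C B F F" if "F \<in> Obj FC" for F
    using FL.ident_arr[OF that] by (simp only: functor_cat_simps(1))
  have comp: "Comp FC F G H g f \<in> nat_trans C B F H"
    if "F \<in> Obj FC" "G \<in> Obj FC" "H \<in> Obj FC" "f \<in> nat_trans C B F G" "g \<in> nat_trans C B G H" for F G H f g
    using FL.comp_arr[OF that(1-3), unfolded functor_cat_simps(1), OF that(4,5)] .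
  show ?thesis
    unfolding is_functor_def functor_cat_simps(1)
    by (intro conjI ballI)
      (use id comp in \<open>auto simp: upper_star_simps objD(1) nat_transD(1) simp del: functor_cat_simps(5,6),
        auto simp: fun_eq_iff\<close>)
qed

lemma upper_star_faithful: "faithful FC (i_upper_star R C B)"
  unfolding faithful_def
proof (intro ballI inj_onI)
  fix F G \<alpha> \<beta> assume o: "F \<in> Obj FC" "G \<in> Obj FC" and ab: "\<alpha> \<in> arr FC F G" "\<beta> \<in> arr FC F G"
    and eq: "FArr (i_upper_star R C B) F G \<alpha> = FArr (i_upper_star R C B) F G \<beta>"
  have "\<alpha> \<in> nat_trans C B F G" "\<beta> \<in> nat_trans C B F G" using ab by simp_all
  moreover from this have "(\<lambda>c\<in>Obj C. \<alpha> c) = (\<lambda>c\<in>Obj C. \<beta> c)" using eq o by (simp add: upper_star_simps)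
  ultimately show "\<alpha> = \<beta>" by (intro nat_trans_eqI[of \<alpha> C B F G \<beta>]) (simp_all add: fun_eq_iff restrict_def, metis)
qed

lemma shriek_upper_star_adjunction: "left_adjoint PC FC (i_lower_shriek R C B) (i_upper_star R C B)"
proof -
  let ?L = "i_lower_shriek R C B" and ?U = "i_upper_star R C B"
  define \<eta> where "\<eta> X = (\<lambda>c\<in>Obj C. gen X c c (Ident C c))" for X
  have \<eta>c: "\<eta> X c \<in> arr B (X c) (FOb (shriek X) c)" if "X \<in> Obj PC" "c \<in> Obj C" for X c
    using is_freeD(5)[OF shriek_free[OF that(1)] that(2,2) C.ident_arr[OF that(2)]] that(2) by (simp add: \<eta>_def)
  have UL: "FOb ?U (FOb ?L X) = (\<lambda>c\<in>Obj C. FOb (shriek X) c)" if "X \<in> Obj PC" for X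
    using upper_star_simps(1)[OF shriek_obj[OF that]] shriek_functor_FOb[OF that] by simp
  have \<eta>X: "\<eta> X \<in> arr PC X (FOb ?U (FOb ?L X))" if X: "X \<in> Obj PC" for X
    using \<eta>c[OF X] by (auto simp: UL[OF X] \<eta>_def simp del: power_cat_simps(1))
  have nat: "Comp PC X Y (FOb ?U (FOb ?L Y)) (\<eta> Y) f
      = Comp PC X (FOb ?U (FOb ?L X)) (FOb ?U (FOb ?L Y)) (FArr ?U (FOb ?L X) (FOb ?L Y) (FArr ?L X Y f)) (\<eta> X)"
    if X: "X \<in> Obj PC" and Y: "Y \<in> Obj PC" and f: "f \<in> arr PC X Y" for X Y f
  proof -
    have "FArr ?U (FOb ?L X) (FOb ?L Y) (FArr ?L X Y f) = (\<lambda>c\<in>Obj C. FArr ?L X Y f c)"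
      using upper_star_simps(2)[OF shriek_obj[OF X] shriek_obj[OF Y] shriek_map(1)[OF X Y f]]
      by (simp only: shriek_functor_FOb[OF X] shriek_functor_FOb[OF Y])
    then show ?thesis
      unfolding power_cat_simps(6)
      using shriek_map(2)[OF X Y f _ _ C.ident_arr]
      by (intro restrict_ext) (simp add: UL[OF X] UL[OF Y] \<eta>_def del: power_cat_simps)
  qed
  have univ: "\<exists>!g. g \<in> arr FC (FOb ?L X) G \<and>
      f = Comp PC X (FOb ?U (FOb ?L X)) (FOb ?U G) (FArr ?U (FOb ?L X) G g) (\<eta> X)"
    if X: "X \<in> Obj PC" and G: "G \<in> Obj FC" and f: "f \<in> arr PC X (FOb ?U G)" for X G f
  proof -
    note fX = shriek_free[OF X] note Xd = is_freeD[OF fX]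
    have XF: "FOb ?L X = shriek X" by (rule shriek_functor_FOb[OF X])
    have fP: "f \<in> (\<Pi>\<^sub>E c\<in>Obj C. arr B (X c) (FOb G c))"
      using f by (simp add: upper_star_simps(1)[OF G] PiE_iff)
    then have fc: "f c \<in> arr B (X c) (FOb G c)" if "c \<in> Obj C" for c using that by auto
    have iff: "f = Comp PC X (FOb ?U (FOb ?L X)) (FOb ?U G) (FArr ?U (FOb ?L X) G g) (\<eta> X)
        \<longleftrightarrow> (\<forall>c\<in>Obj C. Comp B (X c) (FOb (shriek X) c) (FOb G c) (g c) (gen X c c (Ident C c)) = f c)"
      if g: "g \<in> nat_trans C B (shriek X) G" for g
    proof -
      have eq: "Comp PC X (FOb ?U (FOb ?L X)) (FOb ?U G) (FArr ?U (FOb ?L X) G g) (\<eta> X)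
          = (\<lambda>c\<in>Obj C. Comp B (X c) (FOb (shriek X) c) (FOb G c) (g c) (gen X c c (Ident C c)))"
        unfolding power_cat_simps(6)
        by (intro restrict_ext)
          (simp add: XF upper_star_simps(1)[OF Xd(1)] upper_star_simps(1)[OF G] upper_star_simps(2)[OF Xd(1) G g] \<eta>_def)
      show ?thesis
        unfolding eq
      proof
        assume "f = (\<lambda>c\<in>Obj C. Comp B (X c) (FOb (shriek X) c) (FOb G c) (g c) (gen X c c (Ident C c)))"
        from fun_cong[OF this]
        show "\<forall>c\<in>Obj C. Comp B (X c) (FOb (shriek X) c) (FOb G c) (g c) (gen X c c (Ident C c)) = f c" by simp
      next
        assume e: "\<forall>c\<in>Obj C. Comp B (X c) (FOb (shriek X) c) (FOb G c) (g c) (gen X c c (Ident C c)) = f c"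
        show "f = (\<lambda>c\<in>Obj C. Comp B (X c) (FOb (shriek X) c) (FOb G c) (g c) (gen X c c (Ident C c)))"
          by (rule extensionalityI[of _ "Obj C"]) (use fP e in \<open>auto simp: PiE_iff\<close>)
      qed
    qed
    have "\<exists>\<alpha>\<in>nat_trans C B (shriek X) G. \<forall>c\<in>Obj C. \<forall>d\<in>Obj C. \<forall>m\<in>arr C c d.
        Comp B (X c) (FOb (shriek X) d) (FOb G d) (\<alpha> d) (gen X d c m)
        = Comp B (X c) (FOb G c) (FOb G d) (FArr G c d m) (f c)"
      by (rule free_extension[OF fX G fc])
    then obtain \<alpha> where \<alpha>: "\<alpha> \<in> nat_trans C B (shriek X) G"
      and \<alpha>u: "\<forall>c\<in>Obj C. \<forall>d\<in>Obj C. \<forall>m\<in>arr C c d. Comp B (X c) (FOb (shriek X) d) (FOb G d) (\<alpha> d) (gen X d c m)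
        = Comp B (X c) (FOb G c) (FOb G d) (FArr G c d m) (f c)"
      by (elim bexE)
    show ?thesis
    proof (rule ex1I[of _ \<alpha>])
      have "Comp B (X c) (FOb (shriek X) c) (FOb G c) (\<alpha> c) (gen X c c (Ident C c)) = f c" if c: "c \<in> Obj C" for c
        using \<alpha>u c C.ident_arr[OF c] objD(3)[OF G c] B.comp_ident_left[OF Xd(2)[OF c] objD(1)[OF G c] fc[OF c]] by simp
      then show "\<alpha> \<in> arr FC (FOb ?L X) G \<and>
          f = Comp PC X (FOb ?U (FOb ?L X)) (FOb ?U G) (FArr ?U (FOb ?L X) G \<alpha>) (\<eta> X)"
        using \<alpha> iff[OF \<alpha>] by (simp only: functor_cat_simps(1) XF) blast
    next
      fix g assume "g \<in> arr FC (FOb ?L X) G \<and>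
          f = Comp PC X (FOb ?U (FOb ?L X)) (FOb ?U G) (FArr ?U (FOb ?L X) G g) (\<eta> X)"
      then have g: "g \<in> nat_trans C B (shriek X) G" and ge: "f = Comp PC X (FOb ?U (FOb ?L X)) (FOb ?U G) (FArr ?U (FOb ?L X) G g) (\<eta> X)"
        by (simp_all only: functor_cat_simps(1) XF)
      note gf = iff[OF g, THEN iffD1, OF ge]
      show "g = \<alpha>"
      proof (rule nat_trans_eqI[OF g \<alpha>])
        fix d assume d: "d \<in> Obj C"
        show "g d = \<alpha> d"
        proof (rule free_cancel[OF fX d objD(1)[OF G d] nat_transD(1)[OF g d] nat_transD(1)[OF \<alpha> d]])
          fix c m assume c: "c \<in> Obj C" and m: "m \<in> arr C c d"
          show "Comp B (X c) (FOb (shriek X) d) (FOb G d) (g d) (gen X d c m)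
              = Comp B (X c) (FOb (shriek X) d) (FOb G d) (\<alpha> d) (gen X d c m)"
            using free_nat_trans[OF fX G g c d m] gf c \<alpha>u d m by simp
        qed
      qed
    qed
  qed
  have "adjunction PC FC ?L ?U \<eta>"
    unfolding adjunction_def
    by (intro conjI ballI shriek_functor upper_star_functor \<eta>X nat univ)
  then show ?thesis unfolding left_adjoint_def by (intro exI)
qed

end


section \<open>The Nakayama functor\<close>

text \<open>The two actions of \<open>C\<close> on the bimodule \<open>D(C)\<close>; they are exchanged by passing to \<open>C\<^sup>o\<^sup>p\<close>.\<close>

definition dual_pre ::
  "('c, 'm, 'k) lincat \<Rightarrow> 'c \<Rightarrow> 'c \<Rightarrow> 'c \<Rightarrow> 'm \<Rightarrow> ('m \<Rightarrow> 'k) \<Rightarrow> ('m \<Rightarrow> 'k)" where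
  "dual_pre C c d e g \<phi> = (\<lambda>x\<in>arr C c d. \<phi> (Comp C c d e g x))"

definition dual_post ::
  "('c, 'm, 'k) lincat \<Rightarrow> 'c \<Rightarrow> 'c \<Rightarrow> 'c \<Rightarrow> 'm \<Rightarrow> ('m \<Rightarrow> 'k) \<Rightarrow> ('m \<Rightarrow> 'k)" where
  "dual_post C c e d f \<phi> = (\<lambda>x\<in>arr C e d. \<phi> (Comp C c e d x f))"

lemma dual_op_cat:
  "dual_pre (op_cat C) c d e g \<phi> = dual_post C e d c g \<phi>"
  "dual_post (op_cat C) c e d f \<phi> = dual_pre C d e c f \<phi>"
  by (simp_all add: dual_pre_def dual_post_def)

abbreviation nu_in ::
  "('k, 'r) ring_scheme \<Rightarrow> ('c, 'm, 'k) lincat \<Rightarrow> ('o, 'n, 'k) lincat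
    \<Rightarrow> ('c, 'm, 'o, 'n) funct \<Rightarrow> 'c \<Rightarrow> 'c \<Rightarrow> ('m \<Rightarrow> 'k) \<Rightarrow> 'n" where
  "nu_in R C B F c \<equiv> tensor_in R C B (dual_weight R C c) F"

lemma carrier_dual_zero:
  assumes "module R M" "carrier M = {\<zero>\<^bsub>M\<^esub>}"
  shows "carrier (dual R M) = {\<zero>\<^bsub>dual R M\<^esub>}"
proof -
  interpret M: module R M by fact
  interpret D: module R "dual R M" by (rule module_dual[OF assms(1)])
  have "\<phi> = \<zero>\<^bsub>dual R M\<^esub>" if "\<phi> \<in> linear_maps R M (self_module R)" for \<phi>
    by (rule linear_maps_eqI[OF that])
      (use D.zero_closed assms linear_maps_zero[OF assms(1) module_self_module[OF M.is_cring] that] in auto)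
  then have "carrier (dual R M) \<subseteq> {\<zero>\<^bsub>dual R M\<^esub>}" by (intro subsetI) (simp only: dual_simps(1) singleton_iff)
  moreover have "{\<zero>\<^bsub>dual R M\<^esub>} \<subseteq> carrier (dual R M)" using D.zero_closed by (simp only: insert_subset empty_subsetI simp_thms)
  ultimately show ?thesis by (rule equalityI)
qed

context nakayama_setting
begin

abbreviation "DH c d \<equiv> linear_maps R (Hom C c d) (self_module R)"
abbreviation "nob \<equiv> nu_ob R C B"
abbreviation "nin \<equiv> nu_in R C B"

lemma DH_app: "\<lbrakk>\<phi> \<in> DH c d; x \<in> arr C c d\<rbrakk> \<Longrightarrow> \<phi> x \<in> carrier R"
  using linear_maps_closed[of \<phi> R "Hom C c d" "self_module R" x] by simp

lemma dual_weight_FOb: "d \<in> Obj C \<Longrightarrow> FOb (dual_weight R C c) d = dual R (Hom C c d)"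
  by (simp add: dual_weight_def dual_functor_def hom_from_def)

lemma hom_from_linear:
  assumes "c \<in> Obj C" "d \<in> Obj C" "e \<in> Obj C" "g \<in> arr C d e"
  shows "FArr (hom_from C c) d e g \<in> linear_maps R (Hom C c d) (Hom C c e)"
  using C.post_linear[OF assms] by (simp add: hom_from_FArr assms)

lemma dual_weight_FArr:
  assumes "c \<in> Obj C" "d \<in> Obj C" "e \<in> Obj C" "g \<in> arr C d e"
  shows "FArr (dual_weight R C c) e d g = dual_map R (Hom C c d) (Hom C c e) (FArr (hom_from C c) d e g)"
    and "\<phi> \<in> DH c e \<Longrightarrow> FArr (dual_weight R C c) e d g \<phi> = dual_pre C c d e g \<phi>"
proof -
  show *: "FArr (dual_weight R C c) e d g = dual_map R (Hom C c d) (Hom C c e) (FArr (hom_from C c) d e g)"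
    using assms by (simp add: dual_weight_def dual_functor_def) (simp add: hom_from_def)
  show "\<phi> \<in> DH c e \<Longrightarrow> FArr (dual_weight R C c) e d g \<phi> = dual_pre C c d e g \<phi>"
    unfolding * by (simp add: dual_map_def dual_pre_def hom_from_FArr assms cong: restrict_cong)
qed

lemma dual_weight_linear:
  assumes "c \<in> Obj C" "d \<in> Obj C" "e \<in> Obj C" "g \<in> arr C d e"
  shows "FArr (dual_weight R C c) e d g \<in> linear_maps R (dual R (Hom C c e)) (dual R (Hom C c d))"
  unfolding dual_weight_FArr(1)[OF assms]
  by (rule dual_map_linear[OF C.hom_module[OF assms(1,2)] C.hom_module[OF assms(1,3)] hom_from_linear[OF assms]])

lemma dual_pre_closed:
  assumes "c \<in> Obj C" "d \<in> Obj C" "e \<in> Obj C" "g \<in> arr C d e" "\<phi> \<in> DH c e"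
  shows "dual_pre C c d e g \<phi> \<in> DH c d"
  using linear_maps_closed[OF dual_weight_linear[OF assms(1-4)], of \<phi>] dual_weight_FArr(2)[OF assms] assms(5) by simp

lemma dual_weight_right_module:
  assumes c: "c \<in> Obj C"
  shows "right_module R C (dual_weight R C c)"
proof (intro right_module.intro right_module_axioms.intro C.linear_category_axioms, goal_cases)
  case (1 d) then show ?case using module_dual[OF C.hom_module[OF c]] by (simp add: dual_weight_FOb)
next
  case (2 d e g) then show ?case using dual_weight_linear[OF c] by (simp add: dual_weight_FOb)
next
  case (3 d \<phi>)
  then have \<phi>: "\<phi> \<in> DH c d" by (simp add: dual_weight_FOb)
  show ?case
    unfolding dual_weight_FArr(2)[OF c 3(1,1) C.ident_arr[OF 3(1)] \<phi>] dual_pre_def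
    using restrict_linear_maps_eq[OF \<phi>] by (simp add: C.comp_ident_left[OF c 3(1)] cong: restrict_cong)
next
  case (4 d e f g \<phi>)
  then have \<phi>: "\<phi> \<in> DH c e" by (simp add: dual_weight_FOb)
  show ?case
    unfolding dual_weight_FArr(2)[OF c 4(1,2) C.add_arr[OF 4(1-4)] \<phi>] dual_weight_FArr(2)[OF c 4(1,2,3) \<phi>]
      dual_weight_FArr(2)[OF c 4(1,2,4) \<phi>] dual_weight_FOb[OF 4(1)] dual_pre_def
    by (simp add: C.comp_add_left[OF c 4(1,2) _ 4(3,4)] linear_maps_add[OF \<phi>] C.comp_arr[OF c 4(1,2) _ 4(3)]
        C.comp_arr[OF c 4(1,2) _ 4(4)] cong: restrict_cong)
next
  case (5 d e r f \<phi>)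
  then have \<phi>: "\<phi> \<in> DH c e" by (simp add: dual_weight_FOb)
  show ?case
    unfolding dual_weight_FArr(2)[OF c 5(1,2) C.smult_arr[OF 5(1-4)] \<phi>] dual_weight_FArr(2)[OF c 5(1,2,4) \<phi>]
      dual_weight_FOb[OF 5(1)] dual_pre_def
    by (simp add: C.comp_smult_left[OF c 5(1,2,3) _ 5(4)] linear_maps_smult[OF \<phi>] C.comp_arr[OF c 5(1,2) _ 5(4)]
        5(3) cong: restrict_cong)
qed

lemma dual_weight_map_app:
  assumes "c \<in> Obj C" "e \<in> Obj C" "d \<in> Obj C" "f \<in> arr C c e"
  shows "dual_weight_map R C c e f d \<in> linear_maps R (dual R (Hom C c d)) (dual R (Hom C e d))"
    and "\<phi> \<in> DH c d \<Longrightarrow> dual_weight_map R C c e f d \<phi> = dual_post C c e d f \<phi>"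
proof -
  have ft: "FArr (hom_to C d) e c f = (\<lambda>x\<in>arr C e d. Comp C c e d x f)"
    using assms by (simp add: hom_to_def hom_from_def)
  have *: "dual_weight_map R C c e f d = dual_map R (Hom C e d) (Hom C c d) (FArr (hom_to C d) e c f)"
    using assms by (simp add: dual_weight_map_def)
  show "dual_weight_map R C c e f d \<in> linear_maps R (dual R (Hom C c d)) (dual R (Hom C e d))"
    unfolding * ft
    by (rule dual_map_linear[OF C.hom_module[OF assms(2,3)] C.hom_module[OF assms(1,3)] C.pre_linear[OF assms]])
  show "\<phi> \<in> DH c d \<Longrightarrow> dual_weight_map R C c e f d \<phi> = dual_post C c e d f \<phi>"
    unfolding * ft by (simp add: dual_map_def dual_post_def cong: restrict_cong)
qed

lemma dual_post_closed:
  assumes "c \<in> Obj C" "e \<in> Obj C" "d \<in> Obj C" "f \<in> arr C c e" "\<phi> \<in> DH c d"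
  shows "dual_post C c e d f \<phi> \<in> DH e d"
  using linear_maps_closed[OF dual_weight_map_app(1)[OF assms(1-4)], of \<phi>] dual_weight_map_app(2)[OF assms] assms(5) by simp

lemma dual_pre_post:
  assumes o: "c \<in> Obj C" "c' \<in> Obj C" "d \<in> Obj C" "d' \<in> Obj C"
    and f: "f \<in> arr C c c'" and g: "g \<in> arr C d d'"
  shows "dual_post C c c' d f (dual_pre C c d d' g \<phi>) = dual_pre C c' d d' g (dual_post C c c' d' f \<phi>)"
  unfolding dual_pre_def dual_post_def
  by (rule restrict_ext)
    (simp add: C.comp_arr[OF o(1,2,3) f] C.comp_arr[OF o(2,3,4) _ g] C.comp_assoc[OF o(1,2,3,4) f _ g])

lemma nu_diagram:
  assumes "F \<in> Obj FC" "c \<in> Obj C"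
  shows "weighted_diagram R C B (dual_weight R C c) F"
  by (intro weighted_diagram.intro weighted_diagram_axioms.intro dual_weight_right_module assms
      B.linear_category_axioms functor_catD(1)[OF assms(1)])

text \<open>The weight \<open>D(C(c,-))\<close> inherits finite support and dual bases from \<open>C(c,-)\<close>.\<close>

lemma nu_colimit_exists:
  assumes F: "F \<in> Obj FC" and c: "c \<in> Obj C"
  shows "\<exists>X u. is_weighted_colimit R C B (dual_weight R C c) F X u"
proof (rule weighted_diagram.weighted_colimit_exists[OF nu_diagram[OF F c]])
  show "abelian_category R B" by (rule B.abelian_category_axioms)
  show "locally_bounded C" by (rule locally_bounded)
  have "{d \<in> Obj C. carrier (FOb (dual_weight R C c) d) \<noteq> {\<zero>\<^bsub>FOb (dual_weight R C c) d\<^esub>}}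
      \<subseteq> {d \<in> Obj C. arr C c d \<noteq> {\<zero>\<^bsub>Hom C c d\<^esub>}}"
    using carrier_dual_zero[OF C.hom_module[OF c]] by (auto simp: dual_weight_FOb simp del: dual_simps)
  then show "finite {d \<in> Obj C. carrier (FOb (dual_weight R C c) d) \<noteq> {\<zero>\<^bsub>FOb (dual_weight R C c) d\<^esub>}}"
    by (rule finite_subset[OF _ finite_from[OF c]])
  fix d assume d: "d \<in> Obj C"
  obtain n e \<epsilon> where "dual_basis R (Hom C c d) n e \<epsilon>"
    using fg_projective_dual_basis[OF fg_hom[OF c d]] by (elim exE)
  from dual_basis_dual[OF this] show "\<exists>n e \<epsilon>. dual_basis R (FOb (dual_weight R C c) d) n e \<epsilon>"
    unfolding dual_weight_FOb[OF d] by (intro exI)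
next
  fix d e assume "d \<in> Obj C" "e \<in> Obj C"
  then show "\<exists>n b \<epsilon>. dual_basis R (Hom C d e) n b \<epsilon>" by (intro fg_projective_dual_basis fg_hom)
qed

lemma nob_FOb: "c \<in> Obj C \<Longrightarrow> FOb (nob F) c = tensor_ob R C B (dual_weight R C c) F"
  by (simp add: nu_ob_def)

lemma nu_colimit:
  assumes "F \<in> Obj FC" "c \<in> Obj C"
  shows "is_weighted_colimit R C B (dual_weight R C c) F (FOb (nob F) c) (nin F c)"
  unfolding nob_FOb[OF assms(2)] by (rule tensor_is_weighted_colimit[OF nu_colimit_exists[OF assms]])

lemma nob_ob: "\<lbrakk>F \<in> Obj FC; c \<in> Obj C\<rbrakk> \<Longrightarrow> FOb (nob F) c \<in> Obj B"
  by (rule weighted_coconeD(1)[OF is_weighted_colimitD(1)[OF nu_colimit]])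

lemma nin_linear:
  "\<lbrakk>F \<in> Obj FC; c \<in> Obj C; d \<in> Obj C\<rbrakk>
    \<Longrightarrow> nin F c d \<in> linear_maps R (dual R (Hom C c d)) (Hom B (FOb F d) (FOb (nob F) c))"
  using weighted_coconeD(2)[OF is_weighted_colimitD(1)[OF nu_colimit]] by (simp add: dual_weight_FOb)

lemma nin_arr:
  "\<lbrakk>F \<in> Obj FC; c \<in> Obj C; d \<in> Obj C; \<phi> \<in> DH c d\<rbrakk> \<Longrightarrow> nin F c d \<phi> \<in> arr B (FOb F d) (FOb (nob F) c)"
  using linear_maps_closed[OF nin_linear] by simp

lemma nin_pre:
  assumes "F \<in> Obj FC" "c \<in> Obj C" "d \<in> Obj C" "e \<in> Obj C" "g \<in> arr C d e" "\<phi> \<in> DH c e"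
  shows "nin F c d (dual_pre C c d e g \<phi>)
    = Comp B (FOb F d) (FOb F e) (FOb (nob F) c) (nin F c e \<phi>) (FArr F d e g)"
  using weighted_coconeD(4)[OF is_weighted_colimitD(1)[OF nu_colimit[OF assms(1,2)]] assms(3,4,5), of \<phi>]
    dual_weight_FArr(2)[OF assms(2-6)] assms(4,6) by (simp add: dual_weight_FOb)

lemma nu_cancel:
  assumes F: "F \<in> Obj FC" and c: "c \<in> Obj C" and Y: "Y \<in> Obj B"
    and h: "h \<in> arr B (FOb (nob F) c) Y" "h' \<in> arr B (FOb (nob F) c) Y"
    and eq: "\<And>d \<phi>. \<lbrakk>d \<in> Obj C; \<phi> \<in> DH c d\<rbrakk> \<Longrightarrow> Comp B (FOb F d) (FOb (nob F) c) Y h (nin F c d \<phi>)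
      = Comp B (FOb F d) (FOb (nob F) c) Y h' (nin F c d \<phi>)"
  shows "h = h'"
  by (rule weighted_diagram.weighted_colimit_cancel[OF nu_diagram[OF F c] nu_colimit[OF F c] Y h])
    (simp add: eq dual_weight_FOb)

lemma nu_arr:
  assumes F: "F \<in> Obj FC" and o: "c \<in> Obj C" "e \<in> Obj C" and f: "f \<in> arr C c e"
  shows "FArr (nob F) c e f \<in> arr B (FOb (nob F) c) (FOb (nob F) e)"
    and "\<lbrakk>d \<in> Obj C; \<phi> \<in> DH c d\<rbrakk> \<Longrightarrow>
      Comp B (FOb F d) (FOb (nob F) c) (FOb (nob F) e) (FArr (nob F) c e f) (nin F c d \<phi>)
        = nin F e d (dual_post C c e d f \<phi>)"
proof -
  interpret FL: linear_category R FC by (rule linear_functor_cat)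
  have id: "(\<lambda>d\<in>Obj C. Ident B (FOb F d)) \<in> nat_trans C B F F"
    using FL.ident_arr[OF F] by simp
  have wm: "weight_map R C (dual_weight R C c) (dual_weight R C e) (dual_weight_map R C c e f)"
    unfolding weight_map_def
  proof (intro conjI ballI)
    fix d assume d: "d \<in> Obj C"
    then show "dual_weight_map R C c e f d \<in> linear_maps R (FOb (dual_weight R C c) d) (FOb (dual_weight R C e) d)"
      using dual_weight_map_app(1)[OF o d f] by (simp add: dual_weight_FOb)
    fix d' g \<phi> assume d': "d' \<in> Obj C" and g: "g \<in> arr C d d'" and "\<phi> \<in> carrier (FOb (dual_weight R C c) d')"
    then have \<phi>: "\<phi> \<in> DH c d'" by (simp add: dual_weight_FOb)
    show "dual_weight_map R C c e f d (FArr (dual_weight R C c) d' d g \<phi>)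
        = FArr (dual_weight R C e) d' d g (dual_weight_map R C c e f d' \<phi>)"
      using dual_pre_post[OF o d d' f g]
      by (simp add: dual_weight_FArr(2)[OF o(1) d d' g \<phi>] dual_weight_map_app(2)[OF o d f]
          dual_weight_map_app(2)[OF o d' f \<phi>] dual_pre_closed[OF o(1) d d' g \<phi>]
          dual_weight_FArr(2)[OF o(2) d d' g dual_post_closed[OF o d' f \<phi>]])
  qed
  note u = weighted_diagram.tensor_map_universal[OF nu_diagram[OF F o(1)] functor_catD(1)[OF F] wm id
      nu_colimit_exists[OF F o(1)] nu_colimit_exists[OF F o(2)]]
  have FA: "FArr (nob F) c e f = tensor_map R C B (dual_weight R C c) (dual_weight R C e)
      (dual_weight_map R C c e f) F F (\<lambda>d\<in>Obj C. Ident B (FOb F d))"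
    using o f by (simp add: nu_ob_def)
  show "FArr (nob F) c e f \<in> arr B (FOb (nob F) c) (FOb (nob F) e)"
    using u(1) by (simp add: FA nob_FOb o)
  assume d: "d \<in> Obj C" and \<phi>: "\<phi> \<in> DH c d"
  show "Comp B (FOb F d) (FOb (nob F) c) (FOb (nob F) e) (FArr (nob F) c e f) (nin F c d \<phi>)
        = nin F e d (dual_post C c e d f \<phi>)"
    using u(2)[OF d, of \<phi>] \<phi> d dual_weight_map_app(2)[OF o d f \<phi>]
      B.comp_ident_right[OF objD(1)[OF F d] nob_ob[OF F o(2)] nin_arr[OF F o(2) d dual_post_closed[OF o d f \<phi>]]]
    by (simp add: FA nob_FOb o dual_weight_FOb)
qed

lemma nob_obj:
  assumes F: "F \<in> Obj FC"
  shows "nob F \<in> Obj FC"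
proof (rule functor_by_generators[where J = "\<lambda>c. Sigma (Obj C) (DH c)" and s = "\<lambda>c z. FOb F (fst z)"
      and t = "\<lambda>c z. nin F c (fst z) (snd z)" and r = "\<lambda>c e f z. nin F e (fst z) (dual_post C c e (fst z) f (snd z))"],
    goal_cases)
  case 1 show ?case by (simp add: nu_ob_def mk_functor_idem)
next
  case (5 c Y h h')
  show ?case by (rule nu_cancel[OF F 5(1-4)]) (use 5(5)[of "(_, _)"] in simp_all)
next
  case (8 c z)
  then obtain d \<phi> where z: "z = (d, \<phi>)" and d: "d \<in> Obj C" and \<phi>: "\<phi> \<in> DH c d" by auto
  show ?case
    using restrict_linear_maps_eq[OF \<phi>]
    by (simp add: z dual_post_def C.comp_ident_right[OF 8(1) d] cong: restrict_cong)
next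
  case (9 c e e' f g z)
  then obtain d \<phi> where z: "z = (d, \<phi>)" and d: "d \<in> Obj C" and \<phi>: "\<phi> \<in> DH c d" by auto
  have "dual_post C c e' d (Comp C c e e' g f) \<phi> = dual_post C e e' d g (dual_post C c e d f \<phi>)"
    unfolding dual_post_def
    by (rule restrict_ext)
      (simp add: C.comp_arr[OF 9(2,3) d 9(5)] C.comp_assoc[OF 9(1,2,3) d 9(4,5)])
  then show ?case using nu_arr(2)[OF F 9(2,3,5) d dual_post_closed[OF 9(1,2) d 9(4) \<phi>]] by (simp add: z)
next
  case (10 c e f g z)
  then obtain d \<phi> where z: "z = (d, \<phi>)" and d: "d \<in> Obj C" and \<phi>: "\<phi> \<in> DH c d" by auto
  have "dual_post C c e d (f \<oplus>\<^bsub>Hom C c e\<^esub> g) \<phi>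
      = dual_post C c e d f \<phi> \<oplus>\<^bsub>dual R (Hom C e d)\<^esub> dual_post C c e d g \<phi>"
    unfolding dual_post_def
    by (simp add: C.comp_add_right[OF 10(1,2) d 10(3,4)] linear_maps_add[OF \<phi>] C.comp_arr[OF 10(1,2) d 10(3)]
        C.comp_arr[OF 10(1,2) d 10(4)] cong: restrict_cong)
  then show ?case
    using linear_maps_add[OF nin_linear[OF F 10(2) d], of "dual_post C c e d f \<phi>" "dual_post C c e d g \<phi>"]
      dual_post_closed[OF 10(1,2) d 10(3) \<phi>] dual_post_closed[OF 10(1,2) d 10(4) \<phi>] by (simp add: z)
next
  case (11 c e a f z)
  then obtain d \<phi> where z: "z = (d, \<phi>)" and d: "d \<in> Obj C" and \<phi>: "\<phi> \<in> DH c d" by auto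
  have "dual_post C c e d (a \<odot>\<^bsub>Hom C c e\<^esub> f) \<phi> = a \<odot>\<^bsub>dual R (Hom C e d)\<^esub> dual_post C c e d f \<phi>"
    unfolding dual_post_def
    by (simp add: C.comp_smult_right[OF 11(1,2) d 11(3,4)] linear_maps_smult[OF \<phi> 11(3)] C.comp_arr[OF 11(1,2) d 11(4)]
        cong: restrict_cong)
  then show ?case
    using linear_maps_smult[OF nin_linear[OF F 11(2) d] 11(3), of "dual_post C c e d f \<phi>"]
      dual_post_closed[OF 11(1,2) d 11(4) \<phi>] by (simp add: z)
qed (use F nob_ob nin_arr nu_arr objD(1)[OF F] in auto)

lemma nu_map:
  assumes F: "F \<in> Obj FC" and G: "G \<in> Obj FC" and \<alpha>: "\<alpha> \<in> nat_trans C B F G"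
  shows "FArr (nu R C B) F G \<alpha> \<in> nat_trans C B (nob F) (nob G)"
    and "\<lbrakk>c \<in> Obj C; d \<in> Obj C; \<phi> \<in> DH c d\<rbrakk> \<Longrightarrow>
      Comp B (FOb F d) (FOb (nob F) c) (FOb (nob G) c) (FArr (nu R C B) F G \<alpha> c) (nin F c d \<phi>)
        = Comp B (FOb F d) (FOb G d) (FOb (nob G) c) (nin G c d \<phi>) (\<alpha> d)"
proof -
  let ?N = "FArr (nu R C B) F G \<alpha>"
  have FA: "?N = (\<lambda>c\<in>Obj C. tensor_map R C B (dual_weight R C c) (dual_weight R C c)
        (\<lambda>d\<in>Obj C. \<lambda>\<phi>\<in>carrier (FOb (dual_weight R C c) d). \<phi>) F G \<alpha>)"
    unfolding nu_def using mk_functor_simps(2)[OF F G, of \<alpha>] \<alpha> by simp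
  have both: "?N c \<in> arr B (FOb (nob F) c) (FOb (nob G) c)"
    "\<lbrakk>d \<in> Obj C; \<phi> \<in> DH c d\<rbrakk> \<Longrightarrow>
      Comp B (FOb F d) (FOb (nob F) c) (FOb (nob G) c) (?N c) (nin F c d \<phi>)
        = Comp B (FOb F d) (FOb G d) (FOb (nob G) c) (nin G c d \<phi>) (\<alpha> d)" if c: "c \<in> Obj C" for c d \<phi>
  proof -
    interpret W: right_module R C "dual_weight R C c" by (rule dual_weight_right_module[OF c])
    have wm: "weight_map R C (dual_weight R C c) (dual_weight R C c)
        (\<lambda>d\<in>Obj C. \<lambda>\<phi>\<in>carrier (FOb (dual_weight R C c) d). \<phi>)"
      unfolding weight_map_def
      using C.identity_linear[OF W.weight_module] W.weight_closed by simp
    note u = weighted_diagram.tensor_map_universal[OF nu_diagram[OF F c] functor_catD(1)[OF G] wm \<alpha>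
        nu_colimit_exists[OF F c] nu_colimit_exists[OF G c]]
    show "?N c \<in> arr B (FOb (nob F) c) (FOb (nob G) c)" using u(1) by (simp add: FA nob_FOb c)
    show "\<lbrakk>d \<in> Obj C; \<phi> \<in> DH c d\<rbrakk> \<Longrightarrow>
      Comp B (FOb F d) (FOb (nob F) c) (FOb (nob G) c) (?N c) (nin F c d \<phi>)
        = Comp B (FOb F d) (FOb G d) (FOb (nob G) c) (nin G c d \<phi>) (\<alpha> d)"
      using u(2)[of d \<phi>] by (simp add: FA nob_FOb c dual_weight_FOb)
  qed
  note Fo = objD[OF F] and Go = objD[OF G] and NF = objD[OF nob_obj[OF F]] and NG = objD[OF nob_obj[OF G]]
  note \<alpha>d = nat_transD(1)[OF \<alpha>]
  show "?N \<in> nat_trans C B (nob F) (nob G)"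
  proof (rule nat_transI)
    fix a b f assume ab: "a \<in> Obj C" "b \<in> Obj C" and f: "f \<in> arr C a b"
    note o = NF(1)[OF ab(1)] NF(1)[OF ab(2)] NG(1)[OF ab(1)] NG(1)[OF ab(2)]
    show "Comp B (FOb (nob F) a) (FOb (nob F) b) (FOb (nob G) b) (?N b) (FArr (nob F) a b f)
        = Comp B (FOb (nob F) a) (FOb (nob G) a) (FOb (nob G) b) (FArr (nob G) a b f) (?N a)"
    proof (rule nu_cancel[OF F ab(1) o(4)])
      fix d \<phi> assume d: "d \<in> Obj C" and \<phi>: "\<phi> \<in> DH a d"
      note f\<phi> = dual_post_closed[OF ab d f \<phi>]
      note n = nin_arr[OF F ab(1) d \<phi>] and n' = nin_arr[OF G ab(1) d \<phi>]
      show "Comp B (FOb F d) (FOb (nob F) a) (FOb (nob G) b)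
          (Comp B (FOb (nob F) a) (FOb (nob F) b) (FOb (nob G) b) (?N b) (FArr (nob F) a b f)) (nin F a d \<phi>)
        = Comp B (FOb F d) (FOb (nob F) a) (FOb (nob G) b)
          (Comp B (FOb (nob F) a) (FOb (nob G) a) (FOb (nob G) b) (FArr (nob G) a b f) (?N a)) (nin F a d \<phi>)"
        using B.comp_assoc[OF Fo(1)[OF d] o(1,2,4) n NF(2)[OF ab f] both(1)[OF ab(2)]]
          B.comp_assoc[OF Fo(1)[OF d] o(1,3,4) n both(1)[OF ab(1)] NG(2)[OF ab f]]
          B.comp_assoc[OF Fo(1)[OF d] Go(1)[OF d] o(3,4) \<alpha>d[OF d] n' NG(2)[OF ab f]]
          nu_arr(2)[OF F ab f d \<phi>] nu_arr(2)[OF G ab f d \<phi>] both(2)[OF ab(1) d \<phi>] both(2)[OF ab(2) d f\<phi>] by simp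
    qed (use B.comp_arr[OF o(1,2,4) NF(2)[OF ab f] both(1)[OF ab(2)]]
        B.comp_arr[OF o(1,3,4) both(1)[OF ab(1)] NG(2)[OF ab f]] in simp_all)
  qed (simp_all add: both(1), simp add: FA)
  show "\<lbrakk>c \<in> Obj C; d \<in> Obj C; \<phi> \<in> DH c d\<rbrakk> \<Longrightarrow>
      Comp B (FOb F d) (FOb (nob F) c) (FOb (nob G) c) (?N c) (nin F c d \<phi>)
        = Comp B (FOb F d) (FOb G d) (FOb (nob G) c) (nin G c d \<phi>) (\<alpha> d)"
    by (rule both(2))
qed

lemma nu_FOb: "F \<in> Obj FC \<Longrightarrow> FOb (nu R C B) F = nob F"
  by (simp add: nu_def)

lemma nu_functor: "is_functor FC FC (nu R C B)"
  unfolding is_functor_def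
proof (intro conjI ballI)
  let ?N = "nu R C B"
  interpret FL: linear_category R FC by (rule linear_functor_cat)
  fix F assume F: "F \<in> Obj FC"
  note Fo = objD[OF F] note NF = objD[OF nob_obj[OF F]]
  have FF: "FOb ?N F = nob F" by (rule nu_FOb[OF F])
  show "FOb ?N F \<in> Obj FC" using nob_obj[OF F] FF by simp
  {
    fix G \<alpha> assume G: "G \<in> Obj FC" and "\<alpha> \<in> arr FC F G"
    then have \<alpha>: "\<alpha> \<in> nat_trans C B F G" by simp
    show "FArr ?N F G \<alpha> \<in> arr FC (FOb ?N F) (FOb ?N G)"
      using nu_map(1)[OF F G \<alpha>] FF nu_FOb[OF G] by simp
  }
  have id: "Ident FC F \<in> nat_trans C B F F"
    using FL.ident_arr[OF F] by (simp only: functor_cat_simps(1))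
  have idN: "Ident FC (nob F) \<in> nat_trans C B (nob F) (nob F)"
    using FL.ident_arr[OF nob_obj[OF F]] by (simp only: functor_cat_simps(1))
  show "FArr ?N F F (Ident FC F) = Ident FC (FOb ?N F)"
    unfolding FF
  proof (rule nat_trans_eqI[OF nu_map(1)[OF F F id] idN])
    fix c assume c: "c \<in> Obj C"
    show "FArr ?N F F (Ident FC F) c = Ident FC (nob F) c"
    proof (rule nu_cancel[OF F c NF(1)[OF c] nat_transD(1)[OF nu_map(1)[OF F F id] c] nat_transD(1)[OF idN c]])
      fix d \<phi> assume d: "d \<in> Obj C" and \<phi>: "\<phi> \<in> DH c d"
      note n = nin_arr[OF F c d \<phi>]
      show "Comp B (FOb F d) (FOb (nob F) c) (FOb (nob F) c) (FArr ?N F F (Ident FC F) c) (nin F c d \<phi>)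
          = Comp B (FOb F d) (FOb (nob F) c) (FOb (nob F) c) (Ident FC (nob F) c) (nin F c d \<phi>)"
        using nu_map(2)[OF F F id c d \<phi>] c d B.comp_ident_left[OF Fo(1)[OF d] NF(1)[OF c] n]
          B.comp_ident_right[OF Fo(1)[OF d] NF(1)[OF c] n] by simp
    qed
  qed
  fix G H \<alpha> \<beta> assume G: "G \<in> Obj FC" and H: "H \<in> Obj FC" and "\<alpha> \<in> arr FC F G" "\<beta> \<in> arr FC G H"
  then have \<alpha>: "\<alpha> \<in> nat_trans C B F G" and \<beta>: "\<beta> \<in> nat_trans C B G H" by simp_all
  note Go = objD[OF G] and Ho = objD[OF H] and NG = objD[OF nob_obj[OF G]] and NH = objD[OF nob_obj[OF H]]
  have \<beta>\<alpha>: "Comp FC F G H \<beta> \<alpha> \<in> nat_trans C B F H"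
    using FL.comp_arr[OF F G H, unfolded functor_cat_simps(1), OF \<alpha> \<beta>] .
  note na = nu_map(1)[OF F G \<alpha>] and nb = nu_map(1)[OF G H \<beta>] and nba = nu_map(1)[OF F H \<beta>\<alpha>]
  have nbna: "Comp FC (nob F) (nob G) (nob H) (FArr ?N G H \<beta>) (FArr ?N F G \<alpha>) \<in> nat_trans C B (nob F) (nob H)"
    using FL.comp_arr[OF nob_obj[OF F] nob_obj[OF G] nob_obj[OF H], unfolded functor_cat_simps(1), OF na nb] .
  show "FArr ?N F H (Comp FC F G H \<beta> \<alpha>)
      = Comp FC (FOb ?N F) (FOb ?N G) (FOb ?N H) (FArr ?N G H \<beta>) (FArr ?N F G \<alpha>)"
    unfolding FF nu_FOb[OF G] nu_FOb[OF H]
  proof (rule nat_trans_eqI[OF nba nbna])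
    fix c assume c: "c \<in> Obj C"
    show "FArr ?N F H (Comp FC F G H \<beta> \<alpha>) c
        = Comp FC (nob F) (nob G) (nob H) (FArr ?N G H \<beta>) (FArr ?N F G \<alpha>) c"
    proof (rule nu_cancel[OF F c NH(1)[OF c] nat_transD(1)[OF nba c] nat_transD(1)[OF nbna c]])
      fix d \<phi> assume d: "d \<in> Obj C" and \<phi>: "\<phi> \<in> DH c d"
      note n = nin_arr[OF F c d \<phi>] nin_arr[OF G c d \<phi>] nin_arr[OF H c d \<phi>]
      show "Comp B (FOb F d) (FOb (nob F) c) (FOb (nob H) c) (FArr ?N F H (Comp FC F G H \<beta> \<alpha>) c) (nin F c d \<phi>)
        = Comp B (FOb F d) (FOb (nob F) c) (FOb (nob H) c)
            (Comp FC (nob F) (nob G) (nob H) (FArr ?N G H \<beta>) (FArr ?N F G \<alpha>) c) (nin F c d \<phi>)"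
        using nu_map(2)[OF F H \<beta>\<alpha> c d \<phi>] nu_map(2)[OF F G \<alpha> c d \<phi>] nu_map(2)[OF G H \<beta> c d \<phi>] c d
          B.comp_assoc[OF Fo(1)[OF d] NF(1)[OF c] NG(1)[OF c] NH(1)[OF c] n(1) nat_transD(1)[OF na c] nat_transD(1)[OF nb c]]
          B.comp_assoc[OF Fo(1)[OF d] Go(1)[OF d] NG(1)[OF c] NH(1)[OF c] nat_transD(1)[OF \<alpha> d] n(2) nat_transD(1)[OF nb c]]
          B.comp_assoc[OF Fo(1)[OF d] Go(1)[OF d] Ho(1)[OF d] NH(1)[OF c] nat_transD(1)[OF \<alpha> d] nat_transD(1)[OF \<beta> d] n(3)]
        by simp
    qed
  qed
qed

end


section \<open>The right adjoint of the Nakayama functor\<close>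

text \<open>The weighted limit \<open>Hom(D(C(-,d)), G)\<close> is the construction \<open>nu_ob\<close> for the opposite
  categories.\<close>

definition nu_right_ob ::
  "('k, 'r) ring_scheme \<Rightarrow> ('c, 'm, 'k) lincat \<Rightarrow> ('o, 'n, 'k) lincat
    \<Rightarrow> ('c, 'm, 'o, 'n) funct \<Rightarrow> ('c, 'm, 'o, 'n) funct" where
  "nu_right_ob R C B G = op_functor (op_cat C) (nu_ob R (op_cat C) (op_cat B) (op_functor C G))"

definition nu_right ::
  "('k, 'r) ring_scheme \<Rightarrow> ('c, 'm, 'k) lincat \<Rightarrow> ('o, 'n, 'k) lincat
    \<Rightarrow> (('c, 'm, 'o, 'n) funct, 'c \<Rightarrow> 'n, ('c, 'm, 'o, 'n) funct, 'c \<Rightarrow> 'n) funct" where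
  "nu_right R C B = mk_functor (functor_cat R C B) (nu_right_ob R C B)
     (\<lambda>G H \<beta>. FArr (nu R (op_cat C) (op_cat B)) (op_functor C H) (op_functor C G) \<beta>)"

abbreviation nu_proj ::
  "('k, 'r) ring_scheme \<Rightarrow> ('c, 'm, 'k) lincat \<Rightarrow> ('o, 'n, 'k) lincat
    \<Rightarrow> ('c, 'm, 'o, 'n) funct \<Rightarrow> 'c \<Rightarrow> 'c \<Rightarrow> ('m \<Rightarrow> 'k) \<Rightarrow> 'n" where
  "nu_proj R C B G \<equiv> nu_in R (op_cat C) (op_cat B) (op_functor C G)"

text \<open>The transformation \<open>F \<rightarrow> \<nu>\<^sup>-(\<nu> F)\<close> whose component at \<open>d\<close> has as coordinates the structure maps
  \<open>F d \<rightarrow> \<nu> F c\<close> of the tensor products \<open>D(C(c,-)) \<otimes> F\<close>.\<close>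

definition nu_unit ::
  "('k, 'r) ring_scheme \<Rightarrow> ('c, 'm, 'k) lincat \<Rightarrow> ('o, 'n, 'k) lincat
    \<Rightarrow> ('c, 'm, 'o, 'n) funct \<Rightarrow> 'c \<Rightarrow> 'n" where
  "nu_unit R C B F = (\<lambda>d\<in>Obj C. THE h. h \<in> arr B (FOb F d) (FOb (nu_right_ob R C B (nu_ob R C B F)) d) \<and>
     (\<forall>c\<in>Obj C. \<forall>\<phi>\<in>linear_maps R (Hom C c d) (self_module R).
        Comp B (FOb F d) (FOb (nu_right_ob R C B (nu_ob R C B F)) d) (FOb (nu_ob R C B F) c)
          (nu_proj R C B (nu_ob R C B F) d c \<phi>) h = nu_in R C B F c d \<phi>))"

context nakayama_setting
begin

abbreviation "nr \<equiv> nu_right_ob R C B"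
abbreviation "pr \<equiv> nu_proj R C B"
abbreviation "eta \<equiv> nu_unit R C B"

lemma nr_FOb: "c \<in> Obj C \<Longrightarrow> FOb (nr G) c = FOb (nu_ob R (op_cat C) (op_cat B) (op_functor C G)) c"
  by (simp add: nu_right_ob_def)

lemma nr_FArr:
  "\<lbrakk>c \<in> Obj C; d \<in> Obj C; f \<in> arr C c d\<rbrakk>
    \<Longrightarrow> FArr (nr G) c d f = FArr (nu_ob R (op_cat C) (op_cat B) (op_functor C G)) d c f"
  by (simp add: nu_right_ob_def)

lemma nr_obj:
  assumes G: "G \<in> Obj FC" shows "nr G \<in> Obj FC"
  using functor_setting.op_functor_obj[OF functor_setting_op
      nakayama_setting.nob_obj[OF op_setting op_functor_obj[OF G]]]
  unfolding nu_right_ob_def by (simp only: op_cat_op_cat)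

lemma pr_linear:
  assumes "G \<in> Obj FC" "d \<in> Obj C" "c \<in> Obj C"
  shows "pr G d c \<in> linear_maps R (dual R (Hom C c d)) (Hom B (FOb (nr G) d) (FOb G c))"
  using nakayama_setting.nin_linear[OF op_setting op_functor_obj[OF assms(1)], of d c] assms
  by (simp add: nr_FOb)

lemma pr_arr:
  assumes "G \<in> Obj FC" "d \<in> Obj C" "c \<in> Obj C" "\<phi> \<in> DH c d"
  shows "pr G d c \<phi> \<in> arr B (FOb (nr G) d) (FOb G c)"
  using linear_maps_closed[OF pr_linear[OF assms(1-3)]] assms(4) by simp

lemma pr_post:
  assumes "G \<in> Obj FC" "c \<in> Obj C" "d \<in> Obj C" "e \<in> Obj C" "g \<in> arr C e d" "\<phi> \<in> DH e c"
  shows "pr G c d (dual_post C e d c g \<phi>)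
    = Comp B (FOb (nr G) c) (FOb G e) (FOb G d) (FArr G e d g) (pr G c e \<phi>)"
  using nakayama_setting.nin_pre[OF op_setting op_functor_obj[OF assms(1)], of c d e g \<phi>] assms
  by (simp add: nr_FOb dual_op_cat)

lemma pr_pre:
  assumes "G \<in> Obj FC" "d \<in> Obj C" "e \<in> Obj C" "c \<in> Obj C" "g \<in> arr C d e" "\<phi> \<in> DH c e"
  shows "Comp B (FOb (nr G) d) (FOb (nr G) e) (FOb G c) (pr G e c \<phi>) (FArr (nr G) d e g)
    = pr G d c (dual_pre C c d e g \<phi>)"
  using nakayama_setting.nu_arr(2)[OF op_setting op_functor_obj[OF assms(1)], of e d g c \<phi>] assms
  by (simp add: nr_FOb nr_FArr dual_op_cat)

lemma pr_cancel:
  assumes G: "G \<in> Obj FC" and d: "d \<in> Obj C" and Y: "Y \<in> Obj B"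
    and h: "h \<in> arr B Y (FOb (nr G) d)" "h' \<in> arr B Y (FOb (nr G) d)"
    and eq: "\<And>c \<phi>. \<lbrakk>c \<in> Obj C; \<phi> \<in> DH c d\<rbrakk> \<Longrightarrow>
      Comp B Y (FOb (nr G) d) (FOb G c) (pr G d c \<phi>) h = Comp B Y (FOb (nr G) d) (FOb G c) (pr G d c \<phi>) h'"
  shows "h = h'"
  by (rule nakayama_setting.nu_cancel[OF op_setting op_functor_obj[OF G], of d Y])
    (use assms in \<open>simp_all add: nr_FOb\<close>)

lemma pr_universal:
  assumes G: "G \<in> Obj FC" and d: "d \<in> Obj C"
    and v: "weighted_cocone R (op_cat C) (op_cat B) (dual_weight R (op_cat C) d) (op_functor C G) Y v"
  shows "\<exists>!h. h \<in> arr B Y (FOb (nr G) d) \<and>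
    (\<forall>c\<in>Obj C. \<forall>\<phi>\<in>DH c d. Comp B Y (FOb (nr G) d) (FOb G c) (pr G d c \<phi>) h = v c \<phi>)"
proof -
  have "is_weighted_colimit R (op_cat C) (op_cat B) (dual_weight R (op_cat C) d) (op_functor C G)
      (FOb (nr G) d) (pr G d)"
    using nakayama_setting.nu_colimit[OF op_setting op_functor_obj[OF G], of d] d by (simp add: nr_FOb)
  from is_weighted_colimitD(2)[OF this v, unfolded op_cat_simps] show ?thesis
    by (rule ex1_conj_cong) (simp add: nakayama_setting.dual_weight_FOb[OF op_setting] eq_commute)
qed

lemma nr_map:
  assumes G: "G \<in> Obj FC" and H: "H \<in> Obj FC" and \<beta>: "\<beta> \<in> nat_trans C B G H"
  shows "FArr (nu_right R C B) G H \<beta> \<in> nat_trans C B (nr G) (nr H)"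
    and "\<lbrakk>d \<in> Obj C; c \<in> Obj C; \<phi> \<in> DH c d\<rbrakk> \<Longrightarrow>
      Comp B (FOb (nr G) d) (FOb (nr H) d) (FOb H c) (pr H d c \<phi>) (FArr (nu_right R C B) G H \<beta> d)
        = Comp B (FOb (nr G) d) (FOb G c) (FOb H c) (\<beta> c) (pr G d c \<phi>)"
proof -
  have \<beta>': "\<beta> \<in> nat_trans (op_cat C) (op_cat B) (op_functor C H) (op_functor C G)"
    using \<beta> by (simp add: op_nat_trans)
  note m = nakayama_setting.nu_map[OF op_setting op_functor_obj[OF H] op_functor_obj[OF G] \<beta>']
  have FA: "FArr (nu_right R C B) G H \<beta> = FArr (nu R (op_cat C) (op_cat B)) (op_functor C H) (op_functor C G) \<beta>"
    unfolding nu_right_def using mk_functor_simps(2)[OF G H, of \<beta>] \<beta> by simp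
  show "FArr (nu_right R C B) G H \<beta> \<in> nat_trans C B (nr G) (nr H)"
    using m(1) functor_setting.op_nat_trans[OF functor_setting_op]
    unfolding FA nu_right_ob_def by (simp only: op_cat_op_cat)
  show "\<lbrakk>d \<in> Obj C; c \<in> Obj C; \<phi> \<in> DH c d\<rbrakk> \<Longrightarrow>
      Comp B (FOb (nr G) d) (FOb (nr H) d) (FOb H c) (pr H d c \<phi>) (FArr (nu_right R C B) G H \<beta> d)
        = Comp B (FOb (nr G) d) (FOb G c) (FOb H c) (\<beta> c) (pr G d c \<phi>)"
    using m(2)[of d c \<phi>] by (simp add: FA nr_FOb)
qed

lemma nr_functor_FOb: "G \<in> Obj FC \<Longrightarrow> FOb (nu_right R C B) G = nr G"
  by (simp add: nu_right_def)

lemma nu_right_functor: "is_functor FC FC (nu_right R C B)"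
  unfolding is_functor_def
proof (intro conjI ballI)
  let ?N = "nu_right R C B" and ?N' = "nu R (op_cat C) (op_cat B)"
  let ?FC' = "functor_cat R (op_cat C) (op_cat B)"
  interpret FL: linear_category R FC by (rule linear_functor_cat)
  note ai = anti_iso_functor_cat[unfolded anti_iso_def]
  note N' = nakayama_setting.nu_functor[OF op_setting, unfolded is_functor_def]
  have FA: "FArr ?N F G \<beta> = FArr ?N' (op_functor C G) (op_functor C F) \<beta>"
    if "F \<in> Obj FC" "G \<in> Obj FC" "\<beta> \<in> nat_trans C B F G" for F G \<beta>
    unfolding nu_right_def using mk_functor_simps(2)[OF that(1,2), of \<beta>] that(3) by simp
  have op_nr: "op_functor C (nr F) = FOb ?N' (op_functor C F)" if F: "F \<in> Obj FC" for F
    using functor_setting.op_functor_op_functor[OF functor_setting_op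
        nakayama_setting.nob_obj[OF op_setting op_functor_obj[OF F]]]
      nakayama_setting.nu_FOb[OF op_setting op_functor_obj[OF F]]
    unfolding nu_right_ob_def by (simp only: op_cat_op_cat)
  fix F assume F: "F \<in> Obj FC"
  note F' = op_functor_obj[OF F]
  have FF: "FOb ?N F = nr F" by (rule nr_functor_FOb[OF F])
  show "FOb ?N F \<in> Obj FC" using nr_obj[OF F] FF by simp
  {
    fix G \<alpha> assume G: "G \<in> Obj FC" and "\<alpha> \<in> arr FC F G"
    then have \<alpha>: "\<alpha> \<in> nat_trans C B F G" by simp
    show "FArr ?N F G \<alpha> \<in> arr FC (FOb ?N F) (FOb ?N G)"
      using nr_map(1)[OF F G \<alpha>] FF nr_functor_FOb[OF G] by simp
  }
  have id: "Ident FC F \<in> nat_trans C B F F"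
    using FL.ident_arr[OF F] by (simp only: functor_cat_simps(1))
  have "FArr ?N F F (Ident FC F) = FArr ?N' (op_functor C F) (op_functor C F) (Ident ?FC' (op_functor C F))"
    using FA[OF F F id] ai F by simp
  also have "\<dots> = Ident ?FC' (op_functor C (nr F))" using N' F' op_nr[OF F] by metis
  also have "\<dots> = Ident FC (nr F)" using ai nr_obj[OF F] by blast
  finally show "FArr ?N F F (Ident FC F) = Ident FC (FOb ?N F)" by (simp only: FF)
  fix G H \<alpha> \<beta> assume G: "G \<in> Obj FC" and H: "H \<in> Obj FC" and a: "\<alpha> \<in> arr FC F G" and b: "\<beta> \<in> arr FC G H"
  then have \<alpha>: "\<alpha> \<in> nat_trans C B F G" and \<beta>: "\<beta> \<in> nat_trans C B G H" by simp_all
  note G' = op_functor_obj[OF G] and H' = op_functor_obj[OF H]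
  have \<beta>\<alpha>: "Comp FC F G H \<beta> \<alpha> \<in> nat_trans C B F H"
    using FL.comp_arr[OF F G H, unfolded functor_cat_simps(1), OF \<alpha> \<beta>] .
  have ab': "\<beta> \<in> arr ?FC' (op_functor C H) (op_functor C G)" "\<alpha> \<in> arr ?FC' (op_functor C G) (op_functor C F)"
    using ai F G H a b by simp_all
  have "FArr ?N F H (Comp FC F G H \<beta> \<alpha>)
      = FArr ?N' (op_functor C H) (op_functor C F) (Comp ?FC' (op_functor C H) (op_functor C G) (op_functor C F) \<alpha> \<beta>)"
    using FA[OF F H \<beta>\<alpha>] ai F G H by metis
  also have "\<dots> = Comp ?FC' (op_functor C (nr H)) (op_functor C (nr G)) (op_functor C (nr F))
      (FArr ?N' (op_functor C G) (op_functor C F) \<alpha>) (FArr ?N' (op_functor C H) (op_functor C G) \<beta>)"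
    unfolding op_nr[OF F] op_nr[OF G] op_nr[OF H] using N' F' G' H' ab' by blast
  also have "\<dots> = Comp FC (nr F) (nr G) (nr H) (FArr ?N G H \<beta>) (FArr ?N F G \<alpha>)"
    unfolding FA[OF F G \<alpha>] FA[OF G H \<beta>] using ai nr_obj[OF F] nr_obj[OF G] nr_obj[OF H] by blast
  finally show "FArr ?N F H (Comp FC F G H \<beta> \<alpha>)
      = Comp FC (FOb ?N F) (FOb ?N G) (FOb ?N H) (FArr ?N G H \<beta>) (FArr ?N F G \<alpha>)"
    by (simp only: FF nr_functor_FOb[OF G] nr_functor_FOb[OF H])
qed

text \<open>The structure maps of \<open>\<nu> F c\<close>, for fixed \<open>d\<close> and varying \<open>c\<close>, are a cone over \<open>\<nu> F\<close>: the second
  action of \<open>C\<close> on \<open>D(C)\<close> is the one by which \<open>\<nu> F\<close> is a functor.\<close>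

lemma nin_cocone:
  assumes F: "F \<in> Obj FC" and d: "d \<in> Obj C"
  shows "weighted_cocone R (op_cat C) (op_cat B) (dual_weight R (op_cat C) d) (op_functor C (nob F))
    (FOb F d) (\<lambda>c. nin F c d)"
  unfolding weighted_cocone_def
proof (intro conjI ballI)
  note opD = nakayama_setting.dual_weight_FOb[OF op_setting] nakayama_setting.dual_weight_FArr(2)[OF op_setting]
  show "FOb F d \<in> Obj (op_cat B)" using objD(1)[OF F d] by simp
  fix c assume "c \<in> Obj (op_cat C)"
  then have c: "c \<in> Obj C" by simp
  show "nin F c d \<in> linear_maps R (FOb (dual_weight R (op_cat C) d) c) (Hom (op_cat B) (FOb (op_functor C (nob F)) c) (FOb F d))"
    using nin_linear[OF F c d] c by (simp add: opD)
  fix e f \<phi> assume "e \<in> Obj (op_cat C)" "f \<in> arr (op_cat C) c e" "\<phi> \<in> carrier (FOb (dual_weight R (op_cat C) d) e)"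
  then have e: "e \<in> Obj C" and f: "f \<in> arr C e c" and \<phi>: "\<phi> \<in> DH e d" by (simp_all add: opD)
  have "FArr (dual_weight R (op_cat C) d) e c f \<phi> = dual_post C e c d f \<phi>"
    using opD(2)[of d c e f \<phi>] c d e f \<phi> by (simp add: dual_op_cat)
  then show "nin F c d (FArr (dual_weight R (op_cat C) d) e c f \<phi>)
      = Comp (op_cat B) (FOb (op_functor C (nob F)) c) (FOb (op_functor C (nob F)) e) (FOb F d)
          (nin F e d \<phi>) (FArr (op_functor C (nob F)) c e f)"
    using nu_arr(2)[OF F e c f d \<phi>] c e f by simp
qed

lemma eta:
  assumes F: "F \<in> Obj FC" and d: "d \<in> Obj C"
  shows "eta F d \<in> arr B (FOb F d) (FOb (nr (nob F)) d)"
    and "\<lbrakk>c \<in> Obj C; \<phi> \<in> DH c d\<rbrakk> \<Longrightarrow>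
      Comp B (FOb F d) (FOb (nr (nob F)) d) (FOb (nob F) c) (pr (nob F) d c \<phi>) (eta F d) = nin F c d \<phi>"
  using theI'[OF pr_universal[OF nob_obj[OF F] d nin_cocone[OF F d]]] d by (simp_all add: nu_unit_def)

lemma eta_nat_trans:
  assumes F: "F \<in> Obj FC"
  shows "eta F \<in> nat_trans C B F (nr (nob F))"
proof (rule nat_transI)
  note Fo = objD[OF F] and NF = objD[OF nob_obj[OF F]] and NN = objD[OF nr_obj[OF nob_obj[OF F]]]
  fix a b g assume ab: "a \<in> Obj C" "b \<in> Obj C" and g: "g \<in> arr C a b"
  note o = Fo(1)[OF ab(1)] Fo(1)[OF ab(2)] NN(1)[OF ab(1)] NN(1)[OF ab(2)]
  note e = eta(1)[OF F ab(1)] eta(1)[OF F ab(2)]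
  show "Comp B (FOb F a) (FOb F b) (FOb (nr (nob F)) b) (eta F b) (FArr F a b g)
    = Comp B (FOb F a) (FOb (nr (nob F)) a) (FOb (nr (nob F)) b) (FArr (nr (nob F)) a b g) (eta F a)"
  proof (rule pr_cancel[OF nob_obj[OF F] ab(2) o(1) B.comp_arr[OF o(1,2,4) Fo(2)[OF ab g] e(2)]
        B.comp_arr[OF o(1,3,4) e(1) NN(2)[OF ab g]]])
    fix c \<phi> assume c: "c \<in> Obj C" and \<phi>: "\<phi> \<in> DH c b"
    note p = pr_arr[OF nob_obj[OF F] ab(2) c \<phi>]
    note g\<phi> = dual_pre_closed[OF c ab g \<phi>]
    show "Comp B (FOb F a) (FOb (nr (nob F)) b) (FOb (nob F) c) (pr (nob F) b c \<phi>)
          (Comp B (FOb F a) (FOb F b) (FOb (nr (nob F)) b) (eta F b) (FArr F a b g))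
      = Comp B (FOb F a) (FOb (nr (nob F)) b) (FOb (nob F) c) (pr (nob F) b c \<phi>)
          (Comp B (FOb F a) (FOb (nr (nob F)) a) (FOb (nr (nob F)) b) (FArr (nr (nob F)) a b g) (eta F a))"
      using B.comp_assoc[OF o(1,2,4) NF(1)[OF c] Fo(2)[OF ab g] e(2) p]
        B.comp_assoc[OF o(1,3,4) NF(1)[OF c] e(1) NN(2)[OF ab g] p]
        eta(2)[OF F ab(2) c \<phi>] eta(2)[OF F ab(1) c g\<phi>] pr_pre[OF nob_obj[OF F] ab c g \<phi>] nin_pre[OF F c ab g \<phi>]
      by simp
  qed
qed (simp_all add: eta(1)[OF F], simp add: nu_unit_def)

lemma eta_natural:
  assumes F: "F \<in> Obj FC" and G: "G \<in> Obj FC" and \<alpha>: "\<alpha> \<in> nat_trans C B F G" and d: "d \<in> Obj C"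
  shows "Comp B (FOb F d) (FOb G d) (FOb (nr (nob G)) d) (eta G d) (\<alpha> d)
    = Comp B (FOb F d) (FOb (nr (nob F)) d) (FOb (nr (nob G)) d)
        (FArr (nu_right R C B) (nob F) (nob G) (FArr (nu R C B) F G \<alpha>) d) (eta F d)"
proof -
  let ?N\<alpha> = "FArr (nu R C B) F G \<alpha>"
  let ?M = "FArr (nu_right R C B) (nob F) (nob G) ?N\<alpha>"
  note NF = nob_obj[OF F] and NG = nob_obj[OF G]
  note n\<alpha> = nu_map(1)[OF F G \<alpha>]
  note M = nr_map[OF NF NG n\<alpha>]
  note o = objD(1)[OF F d] objD(1)[OF G d] objD(1)[OF nr_obj[OF NF] d] objD(1)[OF nr_obj[OF NG] d]
  note a = nat_transD(1)[OF \<alpha> d] and m = nat_transD(1)[OF M(1) d]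
  note eF = eta(1)[OF F d] and eG = eta(1)[OF G d]
  show ?thesis
  proof (rule pr_cancel[OF NG d o(1) B.comp_arr[OF o(1,2,4) a eG] B.comp_arr[OF o(1,3,4) eF m]])
    fix c \<phi> assume c: "c \<in> Obj C" and \<phi>: "\<phi> \<in> DH c d"
    note p = pr_arr[OF NF d c \<phi>] pr_arr[OF NG d c \<phi>]
    note oc = objD(1)[OF NF c] objD(1)[OF NG c]
    show "Comp B (FOb F d) (FOb (nr (nob G)) d) (FOb (nob G) c) (pr (nob G) d c \<phi>)
          (Comp B (FOb F d) (FOb G d) (FOb (nr (nob G)) d) (eta G d) (\<alpha> d))
      = Comp B (FOb F d) (FOb (nr (nob G)) d) (FOb (nob G) c) (pr (nob G) d c \<phi>)
          (Comp B (FOb F d) (FOb (nr (nob F)) d) (FOb (nr (nob G)) d) (?M d) (eta F d))"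
      using B.comp_assoc[OF o(1,2,4) oc(2) a eG p(2)] B.comp_assoc[OF o(1,3,4) oc(2) eF m p(2)]
        B.comp_assoc[OF o(1,3) oc eF p(1) nat_transD(1)[OF n\<alpha> c]]
        eta(2)[OF F d c \<phi>] eta(2)[OF G d c \<phi>] M(2)[OF d c \<phi>] nu_map(2)[OF F G \<alpha> c d \<phi>] by simp
  qed
qed

text \<open>Both \<open>Hom(\<nu> F, G)\<close> and \<open>Hom(F, \<nu>\<^sup>- G)\<close> are the families \<open>D(C(c,d)) \<rightarrow> B(F d, G c)\<close> that are
  compatible with both actions of \<open>C\<close>.\<close>

lemma eta_universal:
  assumes F: "F \<in> Obj FC" and G: "G \<in> Obj FC" and f: "f \<in> nat_trans C B F (nr G)"
  shows "\<exists>!g. g \<in> nat_trans C B (nob F) G \<and>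
    (\<forall>d\<in>Obj C. f d = Comp B (FOb F d) (FOb (nr (nob F)) d) (FOb (nr G) d)
        (FArr (nu_right R C B) (nob F) G g d) (eta F d))"
proof -
  note NF = nob_obj[OF F]
  note Fo = objD[OF F] and Go = objD[OF G] and No = objD[OF NF] and RG = objD[OF nr_obj[OF G]]
    and RN = objD[OF nr_obj[OF NF]]
  note fd = nat_transD[OF f]
  let ?a = "\<lambda>c d. \<lambda>\<phi>\<in>DH c d. Comp B (FOb F d) (FOb (nr G) d) (FOb G c) (pr G d c \<phi>) (f d)"
  let ?P = "\<lambda>c h. h \<in> arr B (FOb (nob F) c) (FOb G c) \<and>
      (\<forall>d\<in>Obj C. \<forall>\<phi>\<in>DH c d. Comp B (FOb F d) (FOb (nob F) c) (FOb G c) h (nin F c d \<phi>) = ?a c d \<phi>)"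
  have ex: "\<exists>!h. ?P c h" if c: "c \<in> Obj C" for c
  proof -
    have "weighted_cocone R C B (dual_weight R C c) F (FOb G c) (?a c)"
      unfolding weighted_cocone_def
    proof (intro conjI ballI Go(1)[OF c])
      fix d assume d: "d \<in> Obj C"
      show "?a c d \<in> linear_maps R (FOb (dual_weight R C c) d) (Hom B (FOb F d) (FOb G c))"
        using B.comp_linear_pre[OF Fo(1)[OF d] RG(1)[OF d] Go(1)[OF c] fd(1)[OF d] pr_linear[OF G d c]
            module_dual[OF C.hom_module[OF c d]]] by (simp add: dual_weight_FOb[OF d])
      fix e g \<phi> assume e: "e \<in> Obj C" and g: "g \<in> arr C d e" and "\<phi> \<in> carrier (FOb (dual_weight R C c) e)"
      then have \<phi>: "\<phi> \<in> DH c e" by (simp add: dual_weight_FOb)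
      note g\<phi> = dual_pre_closed[OF c d e g \<phi>]
      show "?a c d (FArr (dual_weight R C c) e d g \<phi>) = Comp B (FOb F d) (FOb F e) (FOb G c) (?a c e \<phi>) (FArr F d e g)"
        using dual_weight_FArr(2)[OF c d e g \<phi>] g\<phi> \<phi> pr_pre[OF G d e c g \<phi>] fd(2)[OF d e g]
          B.comp_assoc[OF Fo(1)[OF d] RG(1)[OF d] RG(1)[OF e] Go(1)[OF c] fd(1)[OF d] RG(2)[OF d e g] pr_arr[OF G e c \<phi>]]
          B.comp_assoc[OF Fo(1)[OF d] Fo(1)[OF e] RG(1)[OF e] Go(1)[OF c] Fo(2)[OF d e g] fd(1)[OF e] pr_arr[OF G e c \<phi>]]
        by simp
    qed
    from is_weighted_colimitD(2)[OF nu_colimit[OF F c] this] show ?thesis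
      by (rule ex1_conj_cong) (simp add: dual_weight_FOb eq_commute)
  qed
  define g where "g = (\<lambda>c\<in>Obj C. THE h. ?P c h)"
  have "?P c (g c)" if "c \<in> Obj C" for c
    using theI'[OF ex[OF that]] unfolding g_def using that by simp
  then have g: "g c \<in> arr B (FOb (nob F) c) (FOb G c)"
    "\<lbrakk>d \<in> Obj C; \<phi> \<in> DH c d\<rbrakk> \<Longrightarrow> Comp B (FOb F d) (FOb (nob F) c) (FOb G c) (g c) (nin F c d \<phi>)
      = Comp B (FOb F d) (FOb (nr G) d) (FOb G c) (pr G d c \<phi>) (f d)" if "c \<in> Obj C" for c d \<phi>
    using that by simp_all
  have gN: "g \<in> nat_trans C B (nob F) G"
  proof (rule nat_transI)
    fix a b h assume ab: "a \<in> Obj C" "b \<in> Obj C" and h: "h \<in> arr C a b"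
    note o = No(1)[OF ab(1)] No(1)[OF ab(2)] Go(1)[OF ab(1)] Go(1)[OF ab(2)]
    show "Comp B (FOb (nob F) a) (FOb (nob F) b) (FOb G b) (g b) (FArr (nob F) a b h)
        = Comp B (FOb (nob F) a) (FOb G a) (FOb G b) (FArr G a b h) (g a)"
    proof (rule nu_cancel[OF F ab(1) o(4) B.comp_arr[OF o(1,2,4) No(2)[OF ab h] g(1)[OF ab(2)]]
          B.comp_arr[OF o(1,3,4) g(1)[OF ab(1)] Go(2)[OF ab h]]])
      fix d \<phi> assume d: "d \<in> Obj C" and \<phi>: "\<phi> \<in> DH a d"
      note h\<phi> = dual_post_closed[OF ab d h \<phi>]
      note n = nin_arr[OF F ab(1) d \<phi>]
      show "Comp B (FOb F d) (FOb (nob F) a) (FOb G b)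
            (Comp B (FOb (nob F) a) (FOb (nob F) b) (FOb G b) (g b) (FArr (nob F) a b h)) (nin F a d \<phi>)
          = Comp B (FOb F d) (FOb (nob F) a) (FOb G b)
            (Comp B (FOb (nob F) a) (FOb G a) (FOb G b) (FArr G a b h) (g a)) (nin F a d \<phi>)"
        using B.comp_assoc[OF Fo(1)[OF d] o(1,2,4) n No(2)[OF ab h] g(1)[OF ab(2)]]
          B.comp_assoc[OF Fo(1)[OF d] o(1,3,4) n g(1)[OF ab(1)] Go(2)[OF ab h]]
          B.comp_assoc[OF Fo(1)[OF d] RG(1)[OF d] o(3,4) fd(1)[OF d] pr_arr[OF G d ab(1) \<phi>] Go(2)[OF ab h]]
          nu_arr(2)[OF F ab h d \<phi>] g(2)[OF ab(1) d \<phi>] g(2)[OF ab(2) d h\<phi>] pr_post[OF G d ab(2,1) h \<phi>]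
        by simp
    qed
  qed (simp_all add: g(1), simp add: g_def)
  have iff: "(\<forall>d\<in>Obj C. f d = Comp B (FOb F d) (FOb (nr (nob F)) d) (FOb (nr G) d)
        (FArr (nu_right R C B) (nob F) G g' d) (eta F d))
    \<longleftrightarrow> (\<forall>c\<in>Obj C. \<forall>d\<in>Obj C. \<forall>\<phi>\<in>DH c d. Comp B (FOb F d) (FOb (nob F) c) (FOb G c) (g' c) (nin F c d \<phi>)
        = Comp B (FOb F d) (FOb (nr G) d) (FOb G c) (pr G d c \<phi>) (f d))" (is "?L \<longleftrightarrow> ?R")
    if g': "g' \<in> nat_trans C B (nob F) G" for g'
  proof -
    let ?M = "FArr (nu_right R C B) (nob F) G g'"
    note M = nr_map[OF NF G g']
    have key: "Comp B (FOb F d) (FOb (nr G) d) (FOb G c) (pr G d c \<phi>)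
          (Comp B (FOb F d) (FOb (nr (nob F)) d) (FOb (nr G) d) (?M d) (eta F d))
        = Comp B (FOb F d) (FOb (nob F) c) (FOb G c) (g' c) (nin F c d \<phi>)"
      if c: "c \<in> Obj C" and d: "d \<in> Obj C" and \<phi>: "\<phi> \<in> DH c d" for c d \<phi>
      using B.comp_assoc[OF Fo(1)[OF d] RN(1)[OF d] RG(1)[OF d] Go(1)[OF c] eta(1)[OF F d] nat_transD(1)[OF M(1) d] pr_arr[OF G d c \<phi>]]
        B.comp_assoc[OF Fo(1)[OF d] RN(1)[OF d] No(1)[OF c] Go(1)[OF c] eta(1)[OF F d] pr_arr[OF NF d c \<phi>] nat_transD(1)[OF g' c]]
        M(2)[OF d c \<phi>] eta(2)[OF F d c \<phi>] by simp
    show ?thesis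
    proof
      assume L: ?L
      show ?R
      proof (intro ballI)
        fix c d \<phi> assume c: "c \<in> Obj C" and d: "d \<in> Obj C" and \<phi>: "\<phi> \<in> DH c d"
        show "Comp B (FOb F d) (FOb (nob F) c) (FOb G c) (g' c) (nin F c d \<phi>)
            = Comp B (FOb F d) (FOb (nr G) d) (FOb G c) (pr G d c \<phi>) (f d)"
          by (subst bspec[OF L d]) (rule key[OF c d \<phi>, symmetric])
      qed
    next
      assume R: ?R
      show ?L
      proof
        fix d assume d: "d \<in> Obj C"
        show "f d = Comp B (FOb F d) (FOb (nr (nob F)) d) (FOb (nr G) d) (?M d) (eta F d)"
        proof (rule pr_cancel[OF G d Fo(1)[OF d] fd(1)[OF d]
              B.comp_arr[OF Fo(1)[OF d] RN(1)[OF d] RG(1)[OF d] eta(1)[OF F d] nat_transD(1)[OF M(1) d]]])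
          fix c \<phi> assume c: "c \<in> Obj C" and \<phi>: "\<phi> \<in> DH c d"
          show "Comp B (FOb F d) (FOb (nr G) d) (FOb G c) (pr G d c \<phi>) (f d)
            = Comp B (FOb F d) (FOb (nr G) d) (FOb G c) (pr G d c \<phi>)
                (Comp B (FOb F d) (FOb (nr (nob F)) d) (FOb (nr G) d) (?M d) (eta F d))"
            using key[OF c d \<phi>] R c d \<phi> by simp
        qed
      qed
    qed
  qed
  show ?thesis
  proof (rule ex1I[of _ g], intro conjI gN)
    show "\<forall>d\<in>Obj C. f d = Comp B (FOb F d) (FOb (nr (nob F)) d) (FOb (nr G) d)
        (FArr (nu_right R C B) (nob F) G g d) (eta F d)"
      by (rule iffD2[OF iff[OF gN]]) (use g(2) in simp)
  next
    fix g' assume a: "g' \<in> nat_trans C B (nob F) G \<and> (\<forall>d\<in>Obj C. f d = Comp B (FOb F d) (FOb (nr (nob F)) d) (FOb (nr G) d)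
        (FArr (nu_right R C B) (nob F) G g' d) (eta F d))"
    then have g': "g' \<in> nat_trans C B (nob F) G" by (rule conjunct1)
    note g'e = iffD1[OF iff[OF g'] conjunct2[OF a]]
    show "g' = g"
    proof (rule nat_trans_eqI[OF g' gN])
      fix c assume c: "c \<in> Obj C"
      show "g' c = g c"
        by (rule nu_cancel[OF F c Go(1)[OF c] nat_transD(1)[OF g' c] g(1)[OF c]]) (use g'e g(2)[OF c] c in simp)
    qed
  qed
qed

theorem nu_adjunction: "adjunction FC FC (nu R C B) (nu_right R C B) eta"
  unfolding adjunction_def
proof (intro conjI ballI nu_functor nu_right_functor)
  fix F assume F: "F \<in> Obj FC"
  note NF = nob_obj[OF F]
  have FF: "FOb (nu R C B) F = nob F" "FOb (nu_right R C B) (nob F) = nr (nob F)"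
    by (rule nu_FOb[OF F], rule nr_functor_FOb[OF NF])
  show "eta F \<in> arr FC F (FOb (nu_right R C B) (FOb (nu R C B) F))"
    using eta_nat_trans[OF F] by (simp add: FF)
  fix G assume G: "G \<in> Obj FC"
  note NG = nob_obj[OF G]
  have GG: "FOb (nu R C B) G = nob G" "FOb (nu_right R C B) (nob G) = nr (nob G)" "FOb (nu_right R C B) G = nr G"
    by (rule nu_FOb[OF G], rule nr_functor_FOb[OF NG], rule nr_functor_FOb[OF G])
  {
    fix \<alpha> assume "\<alpha> \<in> arr FC F G"
    then have \<alpha>: "\<alpha> \<in> nat_trans C B F G" by simp
    show "Comp FC F G (FOb (nu_right R C B) (FOb (nu R C B) G)) (eta G) \<alpha>
      = Comp FC F (FOb (nu_right R C B) (FOb (nu R C B) F)) (FOb (nu_right R C B) (FOb (nu R C B) G))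
          (FArr (nu_right R C B) (FOb (nu R C B) F) (FOb (nu R C B) G) (FArr (nu R C B) F G \<alpha>)) (eta F)"
      unfolding FF GG functor_cat_simps(5) by (intro restrict_ext) (rule eta_natural[OF F G \<alpha>])
  next
    fix f assume "f \<in> arr FC F (FOb (nu_right R C B) G)"
    then have f: "f \<in> nat_trans C B F (nr G)" by (simp add: GG)
    show "\<exists>!g. g \<in> arr FC (FOb (nu R C B) F) G \<and>
        f = Comp FC F (FOb (nu_right R C B) (FOb (nu R C B) F)) (FOb (nu_right R C B) G)
          (FArr (nu_right R C B) (FOb (nu R C B) F) G g) (eta F)"
      unfolding FF GG functor_cat_simps(1,5)
    proof (rule ex1_conj_cong[OF eta_universal[OF F G f]])
      fix g
      let ?E = "\<lambda>d. Comp B (FOb F d) (FOb (nr (nob F)) d) (FOb (nr G) d) (FArr (nu_right R C B) (nob F) G g d) (eta F d)"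
      have "f \<in> extensional (Obj C)" using f by (simp add: nat_trans_def PiE_iff)
      then show "f = (\<lambda>d\<in>Obj C. ?E d) \<longleftrightarrow> (\<forall>d\<in>Obj C. f d = ?E d)"
        using extensionalityI[of f "Obj C" "\<lambda>d\<in>Obj C. ?E d"] fun_cong[of f "\<lambda>d\<in>Obj C. ?E d"] by fastforce
    qed
  }
qed

end


section \<open>The Nakayama functor on free functors\<close>

text \<open>In terms of elements, the arrow \<open>x \<mapsto> \<phi> \<otimes> (id \<otimes> x)\<close> from \<open>X c\<close> to \<open>D(C(d,-)) \<otimes> P\<close>.\<close>

definition nu_free_in ::
  "('k, 'r) ring_scheme \<Rightarrow> ('c, 'm, 'k) lincat \<Rightarrow> ('o, 'n, 'k) lincat \<Rightarrow> ('c \<Rightarrow> 'o)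
    \<Rightarrow> ('c, 'm, 'o, 'n) funct \<Rightarrow> ('c \<Rightarrow> 'c \<Rightarrow> 'm \<Rightarrow> 'n) \<Rightarrow> 'c \<Rightarrow> 'c \<Rightarrow> ('m \<Rightarrow> 'k) \<Rightarrow> 'n" where
  "nu_free_in R C B X P u d c = (\<lambda>\<phi>\<in>linear_maps R (Hom C d c) (self_module R).
     Comp B (X c) (FOb P c) (FOb (nu_ob R C B P) d) (nu_in R C B P d c \<phi>) (u c c (Ident C c)))"

context nakayama_setting
begin

lemma dual_pre_ident:
  assumes "c \<in> Obj C" "d \<in> Obj C" "\<phi> \<in> DH c d"
  shows "dual_pre C c d d (Ident C d) \<phi> = \<phi>"
  unfolding dual_pre_def using restrict_linear_maps_eq[OF assms(3)] assms
  by (simp add: C.comp_ident_left[OF assms(1,2)] cong: restrict_cong)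

lemma dual_pre_comp:
  assumes o: "d \<in> Obj C" "c \<in> Obj C" "e \<in> Obj C" "e' \<in> Obj C" and m: "m \<in> arr C c e" and g: "g \<in> arr C e e'"
  shows "dual_pre C d c e m (dual_pre C d e e' g \<phi>) = dual_pre C d c e' (Comp C c e e' g m) \<phi>"
  unfolding dual_pre_def
  by (rule restrict_ext) (simp add: C.comp_arr[OF o(1,2,3) _ m] C.comp_assoc[OF o _ m g])

context
  fixes X P u
  assumes P: "is_free R B C X P u"
begin

private lemmas Pd = is_freeD[OF P]
private lemmas Po = objD[OF Pd(1)]
private lemmas NP = nob_obj[OF Pd(1)]
private lemmas No = objD[OF NP]
private abbreviation "q \<equiv> nu_free_in R C B X P u"
private lemmas id_arr = Pd(5)[OF _ _ C.ident_arr]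

lemma nu_free_in_arr:
  assumes "d \<in> Obj C" "c \<in> Obj C" "\<phi> \<in> DH d c"
  shows "q d c \<phi> \<in> arr B (X c) (FOb (nob P) d)"
  using B.comp_arr[OF Pd(2)[OF assms(2)] Po(1)[OF assms(2)] No(1)[OF assms(1)] id_arr[OF assms(2,2,2)]
      nin_arr[OF Pd(1) assms]] assms(3) by (simp add: nu_free_in_def)

text \<open>In terms of elements, \<open>\<phi> \<otimes> (m \<otimes> x) = \<phi> m \<otimes> (id \<otimes> x)\<close>.\<close>

lemma nin_free:
  assumes d: "d \<in> Obj C" and e: "e \<in> Obj C" and c: "c \<in> Obj C" and m: "m \<in> arr C c e" and \<phi>: "\<phi> \<in> DH d e"
  shows "Comp B (X c) (FOb P e) (FOb (nob P) d) (nin P d e \<phi>) (u e c m) = q d c (dual_pre C d c e m \<phi>)"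
proof -
  have "u e c m = Comp B (X c) (FOb P c) (FOb P e) (FArr P c e m) (u c c (Ident C c))"
    using Pd(4)[OF c c e C.ident_arr[OF c] m] C.comp_ident_right[OF c e m] by simp
  then show ?thesis
    using B.comp_assoc[OF Pd(2)[OF c] Po(1)[OF c] Po(1)[OF e] No(1)[OF d] id_arr[OF c c c] Po(2)[OF c e m]
        nin_arr[OF Pd(1) d e \<phi>]] nin_pre[OF Pd(1) d c e m \<phi>] dual_pre_closed[OF d c e m \<phi>]
    by (simp add: nu_free_in_def)
qed

text \<open>This is the isomorphism of \<open>D(C(d,-)) \<otimes> (C(c,-) \<otimes> X c)\<close> and \<open>D(C(d,c)) \<otimes> X c\<close>, summed over \<open>c\<close>. A cocone
  under \<open>P\<close> is determined on generators by the Yoneda lemma, which leaves a linear map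
  \<open>D(C(d,c)) \<rightarrow> B(X c, Y)\<close> for each \<open>c\<close>.\<close>

lemma nu_free_copower:
  assumes d: "d \<in> Obj C"
  shows "is_copower_sum R B (Obj C) (\<lambda>c. dual R (Hom C d c)) X (FOb (nob P) d) (q d)"
proof -
  interpret W: right_module R C "dual_weight R C d" by (rule dual_weight_right_module[OF d])
  have "\<exists>!h. h \<in> arr B (FOb (nob P) d) Y \<and> (\<forall>c\<in>Obj C. \<forall>\<phi>\<in>carrier (dual R (Hom C d c)).
      Comp B (X c) (FOb (nob P) d) Y h (q d c \<phi>) = a c \<phi>)"
    if Y: "Y \<in> Obj B" and a: "\<forall>c\<in>Obj C. a c \<in> linear_maps R (dual R (Hom C d c)) (Hom B (X c) Y)" for Y a
  proof -
    have al: "a c \<in> linear_maps R (dual R (Hom C d c)) (Hom B (X c) Y)" if "c \<in> Obj C" for c using a that by simp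
    let ?P = "\<lambda>e \<phi> h. h \<in> arr B (FOb P e) Y \<and> (\<forall>c\<in>Obj C. \<forall>m\<in>arr C c e.
        Comp B (X c) (FOb P e) Y h (u e c m) = (\<lambda>m\<in>arr C c e. a c (dual_pre C d c e m \<phi>)) m)"
    have ex: "\<exists>!h. ?P e \<phi> h" if e: "e \<in> Obj C" and \<phi>: "\<phi> \<in> DH d e" for e \<phi>
    proof (rule is_copower_sumD(4)[OF Pd(3)[OF e] Y])
      fix c assume c: "c \<in> Obj C"
      have "\<phi> \<in> carrier (FOb (dual_weight R C d) e)" using \<phi> e by (simp add: dual_weight_FOb)
      from W.weight_orbit_linear[OF c e this]
      have "(\<lambda>m\<in>arr C c e. dual_pre C d c e m \<phi>) \<in> linear_maps R (Hom C c e) (dual R (Hom C d c))"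
        by (simp add: dual_weight_FOb[OF c] dual_weight_FArr(2)[OF d c e _ \<phi>] cong: restrict_cong)
      from linear_maps_compose[OF this al[OF c] C.hom_module[OF c e]]
      show "(\<lambda>m\<in>arr C c e. a c (dual_pre C d c e m \<phi>)) \<in> linear_maps R (Hom C c e) (Hom B (X c) Y)"
        by (simp cong: restrict_cong)
    qed
    define v where "v e = (\<lambda>\<phi>\<in>DH d e. THE h. ?P e \<phi> h)" for e
    have v: "v e \<phi> \<in> arr B (FOb P e) Y"
      "\<lbrakk>c \<in> Obj C; m \<in> arr C c e\<rbrakk> \<Longrightarrow> Comp B (X c) (FOb P e) Y (v e \<phi>) (u e c m) = a c (dual_pre C d c e m \<phi>)"
      if "e \<in> Obj C" "\<phi> \<in> DH d e" for e \<phi> c m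
      using theI'[OF ex[OF that]] that by (simp_all add: v_def)
    have vl: "v e \<in> linear_maps R (dual R (Hom C d e)) (Hom B (FOb P e) Y)" if e: "e \<in> Obj C" for e
    proof -
      interpret D: module R "dual R (Hom C d e)" by (rule module_dual[OF C.hom_module[OF d e]])
      show ?thesis
      proof (rule linear_mapsI)
        fix \<phi> assume "\<phi> \<in> carrier (dual R (Hom C d e))"
        then show "v e \<phi> \<in> carrier (Hom B (FOb P e) Y)" using v(1)[OF e] by simp
      next
        fix \<phi> assume "\<phi> \<notin> carrier (dual R (Hom C d e))"
        then show "v e \<phi> = undefined" by (simp add: v_def)
      next
        fix \<phi> \<psi> assume p: "\<phi> \<in> carrier (dual R (Hom C d e))" "\<psi> \<in> carrier (dual R (Hom C d e))"
        have s: "\<phi> \<oplus>\<^bsub>dual R (Hom C d e)\<^esub> \<psi> \<in> DH d e" using D.a_closed[OF p] by (simp only: dual_simps(1))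
        have p': "\<phi> \<in> DH d e" "\<psi> \<in> DH d e" using p by simp_all
        show "v e (\<phi> \<oplus>\<^bsub>dual R (Hom C d e)\<^esub> \<psi>) = v e \<phi> \<oplus>\<^bsub>Hom B (FOb P e) Y\<^esub> v e \<psi>"
        proof (rule free_cancel[OF P e Y v(1)[OF e s] B.add_arr[OF Po(1)[OF e] Y v(1)[OF e p'(1)] v(1)[OF e p'(2)]]])
          fix c m assume c: "c \<in> Obj C" and m: "m \<in> arr C c e"
          have "dual_pre C d c e m (\<phi> \<oplus>\<^bsub>dual R (Hom C d e)\<^esub> \<psi>)
              = dual_pre C d c e m \<phi> \<oplus>\<^bsub>dual R (Hom C d c)\<^esub> dual_pre C d c e m \<psi>"
            by (simp add: dual_pre_def C.comp_arr[OF d c e _ m] cong: restrict_cong)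
          then show "Comp B (X c) (FOb P e) Y (v e (\<phi> \<oplus>\<^bsub>dual R (Hom C d e)\<^esub> \<psi>)) (u e c m)
              = Comp B (X c) (FOb P e) Y (v e \<phi> \<oplus>\<^bsub>Hom B (FOb P e) Y\<^esub> v e \<psi>) (u e c m)"
            using v(2)[OF e s c m] v(2)[OF e p'(1) c m] v(2)[OF e p'(2) c m]
              B.comp_add_left[OF Pd(2)[OF c] Po(1)[OF e] Y Pd(5)[OF c e m] v(1)[OF e p'(1)] v(1)[OF e p'(2)]]
              linear_maps_add[OF al[OF c], of "dual_pre C d c e m \<phi>" "dual_pre C d c e m \<psi>"]
              dual_pre_closed[OF d c e m p'(1)] dual_pre_closed[OF d c e m p'(2)]
            by (simp del: dual_simps(3))
        qed
      next
        fix r \<phi> assume r: "r \<in> carrier R" and p: "\<phi> \<in> carrier (dual R (Hom C d e))"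
        have s: "r \<odot>\<^bsub>dual R (Hom C d e)\<^esub> \<phi> \<in> DH d e" using D.smult_closed[OF r p] by (simp only: dual_simps(1))
        have p': "\<phi> \<in> DH d e" using p by simp
        show "v e (r \<odot>\<^bsub>dual R (Hom C d e)\<^esub> \<phi>) = r \<odot>\<^bsub>Hom B (FOb P e) Y\<^esub> v e \<phi>"
        proof (rule free_cancel[OF P e Y v(1)[OF e s] B.smult_arr[OF Po(1)[OF e] Y r v(1)[OF e p']]])
          fix c m assume c: "c \<in> Obj C" and m: "m \<in> arr C c e"
          have "dual_pre C d c e m (r \<odot>\<^bsub>dual R (Hom C d e)\<^esub> \<phi>) = r \<odot>\<^bsub>dual R (Hom C d c)\<^esub> dual_pre C d c e m \<phi>"
            by (simp add: dual_pre_def C.comp_arr[OF d c e _ m] cong: restrict_cong)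
          then show "Comp B (X c) (FOb P e) Y (v e (r \<odot>\<^bsub>dual R (Hom C d e)\<^esub> \<phi>)) (u e c m)
              = Comp B (X c) (FOb P e) Y (r \<odot>\<^bsub>Hom B (FOb P e) Y\<^esub> v e \<phi>) (u e c m)"
            using v(2)[OF e s c m] v(2)[OF e p' c m]
              B.comp_smult_left[OF Pd(2)[OF c] Po(1)[OF e] Y r Pd(5)[OF c e m] v(1)[OF e p']]
              linear_maps_smult[OF al[OF c] r, of "dual_pre C d c e m \<phi>"] dual_pre_closed[OF d c e m p']
            by (simp del: dual_simps(4))
        qed
      qed
    qed
    have "weighted_cocone R C B (dual_weight R C d) P Y v"
      unfolding weighted_cocone_def
    proof (intro conjI ballI Y)
      fix e assume e: "e \<in> Obj C"
      show "v e \<in> linear_maps R (FOb (dual_weight R C d) e) (Hom B (FOb P e) Y)"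
        using vl[OF e] by (simp add: dual_weight_FOb[OF e])
      fix e' g \<phi> assume e': "e' \<in> Obj C" and g: "g \<in> arr C e e'" and "\<phi> \<in> carrier (FOb (dual_weight R C d) e')"
      then have \<phi>: "\<phi> \<in> DH d e'" by (simp add: dual_weight_FOb)
      note g\<phi> = dual_pre_closed[OF d e e' g \<phi>]
      have "v e (dual_pre C d e e' g \<phi>) = Comp B (FOb P e) (FOb P e') Y (v e' \<phi>) (FArr P e e' g)"
      proof (rule free_cancel[OF P e Y v(1)[OF e g\<phi>] B.comp_arr[OF Po(1)[OF e] Po(1)[OF e'] Y Po(2)[OF e e' g] v(1)[OF e' \<phi>]]])
        fix c m assume c: "c \<in> Obj C" and m: "m \<in> arr C c e"
        show "Comp B (X c) (FOb P e) Y (v e (dual_pre C d e e' g \<phi>)) (u e c m)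
            = Comp B (X c) (FOb P e) Y (Comp B (FOb P e) (FOb P e') Y (v e' \<phi>) (FArr P e e' g)) (u e c m)"
          using v(2)[OF e g\<phi> c m] v(2)[OF e' \<phi> c C.comp_arr[OF c e e' m g]] Pd(4)[OF c e e' m g]
            B.comp_assoc[OF Pd(2)[OF c] Po(1)[OF e] Po(1)[OF e'] Y Pd(5)[OF c e m] Po(2)[OF e e' g] v(1)[OF e' \<phi>]]
          by (simp add: dual_pre_comp[OF d c e e' m g])
      qed
      then show "v e (FArr (dual_weight R C d) e' e g \<phi>) = Comp B (FOb P e) (FOb P e') Y (v e' \<phi>) (FArr P e e' g)"
        by (simp add: dual_weight_FArr(2)[OF d e e' g \<phi>])
    qed
    from is_weighted_colimitD(2)[OF nu_colimit[OF Pd(1) d] this] show ?thesis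
    proof (rule ex1_conj_cong)
      fix h assume h: "h \<in> arr B (FOb (nob P) d) Y"
      have hq: "Comp B (X c) (FOb P e) Y (Comp B (FOb P e) (FOb (nob P) d) Y h (nin P d e \<phi>)) (u e c m)
          = Comp B (X c) (FOb (nob P) d) Y h (q d c (dual_pre C d c e m \<phi>))"
        if c: "c \<in> Obj C" and e: "e \<in> Obj C" and m: "m \<in> arr C c e" and \<phi>: "\<phi> \<in> DH d e" for c e m \<phi>
        using B.comp_assoc[OF Pd(2)[OF c] Po(1)[OF e] No(1)[OF d] Y Pd(5)[OF c e m] nin_arr[OF Pd(1) d e \<phi>] h]
          nin_free[OF d e c m \<phi>] by simp
      show "(\<forall>c\<in>Obj C. \<forall>\<phi>\<in>carrier (dual R (Hom C d c)). Comp B (X c) (FOb (nob P) d) Y h (q d c \<phi>) = a c \<phi>)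
        \<longleftrightarrow> (\<forall>e\<in>Obj C. \<forall>\<phi>\<in>carrier (FOb (dual_weight R C d) e). v e \<phi> = Comp B (FOb P e) (FOb (nob P) d) Y h (nin P d e \<phi>))"
        (is "?L \<longleftrightarrow> ?R")
      proof
        assume L: ?L
        show ?R
        proof (intro ballI)
          fix e \<phi> assume e: "e \<in> Obj C" and "\<phi> \<in> carrier (FOb (dual_weight R C d) e)"
          then have \<phi>: "\<phi> \<in> DH d e" by (simp add: dual_weight_FOb)
          show "v e \<phi> = Comp B (FOb P e) (FOb (nob P) d) Y h (nin P d e \<phi>)"
          proof (rule free_cancel[OF P e Y v(1)[OF e \<phi>] B.comp_arr[OF Po(1)[OF e] No(1)[OF d] Y nin_arr[OF Pd(1) d e \<phi>] h]])
            fix c m assume c: "c \<in> Obj C" and m: "m \<in> arr C c e"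
            show "Comp B (X c) (FOb P e) Y (v e \<phi>) (u e c m)
                = Comp B (X c) (FOb P e) Y (Comp B (FOb P e) (FOb (nob P) d) Y h (nin P d e \<phi>)) (u e c m)"
              using v(2)[OF e \<phi> c m] hq[OF c e m \<phi>] L c dual_pre_closed[OF d c e m \<phi>] by simp
          qed
        qed
      next
        assume R: ?R
        show ?L
        proof (intro ballI)
          fix c \<phi> assume c: "c \<in> Obj C" and "\<phi> \<in> carrier (dual R (Hom C d c))"
          then have \<phi>: "\<phi> \<in> DH d c" by simp
          have "v c \<phi> = Comp B (FOb P c) (FOb (nob P) d) Y h (nin P d c \<phi>)"
            using R c \<phi> by (simp add: dual_weight_FOb)
          then show "Comp B (X c) (FOb (nob P) d) Y h (q d c \<phi>) = a c \<phi>"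
            using v(2)[OF c \<phi> c C.ident_arr[OF c]] hq[OF c c C.ident_arr[OF c] \<phi>]
            by (simp add: dual_pre_ident[OF d c \<phi>])
        qed
      qed
    qed
  qed
  moreover have "q d c \<in> linear_maps R (dual R (Hom C d c)) (Hom B (X c) (FOb (nob P) d))" if c: "c \<in> Obj C" for c
    using B.comp_linear_pre[OF Pd(2)[OF c] Po(1)[OF c] No(1)[OF d] id_arr[OF c c c] nin_linear[OF Pd(1) d c]
        module_dual[OF C.hom_module[OF d c]]] by (simp add: nu_free_in_def)
  ultimately show ?thesis unfolding is_copower_sum_def using No(1)[OF d] by simp
qed

text \<open>By the duality theorem for sums of copowers, the value at \<open>d\<close> of the image of the free functor on
  \<open>X\<close> is the product of the powers of the \<open>X c\<close> by \<open>C(d,c)\<close>, so that \<open>\<nu>\<close> takes the free functor on \<open>X\<close>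
  to the cofree functor on \<open>X\<close>.\<close>

lemma nu_free_cofree:
  "\<exists>p. is_free R (op_cat B) (op_cat C) X (op_functor C (nob P)) p \<and>
    (\<forall>d\<in>Obj C. \<forall>c\<in>Obj C. \<forall>c'\<in>Obj C. \<forall>m\<in>arr C d c. \<forall>\<phi>\<in>DH d c'.
      Comp B (X c') (FOb (nob P) d) (X c) (p d c m) (q d c' \<phi>)
        = (if c' = c then \<phi> m \<odot>\<^bsub>Hom B (X c') (X c)\<^esub> Ident B (X c') else \<zero>\<^bsub>Hom B (X c') (X c)\<^esub>))"
proof -
  have "\<forall>d\<in>Obj C. \<exists>p. is_copower_sum R (op_cat B) (Obj C) (\<lambda>c. Hom C d c) X (FOb (nob P) d) p \<and>
    (\<forall>c'\<in>Obj C. \<forall>c\<in>Obj C. \<forall>\<phi>\<in>carrier (dual R (Hom C d c')). \<forall>m\<in>arr C d c.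
       Comp B (X c') (FOb (nob P) d) (X c) (p c m) (q d c' \<phi>)
         = (if c' = c then \<phi> m \<odot>\<^bsub>Hom B (X c') (X c)\<^esub> Ident B (X c') else \<zero>\<^bsub>Hom B (X c') (X c)\<^esub>))"
  proof
    fix d assume d: "d \<in> Obj C"
    have z: "carrier (Hom C d c) = {\<zero>\<^bsub>Hom C d c\<^esub>}" if c: "c \<in> Obj C"
      and "carrier (dual R (Hom C d c)) = {\<zero>\<^bsub>dual R (Hom C d c)\<^esub>}" for c
    proof -
      \<comment> \<open>If all functionals vanish then so do all coordinates.\<close>
      obtain n e \<epsilon> where b: "dual_basis R (Hom C d c) n e \<epsilon>"
        using fg_projective_dual_basis[OF fg_hom[OF d c]] by (elim exE)
      interpret H: module R "Hom C d c" by (rule C.hom_module[OF d c])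
      have "\<epsilon> l = (\<lambda>x\<in>arr C d c. \<zero>\<^bsub>R\<^esub>)" if "l < n" for l
        using dual_basisD(3)[OF b that] \<open>carrier (dual R (Hom C d c)) = _\<close> by simp
      then have "x = \<zero>\<^bsub>Hom C d c\<^esub>" if x: "x \<in> arr C d c" for x
      proof -
        have "x = (\<Oplus>\<^bsub>Hom C d c\<^esub>l\<in>{..<n}. \<epsilon> l x \<odot>\<^bsub>Hom C d c\<^esub> e l)" by (rule dual_basisD(5)[OF b x])
        also have "\<dots> = (\<Oplus>\<^bsub>Hom C d c\<^esub>l\<in>{..<n}. \<zero>\<^bsub>Hom C d c\<^esub>)"
          using \<open>\<And>l. l < n \<Longrightarrow> \<epsilon> l = _\<close> x dual_basisD(2)[OF b] by (intro H.finsum_cong') auto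
        finally show ?thesis by simp
      qed
      then show ?thesis using H.zero_closed by blast
    qed
    have "{c \<in> Obj C. carrier (dual R (Hom C d c)) \<noteq> {\<zero>\<^bsub>dual R (Hom C d c)\<^esub>}} \<subseteq> {c \<in> Obj C. arr C d c \<noteq> {\<zero>\<^bsub>Hom C d c\<^esub>}}"
      using carrier_dual_zero[OF C.hom_module[OF d]] by (auto simp del: dual_simps)
    from finite_subset[OF this finite_from[OF d]]
    show "\<exists>p. is_copower_sum R (op_cat B) (Obj C) (\<lambda>c. Hom C d c) X (FOb (nob P) d) p \<and>
      (\<forall>c'\<in>Obj C. \<forall>c\<in>Obj C. \<forall>\<phi>\<in>carrier (dual R (Hom C d c')). \<forall>m\<in>arr C d c.
       Comp B (X c') (FOb (nob P) d) (X c) (p c m) (q d c' \<phi>)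
         = (if c' = c then \<phi> m \<odot>\<^bsub>Hom B (X c') (X c)\<^esub> Ident B (X c') else \<zero>\<^bsub>Hom B (X c') (X c)\<^esub>))"
      by (intro B.copower_sum_dual[OF nu_free_copower[OF d] Pd(2) dual_pair_flip[OF dual_pair_dual[OF fg_hom[OF d]]]] z)
  qed
  from bchoice[OF this] obtain p where
    p: "\<forall>d\<in>Obj C. is_copower_sum R (op_cat B) (Obj C) (\<lambda>c. Hom C d c) X (FOb (nob P) d) (p d) \<and>
    (\<forall>c'\<in>Obj C. \<forall>c\<in>Obj C. \<forall>\<phi>\<in>carrier (dual R (Hom C d c')). \<forall>m\<in>arr C d c.
       Comp B (X c') (FOb (nob P) d) (X c) (p d c m) (q d c' \<phi>)
         = (if c' = c then \<phi> m \<odot>\<^bsub>Hom B (X c') (X c)\<^esub> Ident B (X c') else \<zero>\<^bsub>Hom B (X c') (X c)\<^esub>))"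
    by (elim exE)
  have cs: "is_copower_sum R (op_cat B) (Obj C) (\<lambda>c. Hom C d c) X (FOb (nob P) d) (p d)" if "d \<in> Obj C" for d
    using p that by simp
  have pq: "Comp B (X c') (FOb (nob P) d) (X c) (p d c m) (q d c' \<phi>)
         = (if c' = c then \<phi> m \<odot>\<^bsub>Hom B (X c') (X c)\<^esub> Ident B (X c') else \<zero>\<^bsub>Hom B (X c') (X c)\<^esub>)"
    if "d \<in> Obj C" "c \<in> Obj C" "c' \<in> Obj C" "m \<in> arr C d c" "\<phi> \<in> DH d c'" for d c c' m \<phi>
    using p that by simp
  have pa: "p d c m \<in> arr B (FOb (nob P) d) (X c)" if "d \<in> Obj C" "c \<in> Obj C" "m \<in> arr C d c" for d c m
    using is_copower_sumD(3)[OF cs[OF that(1)], of c m] that by simp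
  have nat: "Comp B (FOb (nob P) e) (FOb (nob P) d) (X c) (p d c m) (FArr (nob P) e d g) = p e c (Comp C e d c m g)"
    if o: "c \<in> Obj C" "d \<in> Obj C" "e \<in> Obj C" and m: "m \<in> arr C d c" and g: "g \<in> arr C e d" for c d e m g
  proof (rule B.copower_sum_cancel[OF nu_free_copower[OF o(3)] Pd(2) module_dual[OF C.hom_module[OF o(3)]] Pd(2)[OF o(1)]])
    show "Comp B (FOb (nob P) e) (FOb (nob P) d) (X c) (p d c m) (FArr (nob P) e d g) \<in> arr B (FOb (nob P) e) (X c)"
      by (rule B.comp_arr[OF No(1)[OF o(3)] No(1)[OF o(2)] Pd(2)[OF o(1)] No(2)[OF o(3,2) g] pa[OF o(2,1) m]])
    show "p e c (Comp C e d c m g) \<in> arr B (FOb (nob P) e) (X c)"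
      by (rule pa[OF o(3,1) C.comp_arr[OF o(3,2,1) g m]])
    fix c' \<phi> assume c': "c' \<in> Obj C" and "\<phi> \<in> carrier (dual R (Hom C e c'))"
    then have \<phi>: "\<phi> \<in> DH e c'" by simp
    note g\<phi> = dual_post_closed[OF o(3,2) c' g \<phi>]
    have "Comp B (X c') (FOb (nob P) e) (FOb (nob P) d) (FArr (nob P) e d g) (q e c' \<phi>) = q d c' (dual_post C e d c' g \<phi>)"
      using B.comp_assoc[OF Pd(2)[OF c'] Po(1)[OF c'] No(1)[OF o(3)] No(1)[OF o(2)] id_arr[OF c' c' c']
          nin_arr[OF Pd(1) o(3) c' \<phi>] No(2)[OF o(3,2) g]] nu_arr(2)[OF Pd(1) o(3,2) g c' \<phi>] \<phi> g\<phi>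
      by (simp add: nu_free_in_def)
    then have "Comp B (X c') (FOb (nob P) e) (X c)
          (Comp B (FOb (nob P) e) (FOb (nob P) d) (X c) (p d c m) (FArr (nob P) e d g)) (q e c' \<phi>)
        = Comp B (X c') (FOb (nob P) d) (X c) (p d c m) (q d c' (dual_post C e d c' g \<phi>))"
      using B.comp_assoc[OF Pd(2)[OF c'] No(1)[OF o(3)] No(1)[OF o(2)] Pd(2)[OF o(1)] nu_free_in_arr[OF o(3) c' \<phi>]
          No(2)[OF o(3,2) g] pa[OF o(2,1) m]] by simp
    also have "\<dots> = (if c' = c then dual_post C e d c' g \<phi> m \<odot>\<^bsub>Hom B (X c') (X c)\<^esub> Ident B (X c')
        else \<zero>\<^bsub>Hom B (X c') (X c)\<^esub>)"
      by (rule pq[OF o(2,1) c' m g\<phi>])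
    also have "\<dots> = (if c' = c then \<phi> (Comp C e d c m g) \<odot>\<^bsub>Hom B (X c') (X c)\<^esub> Ident B (X c')
        else \<zero>\<^bsub>Hom B (X c') (X c)\<^esub>)"
      using m by (simp add: dual_post_def)
    also have "\<dots> = Comp B (X c') (FOb (nob P) e) (X c) (p e c (Comp C e d c m g)) (q e c' \<phi>)"
      by (rule pq[OF o(3,1) c' C.comp_arr[OF o(3,2,1) g m] \<phi>, symmetric])
    finally show "Comp B (X c') (FOb (nob P) e) (X c)
          (Comp B (FOb (nob P) e) (FOb (nob P) d) (X c) (p d c m) (FArr (nob P) e d g)) (q e c' \<phi>)
        = Comp B (X c') (FOb (nob P) e) (X c) (p e c (Comp C e d c m g)) (q e c' \<phi>)" .
  qed
  have "is_free R (op_cat B) (op_cat C) X (op_functor C (nob P)) p"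
    unfolding is_free_def using op_functor_obj[OF NP] cs nat Pd(2) by simp
  then show ?thesis using pq by (intro exI[of _ p]) simp
qed

text \<open>The duality theorem applied to the free functor itself.\<close>

lemma free_powers:
  assumes d: "d \<in> Obj C"
  shows "\<exists>p. is_copower_sum R (op_cat B) (Obj C) (\<lambda>c. dual R (Hom C c d)) X (FOb P d) p \<and>
    (\<forall>c'\<in>Obj C. \<forall>c\<in>Obj C. \<forall>m\<in>arr C c' d. \<forall>\<phi>\<in>carrier (dual R (Hom C c d)).
       Comp B (X c') (FOb P d) (X c) (p c \<phi>) (u d c' m)
         = (if c' = c then \<phi> m \<odot>\<^bsub>Hom B (X c') (X c)\<^esub> Ident B (X c') else \<zero>\<^bsub>Hom B (X c') (X c)\<^esub>))"
  by (rule B.copower_sum_dual[OF Pd(3)[OF d] Pd(2) dual_pair_dual[OF fg_hom[OF _ d]] finite_into[OF d]])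
    (simp_all only: carrier_dual_zero[OF C.hom_module[OF _ d]])

text \<open>A free functor is recovered from its image under \<open>\<nu>\<close>: its value at \<open>d\<close> is the limit of
  \<open>\<nu> P\<close> weighted by \<open>D(C(-,d))\<close>. A cone over the cofree functor \<open>\<nu> P\<close> amounts to linear maps
  from \<open>D(C(c,d))\<close> to \<open>B(Y, X c)\<close>, and these are the maps from \<open>Y\<close> to \<open>P d\<close>.\<close>

lemma free_is_weighted_limit:
  assumes d: "d \<in> Obj C"
  shows "is_weighted_colimit R (op_cat C) (op_cat B) (dual_weight R (op_cat C) d) (op_functor C (nob P))
    (FOb P d) (\<lambda>c. nin P c d)"
proof -
  note opD = nakayama_setting.dual_weight_FOb[OF op_setting] nakayama_setting.dual_weight_FArr(2)[OF op_setting]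
  obtain p where p: "is_free R (op_cat B) (op_cat C) X (op_functor C (nob P)) p"
    and pq: "\<forall>d\<in>Obj C. \<forall>c\<in>Obj C. \<forall>c'\<in>Obj C. \<forall>m\<in>arr C d c. \<forall>\<phi>\<in>DH d c'.
      Comp B (X c') (FOb (nob P) d) (X c) (p d c m) (q d c' \<phi>)
        = (if c' = c then \<phi> m \<odot>\<^bsub>Hom B (X c') (X c)\<^esub> Ident B (X c') else \<zero>\<^bsub>Hom B (X c') (X c)\<^esub>)"
    using nu_free_cofree by (elim exE conjE)
  have pa: "p c c' m \<in> arr B (FOb (nob P) c) (X c')" if "c \<in> Obj C" "c' \<in> Obj C" "m \<in> arr C c c'" for c c' m
    using is_freeD(5)[OF p, of c' c m] that by simp
  have pn: "Comp B (FOb (nob P) c) (FOb (nob P) c') (X c') (p c' c' (Ident C c')) (FArr (nob P) c c' m) = p c c' m"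
    if "c \<in> Obj C" "c' \<in> Obj C" "m \<in> arr C c c'" for c c' m
    using is_freeD(4)[OF p, of c' c' c "Ident C c'" m] that C.ident_arr[OF that(2)] C.comp_ident_left[OF that] by simp
  \<comment> \<open>The arrows \<open>\<epsilon> c : \<nu> P c \<rightarrow> X c\<close> cogenerate: every coordinate of \<open>\<nu> P c\<close> is an action of \<open>C\<close> followed by
    some \<open>\<epsilon> c'\<close>.\<close>
  define \<epsilon> where "\<epsilon> c = p c c (Ident C c)" for c
  have \<epsilon>: "\<epsilon> c \<in> arr B (FOb (nob P) c) (X c)" if "c \<in> Obj C" for c
    using pa[OF that that C.ident_arr[OF that]] by (simp add: \<epsilon>_def)
  obtain r where r: "is_copower_sum R (op_cat B) (Obj C) (\<lambda>c. dual R (Hom C c d)) X (FOb P d) r"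
    and ru: "\<forall>c'\<in>Obj C. \<forall>c\<in>Obj C. \<forall>m\<in>arr C c' d. \<forall>\<phi>\<in>carrier (dual R (Hom C c d)).
       Comp B (X c') (FOb P d) (X c) (r c \<phi>) (u d c' m)
         = (if c' = c then \<phi> m \<odot>\<^bsub>Hom B (X c') (X c)\<^esub> Ident B (X c') else \<zero>\<^bsub>Hom B (X c') (X c)\<^esub>)"
    using free_powers[OF d] by (elim exE conjE)
  note rd = is_copower_sumD[OF r]
  have ra: "r c \<phi> \<in> arr B (FOb P d) (X c)" if "c \<in> Obj C" "\<phi> \<in> DH c d" for c \<phi>
    using rd(3)[of c \<phi>] that by simp
  have \<epsilon>n: "Comp B (FOb P d) (FOb (nob P) c) (X c) (\<epsilon> c) (nin P c d \<phi>) = r c \<phi>"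
    if c: "c \<in> Obj C" and \<phi>: "\<phi> \<in> DH c d" for c \<phi>
  proof (rule free_cancel[OF P d Pd(2)[OF c] B.comp_arr[OF Po(1)[OF d] No(1)[OF c] Pd(2)[OF c] nin_arr[OF Pd(1) c d \<phi>] \<epsilon>[OF c]]
        ra[OF c \<phi>]])
    fix c' m assume c': "c' \<in> Obj C" and m: "m \<in> arr C c' d"
    note m\<phi> = dual_pre_closed[OF c c' d m \<phi>]
    have "Comp B (X c') (FOb P d) (X c) (Comp B (FOb P d) (FOb (nob P) c) (X c) (\<epsilon> c) (nin P c d \<phi>)) (u d c' m)
        = Comp B (X c') (FOb (nob P) c) (X c) (p c c (Ident C c)) (q c c' (dual_pre C c c' d m \<phi>))"
      using B.comp_assoc[OF Pd(2)[OF c'] Po(1)[OF d] No(1)[OF c] Pd(2)[OF c] Pd(5)[OF c' d m] nin_arr[OF Pd(1) c d \<phi>] \<epsilon>[OF c]]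
        nin_free[OF c d c' m \<phi>] by (simp add: \<epsilon>_def)
    also have "\<dots> = (if c' = c then dual_pre C c c' d m \<phi> (Ident C c) \<odot>\<^bsub>Hom B (X c') (X c)\<^esub> Ident B (X c')
        else \<zero>\<^bsub>Hom B (X c') (X c)\<^esub>)"
      using pq c c' C.ident_arr[OF c] m\<phi> by blast
    also have "\<dots> = (if c' = c then \<phi> m \<odot>\<^bsub>Hom B (X c') (X c)\<^esub> Ident B (X c') else \<zero>\<^bsub>Hom B (X c') (X c)\<^esub>)"
      using C.ident_arr[OF c] C.comp_ident_right[OF c' d m] by (auto simp: dual_pre_def)
    also have "\<dots> = Comp B (X c') (FOb P d) (X c) (r c \<phi>) (u d c' m)"
      using ru c c' m \<phi> by simp
    finally show "Comp B (X c') (FOb P d) (X c) (Comp B (FOb P d) (FOb (nob P) c) (X c) (\<epsilon> c) (nin P c d \<phi>)) (u d c' m)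
        = Comp B (X c') (FOb P d) (X c) (r c \<phi>) (u d c' m)" .
  qed
  have "\<exists>!h. h \<in> arr (op_cat B) (FOb P d) Y \<and> (\<forall>c\<in>Obj (op_cat C). \<forall>w\<in>carrier (FOb (dual_weight R (op_cat C) d) c).
      v c w = Comp (op_cat B) (FOb (op_functor C (nob P)) c) (FOb P d) Y h (nin P c d w))"
    if v: "weighted_cocone R (op_cat C) (op_cat B) (dual_weight R (op_cat C) d) (op_functor C (nob P)) Y v" for Y v
  proof -
    note vd = weighted_coconeD[OF v]
    have Y: "Y \<in> Obj B" using vd(1) by simp
    have vl: "v c \<in> linear_maps R (dual R (Hom C c d)) (Hom B Y (FOb (nob P) c))" if "c \<in> Obj C" for c
      using vd(2)[of c] that by (simp add: opD)
    have va: "v c \<phi> \<in> arr B Y (FOb (nob P) c)" if "c \<in> Obj C" "\<phi> \<in> DH c d" for c \<phi>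
      using linear_maps_closed[OF vl[OF that(1)]] that(2) by simp
    have vn: "v c' (dual_post C c c' d f \<phi>) = Comp B Y (FOb (nob P) c) (FOb (nob P) c') (FArr (nob P) c c' f) (v c \<phi>)"
      if "c \<in> Obj C" "c' \<in> Obj C" "f \<in> arr C c c'" "\<phi> \<in> DH c d" for c c' f \<phi>
      using vd(4)[of c' c f \<phi>] that opD(2)[of d c' c f \<phi>] d by (simp add: opD(1) dual_op_cat)
    have "\<exists>!h. h \<in> arr (op_cat B) (FOb P d) Y \<and> (\<forall>c\<in>Obj C. \<forall>\<phi>\<in>carrier (dual R (Hom C c d)).
        Comp (op_cat B) (X c) (FOb P d) Y h (r c \<phi>)
          = (\<lambda>\<phi>\<in>carrier (dual R (Hom C c d)). Comp B Y (FOb (nob P) c) (X c) (\<epsilon> c) (v c \<phi>)) \<phi>)"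
    proof (rule rd(4))
      show "Y \<in> Obj (op_cat B)" using Y by simp
      fix c assume c: "c \<in> Obj C"
      show "(\<lambda>\<phi>\<in>carrier (dual R (Hom C c d)). Comp B Y (FOb (nob P) c) (X c) (\<epsilon> c) (v c \<phi>))
          \<in> linear_maps R (dual R (Hom C c d)) (Hom (op_cat B) (X c) Y)"
        using B.comp_linear_post[OF Y No(1)[OF c] Pd(2)[OF c] \<epsilon>[OF c] vl[OF c] module_dual[OF C.hom_module[OF c d]]] by simp
    qed
    then show ?thesis
      unfolding op_cat_simps
    proof (rule ex1_conj_cong)
      fix h assume h: "h \<in> arr B Y (FOb P d)"
      have \<epsilon>h: "Comp B Y (FOb (nob P) c) (X c) (\<epsilon> c) (Comp B Y (FOb P d) (FOb (nob P) c) (nin P c d \<phi>) h)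
          = Comp B Y (FOb P d) (X c) (r c \<phi>) h" if c: "c \<in> Obj C" and \<phi>: "\<phi> \<in> DH c d" for c \<phi>
        using B.comp_assoc[OF Y Po(1)[OF d] No(1)[OF c] Pd(2)[OF c] h nin_arr[OF Pd(1) c d \<phi>] \<epsilon>[OF c]] \<epsilon>n[OF c \<phi>] by simp
      show "(\<forall>c\<in>Obj C. \<forall>w\<in>carrier (FOb (dual_weight R (op_cat C) d) c).
            v c w = Comp B Y (FOb P d) (FOb (op_functor C (nob P)) c) (nin P c d w) h)
        \<longleftrightarrow> (\<forall>c\<in>Obj C. \<forall>\<phi>\<in>carrier (dual R (Hom C c d)). Comp B Y (FOb P d) (X c) (r c \<phi>) h
          = (\<lambda>\<phi>\<in>carrier (dual R (Hom C c d)). Comp B Y (FOb (nob P) c) (X c) (\<epsilon> c) (v c \<phi>)) \<phi>)" (is "?L \<longleftrightarrow> ?R")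
      proof
        assume L: ?L
        show ?R using L \<epsilon>h by (simp add: opD(1))
      next
        assume R: ?R
        have R': "Comp B Y (FOb P d) (X c) (r c \<phi>) h = Comp B Y (FOb (nob P) c) (X c) (\<epsilon> c) (v c \<phi>)"
          if "c \<in> Obj C" "\<phi> \<in> DH c d" for c \<phi>
          using R that by simp
        have "v c \<phi> = Comp B Y (FOb P d) (FOb (nob P) c) (nin P c d \<phi>) h" (is "_ = ?n")
          if c: "c \<in> Obj C" and \<phi>: "\<phi> \<in> DH c d" for c \<phi>
        proof -
          note nh = B.comp_arr[OF Y Po(1)[OF d] No(1)[OF c] h nin_arr[OF Pd(1) c d \<phi>]]
          have "Comp B Y (FOb (nob P) c) (X c') (p c c' m) (v c \<phi>) = Comp B Y (FOb (nob P) c) (X c') (p c c' m) ?n"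
            if c': "c' \<in> Obj C" and m: "m \<in> arr C c c'" for c' m
          proof -
            note m\<phi> = dual_post_closed[OF c c' d m \<phi>]
            have step: "Comp B Y (FOb (nob P) c) (X c') (p c c' m) w
                = Comp B Y (FOb (nob P) c') (X c') (\<epsilon> c') (Comp B Y (FOb (nob P) c) (FOb (nob P) c') (FArr (nob P) c c' m) w)"
              if w: "w \<in> arr B Y (FOb (nob P) c)" for w
              using B.comp_assoc[OF Y No(1)[OF c] No(1)[OF c'] Pd(2)[OF c'] w No(2)[OF c c' m] \<epsilon>[OF c']] pn[OF c c' m]
              by (simp add: \<epsilon>_def)
            have "Comp B Y (FOb (nob P) c) (FOb (nob P) c') (FArr (nob P) c c' m) ?n
                = Comp B Y (FOb P d) (FOb (nob P) c') (nin P c' d (dual_post C c c' d m \<phi>)) h"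
              using B.comp_assoc[OF Y Po(1)[OF d] No(1)[OF c] No(1)[OF c'] h nin_arr[OF Pd(1) c d \<phi>] No(2)[OF c c' m]]
                nu_arr(2)[OF Pd(1) c c' m d \<phi>] by simp
            then show ?thesis
              using step[OF va[OF c \<phi>]] step[OF nh] vn[OF c c' m \<phi>] \<epsilon>h[OF c' m\<phi>] R'[OF c' m\<phi>] by simp
          qed
          then show ?thesis
            using functor_setting.free_cancel[OF functor_setting_op p, of c Y "v c \<phi>" ?n] c Y va[OF c \<phi>] nh by simp
        qed
        then show ?L by (simp add: opD(1))
      qed
    qed
  qed
  then show ?thesis unfolding is_weighted_colimit_def using nin_cocone[OF Pd(1) d] by simp
qed

text \<open>Each component of the unit compares two limits of \<open>\<nu> P\<close> with the same weight.\<close>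

lemma eta_free_iso: "iso FC P (nr (nob P)) (eta P)"
proof -
  note RN = objD[OF nr_obj[OF NP]]
  note en = eta_nat_trans[OF Pd(1)]
  have "\<forall>d\<in>Obj C. \<exists>g. g \<in> arr B (FOb (nr (nob P)) d) (FOb P d) \<and>
      Comp B (FOb P d) (FOb (nr (nob P)) d) (FOb P d) g (eta P d) = Ident B (FOb P d) \<and>
      Comp B (FOb (nr (nob P)) d) (FOb P d) (FOb (nr (nob P)) d) (eta P d) g = Ident B (FOb (nr (nob P)) d)"
  proof
    fix d assume d: "d \<in> Obj C"
    interpret opd: weighted_diagram R "op_cat C" "op_cat B" "dual_weight R (op_cat C) d" "op_functor C (nob P)"
      by (rule nakayama_setting.nu_diagram[OF op_setting op_functor_obj[OF NP]]) (simp add: d)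
    have lim: "is_weighted_colimit R (op_cat C) (op_cat B) (dual_weight R (op_cat C) d) (op_functor C (nob P))
      (FOb (nr (nob P)) d) (pr (nob P) d)"
      using nakayama_setting.nu_colimit[OF op_setting op_functor_obj[OF NP], of d] d by (simp add: nr_FOb)
    have "iso (op_cat B) (FOb (nr (nob P)) d) (FOb P d) (eta P d)"
      by (rule opd.weighted_colimit_iso[OF lim free_is_weighted_limit[OF d]])
        (use eta[OF Pd(1) d] in \<open>simp_all add: nakayama_setting.dual_weight_FOb[OF op_setting]\<close>)
    then show "\<exists>g. g \<in> arr B (FOb (nr (nob P)) d) (FOb P d) \<and>
      Comp B (FOb P d) (FOb (nr (nob P)) d) (FOb P d) g (eta P d) = Ident B (FOb P d) \<and>
      Comp B (FOb (nr (nob P)) d) (FOb P d) (FOb (nr (nob P)) d) (eta P d) g = Ident B (FOb (nr (nob P)) d)"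
      by (auto simp: iso_def)
  qed
  from bchoice[OF this] obtain g where g_all: "\<forall>d\<in>Obj C. g d \<in> arr B (FOb (nr (nob P)) d) (FOb P d) \<and>
      Comp B (FOb P d) (FOb (nr (nob P)) d) (FOb P d) (g d) (eta P d) = Ident B (FOb P d) \<and>
      Comp B (FOb (nr (nob P)) d) (FOb P d) (FOb (nr (nob P)) d) (eta P d) (g d) = Ident B (FOb (nr (nob P)) d)"
    by (elim exE)
  then have g: "g d \<in> arr B (FOb (nr (nob P)) d) (FOb P d)"
      "Comp B (FOb P d) (FOb (nr (nob P)) d) (FOb P d) (g d) (eta P d) = Ident B (FOb P d)"
      "Comp B (FOb (nr (nob P)) d) (FOb P d) (FOb (nr (nob P)) d) (eta P d) (g d) = Ident B (FOb (nr (nob P)) d)"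
    if "d \<in> Obj C" for d
    using that by simp_all
  have "restrict g (Obj C) \<in> nat_trans C B (nr (nob P)) P"
  proof (rule nat_transI)
    fix a b f assume ab: "a \<in> Obj C" "b \<in> Obj C" and f: "f \<in> arr C a b"
    note o = RN(1)[OF ab(1)] RN(1)[OF ab(2)] Po(1)[OF ab(1)] Po(1)[OF ab(2)]
    note e = nat_transD(1)[OF en ab(1)] nat_transD(1)[OF en ab(2)]
    note ga = g(1)[OF ab(1)] and gb = g(1)[OF ab(2)]
    let ?R = "FArr (nr (nob P)) a b f"
    have gR: "Comp B (FOb (nr (nob P)) a) (FOb (nr (nob P)) b) (FOb P b) (g b) ?R \<in> arr B (FOb (nr (nob P)) a) (FOb P b)"
      by (rule B.comp_arr[OF o(1,2,4) RN(2)[OF ab f] gb])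
    have "Comp B (FOb (nr (nob P)) a) (FOb P a) (FOb P b) (FArr P a b f) (g a)
        = Comp B (FOb (nr (nob P)) a) (FOb P a) (FOb P b)
            (Comp B (FOb P a) (FOb (nr (nob P)) b) (FOb P b) (g b)
              (Comp B (FOb P a) (FOb P b) (FOb (nr (nob P)) b) (eta P b) (FArr P a b f))) (g a)"
      using B.comp_assoc[OF o(3,4,2,4) Po(2)[OF ab f] e(2) gb] g(2)[OF ab(2)]
        B.comp_ident_left[OF o(3,4) Po(2)[OF ab f]] by simp
    also have "\<dots> = Comp B (FOb (nr (nob P)) a) (FOb P a) (FOb P b)
        (Comp B (FOb P a) (FOb (nr (nob P)) a) (FOb P b) (Comp B (FOb (nr (nob P)) a) (FOb (nr (nob P)) b) (FOb P b) (g b) ?R) (eta P a)) (g a)"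
      using nat_transD(2)[OF en ab f] B.comp_assoc[OF o(3,1,2,4) e(1) RN(2)[OF ab f] gb] by simp
    also have "\<dots> = Comp B (FOb (nr (nob P)) a) (FOb (nr (nob P)) b) (FOb P b) (g b) ?R"
      using B.comp_assoc[OF o(1,3,1,4) ga e(1) gR] g(3)[OF ab(1)] B.comp_ident_right[OF o(1,4) gR] by simp
    finally show "Comp B (FOb (nr (nob P)) a) (FOb (nr (nob P)) b) (FOb P b) (restrict g (Obj C) b) ?R
        = Comp B (FOb (nr (nob P)) a) (FOb P a) (FOb P b) (FArr P a b f) (restrict g (Obj C) a)"
      using ab by simp
  qed (simp_all add: g(1))
  then show ?thesis
    unfolding iso_def functor_cat_simps
    using en g by (intro conjI bexI[of _ "restrict g (Obj C)"]) (auto intro!: restrict_ext)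
qed

end

end

context nakayama_setting
begin

lemma nu_shriek_map:
  assumes X: "X \<in> Obj PC" and Y: "Y \<in> Obj PC" and f: "f \<in> arr PC X Y"
    and d: "d \<in> Obj C" and c: "c \<in> Obj C" and \<phi>: "\<phi> \<in> DH d c"
  shows "Comp B (X c) (FOb (nob (shriek X)) d) (FOb (nob (shriek Y)) d)
      (FArr (nu R C B) (shriek X) (shriek Y) (FArr (i_lower_shriek R C B) X Y f) d)
      (nu_free_in R C B X (shriek X) (gen X) d c \<phi>)
    = Comp B (X c) (Y c) (FOb (nob (shriek Y)) d) (nu_free_in R C B Y (shriek Y) (gen Y) d c \<phi>) (f c)"
proof -
  note fX = is_freeD[OF shriek_free[OF X]] and fY = is_freeD[OF shriek_free[OF Y]]
  note s = shriek_map[OF X Y f]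
  note n = nu_map[OF fX(1) fY(1) s(1)]
  note i = C.ident_arr[OF c]
  have fc: "f c \<in> arr B (X c) (Y c)" using f c by auto
  note o = fX(2)[OF c] objD(1)[OF fX(1) c] objD(1)[OF nob_obj[OF fX(1)] d]
    fY(2)[OF c] objD(1)[OF fY(1) c] objD(1)[OF nob_obj[OF fY(1)] d]
  show ?thesis
    using B.comp_assoc[OF o(1,2,3,6) fX(5)[OF c c i] nin_arr[OF fX(1) d c \<phi>] nat_transD(1)[OF n(1) d]]
      B.comp_assoc[OF o(1,2,5,6) fX(5)[OF c c i] nat_transD(1)[OF s(1) c] nin_arr[OF fY(1) d c \<phi>]]
      B.comp_assoc[OF o(1,4,5,6) fc fY(5)[OF c c i] nin_arr[OF fY(1) d c \<phi>]]
      n(2)[OF d c \<phi>] s(2)[OF c c i] \<phi> by (simp add: nu_free_in_def)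
qed

text \<open>As \<open>\<nu> (i\<^sub>! X)\<close> is cofree on \<open>X\<close>, the Yoneda lemma for the opposite categories identifies
  transformations \<open>F \<rightarrow> \<nu> (i\<^sub>! X)\<close> with families of arrows \<open>F c \<rightarrow> X c\<close>. The unit \<open>\<theta> F\<close> corresponds to the
  family of identities.\<close>

lemma upper_star_nu_shriek_adjunction:
  "left_adjoint FC PC (i_upper_star R C B) (comp_functor (nu R C B) (i_lower_shriek R C B))"
proof -
  let ?U = "i_upper_star R C B" and ?L = "i_lower_shriek R C B" and ?N = "nu R C B"
  let ?G = "comp_functor ?N ?L"
  let ?Q = "\<lambda>X. nob (shriek X)"
  let ?q = "\<lambda>X. nu_free_in R C B X (shriek X) (gen X)"
  have LX: "FOb ?L X = shriek X" if "X \<in> Obj PC" for X by (rule shriek_functor_FOb[OF that])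
  have GX: "FOb ?G X = ?Q X" if "X \<in> Obj PC" for X
    using nu_FOb[OF shriek_obj[OF that]] LX[OF that] by (simp add: comp_functor_def)
  have GA: "FArr ?G X Y f = FArr ?N (shriek X) (shriek Y) (FArr ?L X Y f)"
    if "X \<in> Obj PC" "Y \<in> Obj PC" for X Y f
    using LX[OF that(1)] LX[OF that(2)] by (simp add: comp_functor_def)
  have QO: "?Q X \<in> Obj FC" if "X \<in> Obj PC" for X by (rule nob_obj[OF shriek_obj[OF that]])
  have GN: "FArr ?G X Y f \<in> nat_trans C B (?Q X) (?Q Y)"
    if "X \<in> Obj PC" "Y \<in> Obj PC" "f \<in> arr PC X Y" for X Y f
    unfolding GA[OF that(1,2)]
    by (rule nu_map(1)[OF shriek_obj[OF that(1)] shriek_obj[OF that(2)] shriek_map(1)[OF that]])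
  have G: "is_functor PC FC ?G"
    using shriek_functor nu_functor unfolding is_functor_def comp_functor_def by simp
  have UF: "FOb ?U F = (\<lambda>c\<in>Obj C. FOb F c)" if "F \<in> Obj FC" for F by (rule upper_star_simps(1)[OF that])
  have UO: "FOb ?U F \<in> Obj PC" if "F \<in> Obj FC" for F
    using objD(1)[OF that] by (auto simp: UF[OF that])
  have UA: "FArr ?U F H \<alpha> = (\<lambda>c\<in>Obj C. \<alpha> c)" if "F \<in> Obj FC" "H \<in> Obj FC" "\<alpha> \<in> nat_trans C B F H" for F H \<alpha>
    by (rule upper_star_simps(2)[OF that])
  have UAr: "FArr ?U F H \<alpha> \<in> arr PC (FOb ?U F) (FOb ?U H)"
    if "F \<in> Obj FC" "H \<in> Obj FC" "\<alpha> \<in> nat_trans C B F H" for F H \<alpha>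
    using nat_transD(1)[OF that(3)] by (simp add: UA[OF that] UF that(1,2))
  have "\<forall>X\<in>Obj PC. \<exists>p. is_free R (op_cat B) (op_cat C) X (op_functor C (?Q X)) p \<and>
    (\<forall>d\<in>Obj C. \<forall>c\<in>Obj C. \<forall>c'\<in>Obj C. \<forall>m\<in>arr C d c. \<forall>\<phi>\<in>DH d c'.
      Comp B (X c') (FOb (?Q X) d) (X c) (p d c m) (?q X d c' \<phi>)
        = (if c' = c then \<phi> m \<odot>\<^bsub>Hom B (X c') (X c)\<^esub> Ident B (X c') else \<zero>\<^bsub>Hom B (X c') (X c)\<^esub>))"
    by (intro ballI nu_free_cofree shriek_free)
  from bchoice[OF this] obtain p where p_all: "\<forall>X\<in>Obj PC. is_free R (op_cat B) (op_cat C) X (op_functor C (?Q X)) (p X) \<and>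
    (\<forall>d\<in>Obj C. \<forall>c\<in>Obj C. \<forall>c'\<in>Obj C. \<forall>m\<in>arr C d c. \<forall>\<phi>\<in>DH d c'.
      Comp B (X c') (FOb (?Q X) d) (X c) (p X d c m) (?q X d c' \<phi>)
        = (if c' = c then \<phi> m \<odot>\<^bsub>Hom B (X c') (X c)\<^esub> Ident B (X c') else \<zero>\<^bsub>Hom B (X c') (X c)\<^esub>))"
    by (elim exE)
  have p: "is_free R (op_cat B) (op_cat C) X (op_functor C (?Q X)) (p X)" if "X \<in> Obj PC" for X
    using bspec[OF p_all that] by (rule conjunct1)
  have pq: "Comp B (X c') (FOb (?Q X) d) (X c) (p X d c m) (?q X d c' \<phi>)
        = (if c' = c then \<phi> m \<odot>\<^bsub>Hom B (X c') (X c)\<^esub> Ident B (X c') else \<zero>\<^bsub>Hom B (X c') (X c)\<^esub>)"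
    if "X \<in> Obj PC" "d \<in> Obj C" "c \<in> Obj C" "c' \<in> Obj C" "m \<in> arr C d c" "\<phi> \<in> DH d c'" for X d c c' m \<phi>
    using conjunct2[OF bspec[OF p_all that(1)]] that(2-) by simp
  have Xo: "X c \<in> Obj B" if "X \<in> Obj PC" "c \<in> Obj C" for X c using that by auto
  have pa: "p X d c m \<in> arr B (FOb (?Q X) d) (X c)"
    if "X \<in> Obj PC" "d \<in> Obj C" "c \<in> Obj C" "m \<in> arr C d c" for X d c m
    using is_freeD(5)[OF p[OF that(1)], of c d m] that(2-) by simp
  have cancel: "h = h'" if "X \<in> Obj PC" "d \<in> Obj C" "Y \<in> Obj B" "h \<in> arr B Y (FOb (?Q X) d)" "h' \<in> arr B Y (FOb (?Q X) d)"
    "\<And>c m. \<lbrakk>c \<in> Obj C; m \<in> arr C d c\<rbrakk> \<Longrightarrow>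
      Comp B Y (FOb (?Q X) d) (X c) (p X d c m) h = Comp B Y (FOb (?Q X) d) (X c) (p X d c m) h'" for X d Y h h'
    by (rule functor_setting.free_cancel[OF functor_setting_op p[OF that(1)], of d Y h h']) (use that in simp_all)
  have pG: "Comp B (FOb (?Q X) d) (FOb (?Q Y) d) (Y c) (p Y d c m) (FArr ?G X Y f d)
      = Comp B (FOb (?Q X) d) (X c) (Y c) (f c) (p X d c m)"
    if X: "X \<in> Obj PC" and Y: "Y \<in> Obj PC" and f: "f \<in> arr PC X Y" and d: "d \<in> Obj C" and c: "c \<in> Obj C"
      and m: "m \<in> arr C d c" for X Y f d c m
  proof (rule B.copower_sum_cancel[OF nu_free_copower[OF shriek_free[OF X] d]])
    note o = objD(1)[OF QO[OF X] d] objD(1)[OF QO[OF Y] d]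
    note gd = nat_transD(1)[OF GN[OF X Y f] d]
    have fc: "f c \<in> arr B (X c) (Y c)" if "c \<in> Obj C" for c using f that by auto
    show "Y c \<in> Obj B" by (rule Xo[OF Y c])
    show "Comp B (FOb (?Q X) d) (FOb (?Q Y) d) (Y c) (p Y d c m) (FArr ?G X Y f d) \<in> arr B (FOb (?Q X) d) (Y c)"
      by (rule B.comp_arr[OF o Xo[OF Y c] gd pa[OF Y d c m]])
    show "Comp B (FOb (?Q X) d) (X c) (Y c) (f c) (p X d c m) \<in> arr B (FOb (?Q X) d) (Y c)"
      by (rule B.comp_arr[OF o(1) Xo[OF X c] Xo[OF Y c] pa[OF X d c m] fc[OF c]])
    fix c' \<phi> assume c': "c' \<in> Obj C" and "\<phi> \<in> carrier (dual R (Hom C d c'))"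
    then have \<phi>: "\<phi> \<in> DH d c'" by simp
    note qX = nu_free_in_arr[OF shriek_free[OF X] d c' \<phi>] and qY = nu_free_in_arr[OF shriek_free[OF Y] d c' \<phi>]
    have l: "Comp B (X c') (FOb (?Q X) d) (Y c) (Comp B (FOb (?Q X) d) (FOb (?Q Y) d) (Y c) (p Y d c m) (FArr ?G X Y f d)) (?q X d c' \<phi>)
        = Comp B (X c') (Y c') (Y c) (if c' = c then \<phi> m \<odot>\<^bsub>Hom B (Y c') (Y c)\<^esub> Ident B (Y c') else \<zero>\<^bsub>Hom B (Y c') (Y c)\<^esub>) (f c')"
      using B.comp_assoc[OF Xo[OF X c'] o Xo[OF Y c] qX gd pa[OF Y d c m]]
        B.comp_assoc[OF Xo[OF X c'] Xo[OF Y c'] o(2) Xo[OF Y c] fc[OF c'] qY pa[OF Y d c m]]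
        nu_shriek_map[OF X Y f d c' \<phi>] pq[OF Y d c c' m \<phi>] GA[OF X Y, of f] by simp
    have r: "Comp B (X c') (FOb (?Q X) d) (Y c) (Comp B (FOb (?Q X) d) (X c) (Y c) (f c) (p X d c m)) (?q X d c' \<phi>)
        = Comp B (X c') (X c) (Y c) (f c) (if c' = c then \<phi> m \<odot>\<^bsub>Hom B (X c') (X c)\<^esub> Ident B (X c') else \<zero>\<^bsub>Hom B (X c') (X c)\<^esub>)"
      using B.comp_assoc[OF Xo[OF X c'] o(1) Xo[OF X c] Xo[OF Y c] qX pa[OF X d c m] fc[OF c]] pq[OF X d c c' m \<phi>] by simp
    have "Comp B (X c') (Y c') (Y c) (if c' = c then \<phi> m \<odot>\<^bsub>Hom B (Y c') (Y c)\<^esub> Ident B (Y c') else \<zero>\<^bsub>Hom B (Y c') (Y c)\<^esub>) (f c')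
        = Comp B (X c') (X c) (Y c) (f c) (if c' = c then \<phi> m \<odot>\<^bsub>Hom B (X c') (X c)\<^esub> Ident B (X c') else \<zero>\<^bsub>Hom B (X c') (X c)\<^esub>)"
    proof (cases "c' = c")
      case True
      have "\<phi> m \<in> carrier R" using DH_app[of \<phi> d c m] \<phi> m True by simp
      then show ?thesis
        using True B.comp_smult_left[OF Xo[OF X c] Xo[OF Y c] Xo[OF Y c] _ fc[OF c] B.ident_arr[OF Xo[OF Y c]]]
          B.comp_smult_right[OF Xo[OF X c] Xo[OF X c] Xo[OF Y c] _ B.ident_arr[OF Xo[OF X c]] fc[OF c]]
          B.comp_ident_left[OF Xo[OF X c] Xo[OF Y c] fc[OF c]] B.comp_ident_right[OF Xo[OF X c] Xo[OF Y c] fc[OF c]]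
        by simp
    next
      case False
      then show ?thesis
        using B.comp_zero_left[OF Xo[OF X c'] Xo[OF Y c'] Xo[OF Y c] fc[OF c']]
          B.comp_zero_right[OF Xo[OF X c'] Xo[OF X c] Xo[OF Y c] fc[OF c]] by simp
    qed
    then show "Comp B (X c') (FOb (?Q X) d) (Y c) (Comp B (FOb (?Q X) d) (FOb (?Q Y) d) (Y c) (p Y d c m) (FArr ?G X Y f d)) (?q X d c' \<phi>)
        = Comp B (X c') (FOb (?Q X) d) (Y c) (Comp B (FOb (?Q X) d) (X c) (Y c) (f c) (p X d c m)) (?q X d c' \<phi>)"
      using l r by simp
  qed (use Xo[OF X] module_dual[OF C.hom_module[OF d]] in simp_all)
  have "\<forall>F\<in>Obj FC. \<exists>\<theta>. \<theta> \<in> nat_trans C B F (?Q (FOb ?U F)) \<and> (\<forall>d\<in>Obj C. \<forall>c\<in>Obj C. \<forall>m\<in>arr C d c.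
      Comp B (FOb F d) (FOb (?Q (FOb ?U F)) d) (FOb F c) (p (FOb ?U F) d c m) (\<theta> d) = FArr F d c m)"
  proof
    fix F assume F: "F \<in> Obj FC"
    let ?X = "FOb ?U F"
    note X = UO[OF F]
    have Xc: "?X c = FOb F c" if "c \<in> Obj C" for c using that by (simp add: UF[OF F])
    have "\<exists>\<alpha>\<in>nat_trans (op_cat C) (op_cat B) (op_functor C (?Q ?X)) (op_functor C F).
        \<forall>c\<in>Obj (op_cat C). \<forall>d\<in>Obj (op_cat C). \<forall>m\<in>arr (op_cat C) c d.
      Comp (op_cat B) (?X c) (FOb (op_functor C (?Q ?X)) d) (FOb (op_functor C F) d) (\<alpha> d) (p ?X d c m)
        = Comp (op_cat B) (?X c) (FOb (op_functor C F) c) (FOb (op_functor C F) d) (FArr (op_functor C F) c d m)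
            (Ident B (FOb F c))"
      by (rule functor_setting.free_extension[OF functor_setting_op p[OF X] op_functor_obj[OF F]])
        (simp add: Xc B.ident_arr objD(1)[OF F])
    then obtain \<theta> where \<theta>: "\<theta> \<in> nat_trans C B F (?Q ?X)"
      and e: "\<forall>c\<in>Obj (op_cat C). \<forall>d\<in>Obj (op_cat C). \<forall>m\<in>arr (op_cat C) c d.
      Comp (op_cat B) (?X c) (FOb (op_functor C (?Q ?X)) d) (FOb (op_functor C F) d) (\<theta> d) (p ?X d c m)
        = Comp (op_cat B) (?X c) (FOb (op_functor C F) c) (FOb (op_functor C F) d) (FArr (op_functor C F) c d m)
            (Ident B (FOb F c))"
      unfolding op_nat_trans by (elim bexE)
    have "Comp B (FOb F d) (FOb (?Q ?X) d) (FOb F c) (p ?X d c m) (\<theta> d) = FArr F d c m"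
      if c: "c \<in> Obj C" and d: "d \<in> Obj C" and m: "m \<in> arr C d c" for c d m
      using e c d m B.comp_ident_left[OF objD(1)[OF F d] objD(1)[OF F c] objD(2)[OF F d c m]] by (simp add: Xc)
    then show "\<exists>\<theta>. \<theta> \<in> nat_trans C B F (?Q (FOb ?U F)) \<and> (\<forall>d\<in>Obj C. \<forall>c\<in>Obj C. \<forall>m\<in>arr C d c.
      Comp B (FOb F d) (FOb (?Q (FOb ?U F)) d) (FOb F c) (p (FOb ?U F) d c m) (\<theta> d) = FArr F d c m)"
      using \<theta> by (intro exI[of _ \<theta>]) simp
  qed
  from bchoice[OF this] obtain \<theta> where \<theta>_all: "\<forall>F\<in>Obj FC. \<theta> F \<in> nat_trans C B F (?Q (FOb ?U F)) \<and>
      (\<forall>d\<in>Obj C. \<forall>c\<in>Obj C. \<forall>m\<in>arr C d c.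
      Comp B (FOb F d) (FOb (?Q (FOb ?U F)) d) (FOb F c) (p (FOb ?U F) d c m) (\<theta> F d) = FArr F d c m)"
    by (elim exE)
  have \<theta>: "\<theta> F \<in> nat_trans C B F (?Q (FOb ?U F))" if "F \<in> Obj FC" for F
    using bspec[OF \<theta>_all that] by (rule conjunct1)
  have p\<theta>: "Comp B (FOb F d) (FOb (?Q (FOb ?U F)) d) (FOb F c) (p (FOb ?U F) d c m) (\<theta> F d) = FArr F d c m"
    if "F \<in> Obj FC" "d \<in> Obj C" "c \<in> Obj C" "m \<in> arr C d c" for F d c m
    using conjunct2[OF bspec[OF \<theta>_all that(1)]] that(2-) by simp
  have \<theta>G: "Comp B (FOb F d) (FOb (?Q X) d) (X c) (p X d c m)
        (Comp B (FOb F d) (FOb (?Q (FOb ?U F)) d) (FOb (?Q X) d) (FArr ?G (FOb ?U F) X g d) (\<theta> F d))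
      = Comp B (FOb F d) (FOb F c) (X c) (g c) (FArr F d c m)"
    if F: "F \<in> Obj FC" and X: "X \<in> Obj PC" and g: "g \<in> arr PC (FOb ?U F) X" and d: "d \<in> Obj C" and c: "c \<in> Obj C"
      and m: "m \<in> arr C d c" for F X g d c m
  proof -
    note U = UO[OF F]
    note o = objD(1)[OF F d] objD(1)[OF QO[OF U] d] objD(1)[OF QO[OF X] d] Xo[OF X c] objD(1)[OF F c]
    have Uc: "FOb ?U F c = FOb F c" using c by (simp add: UF[OF F])
    have "g c \<in> arr B (FOb ?U F c) (X c)" using g c by auto
    then have gc: "g c \<in> arr B (FOb F c) (X c)" by (simp only: Uc)
    have pc: "p (FOb ?U F) d c m \<in> arr B (FOb (?Q (FOb ?U F)) d) (FOb F c)" using pa[OF U d c m] by (simp add: Uc)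
    note td = nat_transD(1)[OF \<theta>[OF F] d] and Gd = nat_transD(1)[OF GN[OF U X g] d]
    show ?thesis
      using B.comp_assoc[OF o(1,2,3,4) td Gd pa[OF X d c m]] B.comp_assoc[OF o(1,2,5,4) td pc gc]
        pG[OF U X g d c m] p\<theta>[OF F d c m] Uc by simp
  qed
  have nat: "Comp FC F H (FOb ?G (FOb ?U H)) (\<theta> H) \<alpha>
      = Comp FC F (FOb ?G (FOb ?U F)) (FOb ?G (FOb ?U H)) (FArr ?G (FOb ?U F) (FOb ?U H) (FArr ?U F H \<alpha>)) (\<theta> F)"
    if F: "F \<in> Obj FC" and H: "H \<in> Obj FC" and "\<alpha> \<in> arr FC F H" for F H \<alpha>
  proof -
    have \<alpha>: "\<alpha> \<in> nat_trans C B F H" using that(3) by simp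
    note U = UO[OF F] UO[OF H] and u = UAr[OF F H \<alpha>]
    show ?thesis
      unfolding functor_cat_simps(5) GX[OF U(1)] GX[OF U(2)]
    proof (rule restrict_ext)
      fix d assume d: "d \<in> Obj C"
      note o = objD(1)[OF F d] objD(1)[OF H d] objD(1)[OF QO[OF U(1)] d] objD(1)[OF QO[OF U(2)] d]
      note ar = nat_transD(1)[OF \<alpha> d] nat_transD(1)[OF \<theta>[OF H] d] nat_transD(1)[OF \<theta>[OF F] d]
        nat_transD(1)[OF GN[OF U u] d]
      show "Comp B (FOb F d) (FOb H d) (FOb (?Q (FOb ?U H)) d) (\<theta> H d) (\<alpha> d)
          = Comp B (FOb F d) (FOb (?Q (FOb ?U F)) d) (FOb (?Q (FOb ?U H)) d)
              (FArr ?G (FOb ?U F) (FOb ?U H) (FArr ?U F H \<alpha>) d) (\<theta> F d)"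
      proof (rule cancel[OF U(2) d o(1) B.comp_arr[OF o(1,2,4) ar(1,2)] B.comp_arr[OF o(1,3,4) ar(3,4)]])
        fix c m assume c: "c \<in> Obj C" and m: "m \<in> arr C d c"
        have Uc: "FOb ?U H c = FOb H c" using c by (simp add: UF[OF H])
        have pc: "p (FOb ?U H) d c m \<in> arr B (FOb (?Q (FOb ?U H)) d) (FOb H c)" using pa[OF U(2) d c m] by (simp add: Uc)
        have uc: "FArr ?U F H \<alpha> c = \<alpha> c" using c by (simp add: UA[OF F H \<alpha>])
        show "Comp B (FOb F d) (FOb (?Q (FOb ?U H)) d) (FOb ?U H c) (p (FOb ?U H) d c m)
              (Comp B (FOb F d) (FOb H d) (FOb (?Q (FOb ?U H)) d) (\<theta> H d) (\<alpha> d))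
            = Comp B (FOb F d) (FOb (?Q (FOb ?U H)) d) (FOb ?U H c) (p (FOb ?U H) d c m)
              (Comp B (FOb F d) (FOb (?Q (FOb ?U F)) d) (FOb (?Q (FOb ?U H)) d)
                (FArr ?G (FOb ?U F) (FOb ?U H) (FArr ?U F H \<alpha>) d) (\<theta> F d))"
          using \<theta>G[OF F U(2) u d c m] B.comp_assoc[OF o(1,2,4) objD(1)[OF H c] ar(1,2) pc]
            p\<theta>[OF H d c m] nat_transD(2)[OF \<alpha> d c m] by (simp add: Uc uc)
      qed
    qed
  qed
  have univ: "\<exists>!g. g \<in> arr PC (FOb ?U F) X \<and>
      f = Comp FC F (FOb ?G (FOb ?U F)) (FOb ?G X) (FArr ?G (FOb ?U F) X g) (\<theta> F)"
    if F: "F \<in> Obj FC" and X: "X \<in> Obj PC" and "f \<in> arr FC F (FOb ?G X)" for F X f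
  proof -
    have f: "f \<in> nat_trans C B F (?Q X)" using that(3) by (simp add: GX[OF X])
    note U = UO[OF F]
    have Uc: "FOb ?U F c = FOb F c" if "c \<in> Obj C" for c using that by (simp add: UF[OF F])
    note fd = nat_transD[OF f]
    have pf: "Comp B (FOb F d) (FOb (?Q X) d) (X c) (p X d c m) (f d)
        = Comp B (FOb F d) (FOb F c) (X c) (Comp B (FOb F c) (FOb (?Q X) c) (X c) (p X c c (Ident C c)) (f c)) (FArr F d c m)"
      if c: "c \<in> Obj C" and d: "d \<in> Obj C" and m: "m \<in> arr C d c" for c d m
    proof -
      note i = C.ident_arr[OF c]
      note o = objD(1)[OF F d] objD(1)[OF F c] objD(1)[OF QO[OF X] d] objD(1)[OF QO[OF X] c] Xo[OF X c]
      have "Comp B (FOb (?Q X) d) (FOb (?Q X) c) (X c) (p X c c (Ident C c)) (FArr (?Q X) d c m) = p X d c m"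
        using is_freeD(4)[OF p[OF X], of c c d "Ident C c" m] c d m i C.comp_ident_left[OF d c m] by simp
      then show ?thesis
        using B.comp_assoc[OF o(1,3,4,5) fd(1)[OF d] objD(2)[OF QO[OF X] d c m] pa[OF X c c i]]
          B.comp_assoc[OF o(1,2,4,5) objD(2)[OF F d c m] fd(1)[OF c] pa[OF X c c i]] fd(2)[OF d c m] by simp
    qed
    let ?E = "\<lambda>g d. Comp B (FOb F d) (FOb (?Q (FOb ?U F)) d) (FOb (?Q X) d) (FArr ?G (FOb ?U F) X g d) (\<theta> F d)"
    have iff: "f = Comp FC F (FOb ?G (FOb ?U F)) (FOb ?G X) (FArr ?G (FOb ?U F) X g) (\<theta> F)
        \<longleftrightarrow> (\<forall>c\<in>Obj C. Comp B (FOb F c) (FOb (?Q X) c) (X c) (p X c c (Ident C c)) (f c) = g c)"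
      (is "?L \<longleftrightarrow> ?R") if g: "g \<in> arr PC (FOb ?U F) X" for g
    proof -
      have "g c \<in> arr B (FOb ?U F c) (X c)" if "c \<in> Obj C" for c using g that by auto
      then have gc: "g c \<in> arr B (FOb F c) (X c)" if "c \<in> Obj C" for c using that by (simp only: Uc)
      have E: "Comp FC F (FOb ?G (FOb ?U F)) (FOb ?G X) (FArr ?G (FOb ?U F) X g) (\<theta> F) = (\<lambda>d\<in>Obj C. ?E g d)"
        by (simp only: functor_cat_simps(5) GX[OF U] GX[OF X])
      show ?thesis
        unfolding E
      proof
        assume L: "f = (\<lambda>d\<in>Obj C. ?E g d)"
        show ?R
        proof
          fix c assume c: "c \<in> Obj C"
          have "f c = ?E g c" using fun_cong[OF L, of c] c by simp
          then show "Comp B (FOb F c) (FOb (?Q X) c) (X c) (p X c c (Ident C c)) (f c) = g c"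
            using \<theta>G[OF F X g c c C.ident_arr[OF c]] objD(3)[OF F c]
              B.comp_ident_right[OF objD(1)[OF F c] Xo[OF X c] gc[OF c]] by simp
        qed
      next
        assume R: ?R
        show "f = (\<lambda>d\<in>Obj C. ?E g d)"
        proof (rule extensionalityI[of _ "Obj C"])
          show "f \<in> extensional (Obj C)" using f by (simp add: nat_trans_def PiE_iff)
          fix d assume d: "d \<in> Obj C"
          have Ed: "?E g d \<in> arr B (FOb F d) (FOb (?Q X) d)"
            by (rule B.comp_arr[OF objD(1)[OF F d] objD(1)[OF QO[OF U] d] objD(1)[OF QO[OF X] d]
                nat_transD(1)[OF \<theta>[OF F] d] nat_transD(1)[OF GN[OF U X g] d]])
          have "f d = ?E g d"
          proof (rule cancel[OF X d objD(1)[OF F d] fd(1)[OF d] Ed])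
            fix c m assume c: "c \<in> Obj C" and m: "m \<in> arr C d c"
            show "Comp B (FOb F d) (FOb (?Q X) d) (X c) (p X d c m) (f d)
                = Comp B (FOb F d) (FOb (?Q X) d) (X c) (p X d c m) (?E g d)"
              using pf[OF c d m] \<theta>G[OF F X g d c m] R c by simp
          qed
          then show "f d = (\<lambda>d\<in>Obj C. ?E g d) d" using d by simp
        qed simp
      qed
    qed
    let ?g = "\<lambda>c\<in>Obj C. Comp B (FOb F c) (FOb (?Q X) c) (X c) (p X c c (Ident C c)) (f c)"
    have gP: "?g \<in> arr PC (FOb ?U F) X"
      using B.comp_arr[OF objD(1)[OF F] objD(1)[OF QO[OF X]] Xo[OF X] fd(1) pa[OF X _ _ C.ident_arr]]
      by (simp add: Uc)
    show ?thesis
    proof (rule ex1I[of _ ?g])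
      show "?g \<in> arr PC (FOb ?U F) X \<and>
          f = Comp FC F (FOb ?G (FOb ?U F)) (FOb ?G X) (FArr ?G (FOb ?U F) X ?g) (\<theta> F)"
        by (intro conjI gP iffD2[OF iff[OF gP]]) simp
      fix g assume a: "g \<in> arr PC (FOb ?U F) X \<and>
          f = Comp FC F (FOb ?G (FOb ?U F)) (FOb ?G X) (FArr ?G (FOb ?U F) X g) (\<theta> F)"
      show "g = ?g"
      proof (rule extensionalityI[of _ "Obj C"])
        show "g \<in> extensional (Obj C)" using conjunct1[OF a] by (simp add: PiE_iff)
        fix c assume c: "c \<in> Obj C"
        show "g c = ?g c" using bspec[OF iffD1[OF iff[OF conjunct1[OF a]] conjunct2[OF a]] c] c by simp
      qed simp
    qed
  qed
  have unit: "\<theta> F \<in> arr FC F (FOb ?G (FOb ?U F))" if "F \<in> Obj FC" for F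
    using \<theta>[OF that] GX[OF UO[OF that]] by simp
  have "adjunction FC PC ?U ?G \<theta>"
    unfolding adjunction_def by (intro conjI ballI upper_star_functor G unit nat univ)
  then show ?thesis unfolding left_adjoint_def by (intro exI)
qed

end

theorem theorem5p3p3:
  fixes k :: "('k, 'r) ring_scheme"
    and B :: "('o, 'n, 'k) lincat"
    and C :: "('c, 'm, 'k) lincat"
  assumes "cring k"
    and "abelian_category k B"
    and "linear_category k C"
    and "locally_bounded C"
    and "hom_finite k C"
  shows "nakayama_functor k (functor_cat k C B) (power_cat (Obj C) B)
           (i_lower_shriek k C B) (i_upper_star k C B) (nu k C B)"
proof -
  interpret nakayama_setting k B C
    using assms by (intro nakayama_setting.intro functor_setting.intro nakayama_setting_axioms.intro)
  have "iso FC (FOb (i_lower_shriek k C B) X)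
      (FOb (nu_right k C B) (FOb (nu k C B) (FOb (i_lower_shriek k C B) X))) (eta (FOb (i_lower_shriek k C B) X))"
    if X: "X \<in> Obj PC" for X
    unfolding shriek_functor_FOb[OF X] nu_FOb[OF shriek_obj[OF X]] nr_functor_FOb[OF nob_obj[OF shriek_obj[OF X]]]
    by (rule eta_free_iso[OF shriek_free[OF X]])
  then show ?thesis
    unfolding nakayama_functor_def
    by (intro conjI exI[of _ "nu_right k C B"] exI[of _ eta] ballI abelian_functor_cat B.additive_power_cat
        upper_star_functor upper_star_faithful shriek_upper_star_adjunction nu_functor nu_adjunction
        upper_star_nu_shriek_adjunction)
qed

end
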